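(* Let $\theta=(\psi,\phi)$ be the true value of a $d$-dimensional parameter, with $\psi$ a (possibly vector-valued) interest parameter of dimension $q$ and $\phi$ a nuisance parameter. Let $\bar M(\psi)=M(\psi)+B(\psi)$ be an adjusted profile loglikelihood, where $M$ is the profile loglikelihood and $B(\psi)$ is an adjustment function, which is a function of $Y$ and $\psi$ only, whose derivatives with respect to $\psi$ are of order $O_p(1)$. Let $\bar W(\psi)=2\{\bar M(\bar\psi)-\bar M(\psi)\}$ be the likelihood ratio statistic based on $\bar M$, where $\bar\psi$ is the point at which $\bar M$ is maximized. Let $A$ be an ancillary statistic such that $(\hat\theta,A)$ is sufficient. Under the standing assumptions listed in the context, the unconditional distribution of $\bar W(\psi)$ and the conditional distribution of $\bar W(\psi)$ given $A$ agree to order $O(n^{-3/2})$, given $A$.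
   Context: Setting. $Y=(Y_1,\dots,Y_n)$ is a continuous random vector whose distribution depends on an unknown $d$-dimensional parameter $\theta=(\psi,\phi)$. $L(\theta)$ is the loglikelihood based on $Y$; $\hat\theta=(\hat\psi,\hat\phi)$ is the global maximum likelihood estimator; $\tilde\theta(\psi)=(\psi,\tilde\phi(\psi))$ is the constrained maximum likelihood estimator of $\theta$ for given $\psi$; $M(\psi)=L\{\tilde\theta(\psi)\}$ is the profile loglikelihood. All distributions and expectations are under the true value $\theta=(\psi,\phi)$ (the statistic is evaluated at the true $\psi$), and asymptotics are as $n\to\infty$. Unconditional assumptions. Indices $a,b,\dots$ range over $1,\dots,q$ and $r,s,t,\dots$ over $1,\dots,d$, the first $q$ components of $\theta$ being those of $\psi$. Subscripts on $L$ denote derivatives with respect to components of $\theta$. Put $\lambda_{rs}=E\{L_{rs}(\theta)\}$, $\lambda_{rst}=E\{L_{rst}(\theta)\}$, etc., $l_r=L_r(\theta)$ (with $E(l_r)=0$), $l_{rs}=L_{rs}(\theta)-\lambda_{rs}$, etc., and $\lambda_{rs/t}=\partial\lambda_{rs}/\partial\theta^t$. The constants $\lambda_{rs},\lambda_{rst},\dots$ are of order $O(n)$; the inverse of the matrix $(\lambda_{rs})$ has entries of order $O(n^{-1})$; the variables $l_r,l_{rs},\dots$ are of order $O_p(n^{1/2})$. Write $B_a(\psi)=\partial B(\psi)/\partial\psi^a$, $B_{ab}(\psi)=\partial^2B(\psi)/\partial\psi^a\partial\psi^b$, $\beta_a=E\{B_a(\psi)\}$, $\beta_{ab}=E\{B_{ab}(\psi)\}$,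 $b_a=B_a(\psi)-\beta_a$, $b_{ab}=B_{ab}(\psi)-\beta_{ab}$, and so forth. The constants $\beta_a,\beta_{ab},\dots$ are of order $O(1)$; the variables $b_a,b_{ab},\dots$ are of order $O_p(n^{-1/2})$; the joint cumulants of $nb_a,nb_{ab},l_r,l_{rs},\dots$ are of order $O(n)$. Conditional assumptions. $A$ is ancillary, i.e. its distribution does not depend on $\theta$, and $(\hat\theta,A)$ is sufficient. A ring denotes quantities computed under the conditional distribution of $Y$ given $A$: $\mathring E$ is conditional expectation given $A$, $\mathring\lambda_{rs}=\mathring E\{L_{rs}(\theta)\}$, etc., $\mathring l_r=l_r$, $\mathring l_{rs}=L_{rs}(\theta)-\mathring\lambda_{rs}$, etc., $\mathring\beta_a=\mathring E\{B_a(\psi)\}$, $\mathring\beta_{ab}=\mathring E\{B_{ab}(\psi)\}$, $\mathring b_a=B_a(\psi)-\mathring\beta_a$, $\mathring b_{ab}=B_{ab}(\psi)-\mathring\beta_{ab}$, etc. The $\mathring\lambda$'s are random variables depending on $A$, of order $O_p(n)$; $\mathring l_r,\mathring l_{rs},\dots$ are of order $O_p(n^{1/2})$; $\mathring\beta_a,\mathring\beta_{ab},\dots$ are of order $O_p(1)$; $\mathring b_a,\mathring b_{ab},\dots$ are of order $O_p(n^{-1/2})$; the joint conditional cumulants of $n\mathring b_a,n\mathring b_{ab},\mathring l_r,\mathring l_{rs},\dots$ given $A$ are of order $O_p(n)$. It is also assumed that asymptotic relations between conditional and unconditional quantities, such as $\mathring\lambda_{rs}=\lambda_{rs}+O_p(n^{1/2})$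 and $\mathring\beta_a=\beta_a+O_p(n^{-1/2})$, may be differentiated in $\theta$ with the order preserved: $\partial\mathring\lambda_{rs}/\partial\theta^t=\lambda_{rs/t}+O_p(n^{1/2})$, $\partial\mathring\beta_a/\partial\theta^r=\partial\beta_a/\partial\theta^r+O_p(n^{-1/2})$. Regularity convention. The problem is regular in the usual sense of higher-order likelihood asymptotics, both unconditionally and conditionally on $A$: the usual stochastic expansions of likelihood quantities are valid, differentiation and integration may be interchanged, orders of remainder terms are preserved on taking expectations and cumulants, and the usual asymptotic expansions of distributions (including the Bartlett-correction expansion of $\bar W(\psi)$: $\bar W(\psi)$ is distributed as $(1+n^{-1}\bar\omega)\chi^2_q$ to error of order $O(n^{-2})$, where $E\{\bar W(\psi)\}=q(1+n^{-1}\bar\omega)+O(n^{-2})$) are valid. Meaning of the conclusion. "Agree to order $O(n^{-3/2})$, given $A$" means that $\Pr\{\bar W(\psi)\le x\mid A\}=\Pr\{\bar W(\psi)\le x\}+O_p(n^{-3/2})$ for each fixed real $x$. *)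

theory Defs
  imports "HOL-Probability.Probability"
begin

definition pd :: "'v::real_normed_vector \<Rightarrow> ('v \<Rightarrow> real) \<Rightarrow> 'v \<Rightarrow> real" where
  "pd v f x = deriv (\<lambda>t. f (x + t *\<^sub>R v)) 0"

definition pds :: "'v::real_normed_vector list \<Rightarrow> ('v \<Rightarrow> real) \<Rightarrow> 'v \<Rightarrow> real" where
  "pds vs f = foldr pd vs f"

definition C_k_on :: "nat \<Rightarrow> 'v::euclidean_space set \<Rightarrow> ('v \<Rightarrow> real) \<Rightarrow> bool" where
  "C_k_on k S f \<longleftrightarrow> (\<forall>vs. set vs \<subseteq> Basis \<longrightarrow>
     (length vs < k \<longrightarrow> pds vs f differentiable_on S) \<and>
     (length vs \<le> k \<longrightarrow> continuous_on S (pds vs f)))"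

text \<open>
  \<open>X\<^sub>n = O\<^sub>p(a\<^sub>n)\<close>.  The event is required to be measurable, so that nothing is gained from the
  convention that non-measurable sets have measure 0.  If \<open>X\<^sub>n\<close> is deterministic this says
  \<open>X\<^sub>n = O(a\<^sub>n)\<close>.
\<close>
definition bigOp :: "(nat \<Rightarrow> 's measure) \<Rightarrow> (nat \<Rightarrow> 's \<Rightarrow> real) \<Rightarrow> (nat \<Rightarrow> real) \<Rightarrow> bool" where
  "bigOp P X a \<longleftrightarrow> (\<forall>\<epsilon>>0. \<exists>K. \<forall>\<^sub>F n in sequentially.
     \<exists>E\<in>sets (P n). measure (P n) E \<ge> 1 - \<epsilon> \<and> (\<forall>y\<in>E. \<bar>X n y\<bar> \<le> K * a n))"

definition joint_cumulant :: "'s measure \<Rightarrow> ('s \<Rightarrow> real) list \<Rightarrow> real" where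
  "joint_cumulant M Xs =
     (\<Sum>\<pi> | partition_on {..<length Xs} \<pi>.
        (-1) ^ (card \<pi> - 1) * fact (card \<pi> - 1) *
        (\<Prod>J\<in>\<pi>. \<integral>y. (\<Prod>i\<in>J. (Xs ! i) y) \<partial>M))"

definition chi_square :: "nat \<Rightarrow> real measure" where
  "chi_square k = density lborel (\<lambda>x. ennreal
     (if x > 0 then x powr (k / 2 - 1) * exp (- x / 2) / (2 powr (k / 2) * Gamma (k / 2)) else 0))"

type_synonym sample = "nat \<Rightarrow> real"

type_synonym ('q, 'p) par = "(real ^ 'q) \<times> (real ^ 'p)"

text \<open>
  Components of \<open>\<theta> = (\<psi>, \<phi>)\<close> are indexed by \<open>'q + 'p\<close>, the components of \<open>\<psi>\<close> being those with
  index \<open>Inl a\<close>; thus \<open>q = CARD('q)\<close> and \<open>d = CARD('q + 'p)\<close>.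
\<close>
fun par_axis :: "'q::finite + 'p::finite \<Rightarrow> ('q, 'p) par" where
  "par_axis (Inl a) = (axis a 1, 0)"
| "par_axis (Inr i) = (0, axis i 1)"

text \<open>
  For sample size \<open>n\<close>: \<open>pdf\<close> is the joint density of \<open>Y\<close>, \<open>adj\<close> the adjustment function \<open>B\<close>,
  \<open>mle\<close> is \<open>\<theta>\<close>-hat, \<open>cmle n y \<psi>\<close> is \<open>\<phi>\<close>-tilde at \<open>\<psi>\<close>, \<open>psibar\<close> is \<open>\<psi>\<close>-bar, and \<open>anc\<close> is \<open>A\<close>, with
  values in \<open>anc_space\<close>.  The measures \<open>cbase n a\<close> do not depend on \<open>\<theta>\<close>; they are dominating
  measures such that \<open>pdf n \<theta>\<close> is the density of \<open>Y\<close> given \<open>A = a\<close> with respect to \<open>cbase n a\<close>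
  (see \<open>cond_dist\<close>).
\<close>
record ('q, 'p, 'c) problem =
  pdf :: "nat \<Rightarrow> ('q, 'p) par \<Rightarrow> sample \<Rightarrow> real"
  Theta :: "('q, 'p) par set"
  theta0 :: "('q, 'p) par"
  adj :: "nat \<Rightarrow> sample \<Rightarrow> real ^ 'q \<Rightarrow> real"
  mle :: "nat \<Rightarrow> sample \<Rightarrow> ('q, 'p) par"
  cmle :: "nat \<Rightarrow> sample \<Rightarrow> real ^ 'q \<Rightarrow> real ^ 'p"
  psibar :: "nat \<Rightarrow> sample \<Rightarrow> real ^ 'q"
  anc_space :: "nat \<Rightarrow> 'c measure"
  anc :: "nat \<Rightarrow> sample \<Rightarrow> 'c"
  cbase :: "nat \<Rightarrow> 'c \<Rightarrow> sample measure"

definition leb :: "nat \<Rightarrow> sample measure" where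
  "leb n = (\<Pi>\<^sub>M i\<in>{..<n}. lborel)"

definition dist_of ::
    "('q::finite, 'p::finite, 'c) problem \<Rightarrow> nat \<Rightarrow> sample measure \<Rightarrow> ('q, 'p) par \<Rightarrow> sample measure" where
  "dist_of D n \<mu> \<theta> = density \<mu> (\<lambda>y. ennreal (pdf D n \<theta> y))"

definition truth :: "('q::finite, 'p::finite, 'c) problem \<Rightarrow> nat \<Rightarrow> sample measure" where
  "truth D n = dist_of D n (leb n) (theta0 D)"

definition loglik :: "('q::finite, 'p::finite, 'c) problem \<Rightarrow> nat \<Rightarrow> sample \<Rightarrow> ('q, 'p) par \<Rightarrow> real" where
  "loglik D n y \<theta> = ln (pdf D n \<theta> y)"

definition proflik :: "('q::finite, 'p::finite, 'c) problem \<Rightarrow> nat \<Rightarrow> sample \<Rightarrow> real ^ 'q \<Rightarrow> real" where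
  "proflik D n y \<psi> = loglik D n y (\<psi>, cmle D n y \<psi>)"

definition adj_proflik :: "('q::finite, 'p::finite, 'c) problem \<Rightarrow> nat \<Rightarrow> sample \<Rightarrow> real ^ 'q \<Rightarrow> real" where
  "adj_proflik D n y \<psi> = proflik D n y \<psi> + adj D n y \<psi>"

definition Wbar :: "('q::finite, 'p::finite, 'c) problem \<Rightarrow> nat \<Rightarrow> sample \<Rightarrow> real" where
  "Wbar D n y = 2 * (adj_proflik D n y (psibar D n y) - adj_proflik D n y (fst (theta0 D)))"

definition model :: "('q::finite, 'p::finite, 'c) problem \<Rightarrow> nat \<Rightarrow> bool" where
  "model D n \<longleftrightarrow>
     open (Theta D) \<and> theta0 D \<in> Theta D \<and>
     (\<forall>\<theta>\<in>Theta D. pdf D n \<theta> \<in> borel_measurable (leb n) \<and>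
        (\<forall>y\<in>space (leb n). 0 \<le> pdf D n \<theta> y) \<and> prob_space (dist_of D n (leb n) \<theta>)) \<and>
     (\<forall>\<theta>\<in>Theta D. \<forall>\<theta>'\<in>Theta D. \<forall>y\<in>space (leb n). 0 < pdf D n \<theta> y \<longleftrightarrow> 0 < pdf D n \<theta>' y) \<and>
     (\<forall>y\<in>space (leb n). C_k_on 5 (Theta D) (loglik D n y))"

definition adjustment :: "('q::finite, 'p::finite, 'c) problem \<Rightarrow> nat \<Rightarrow> bool" where
  "adjustment D n \<longleftrightarrow>
     (\<forall>\<psi>\<in>fst ` Theta D. (\<lambda>y. adj D n y \<psi>) \<in> borel_measurable (leb n)) \<and>
     (\<forall>y\<in>space (leb n). C_k_on 3 (fst ` Theta D) (adj D n y))"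

definition estimators :: "('q::finite, 'p::finite, 'c) problem \<Rightarrow> nat \<Rightarrow> bool" where
  "estimators D n \<longleftrightarrow>
     mle D n \<in> borel_measurable (leb n) \<and>
     Wbar D n \<in> borel_measurable (leb n) \<and>
     (AE y in truth D n. mle D n y \<in> Theta D \<and>
        (\<forall>\<theta>\<in>Theta D. loglik D n y \<theta> \<le> loglik D n y (mle D n y))) \<and>
     (AE y in truth D n. \<forall>\<psi>\<in>fst ` Theta D. (\<psi>, cmle D n y \<psi>) \<in> Theta D \<and>
        (\<forall>\<phi>. (\<psi>, \<phi>) \<in> Theta D \<longrightarrow> loglik D n y (\<psi>, \<phi>) \<le> loglik D n y (\<psi>, cmle D n y \<psi>))) \<and>
     (AE y in truth D n. psibar D n y \<in> fst ` Theta D \<and>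
        (\<forall>\<psi>\<in>fst ` Theta D. adj_proflik D n y \<psi> \<le> adj_proflik D n y (psibar D n y)))"

definition sufficient ::
    "('q::finite, 'p::finite, 'c) problem \<Rightarrow> nat \<Rightarrow> 't measure \<Rightarrow> (sample \<Rightarrow> 't) \<Rightarrow> bool" where
  "sufficient D n N T \<longleftrightarrow>
     T \<in> measurable (leb n) N \<and>
     (let F = vimage_algebra (space (leb n)) T N in
      \<forall>E\<in>sets (leb n). \<exists>g\<in>borel_measurable F. \<forall>\<theta>\<in>Theta D.
        AE y in dist_of D n (leb n) \<theta>.
          real_cond_exp (dist_of D n (leb n) \<theta>) F (indicator E) y = g y)"

definition ancillary ::
    "('q::finite, 'p::finite, 'c) problem \<Rightarrow> nat \<Rightarrow> 't measure \<Rightarrow> (sample \<Rightarrow> 't) \<Rightarrow> bool" where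
  "ancillary D n N T \<longleftrightarrow>
     T \<in> measurable (leb n) N \<and>
     (\<forall>\<theta>\<in>Theta D. \<forall>\<theta>'\<in>Theta D.
        distr (dist_of D n (leb n) \<theta>) N T = distr (dist_of D n (leb n) \<theta>') N T)"

text \<open>
  Conditional quantities have to be differentiated in \<open>\<theta>\<close>, so versions of the conditional
  distributions of \<open>Y\<close> given \<open>A = a\<close> must be fixed simultaneously for all \<open>\<theta>\<close>.  Because \<open>A\<close> is
  ancillary, such versions have a density proportional to \<open>pdf n \<theta>\<close>, the factor being free of \<open>\<theta>\<close>:
  if \<open>K a\<close> is a version at the true value \<open>\<theta>\<^sub>0\<close>, then
  \<open>cbase n a = density (K a) (\<lambda>y. 1 / pdf n \<theta>\<^sub>0 y)\<close> will do for every \<open>\<theta>\<close>.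
\<close>
definition cond_dist :: "('q::finite, 'p::finite, 'c) problem \<Rightarrow> nat \<Rightarrow> bool" where
  "cond_dist D n \<longleftrightarrow> (\<forall>\<theta>\<in>Theta D.
     (\<lambda>a. dist_of D n (cbase D n a) \<theta>) \<in> measurable (anc_space D n) (prob_algebra (leb n)) \<and>
     (\<forall>E\<in>sets (leb n). \<forall>C\<in>sets (anc_space D n).
        emeasure (dist_of D n (leb n) \<theta>) (E \<inter> anc D n -` C) =
        (\<integral>\<^sup>+a\<in>C. emeasure (dist_of D n (cbase D n a) \<theta>) E
           \<partial>distr (dist_of D n (leb n) \<theta>) (anc_space D n) (anc D n))))"

text \<open>
  \<open>Inl [r, s, \<dots>]\<close> stands for \<open>L\<^sub>r\<^sub>s\<^sub>\<dots>(\<theta>)\<close> and \<open>Inr [a, b, \<dots>]\<close> for \<open>B\<^sub>a\<^sub>b\<^sub>\<dots>(\<psi>)\<close>.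
\<close>
type_synonym ('q, 'p) idx = "('q + 'p) list + 'q list"

definition idx_upto :: "nat \<Rightarrow> nat \<Rightarrow> ('q, 'p) idx set" where
  "idx_upto j k = Inl ` {rs. 1 \<le> length rs \<and> length rs \<le> j} \<union> Inr ` {as. 1 \<le> length as \<and> length as \<le> k}"

fun dv :: "('q::finite, 'p::finite, 'c) problem \<Rightarrow> nat \<Rightarrow> ('q, 'p) idx \<Rightarrow> ('q, 'p) par \<Rightarrow> sample \<Rightarrow> real" where
  "dv D n (Inl rs) \<theta> y = pds (map par_axis rs) (loglik D n y) \<theta>"
| "dv D n (Inr as) \<theta> y = pds (map (\<lambda>a. axis a 1) as) (adj D n y) (fst \<theta>)"

text \<open>
  The argument \<open>\<mu>\<close> below is a dominating measure: \<open>\<mu> = leb n\<close> gives the unconditional quantities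
  \<open>\<lambda>\<^sub>r\<^sub>s, \<beta>\<^sub>a, l\<^sub>r\<^sub>s, b\<^sub>a, \<dots>\<close>, and \<open>\<mu> = cbase n (anc n y)\<close> the corresponding ringed ones.
\<close>
definition mean :: "('q::finite, 'p::finite, 'c) problem \<Rightarrow> nat \<Rightarrow> sample measure \<Rightarrow> ('q, 'p) idx \<Rightarrow> ('q, 'p) par \<Rightarrow> real" where
  "mean D n \<mu> v \<theta> = (\<integral>y. dv D n v \<theta> y \<partial>dist_of D n \<mu> \<theta>)"

definition cent :: "('q::finite, 'p::finite, 'c) problem \<Rightarrow> nat \<Rightarrow> sample measure \<Rightarrow> ('q, 'p) idx \<Rightarrow> sample \<Rightarrow> real" where
  "cent D n \<mu> v y = dv D n v (theta0 D) y - mean D n \<mu> v (theta0 D)"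

text \<open>The variables \<open>l\<^sub>r, l\<^sub>r\<^sub>s, \<dots>, n b\<^sub>a, n b\<^sub>a\<^sub>b, \<dots>\<close>.\<close>
fun cvar :: "('q::finite, 'p::finite, 'c) problem \<Rightarrow> nat \<Rightarrow> sample measure \<Rightarrow> ('q, 'p) idx \<Rightarrow> sample \<Rightarrow> real" where
  "cvar D n \<mu> (Inl rs) y = cent D n \<mu> (Inl rs) y"
| "cvar D n \<mu> (Inr as) y = real n * cent D n \<mu> (Inr as) y"

definition lambda_matrix :: "('q::finite, 'p::finite, 'c) problem \<Rightarrow> nat \<Rightarrow> real ^ ('q + 'p) ^ ('q + 'p)" where
  "lambda_matrix D n = (\<chi> r s. mean D n (leb n) (Inl [r, s]) (theta0 D))"

text \<open>
  The assumptions that are made both unconditionally and conditionally are stated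
  given a statistic \<open>T\<close>, with \<open>\<nu> n t\<close> a dominating measure for the distribution of \<open>Y\<close> given
  \<open>T = t\<close>.  They are used with \<open>T\<close> trivial and \<open>\<nu> n () = leb n\<close>, where all the "constants" are
  deterministic and \<open>O\<^sub>p\<close> for them means \<open>O\<close>, and with \<open>T = A\<close> and \<open>\<nu> = cbase\<close>.
\<close>

definition orders ::
    "('q::finite, 'p::finite, 'c) problem \<Rightarrow> (nat \<Rightarrow> sample \<Rightarrow> 't) \<Rightarrow> (nat \<Rightarrow> 't \<Rightarrow> sample measure) \<Rightarrow> bool" where
  "orders D T \<nu> \<longleftrightarrow>
     (\<forall>r. \<forall>\<^sub>F n in sequentially. AE y in truth D n. mean D n (\<nu> n (T n y)) (Inl [r]) (theta0 D) = 0) \<and>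
     (\<forall>rs. 2 \<le> length rs \<and> length rs \<le> 4 \<longrightarrow>
        bigOp (truth D) (\<lambda>n y. mean D n (\<nu> n (T n y)) (Inl rs) (theta0 D)) (\<lambda>n. real n)) \<and>
     (\<forall>rs. 1 \<le> length rs \<and> length rs \<le> 4 \<longrightarrow>
        bigOp (truth D) (\<lambda>n y. cent D n (\<nu> n (T n y)) (Inl rs) y) (\<lambda>n. real n powr (1/2))) \<and>
     (\<forall>as. 1 \<le> length as \<and> length as \<le> 2 \<longrightarrow>
        bigOp (truth D) (\<lambda>n y. mean D n (\<nu> n (T n y)) (Inr as) (theta0 D)) (\<lambda>n. 1)) \<and>
     (\<forall>as. 1 \<le> length as \<and> length as \<le> 2 \<longrightarrow>
        bigOp (truth D) (\<lambda>n y. cent D n (\<nu> n (T n y)) (Inr as) y) (\<lambda>n. real n powr (-1/2))) \<and>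
     (\<forall>vs. set vs \<subseteq> idx_upto 4 2 \<longrightarrow>
        (\<forall>\<^sub>F n in sequentially. AE y in truth D n.
           integrable (dist_of D n (\<nu> n (T n y)) (theta0 D)) (\<lambda>z. \<Prod>v\<leftarrow>vs. dv D n v (theta0 D) z))) \<and>
     (\<forall>vs. vs \<noteq> [] \<and> set vs \<subseteq> idx_upto 4 2 \<longrightarrow>
        bigOp (truth D)
          (\<lambda>n y. joint_cumulant (dist_of D n (\<nu> n (T n y)) (theta0 D)) (map (cvar D n (\<nu> n (T n y))) vs))
          (\<lambda>n. real n))"

definition inverse_order :: "('q::finite, 'p::finite, 'c) problem \<Rightarrow> bool" where
  "inverse_order D \<longleftrightarrow>
     (\<forall>\<^sub>F n in sequentially. invertible (lambda_matrix D n)) \<and>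
     (\<forall>r s. (\<lambda>n. matrix_inv (lambda_matrix D n) $ r $ s) \<in> O(\<lambda>n. 1 / real n))"

definition adj_order :: "('q::finite, 'p::finite, 'c) problem \<Rightarrow> bool" where
  "adj_order D \<longleftrightarrow> (\<forall>as. 1 \<le> length as \<and> length as \<le> 3 \<longrightarrow>
     bigOp (truth D) (\<lambda>n y. dv D n (Inr as) (theta0 D) y) (\<lambda>n. 1))"

text \<open>
  \<open>\<lambda>\<close>-ring \<open>= \<lambda> + O\<^sub>p(n\<^sup>1\<^sup>/\<^sup>2)\<close> and \<open>\<beta>\<close>-ring \<open>= \<beta> + O\<^sub>p(n\<^sup>-\<^sup>1\<^sup>/\<^sup>2)\<close>, and the relations obtained from these
  by (repeated) differentiation in \<open>\<theta>\<close>.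
\<close>
definition differentiable_relations :: "('q::finite, 'p::finite, 'c) problem \<Rightarrow> bool" where
  "differentiable_relations D \<longleftrightarrow>
     (\<forall>rs ts. 2 \<le> length rs \<and> length rs + length ts \<le> 4 \<longrightarrow>
        bigOp (truth D)
          (\<lambda>n y. pds (map par_axis ts) (mean D n (cbase D n (anc D n y)) (Inl rs)) (theta0 D)
               - pds (map par_axis ts) (mean D n (leb n) (Inl rs)) (theta0 D))
          (\<lambda>n. real n powr (1/2))) \<and>
     (\<forall>as ts. 1 \<le> length as \<and> length as + length ts \<le> 2 \<longrightarrow>
        bigOp (truth D)
          (\<lambda>n y. pds (map par_axis ts) (mean D n (cbase D n (anc D n y)) (Inr as)) (theta0 D)
               - pds (map par_axis ts) (mean D n (leb n) (Inr as)) (theta0 D))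
          (\<lambda>n. real n powr (-1/2)))"

text \<open>
  Validity of the stochastic expansions: root-\<open>n\<close> consistency, and local control of the derivatives
  that appear in the remainders of the Taylor expansions about the true value.
\<close>
definition expansions_valid :: "('q::finite, 'p::finite, 'c) problem \<Rightarrow> bool" where
  "expansions_valid D \<longleftrightarrow>
     bigOp (truth D) (\<lambda>n y. norm (mle D n y - theta0 D)) (\<lambda>n. real n powr (-1/2)) \<and>
     bigOp (truth D) (\<lambda>n y. norm (cmle D n y (fst (theta0 D)) - snd (theta0 D))) (\<lambda>n. real n powr (-1/2)) \<and>
     bigOp (truth D) (\<lambda>n y. norm ((psibar D n y, cmle D n y (psibar D n y)) - theta0 D)) (\<lambda>n. real n powr (-1/2)) \<and>
     (\<exists>\<epsilon>>0. cball (theta0 D) \<epsilon> \<subseteq> Theta D \<and>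
        (\<forall>rs. length rs = 5 \<longrightarrow>
           bigOp (truth D) (\<lambda>n y. SUP \<theta>\<in>cball (theta0 D) \<epsilon>. \<bar>dv D n (Inl rs) \<theta> y\<bar>) (\<lambda>n. real n)) \<and>
        (\<forall>as. length as = 3 \<longrightarrow>
           bigOp (truth D) (\<lambda>n y. SUP \<theta>\<in>cball (theta0 D) \<epsilon>. \<bar>dv D n (Inr as) \<theta> y\<bar>) (\<lambda>n. 1)))"

text \<open>
  Interchange of differentiation in \<open>\<theta>\<close> and integration over the sample space for expectations of
  products of derivatives of \<open>L\<close> and \<open>B\<close>, near the true value.
\<close>
definition interchange ::
    "('q::finite, 'p::finite, 'c) problem \<Rightarrow> (nat \<Rightarrow> sample \<Rightarrow> 't) \<Rightarrow> (nat \<Rightarrow> 't \<Rightarrow> sample measure) \<Rightarrow> bool" where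
  "interchange D T \<nu> \<longleftrightarrow>
     (\<forall>vs. set vs \<subseteq> idx_upto 3 1 \<longrightarrow>
       (\<forall>\<^sub>F n in sequentially. AE y in truth D n. \<forall>\<^sub>F \<theta> in nhds (theta0 D). \<forall>r.
          let \<mu> = \<nu> n (T n y);
              h = (\<lambda>\<theta> z. (\<Prod>v\<leftarrow>vs. dv D n v \<theta> z) * pdf D n \<theta> z)
          in integrable \<mu> (h \<theta>) \<and>
             integrable \<mu> (\<lambda>z. pd (par_axis r) (\<lambda>\<theta>. h \<theta> z) \<theta>) \<and>
             ((\<lambda>t. \<integral>z. h (\<theta> + t *\<^sub>R par_axis r) z \<partial>\<mu>) has_real_derivative
                (\<integral>z. pd (par_axis r) (\<lambda>\<theta>. h \<theta> z) \<theta> \<partial>\<mu>)) (at 0)))"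

text \<open>
  The order of the remainder is preserved on taking expectations: whenever the statistic
  \<open>W\<close>-bar is approximated to order \<open>O\<^sub>p(n\<^sup>-\<^sup>3\<^sup>/\<^sup>2)\<close> by a polynomial (the sum over \<open>m \<in> I\<close>, with
  coefficients \<open>c\<close> of order \<open>O(1)\<close> or \<open>O\<^sub>p(1)\<close>) in the standardized variables
  \<open>n\<^sup>-\<^sup>1\<^sup>/\<^sup>2 l\<^sub>r, n\<^sup>-\<^sup>1\<^sup>/\<^sup>2 l\<^sub>r\<^sub>s, \<dots>, n\<^sup>1\<^sup>/\<^sup>2 b\<^sub>a, \<dots>\<close>, the expectation of the error is of that order too.
\<close>
definition remainder_preserved ::
    "('q::finite, 'p::finite, 'c) problem \<Rightarrow> (nat \<Rightarrow> sample \<Rightarrow> 't) \<Rightarrow> (nat \<Rightarrow> 't \<Rightarrow> sample measure) \<Rightarrow> bool" where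
  "remainder_preserved D T \<nu> \<longleftrightarrow>
     (\<forall>\<^sub>F n in sequentially. AE y in truth D n. integrable (dist_of D n (\<nu> n (T n y)) (theta0 D)) (Wbar D n)) \<and>
     (\<forall>(I :: ('q, 'p) idx list set) (c :: nat \<Rightarrow> 't \<Rightarrow> ('q, 'p) idx list \<Rightarrow> real).
        let R = (\<lambda>n t z. Wbar D n z -
                   (\<Sum>m\<in>I. c n t m * (\<Prod>v\<leftarrow>m. cvar D n (\<nu> n t) v z / sqrt (real n))))
        in finite I \<and> (\<forall>m\<in>I. set m \<subseteq> idx_upto 4 2 \<and> bigOp (truth D) (\<lambda>n y. c n (T n y) m) (\<lambda>n. 1)) \<and>
           bigOp (truth D) (\<lambda>n y. R n (T n y) y) (\<lambda>n. real n powr (-3/2)) \<longrightarrow>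
           bigOp (truth D)
             (\<lambda>n y. \<integral>z. R n (T n y) z \<partial>dist_of D n (\<nu> n (T n y)) (theta0 D))
             (\<lambda>n. real n powr (-3/2)))"

definition bartlett_expansion ::
    "('q::finite, 'p::finite, 'c) problem \<Rightarrow> (nat \<Rightarrow> sample \<Rightarrow> 't) \<Rightarrow> (nat \<Rightarrow> 't \<Rightarrow> sample measure) \<Rightarrow> bool" where
  "bartlett_expansion D T \<nu> \<longleftrightarrow>
     (\<exists>\<omega> :: nat \<Rightarrow> 't \<Rightarrow> real.
        bigOp (truth D) (\<lambda>n y. \<omega> n (T n y)) (\<lambda>n. 1) \<and>
        bigOp (truth D)
          (\<lambda>n y. (\<integral>z. Wbar D n z \<partial>dist_of D n (\<nu> n (T n y)) (theta0 D))
               - real CARD('q) * (1 + \<omega> n (T n y) / real n))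
          (\<lambda>n. real n powr (-2)) \<and>
        (\<forall>x. bigOp (truth D)
          (\<lambda>n y. measure (dist_of D n (\<nu> n (T n y)) (theta0 D)) {z \<in> space (leb n). Wbar D n z \<le> x}
               - measure (chi_square CARD('q)) {u. (1 + \<omega> n (T n y) / real n) * u \<le> x})
          (\<lambda>n. real n powr (-2))))"

definition regular_given ::
    "('q::finite, 'p::finite, 'c) problem \<Rightarrow> (nat \<Rightarrow> sample \<Rightarrow> 't) \<Rightarrow> (nat \<Rightarrow> 't \<Rightarrow> sample measure) \<Rightarrow> bool" where
  "regular_given D T \<nu> \<longleftrightarrow>
     orders D T \<nu> \<and> interchange D T \<nu> \<and> remainder_preserved D T \<nu> \<and> bartlett_expansion D T \<nu>"

end

theory Submission
  imports Defs "HOL-Library.Landau_Symbols"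
begin

text \<open>
  Let \<open>Lbar(\<theta>) = L(\<theta>) + B(\<psi>)\<close>.  Profiling commutes with adding a function of \<open>\<psi>\<close>, so
  the adjusted estimate, completed by the constrained estimate of the nuisance parameter, maximizes
  \<open>Lbar\<close> over the whole parameter space, and the constrained estimate at the true \<open>\<psi>\<close> maximizes it
  over the points with that first component.  Hence \<open>Wbar\<close> is the difference of two quantities of the
  same kind, namely twice the largest increase of \<open>Lbar\<close> from the true value when a set \<open>S\<close> of
  coordinates may vary: all coordinates, or the nuisance coordinates only (\<open>Wbar_Lbar\<close>).

  In coordinates scaled by \<open>n\<^sup>-\<^sup>1\<^sup>/\<^sup>2\<close>, \<open>Lbar\<close> is a strictly concave quadratic form
  with perturbations of orders \<open>n\<^sup>-\<^sup>1\<^sup>/\<^sup>2\<close> and \<open>n\<^sup>-\<^sup>1\<close>.  Up to \<open>O\<^sub>p(n\<^sup>-\<^sup>3\<^sup>/\<^sup>2)\<close> its maximum is a polynomial of degree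
  four in the standardized derivatives of \<open>L\<close> and \<open>B\<close> (\<open>maximum_expansion\<close>, \<open>maximum_approx\<close>,
  \<open>Wbar_approx\<close>).

  As cumulants of order four are small, the expectation of this polynomial is
  \<open>card S + \<Omega>/n + O(n\<^sup>-\<^sup>2)\<close>, where \<open>\<Omega>\<close> is a rational function of means, covariances and third moments
  (\<open>expectation_lr_poly\<close>).  Differentiating expectations under the integral sign (the Bartlett
  identities) turns moments that contain a score into means of derivatives of \<open>L\<close> and \<open>B\<close> and
  \<open>\<theta>\<close>-derivatives of such means.  The covariances of second derivatives of \<open>L\<close> contain no score and
  cannot be expressed in this way.  They occur twice in the expectation: with the third moments of one
  second derivative and two scores, whose sum with these covariances is determined by means
  (\<open>mixed_third_moment\<close>), and in the mean square of the gradient of the first perturbation.  The two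
  contributions cancel, and this is the heart of the theorem: \<open>\<Omega>\<close> is a function of the means and
  their \<open>\<theta>\<close>-derivatives alone.

  The same computation applies given \<open>A\<close>, with the conditional means in place of the
  unconditional ones.  After standardization the two kinds of means differ by \<open>O\<^sub>p(n\<^sup>-\<^sup>1\<^sup>/\<^sup>2)\<close>, and so do
  their \<open>\<theta>\<close>-derivatives.  Hence the two values of \<open>\<Omega>\<close> differ by \<open>O\<^sub>p(n\<^sup>-\<^sup>1\<^sup>/\<^sup>2)\<close> (\<open>Omega_close\<close>)
  and the two expectations of \<open>Wbar\<close> by \<open>O\<^sub>p(n\<^sup>-\<^sup>3\<^sup>/\<^sup>2)\<close>.  By the Bartlett-correction expansions both
  distributions are, to order \<open>n\<^sup>-\<^sup>2\<close>, those of \<open>(1 + a)\<chi>\<^sup>2\<close> with factors fixed by the expectations.  Thus the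
  factors differ by \<open>O\<^sub>p(n\<^sup>-\<^sup>3\<^sup>/\<^sup>2)\<close>, and so do the probabilities, because a chi-square probability is
  Lipschitz in the scale (\<open>chi_square_Lipschitz\<close>).

  A relation \<open>X = O\<^sub>p(a)\<close> is read as \<open>X = O(a)\<close> along filters on pairs of a sample
  size and a sample, the sample being confined to events of probability close to one (\<open>tight\<close>).  The
  analytic part of the proof is therefore ordinary calculus of orders along one filter.
\<close>

section \<open>Asymptotic relations that hold with high probability\<close>

text \<open>
  Along this filter \<open>n\<close> tends to infinity while the sample stays in \<open>E n\<close>; eventual statements along
  it are uniform over the event.
\<close>
definition on_events :: "(nat \<Rightarrow> 's set) \<Rightarrow> (nat \<times> 's) filter" where
  "on_events E = inf (filtercomap fst sequentially) (principal {(n, y). y \<in> E n})"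

lemma eventually_on_events:
  "eventually Q (on_events E) \<longleftrightarrow> (\<forall>\<^sub>F n in sequentially. \<forall>y\<in>E n. Q (n, y))"
proof
  assume "eventually Q (on_events E)"
  then obtain R where R: "eventually R sequentially" "\<And>w. R (fst w) \<Longrightarrow> w \<in> {(n, y). y \<in> E n} \<Longrightarrow> Q w"
    unfolding on_events_def eventually_inf_principal eventually_filtercomap by blast
  show "\<forall>\<^sub>F n in sequentially. \<forall>y\<in>E n. Q (n, y)"
    using R(1) by eventually_elim (use R(2) in auto)
next
  assume "\<forall>\<^sub>F n in sequentially. \<forall>y\<in>E n. Q (n, y)"
  then show "eventually Q (on_events E)"
    unfolding on_events_def eventually_inf_principal eventually_filtercomap by (auto intro!: exI)
qed

lemma on_events_le: "on_events E \<le> filtercomap fst sequentially"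
  unfolding on_events_def by simp

lemma on_events_mono: "(\<And>n. E n \<subseteq> E' n) \<Longrightarrow> on_events E \<le> on_events E'"
  unfolding on_events_def by (intro inf_mono) auto

text \<open>
  \<open>\<Phi>\<close> is required for all finer filters because the events that belong to several
  properties have to be intersected; this is what makes the notion closed under conjunction.
\<close>
definition tight :: "(nat \<Rightarrow> 's measure) \<Rightarrow> ((nat \<times> 's) filter \<Rightarrow> bool) \<Rightarrow> bool" where
  "tight P \<Phi> \<longleftrightarrow> (\<forall>\<epsilon>>0. \<exists>E. (\<forall>\<^sub>F n in sequentially. E n \<in> sets (P n) \<and> 1 - \<epsilon> \<le> measure (P n) (E n)) \<and>
     (\<forall>F\<le>on_events E. \<Phi> F))"

lemma tight_mono:
  assumes "tight P \<Phi>" "\<And>F. F \<le> filtercomap fst sequentially \<Longrightarrow> \<Phi> F \<Longrightarrow> \<Psi> F"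
  shows "tight P \<Psi>"
  using assms(1) unfolding tight_def by (meson assms(2) on_events_le order_trans)

lemma tight_conj:
  assumes P: "\<forall>\<^sub>F n in sequentially. prob_space (P n)" and "tight P \<Phi>" "tight P \<Psi>"
  shows "tight P (\<lambda>F. \<Phi> F \<and> \<Psi> F)"
  unfolding tight_def
proof (intro allI impI)
  fix \<epsilon> :: real assume "\<epsilon> > 0"
  then have "\<epsilon> / 2 > 0" by simp
  obtain E1 where E1: "\<forall>\<^sub>F n in sequentially. E1 n \<in> sets (P n) \<and> 1 - \<epsilon>/2 \<le> measure (P n) (E1 n)"
      "\<And>F. F \<le> on_events E1 \<Longrightarrow> \<Phi> F"
    using assms(2) \<open>\<epsilon> / 2 > 0\<close> unfolding tight_def by metis
  obtain E2 where E2: "\<forall>\<^sub>F n in sequentially. E2 n \<in> sets (P n) \<and> 1 - \<epsilon>/2 \<le> measure (P n) (E2 n)"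
      "\<And>F. F \<le> on_events E2 \<Longrightarrow> \<Psi> F"
    using assms(3) \<open>\<epsilon> / 2 > 0\<close> unfolding tight_def by metis
  have "\<forall>\<^sub>F n in sequentially. E1 n \<inter> E2 n \<in> sets (P n) \<and> 1 - \<epsilon> \<le> measure (P n) (E1 n \<inter> E2 n)"
    using E1(1) E2(1) P
  proof eventually_elim
    case (elim n)
    interpret prob_space "P n" by (rule elim)
    have "measure (P n) (E1 n \<union> E2 n) \<le> 1" by simp
    moreover have "measure (P n) (E1 n \<union> E2 n) = measure (P n) (E1 n) + measure (P n) (E2 n) - measure (P n) (E1 n \<inter> E2 n)"
      by (rule measure_Un3) (use elim in \<open>auto simp: fmeasurable_eq_sets\<close>)
    ultimately show ?case using elim by auto
  qed
  moreover have "F \<le> on_events (\<lambda>n. E1 n \<inter> E2 n) \<Longrightarrow> \<Phi> F \<and> \<Psi> F" for F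
    using E1(2)[of F] E2(2)[of F] on_events_mono[of "\<lambda>n. E1 n \<inter> E2 n" E1] on_events_mono[of "\<lambda>n. E1 n \<inter> E2 n" E2]
    by (meson inf_le1 inf_le2 order_trans)
  ultimately show "\<exists>E. (\<forall>\<^sub>F n in sequentially. E n \<in> sets (P n) \<and> 1 - \<epsilon> \<le> measure (P n) (E n)) \<and>
     (\<forall>F\<le>on_events E. \<Phi> F \<and> \<Psi> F)"
    by (intro exI[of _ "\<lambda>n. E1 n \<inter> E2 n"]) auto
qed

lemma tight_AE:
  assumes P: "\<forall>\<^sub>F n in sequentially. prob_space (P n)"
    and Q: "\<forall>\<^sub>F n in sequentially. AE y in P n. Q n y"
  shows "tight P (\<lambda>F. \<forall>\<^sub>F w in F. Q (fst w) (snd w))"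
  unfolding tight_def
proof (intro allI impI)
  fix \<epsilon> :: real assume "\<epsilon> > 0"
  have "\<forall>\<^sub>F n in sequentially. \<exists>E. E \<in> sets (P n) \<and> 1 - \<epsilon> \<le> measure (P n) E \<and> (\<forall>y\<in>E. Q n y)"
    using P Q
  proof eventually_elim
    case (elim n)
    interpret prob_space "P n" by (rule elim)
    from elim(2) obtain N where N: "{y \<in> space (P n). \<not> Q n y} \<subseteq> N" "emeasure (P n) N = 0" "N \<in> sets (P n)"
      by (rule AE_E)
    have "measure (P n) (space (P n) - N) = 1"
      using N by (subst prob_compl) (auto simp: measure_def)
    then show ?case using N \<open>\<epsilon> > 0\<close> by (intro exI[of _ "space (P n) - N"]) auto
  qed
  then obtain E where E: "\<forall>\<^sub>F n in sequentially. E n \<in> sets (P n) \<and> 1 - \<epsilon> \<le> measure (P n) (E n) \<and> (\<forall>y\<in>E n. Q n y)"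
    unfolding eventually_ex by blast
  then have "\<forall>\<^sub>F w in on_events E. Q (fst w) (snd w)"
    unfolding eventually_on_events by eventually_elim auto
  then show "\<exists>E. (\<forall>\<^sub>F n in sequentially. E n \<in> sets (P n) \<and> 1 - \<epsilon> \<le> measure (P n) (E n)) \<and>
     (\<forall>F\<le>on_events E. \<forall>\<^sub>F w in F. Q (fst w) (snd w))"
    using E by (intro exI[of _ E] conjI) (auto elim: eventually_mono simp: le_filter_def)
qed

lemma tight_True:
  assumes P: "\<forall>\<^sub>F n in sequentially. prob_space (P n)"
  shows "tight P (\<lambda>F. True)"
  using tight_AE[OF P, of "\<lambda>_ _. True"] by (simp add: tight_def)

lemma tight_ball:
  assumes P: "\<forall>\<^sub>F n in sequentially. prob_space (P n)"
    and "finite I" "\<And>i. i \<in> I \<Longrightarrow> tight P (\<Phi> i)"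
  shows "tight P (\<lambda>F. \<forall>i\<in>I. \<Phi> i F)"
  using assms(2,3)
proof (induction I)
  case empty then show ?case using tight_True[OF P] by simp
next
  case (insert i I)
  then have "tight P (\<lambda>F. \<Phi> i F \<and> (\<forall>i\<in>I. \<Phi> i F))" by (intro tight_conj[OF P]) auto
  then show ?case by simp
qed

text \<open>
  Together with the converse \<open>bigOp_tight\<close> this translates stochastic orders into deterministic ones.
\<close>
lemma tight_bigOp:
  assumes "bigOp P X a"
  shows "tight P (\<lambda>F. (\<lambda>w. X (fst w) (snd w)) \<in> O[F](\<lambda>w. a (fst w)))"
  unfolding tight_def
proof (intro allI impI)
  fix \<epsilon> :: real assume "\<epsilon> > 0"
  then obtain K where "\<forall>\<^sub>F n in sequentially. \<exists>E. E \<in> sets (P n) \<and> measure (P n) E \<ge> 1 - \<epsilon> \<and> (\<forall>y\<in>E. \<bar>X n y\<bar> \<le> K * a n)"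
    using assms unfolding bigOp_def by meson
  then obtain E where E: "\<forall>\<^sub>F n in sequentially. E n \<in> sets (P n) \<and> measure (P n) (E n) \<ge> 1 - \<epsilon> \<and> (\<forall>y\<in>E n. \<bar>X n y\<bar> \<le> K * a n)"
    unfolding eventually_ex by blast
  have "\<forall>\<^sub>F w in on_events E. \<bar>X (fst w) (snd w)\<bar> \<le> \<bar>K\<bar> * \<bar>a (fst w)\<bar>"
    unfolding eventually_on_events using E
    by eventually_elim (auto simp: abs_mult[symmetric] intro: order_trans)
  then have "(\<lambda>w. X (fst w) (snd w)) \<in> O[F](\<lambda>w. a (fst w))" if "F \<le> on_events E" for F
    using that by (intro landau_o.bigI[of "\<bar>K\<bar> + 1"])
      (auto simp: le_filter_def distrib_right elim!: eventually_mono allE intro: order_trans)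
  then show "\<exists>E. (\<forall>\<^sub>F n in sequentially. E n \<in> sets (P n) \<and> 1 - \<epsilon> \<le> measure (P n) (E n)) \<and>
     (\<forall>F\<le>on_events E. (\<lambda>w. X (fst w) (snd w)) \<in> O[F](\<lambda>w. a (fst w)))"
    using E by (intro exI[of _ E]) (auto elim: eventually_mono)
qed

lemma bigOp_tight:
  assumes "tight P (\<lambda>F. (\<lambda>w. X (fst w) (snd w)) \<in> O[F](\<lambda>w. a (fst w)))"
    and a: "\<forall>\<^sub>F n in sequentially. 0 \<le> a n"
  shows "bigOp P X a"
  unfolding bigOp_def
proof (intro allI impI)
  fix \<epsilon> :: real assume "\<epsilon> > 0"
  then obtain E where E: "\<forall>\<^sub>F n in sequentially. E n \<in> sets (P n) \<and> 1 - \<epsilon> \<le> measure (P n) (E n)"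
      "(\<lambda>w. X (fst w) (snd w)) \<in> O[on_events E](\<lambda>w. a (fst w))"
    using assms(1) unfolding tight_def by blast
  then obtain c where "\<forall>\<^sub>F w in on_events E. norm (X (fst w) (snd w)) \<le> c * norm (a (fst w))"
    using landau_o.bigE by metis
  then have "\<forall>\<^sub>F n in sequentially. \<forall>y\<in>E n. norm (X n y) \<le> c * norm (a n)"
    unfolding eventually_on_events by simp
  then have "\<forall>\<^sub>F n in sequentially. \<exists>E\<in>sets (P n). measure (P n) E \<ge> 1 - \<epsilon> \<and> (\<forall>y\<in>E. \<bar>X n y\<bar> \<le> c * a n)"
    using E(1) a by eventually_elim auto
  then show "\<exists>K. \<forall>\<^sub>F n in sequentially. \<exists>E\<in>sets (P n). measure (P n) E \<ge> 1 - \<epsilon> \<and> (\<forall>y\<in>E. \<bar>X n y\<bar> \<le> K * a n)"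
    by blast
qed

section \<open>Multilinear forms and orders of magnitude\<close>

definition form1 :: "('r::finite \<Rightarrow> real) \<Rightarrow> ('r \<Rightarrow> real) \<Rightarrow> real" where
  "form1 a u = (\<Sum>r\<in>UNIV. a r * u r)"
definition form2 :: "('r::finite \<Rightarrow> 'r \<Rightarrow> real) \<Rightarrow> ('r \<Rightarrow> real) \<Rightarrow> ('r \<Rightarrow> real) \<Rightarrow> real" where
  "form2 A u v = (\<Sum>r\<in>UNIV. \<Sum>s\<in>UNIV. A r s * u r * v s)"
definition form3 :: "('r::finite \<Rightarrow> 'r \<Rightarrow> 'r \<Rightarrow> real) \<Rightarrow> ('r \<Rightarrow> real) \<Rightarrow> ('r \<Rightarrow> real) \<Rightarrow> ('r \<Rightarrow> real) \<Rightarrow> real" where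
  "form3 A u v x = (\<Sum>r\<in>UNIV. \<Sum>s\<in>UNIV. \<Sum>t\<in>UNIV. A r s t * u r * v s * x t)"
definition form4 :: "('r::finite \<Rightarrow> 'r \<Rightarrow> 'r \<Rightarrow> 'r \<Rightarrow> real) \<Rightarrow> ('r \<Rightarrow> real) \<Rightarrow> ('r \<Rightarrow> real) \<Rightarrow> ('r \<Rightarrow> real) \<Rightarrow> ('r \<Rightarrow> real) \<Rightarrow> real" where
  "form4 A u v x y = (\<Sum>r\<in>UNIV. \<Sum>s\<in>UNIV. \<Sum>t\<in>UNIV. \<Sum>z\<in>UNIV. A r s t z * u r * v s * x t * y z)"

lemma form_add:
  "form1 a (\<lambda>r. u r + v r) = form1 a u + form1 a v"
  "form2 A (\<lambda>r. u r + v r) x = form2 A u x + form2 A v x"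
  "form2 A x (\<lambda>r. u r + v r) = form2 A x u + form2 A x v"
  "form3 B (\<lambda>r. u r + v r) x y = form3 B u x y + form3 B v x y"
  "form3 B x (\<lambda>r. u r + v r) y = form3 B x u y + form3 B x v y"
  "form3 B x y (\<lambda>r. u r + v r) = form3 B x y u + form3 B x y v"
  "form4 C (\<lambda>r. u r + v r) x y z = form4 C u x y z + form4 C v x y z"
  "form4 C x (\<lambda>r. u r + v r) y z = form4 C x u y z + form4 C x v y z"
  "form4 C x y (\<lambda>r. u r + v r) z = form4 C x y u z + form4 C x y v z"
  "form4 C x y z (\<lambda>r. u r + v r) = form4 C x y z u + form4 C x y z v"
  by (simp_all add: form1_def form2_def form3_def form4_def algebra_simps sum.distrib)

lemma form_scale:
  "form1 a (\<lambda>r. c * u r) = c * form1 a u"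
  "form2 A (\<lambda>r. c * u r) x = c * form2 A u x"
  "form2 A x (\<lambda>r. c * u r) = c * form2 A x u"
  "form3 B (\<lambda>r. c * u r) x y = c * form3 B u x y"
  "form3 B x (\<lambda>r. c * u r) y = c * form3 B x u y"
  "form3 B x y (\<lambda>r. c * u r) = c * form3 B x y u"
  "form4 C (\<lambda>r. c * u r) x y z = c * form4 C u x y z"
  "form4 C x (\<lambda>r. c * u r) y z = c * form4 C x u y z"
  "form4 C x y (\<lambda>r. c * u r) z = c * form4 C x y u z"
  "form4 C x y z (\<lambda>r. c * u r) = c * form4 C x y z u"
  by (simp_all add: form1_def form2_def form3_def form4_def sum_distrib_left mult_ac)

lemma form2_sym: "(\<And>r s. A r s = A s r) \<Longrightarrow> form2 A u v = form2 A v u"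
  unfolding form2_def by (subst sum.swap) (simp add: mult_ac)
lemma form3_sym12: "(\<And>r s t. B r s t = B s r t) \<Longrightarrow> form3 B u v x = form3 B v u x"
  unfolding form3_def by (subst sum.swap) (simp add: mult_ac)
lemma form3_sym23: "(\<And>r s t. B r s t = B r t s) \<Longrightarrow> form3 B u v x = form3 B u x v"
  unfolding form3_def by (rule sum.cong[OF refl], subst sum.swap) (simp add: mult_ac)

lemma big_sum_fin: "(\<And>r. f r \<in> O[F](g)) \<Longrightarrow> (\<lambda>w. \<Sum>r\<in>(UNIV::'r::finite set). (f r w :: real)) \<in> O[F](g)"
  by (rule big_sum_in_bigo) auto

lemma big_prod2: "f \<in> O[F](a) \<Longrightarrow> g \<in> O[F](b) \<Longrightarrow> (\<lambda>w. (f w :: real) * g w) \<in> O[F](\<lambda>w. a w * b w)"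
  by (rule landau_o.big.mult)

lemma big_cmult: "f \<in> O[F](g) \<Longrightarrow> (\<lambda>w. (f w :: real) * c) \<in> O[F](g)"
  using big_prod2[of f F g "\<lambda>_. c" "\<lambda>_. 1"] by simp

lemma form1_big: "\<lbrakk>\<And>r. a r \<in> O[F](\<lambda>_. 1); \<And>r. u r \<in> O[F](f)\<rbrakk> \<Longrightarrow> (\<lambda>w. form1 (\<lambda>r. a r w) (\<lambda>r. u r w)) \<in> O[F](f)"
  unfolding form1_def using big_prod2[of _ F "\<lambda>_. 1" _ f] by (intro big_sum_fin) simp
lemma form2_big: "\<lbrakk>\<And>r s. A r s \<in> O[F](\<lambda>_. 1); \<And>r. u r \<in> O[F](f); \<And>r. v r \<in> O[F](g)\<rbrakk>
   \<Longrightarrow> (\<lambda>w. form2 (\<lambda>r s. A r s w) (\<lambda>r. u r w) (\<lambda>r. v r w)) \<in> O[F](\<lambda>w. f w * g w)"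
  unfolding form2_def using big_prod2[of _ F "\<lambda>_. 1" _ f] by (intro big_sum_fin big_prod2) simp
lemma form3_big: "\<lbrakk>\<And>r s t. A r s t \<in> O[F](\<lambda>_. 1); \<And>r. u r \<in> O[F](f); \<And>r. v r \<in> O[F](g); \<And>r. x r \<in> O[F](h)\<rbrakk>
   \<Longrightarrow> (\<lambda>w. form3 (\<lambda>r s t. A r s t w) (\<lambda>r. u r w) (\<lambda>r. v r w) (\<lambda>r. x r w)) \<in> O[F](\<lambda>w. f w * g w * h w)"
  unfolding form3_def using big_prod2[of _ F "\<lambda>_. 1" _ f] by (intro big_sum_fin big_prod2) simp
lemma form4_big: "\<lbrakk>\<And>r s t z. A r s t z \<in> O[F](\<lambda>_. 1); \<And>r. u r \<in> O[F](f); \<And>r. v r \<in> O[F](g); \<And>r. x r \<in> O[F](h); \<And>r. y r \<in> O[F](j)\<rbrakk>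
   \<Longrightarrow> (\<lambda>w. form4 (\<lambda>r s t z. A r s t z w) (\<lambda>r. u r w) (\<lambda>r. v r w) (\<lambda>r. x r w) (\<lambda>r. y r w)) \<in> O[F](\<lambda>w. f w * g w * h w * j w)"
  unfolding form4_def using big_prod2[of _ F "\<lambda>_. 1" _ f] by (intro big_sum_fin big_prod2) simp

text \<open>
  The quantity \<open>\<delta>\<close> is the unit in which orders are measured; for a sample of size \<open>n\<close> it is \<open>n\<^sup>-\<^sup>1\<^sup>/\<^sup>2\<close>.
\<close>
locale scale =
  fixes F :: "'w filter" and \<delta> :: "'w \<Rightarrow> real"
  assumes \<delta>_pos: "\<forall>\<^sub>F w in F. 0 < \<delta> w" and \<delta>_0: "(\<delta> \<longlongrightarrow> 0) F"
begin

abbreviation bnd :: "('w \<Rightarrow> real) \<Rightarrow> bool" where "bnd X \<equiv> X \<in> O[F](\<lambda>_. 1)"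

lemma \<delta>_less: "e > 0 \<Longrightarrow> \<forall>\<^sub>F w in F. \<delta> w < e"
  using order_tendstoD(2)[OF \<delta>_0] by simp

lemma \<delta>_bnd: "bnd \<delta>"
proof (rule landau_o.bigI[of 1])
  show "\<forall>\<^sub>F w in F. norm (\<delta> w) \<le> 1 * norm (1::real)"
    using \<delta>_less[OF zero_less_one] \<delta>_pos by eventually_elim auto
qed simp

lemma \<delta>_power_le: "j \<le> k \<Longrightarrow> (\<lambda>w. \<delta> w ^ k) \<in> O[F](\<lambda>w. \<delta> w ^ j)"
proof (rule landau_o.bigI[of 1])
  assume "j \<le> k"
  show "\<forall>\<^sub>F w in F. norm (\<delta> w ^ k) \<le> 1 * norm (\<delta> w ^ j)"
    using \<delta>_less[OF zero_less_one] \<delta>_pos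
    by eventually_elim (use \<open>j \<le> k\<close> in \<open>auto intro: power_decreasing\<close>)
qed simp

lemma big_\<delta>_weaken: "X \<in> O[F](\<lambda>w. \<delta> w ^ k) \<Longrightarrow> j \<le> k \<Longrightarrow> X \<in> O[F](\<lambda>w. \<delta> w ^ j)"
  using landau_o.big_trans \<delta>_power_le by blast

lemma bnd_mult: "bnd X \<Longrightarrow> bnd Y \<Longrightarrow> bnd (\<lambda>w. X w * Y w)"
  using big_prod2[of X F "\<lambda>_. 1" Y "\<lambda>_. 1"] by simp
lemma bnd_add: "bnd X \<Longrightarrow> bnd Y \<Longrightarrow> bnd (\<lambda>w. X w + Y w)" by (rule sum_in_bigo)
lemma bnd_diff: "bnd X \<Longrightarrow> bnd Y \<Longrightarrow> bnd (\<lambda>w. X w - Y w)" by (rule sum_in_bigo)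
lemma bnd_const: "bnd (\<lambda>_. c)" by simp
lemma bnd_minus: "bnd X \<Longrightarrow> bnd (\<lambda>w. - X w)" by simp
lemmas bnd_intros = bnd_mult bnd_add bnd_diff bnd_const bnd_minus big_sum_fin \<delta>_bnd

end

section \<open>The maximum of a perturbed concave quadratic form\<close>

text \<open>
  A log-likelihood with an adjustment, near the true value and in coordinates scaled by \<open>\<delta>\<close>.  Here \<open>\<Lambda>\<close>, \<open>\<mu>3\<close>, \<open>\<mu>4\<close>
  are the standardized means of the derivatives of the log-likelihood of orders 2, 3 and 4, and
  \<open>\<beta>\<close>, \<open>\<beta>2\<close> those of the first two derivatives of the adjustment; \<open>Z1\<close>, \<open>Z2\<close>, \<open>Z3\<close> and \<open>Zb\<close> are the standardized
  deviations from the means.  Only the coordinates in \<open>S\<close> vary, and \<open>G\<close> is the inverse of the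
  \<open>S\<close>-block of \<open>\<Lambda>\<close>, extended by 0.
\<close>
locale lik_expansion = scale F \<delta> for F :: "'w filter" and \<delta> :: "'w \<Rightarrow> real" +
  fixes S :: "'r::finite set"
    and Z1 \<beta> Zb :: "'r \<Rightarrow> 'w \<Rightarrow> real" and Z2 \<beta>2 \<Lambda> G :: "'r \<Rightarrow> 'r \<Rightarrow> 'w \<Rightarrow> real"
    and Z3 \<mu>3 :: "'r \<Rightarrow> 'r \<Rightarrow> 'r \<Rightarrow> 'w \<Rightarrow> real" and \<mu>4 :: "'r \<Rightarrow> 'r \<Rightarrow> 'r \<Rightarrow> 'r \<Rightarrow> 'w \<Rightarrow> real" and c :: real
  assumes bounded: "\<And>r. bnd (Z1 r)" "\<And>r. bnd (\<beta> r)" "\<And>r. bnd (Zb r)" "\<And>r s. bnd (Z2 r s)"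
      "\<And>r s. bnd (\<beta>2 r s)" "\<And>r s. bnd (\<Lambda> r s)" "\<And>r s. bnd (G r s)" "\<And>r s t. bnd (Z3 r s t)"
      "\<And>r s t. bnd (\<mu>3 r s t)" "\<And>r s t z. bnd (\<mu>4 r s t z)"
    and sym: "\<forall>\<^sub>F w in F. \<forall>r s. Z2 r s w = Z2 s r w" "\<forall>\<^sub>F w in F. \<forall>r s. \<Lambda> r s w = \<Lambda> s r w"
      "\<forall>\<^sub>F w in F. \<forall>r s t. \<mu>3 r s t w = \<mu>3 s r t w" "\<forall>\<^sub>F w in F. \<forall>r s t. \<mu>3 r s t w = \<mu>3 r t s w"
    and G_off: "\<And>r s w. r \<notin> S \<or> s \<notin> S \<Longrightarrow> G r s w = 0"
    and G_inv: "\<forall>\<^sub>F w in F. \<forall>r\<in>S. \<forall>t\<in>S. (\<Sum>s\<in>UNIV. \<Lambda> r s w * G s t w) = (if r = t then 1 else 0)"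
    and c_pos: "c > 0"
    and coercive: "\<forall>\<^sub>F w in F. \<forall>u. form2 (\<lambda>r s. \<Lambda> r s w) u u \<le> - c * (\<Sum>r\<in>UNIV. (u r)\<^sup>2)"
begin

text \<open>
  The increase of the log-likelihood at the scaled displacement \<open>u\<close>, split into its terms of orders
  \<open>1\<close>, \<open>\<delta>\<close> and \<open>\<delta>\<^sup>2\<close>.
\<close>
definition "q0 u w = form1 (\<lambda>r. Z1 r w) u + form2 (\<lambda>r s. \<Lambda> r s w) u u / 2"
definition "q1 u w = form2 (\<lambda>r s. Z2 r s w) u u / 2 + form3 (\<lambda>r s t. \<mu>3 r s t w) u u u / 6 + form1 (\<lambda>r. \<beta> r w) u"
definition "q2 u w = form3 (\<lambda>r s t. Z3 r s t w) u u u / 6 + form4 (\<lambda>r s t z. \<mu>4 r s t z w) u u u u / 24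
   + form1 (\<lambda>r. Zb r w) u + form2 (\<lambda>r s. \<beta>2 r s w) u u / 2"
definition "f u w = q0 u w + \<delta> w * q1 u w + (\<delta> w)\<^sup>2 * q2 u w"

text \<open>
  The maximizer of \<open>q0\<close> over the vectors supported in \<open>S\<close> is \<open>h\<close>, and \<open>g\<close> is the gradient of \<open>q1\<close> at \<open>h\<close>.  One
  Newton step from \<open>h\<close> leads to the trial point \<open>ut\<close>, and \<open>P\<close> is twice the value of \<open>f\<close>
  there up to terms of order \<open>\<delta>\<^sup>3\<close>.
\<close>
definition "h r w = - (\<Sum>s\<in>UNIV. G r s w * Z1 s w)"
definition "g r w = (\<Sum>s\<in>UNIV. Z2 r s w * h s w) + (\<Sum>s\<in>UNIV. \<Sum>t\<in>UNIV. \<mu>3 r s t w * h s w * h t w) / 2 + \<beta> r w"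
definition "k r w = - (\<Sum>s\<in>UNIV. G r s w * g s w)"
definition "ut r w = h r w + \<delta> w * k r w"
definition "P w = - form2 (\<lambda>r s. G r s w) (\<lambda>r. Z1 r w) (\<lambda>r. Z1 r w) + \<delta> w * (2 * q1 (\<lambda>r. h r w) w)
   + (\<delta> w)\<^sup>2 * (2 * q2 (\<lambda>r. h r w) w - form2 (\<lambda>r s. G r s w) (\<lambda>r. g r w) (\<lambda>r. g r w))"

lemma h_bnd: "bnd (h r)" unfolding h_def by (intro bnd_intros bounded)
lemma g_bnd: "bnd (g r)" unfolding g_def divide_inverse by (intro bnd_intros bounded h_bnd)
lemma k_bnd: "bnd (k r)" unfolding k_def by (intro bnd_intros bounded g_bnd)
lemma ut_bnd: "bnd (ut r)" unfolding ut_def by (intro bnd_intros h_bnd k_bnd)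

lemma h_off: "r \<notin> S \<Longrightarrow> h r w = 0" and k_off: "r \<notin> S \<Longrightarrow> k r w = 0" and ut_off: "r \<notin> S \<Longrightarrow> ut r w = 0"
  by (simp_all add: h_def k_def ut_def G_off)

text \<open>
  Contraction with \<open>G\<close> solves the linear equation with matrix \<open>\<Lambda>\<close> when tested against vectors supported
  in \<open>S\<close>.
\<close>
lemma form2_G:
  assumes "\<forall>r\<in>S. \<forall>t\<in>S. (\<Sum>s\<in>UNIV. \<Lambda> r s w * G s t w) = (if r = t then 1 else 0)"
    and e: "\<And>r. r \<notin> S \<Longrightarrow> e r = 0"
    and kk: "\<And>r. kk r = - (\<Sum>s\<in>UNIV. G r s w * x s)"
  shows "form2 (\<lambda>r s. \<Lambda> r s w) e kk = - form1 x e"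
proof -
  have *: "(\<Sum>s\<in>UNIV. \<Lambda> r s w * kk s) = - x r" if "r \<in> S" for r
  proof -
    have "(\<Sum>s\<in>UNIV. \<Lambda> r s w * kk s) = - (\<Sum>s\<in>UNIV. \<Sum>t\<in>UNIV. \<Lambda> r s w * G s t w * x t)"
      by (simp add: kk sum_distrib_left sum_negf mult_ac)
    also have "\<dots> = - (\<Sum>t\<in>UNIV. (\<Sum>s\<in>UNIV. \<Lambda> r s w * G s t w) * x t)"
      by (subst sum.swap) (simp add: sum_distrib_right)
    also have "\<dots> = - (\<Sum>t\<in>UNIV. if r = t then x t else 0)"
    proof (intro arg_cong[of _ _ uminus] sum.cong refl)
      fix t show "(\<Sum>s\<in>UNIV. \<Lambda> r s w * G s t w) * x t = (if r = t then x t else 0)"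
        using assms(1) that G_off[of _ t w] by (cases "t \<in> S") auto
    qed
    finally show ?thesis by simp
  qed
  have "form2 (\<lambda>r s. \<Lambda> r s w) e kk = (\<Sum>r\<in>UNIV. e r * (\<Sum>s\<in>UNIV. \<Lambda> r s w * kk s))"
    by (simp add: form2_def sum_distrib_left mult_ac)
  also have "\<dots> = (\<Sum>r\<in>UNIV. - (x r * e r))"
  proof (rule sum.cong[OF refl])
    fix r show "e r * (\<Sum>s\<in>UNIV. \<Lambda> r s w * kk s) = - (x r * e r)"
      using *[of r] e[of r] by (cases "r \<in> S") auto
  qed
  finally show ?thesis by (simp add: form1_def sum_negf)
qed

lemma form1_g: "form1 (\<lambda>r. g r w) e = form2 (\<lambda>r s. Z2 r s w) e (\<lambda>r. h r w)
   + form3 (\<lambda>r s t. \<mu>3 r s t w) e (\<lambda>r. h r w) (\<lambda>r. h r w) / 2 + form1 (\<lambda>r. \<beta> r w) e"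
  unfolding g_def form1_def form2_def form3_def
  by (simp add: algebra_simps sum.distrib sum_distrib_left sum_distrib_right sum_divide_distrib)

lemma q2_diff:
  assumes "\<And>r. u r \<in> O[F](\<lambda>_. 1)" "\<And>r. e r \<in> O[F](\<lambda>_. 1)" "\<And>r. e r \<in> O[F](E)"
  shows "(\<lambda>w. q2 (\<lambda>r. u r w + e r w) w - q2 (\<lambda>r. u r w) w) \<in> O[F](E)"
proof -
  let ?e = "\<lambda>w r. e r w" let ?u = "\<lambda>w r. u r w" let ?v = "\<lambda>w r. u r w + e r w"
  have v: "bnd (\<lambda>w. u r w + e r w)" for r by (intro bnd_intros assms)
  have *: "q2 (\<lambda>r. u r w + e r w) w - q2 (\<lambda>r. u r w) w =
     (form3 (\<lambda>r s t. Z3 r s t w) (?e w) (?v w) (?v w) + form3 (\<lambda>r s t. Z3 r s t w) (?u w) (?e w) (?v w)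
       + form3 (\<lambda>r s t. Z3 r s t w) (?u w) (?u w) (?e w)) * (1/6)
   + (form4 (\<lambda>r s t z. \<mu>4 r s t z w) (?e w) (?v w) (?v w) (?v w) + form4 (\<lambda>r s t z. \<mu>4 r s t z w) (?u w) (?e w) (?v w) (?v w)
     + form4 (\<lambda>r s t z. \<mu>4 r s t z w) (?u w) (?u w) (?e w) (?v w) + form4 (\<lambda>r s t z. \<mu>4 r s t z w) (?u w) (?u w) (?u w) (?e w)) * (1/24)
   + form1 (\<lambda>r. Zb r w) (?e w)
   + (form2 (\<lambda>r s. \<beta>2 r s w) (?e w) (?v w) + form2 (\<lambda>r s. \<beta>2 r s w) (?u w) (?e w)) * (1/2)" for w
  proof -
    have d3: "form3 A (\<lambda>r. u r w + e r w) (\<lambda>r. u r w + e r w) (\<lambda>r. u r w + e r w) - form3 A (?u w) (?u w) (?u w) =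
      form3 A (?e w) (?v w) (?v w) + form3 A (?u w) (?e w) (?v w) + form3 A (?u w) (?u w) (?e w)" for A
      by (simp add: form_add)
    have d4: "form4 A (\<lambda>r. u r w + e r w) (\<lambda>r. u r w + e r w) (\<lambda>r. u r w + e r w) (\<lambda>r. u r w + e r w) - form4 A (?u w) (?u w) (?u w) (?u w) =
      form4 A (?e w) (?v w) (?v w) (?v w) + form4 A (?u w) (?e w) (?v w) (?v w) + form4 A (?u w) (?u w) (?e w) (?v w)
        + form4 A (?u w) (?u w) (?u w) (?e w)" for A
      by (simp add: form_add)
    have d2: "form2 A (\<lambda>r. u r w + e r w) (\<lambda>r. u r w + e r w) - form2 A (?u w) (?u w) =
      form2 A (?e w) (?v w) + form2 A (?u w) (?e w)" for A
      by (simp add: form_add)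
    have d1: "form1 A (\<lambda>r. u r w + e r w) - form1 A (?u w) = form1 A (?e w)" for A
      by (simp add: form_add)
    have alg: "x3 / 6 + x4 / 24 + x1 + x2 / 2 - (y3 / 6 + y4 / 24 + y1 + y2 / 2)
        = (x3 - y3) * (1/6) + (x4 - y4) * (1/24) + (x1 - y1) + (x2 - y2) * (1/2)" for x1 x2 x3 x4 y1 y2 y3 y4 :: real
      by (simp add: field_simps)
    have "q2 (\<lambda>r. u r w + e r w) w - q2 (\<lambda>r. u r w) w =
       (form3 (\<lambda>r s t. Z3 r s t w) (?v w) (?v w) (?v w) - form3 (\<lambda>r s t. Z3 r s t w) (?u w) (?u w) (?u w)) * (1/6)
     + (form4 (\<lambda>r s t z. \<mu>4 r s t z w) (?v w) (?v w) (?v w) (?v w) - form4 (\<lambda>r s t z. \<mu>4 r s t z w) (?u w) (?u w) (?u w) (?u w)) * (1/24)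
     + (form1 (\<lambda>r. Zb r w) (?v w) - form1 (\<lambda>r. Zb r w) (?u w))
     + (form2 (\<lambda>r s. \<beta>2 r s w) (?v w) (?v w) - form2 (\<lambda>r s. \<beta>2 r s w) (?u w) (?u w)) * (1/2)"
      unfolding q2_def by (rule alg)
    then show ?thesis unfolding d3 d4 d2 d1 .
  qed
  have cm: "\<And>X b. X \<in> O[F](E) \<Longrightarrow> (\<lambda>w. X w * (b::real)) \<in> O[F](E)"
    by (rule big_cmult)
  note big = form3_big[OF bounded(8) assms(3) v v, simplified] form3_big[OF bounded(8) assms(1,3) v, simplified]
     form3_big[OF bounded(8) assms(1,1,3), simplified]
     form4_big[OF bounded(10) assms(3) v v v, simplified] form4_big[OF bounded(10) assms(1,3) v v, simplified]
     form4_big[OF bounded(10) assms(1,1,3) v, simplified] form4_big[OF bounded(10) assms(1,1,1,3), simplified]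
     form2_big[OF bounded(5) assms(3) v, simplified] form2_big[OF bounded(5) assms(1,3), simplified]
     form1_big[OF bounded(3) assms(3)]
  show ?thesis unfolding * by (intro sum_in_bigo cm big)
qed

text \<open>
  Since \<open>h\<close> is stationary for \<open>q0\<close>, the Newton step changes \<open>q0\<close> only at order \<open>\<delta>\<^sup>2\<close>.  With the change of
  \<open>\<delta> q1\<close> this makes the single term \<open>- \<delta>\<^sup>2 G(g, g)/2\<close>.
\<close>
lemma value_at_ut: "(\<lambda>w. 2 * f (\<lambda>r. ut r w) w - P w) \<in> O[F](\<lambda>w. \<delta> w ^ 3)"
proof -
  define k' where "k' r w = \<delta> w * k r w" for r w
  have k'1: "k' r \<in> O[F](\<delta>)" for r unfolding k'_def
    using big_prod2[of \<delta> F \<delta> "k r" "\<lambda>_. 1"] k_bnd by simp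
  have k'0: "bnd (k' r)" for r unfolding k'_def by (intro bnd_intros k_bnd)
  let ?h = "\<lambda>w r. h r w" let ?k = "\<lambda>w r. k r w"
  let ?D = "\<lambda>w. q2 (\<lambda>r. h r w + k' r w) w - q2 (\<lambda>r. h r w) w"
  let ?X = "\<lambda>w. form2 (\<lambda>r s. Z2 r s w) (?k w) (?k w) + form3 (\<lambda>r s t. \<mu>3 r s t w) (?h w) (?k w) (?k w)
     + \<delta> w * form3 (\<lambda>r s t. \<mu>3 r s t w) (?k w) (?k w) (?k w) * (1/3)"
  have D: "?D \<in> O[F](\<delta>)" by (rule q2_diff) (use h_bnd k'0 k'1 in auto)
  note f3 = form3_big[where f="\<lambda>_. 1" and g="\<lambda>_. 1" and h="\<lambda>_. 1", simplified]
    and f2 = form2_big[where f="\<lambda>_. 1" and g="\<lambda>_. 1", simplified]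
  have X: "bnd ?X" by (intro bnd_intros f3 f2 bounded h_bnd k_bnd)
  have "\<forall>\<^sub>F w in F. 2 * f (\<lambda>r. ut r w) w - P w = \<delta> w ^ 3 * ?X w + 2 * (\<delta> w)\<^sup>2 * ?D w"
    using sym G_inv
  proof eventually_elim
    case (elim w)
    let ?Z2 = "\<lambda>r s. Z2 r s w" let ?\<Lambda> = "\<lambda>r s. \<Lambda> r s w" let ?\<mu>3 = "\<lambda>r s t. \<mu>3 r s t w" let ?G = "\<lambda>r s. G r s w"
    have s2: "form2 ?Z2 u v = form2 ?Z2 v u" for u v using elim by (intro form2_sym) auto
    have sL: "form2 ?\<Lambda> u v = form2 ?\<Lambda> v u" for u v using elim by (intro form2_sym) auto
    have s3: "form3 ?\<mu>3 u v x = form3 ?\<mu>3 v u x" "form3 ?\<mu>3 u v x = form3 ?\<mu>3 u x v" for u v x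
      by (rule form3_sym12, use elim in metis, rule form3_sym23, use elim in metis)
    have sA: "form3 ?\<mu>3 u v v = form3 ?\<mu>3 v v u" and sB: "form3 ?\<mu>3 v u v = form3 ?\<mu>3 v v u" for u v
      using s3(1)[of u v v] s3(2)[of v u v] by simp_all
    have Lh: "form2 ?\<Lambda> e (?h w) = - form1 (\<lambda>r. Z1 r w) e" if "\<And>r. r \<notin> S \<Longrightarrow> e r = 0" for e
      by (rule form2_G[OF elim(5) that]) (auto simp: h_def)
    have Lk: "form2 ?\<Lambda> e (?k w) = - form1 (\<lambda>r. g r w) e" if "\<And>r. r \<notin> S \<Longrightarrow> e r = 0" for e
      by (rule form2_G[OF elim(5) that]) (auto simp: k_def)
    have Gz: "form2 ?G (\<lambda>r. Z1 r w) (\<lambda>r. Z1 r w) = - form1 (\<lambda>r. Z1 r w) (?h w)"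
      by (simp add: form2_def form1_def h_def sum_distrib_left sum_negf mult_ac)
    have Gg: "form2 ?G (\<lambda>r. g r w) (\<lambda>r. g r w) = - form1 (\<lambda>r. g r w) (?k w)"
      by (simp add: form2_def form1_def k_def sum_distrib_left sum_negf mult_ac)
    have utk: "(\<lambda>r. ut r w) = (\<lambda>r. h r w + k' r w)" by (simp add: ut_def k'_def)
    have k': "(\<lambda>r. k' r w) = (\<lambda>r. \<delta> w * k r w)" by (simp add: k'_def)
    have q0: "q0 (\<lambda>r. ut r w) w = form1 (\<lambda>r. Z1 r w) (?h w) / 2 - (\<delta> w)\<^sup>2 * form1 (\<lambda>r. g r w) (?k w) / 2"
      unfolding utk q0_def using Lh[of "?h w"] Lh[of "?k w"] Lk[of "?k w"] sL[of "?h w" "?k w"]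
      by (simp add: form_add form_scale k' h_off k_off power2_eq_square field_simps)
    have s3': "form3 ?\<mu>3 (?k w) (?h w) (?h w) = form3 ?\<mu>3 (?h w) (?h w) (?k w)"
       "form3 ?\<mu>3 (?h w) (?k w) (?h w) = form3 ?\<mu>3 (?h w) (?h w) (?k w)"
       "form3 ?\<mu>3 (?k w) (?k w) (?h w) = form3 ?\<mu>3 (?h w) (?k w) (?k w)"
       "form3 ?\<mu>3 (?k w) (?h w) (?k w) = form3 ?\<mu>3 (?h w) (?k w) (?k w)"
      by (simp_all only: sA[of "?k w" "?h w"] sB[of "?k w" "?h w"] sA[of "?h w" "?k w"] sB[of "?h w" "?k w"])
    have q1: "q1 (\<lambda>r. ut r w) w = q1 (?h w) w + \<delta> w * form1 (\<lambda>r. g r w) (?k w) + (\<delta> w)\<^sup>2 * ?X w / 2"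
      unfolding utk q1_def form1_g using s2[of "?h w" "?k w"] 
      by (simp add: form_add form_scale k' power2_eq_square s3' field_simps)
    have q2: "q2 (\<lambda>r. ut r w) w = q2 (?h w) w + ?D w" unfolding utk by simp
    have "2 * f (\<lambda>r. ut r w) w - P w = 2 * q0 (\<lambda>r. ut r w) w + 2 * \<delta> w * q1 (\<lambda>r. ut r w) w + 2 * (\<delta> w)\<^sup>2 * q2 (\<lambda>r. ut r w) w - P w"
      by (simp add: f_def algebra_simps)
    also have "\<dots> = \<delta> w ^ 3 * ?X w + 2 * (\<delta> w)\<^sup>2 * ?D w"
      unfolding q0 q1 q2 P_def Gz Gg by (simp add: algebra_simps power2_eq_square power3_eq_cube)
    finally show ?case .
  qed
  moreover have "(\<lambda>w. \<delta> w ^ 3 * ?X w + 2 * (\<delta> w)\<^sup>2 * ?D w) \<in> O[F](\<lambda>w. \<delta> w ^ 3)"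
  proof (rule sum_in_bigo)
    show "(\<lambda>w. \<delta> w ^ 3 * ?X w) \<in> O[F](\<lambda>w. \<delta> w ^ 3)"
      using big_prod2[OF _ X, of "\<lambda>w. \<delta> w ^ 3" "\<lambda>w. \<delta> w ^ 3"] by simp
    have "(\<lambda>w. 2 * (\<delta> w)\<^sup>2 * ?D w) \<in> O[F](\<lambda>w. (\<delta> w)\<^sup>2 * \<delta> w)"
      by (rule big_prod2[OF _ D]) simp
    then show "(\<lambda>w. 2 * (\<delta> w)\<^sup>2 * ?D w) \<in> O[F](\<lambda>w. \<delta> w ^ 3)"
      by (simp add: power2_eq_square power3_eq_cube mult_ac)
  qed
  ultimately show ?thesis by (subst landau_o.big.in_cong)
qed

text \<open>
  Let \<open>E\<close> be the \<open>l\<^sup>1\<close>-distance of a competitor from the trial point.  By the choice of the trial point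
  the linear part of the difference of the values is at most \<open>C \<delta>\<^sup>2 E\<close>, while concavity contributes \<open>- \<kappa> E\<^sup>2\<close>.
  The maximum over \<open>E\<close> is of order \<open>\<delta>\<^sup>4\<close>, uniformly over bounded competitors.
\<close>
lemma value_le:
  assumes ub: "\<And>r. bnd (ub r)" and off: "\<forall>\<^sub>F w in F. \<forall>r. r \<notin> S \<longrightarrow> ub r w = 0"
  shows "\<exists>C. \<forall>\<^sub>F w in F. f (\<lambda>r. ub r w) w \<le> f (\<lambda>r. ut r w) w + C * \<delta> w ^ 4"
proof -
  define e where "e r w = ub r w - ut r w" for r w
  define E where "E w = (\<Sum>r\<in>UNIV. \<bar>e r w\<bar>)" for w
  have e0: "bnd (e r)" for r unfolding e_def by (intro bnd_intros ub ut_bnd)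
  have eE: "e r \<in> O[F](E)" for r
  proof (rule landau_o.bigI[of 1])
    have "\<bar>e r w\<bar> \<le> E w" for w unfolding E_def by (rule member_le_sum) auto
    then show "\<forall>\<^sub>F w in F. norm (e r w) \<le> 1 * norm (E w)"
      by (intro always_eventually allI) (auto intro: order_trans[OF _ abs_ge_self])
  qed simp
  let ?h = "\<lambda>w r. h r w" let ?k = "\<lambda>w r. k r w" let ?e = "\<lambda>w r. e r w" let ?u = "\<lambda>w r. ut r w"
  let ?Z2 = "\<lambda>w r s. Z2 r s w" let ?\<mu>3 = "\<lambda>w r s t. \<mu>3 r s t w" 
  let ?D = "\<lambda>w. q2 (\<lambda>r. ut r w + e r w) w - q2 (\<lambda>r. ut r w) w"
  let ?X1 = "\<lambda>w. form2 (?Z2 w) (?k w) (?e w) + form3 (?\<mu>3 w) (?h w) (?k w) (?e w) 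
     + \<delta> w * form3 (?\<mu>3 w) (?k w) (?k w) (?e w) * (1/2) + ?D w"
  let ?X2 = "\<lambda>w. form2 (?Z2 w) (?e w) (?e w) * (1/2) + form3 (?\<mu>3 w) (?u w) (?e w) (?e w) * (1/2)
     + form3 (?\<mu>3 w) (?e w) (?e w) (?e w) * (1/6)"
  have cm: "\<And>X a b. X \<in> O[F](a) \<Longrightarrow> (\<lambda>w. X w * (b::real)) \<in> O[F](a)"
    by (rule big_cmult)
  have dm: "\<And>X a. X \<in> O[F](a) \<Longrightarrow> (\<lambda>w. \<delta> w * X w) \<in> O[F](a)"
    using big_prod2[OF \<delta>_bnd] by simp
  note big = form3_big[OF bounded(9) h_bnd k_bnd eE, simplified] form3_big[OF bounded(9) k_bnd k_bnd eE, simplified]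
     form2_big[OF bounded(4) k_bnd eE, simplified] 
  note big2 = form3_big[OF bounded(9) ut_bnd eE eE, simplified] form3_big[OF bounded(9) e0 eE eE, simplified]
     form2_big[OF bounded(4) eE eE, simplified]
  have D: "?D \<in> O[F](E)" by (rule q2_diff) (use ut_bnd e0 eE in auto)
  have "?X1 \<in> O[F](E)"
    by (intro sum_in_bigo D cm big big[THEN dm])
  then obtain C1 where C1: "C1 > 0" "\<forall>\<^sub>F w in F. norm (?X1 w) \<le> C1 * norm (E w)" by (rule landau_o.bigE)
  have "?X2 \<in> O[F](\<lambda>w. E w * E w)"
    by (intro sum_in_bigo cm big2)
  then obtain C2 where C2: "C2 > 0" "\<forall>\<^sub>F w in F. norm (?X2 w) \<le> C2 * norm (E w * E w)" by (rule landau_o.bigE)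
  define d where "d = real (card (UNIV :: 'r set))"
  have d: "d > 0" unfolding d_def by (simp add: card_gt_0_iff)
  \<comment> \<open>Half of the curvature \<open>2\<kappa>\<close> absorbs the quadratic error \<open>\<delta> X2\<close>, the other half the linear one.\<close>
  define \<kappa> where "\<kappa> = c / (4 * d)"
  have \<kappa>: "\<kappa> > 0" using c_pos d by (simp add: \<kappa>_def)
  have "\<forall>\<^sub>F w in F. \<delta> w < \<kappa> / C2" using \<kappa> C2(1) by (intro \<delta>_less) simp
  then have "\<forall>\<^sub>F w in F. f (\<lambda>r. ub r w) w \<le> f (\<lambda>r. ut r w) w + (C1\<^sup>2 / (4 * \<kappa>)) * \<delta> w ^ 4"
    using sym G_inv coercive off C1(2) C2(2) \<delta>_pos
  proof eventually_elim
    case (elim w)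
    let ?Z2 = "\<lambda>r s. Z2 r s w" let ?\<Lambda> = "\<lambda>r s. \<Lambda> r s w" let ?\<mu>3 = "\<lambda>r s t. \<mu>3 r s t w" let ?G = "\<lambda>r s. G r s w"
    have s2: "form2 ?Z2 u v = form2 ?Z2 v u" for u v using elim by (intro form2_sym) auto
    have sL: "form2 ?\<Lambda> u v = form2 ?\<Lambda> v u" for u v using elim by (intro form2_sym) auto
    have s3: "form3 ?\<mu>3 u v x = form3 ?\<mu>3 v u x" "form3 ?\<mu>3 u v x = form3 ?\<mu>3 u x v" for u v x
      by (rule form3_sym12, use elim in metis, rule form3_sym23, use elim in metis)
    have sA: "form3 ?\<mu>3 u v v = form3 ?\<mu>3 v v u" and sB: "form3 ?\<mu>3 v u v = form3 ?\<mu>3 v v u" for u v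
      using s3(1)[of u v v] s3(2)[of v u v] by simp_all
    have e_off: "r \<notin> S \<Longrightarrow> e r w = 0" for r using elim ut_off by (simp add: e_def)
    have Lh: "form2 ?\<Lambda> (?e w) (?h w) = - form1 (\<lambda>r. Z1 r w) (?e w)"
      by (rule form2_G[OF elim(6) e_off]) (auto simp: h_def)
    have Lk: "form2 ?\<Lambda> (?e w) (?k w) = - form1 (\<lambda>r. g r w) (?e w)"
      by (rule form2_G[OF elim(6) e_off]) (auto simp: k_def)
    have ub: "(\<lambda>r. ub r w) = (\<lambda>r. ut r w + e r w)" by (simp add: e_def)
    have ut: "(\<lambda>r. ut r w) = (\<lambda>r. h r w + \<delta> w * k r w)" by (simp add: ut_def)
    have q0: "q0 (\<lambda>r. ub r w) w - q0 (\<lambda>r. ut r w) w = form2 ?\<Lambda> (?e w) (?e w) / 2 - \<delta> w * form1 (\<lambda>r. g r w) (?e w)"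
    proof -
      have "form2 ?\<Lambda> (?e w) (?u w) = form2 ?\<Lambda> (?e w) (?h w) + \<delta> w * form2 ?\<Lambda> (?e w) (?k w)"
        by (simp add: ut form_add form_scale)
      then show ?thesis unfolding ub q0_def form_add using Lh Lk sL[of "?u w" "?e w"]
        by (simp add: field_simps)
    qed
    have s3': "form3 ?\<mu>3 (?e w) (?u w) (?u w) = form3 ?\<mu>3 (?u w) (?u w) (?e w)"
       "form3 ?\<mu>3 (?u w) (?e w) (?u w) = form3 ?\<mu>3 (?u w) (?u w) (?e w)"
       "form3 ?\<mu>3 (?e w) (?e w) (?u w) = form3 ?\<mu>3 (?u w) (?e w) (?e w)"
       "form3 ?\<mu>3 (?e w) (?u w) (?e w) = form3 ?\<mu>3 (?u w) (?e w) (?e w)"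
      by (simp_all only: sA[of "?e w" "?u w"] sB[of "?e w" "?u w"] sA[of "?u w" "?e w"] sB[of "?u w" "?e w"])
    have s3'': "form3 ?\<mu>3 (?e w) (?h w) (?h w) = form3 ?\<mu>3 (?h w) (?h w) (?e w)"
       "form3 ?\<mu>3 (?k w) (?h w) (?e w) = form3 ?\<mu>3 (?h w) (?k w) (?e w)" by (simp_all only: sA[of "?e w" "?h w"] s3(1)[of "?k w" "?h w" "?e w"])
    have q1a: "q1 (\<lambda>r. ub r w) w - q1 (\<lambda>r. ut r w) w = form2 ?Z2 (?u w) (?e w) + form3 ?\<mu>3 (?u w) (?u w) (?e w) / 2
        + form1 (\<lambda>r. \<beta> r w) (?e w) + ?X2 w"
      unfolding ub q1_def using s2[of "?u w" "?e w"] by (simp add: form_add s3' field_simps)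
    have q1b: "form2 ?Z2 (?u w) (?e w) + form3 ?\<mu>3 (?u w) (?u w) (?e w) / 2 + form1 (\<lambda>r. \<beta> r w) (?e w)
        = form1 (\<lambda>r. g r w) (?e w) + \<delta> w * (form2 ?Z2 (?k w) (?e w) + form3 ?\<mu>3 (?h w) (?k w) (?e w) 
            + \<delta> w * form3 ?\<mu>3 (?k w) (?k w) (?e w) * (1/2))"
      unfolding ut form1_g using s2[of "?h w" "?e w"] by (simp add: form_add form_scale s3'' field_simps)
    have q2: "q2 (\<lambda>r. ub r w) w - q2 (\<lambda>r. ut r w) w = ?D w" unfolding ub by simp
    have "f (\<lambda>r. ub r w) w - f (\<lambda>r. ut r w) w = (q0 (\<lambda>r. ub r w) w - q0 (\<lambda>r. ut r w) w)
        + \<delta> w * (q1 (\<lambda>r. ub r w) w - q1 (\<lambda>r. ut r w) w) + (\<delta> w)\<^sup>2 * (q2 (\<lambda>r. ub r w) w - q2 (\<lambda>r. ut r w) w)"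
      by (simp add: f_def algebra_simps)
    also have "\<dots> = form2 ?\<Lambda> (?e w) (?e w) / 2 + (\<delta> w)\<^sup>2 * ?X1 w + \<delta> w * ?X2 w"
      unfolding q0 q1a q1b q2 by (simp add: power2_eq_square algebra_simps)
    finally have *: "f (\<lambda>r. ub r w) w - f (\<lambda>r. ut r w) w = form2 ?\<Lambda> (?e w) (?e w) / 2 + (\<delta> w)\<^sup>2 * ?X1 w + \<delta> w * ?X2 w" .
    have E0: "E w \<ge> 0" by (simp add: E_def sum_nonneg)
    have "(E w)\<^sup>2 \<le> d * (\<Sum>r\<in>UNIV. (e r w)\<^sup>2)"
      using sum_squared_le_sum_of_squares[of "\<lambda>r. \<bar>e r w\<bar>" UNIV] by (simp add: E_def d_def mult.commute)
    then have "c * ((E w)\<^sup>2 / d) \<le> c * (\<Sum>r\<in>UNIV. (e r w)\<^sup>2)"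
      using c_pos d by (intro mult_left_mono) (auto simp: field_simps)
    also have "\<dots> \<le> - form2 ?\<Lambda> (?e w) (?e w)"
      using elim(7)[rule_format, of "?e w"] by simp
    finally have q: "form2 ?\<Lambda> (?e w) (?e w) / 2 \<le> - 2 * \<kappa> * (E w)\<^sup>2"
      using d by (simp add: \<kappa>_def field_simps)
    have x1: "(\<delta> w)\<^sup>2 * ?X1 w \<le> (\<delta> w)\<^sup>2 * (C1 * E w)"
      using elim(9) E0 by (intro mult_left_mono) auto
    have "\<delta> w * ?X2 w \<le> \<delta> w * (C2 * (E w * E w))"
      using elim(10,11) E0 by (intro mult_left_mono) auto
    also have "\<dots> = (\<delta> w * C2) * (E w)\<^sup>2" by (simp add: power2_eq_square)
    also have "\<dots> \<le> \<kappa> * (E w)\<^sup>2"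
      using elim(1) C2(1) by (intro mult_right_mono) (auto simp: field_simps)
    finally have x2: "\<delta> w * ?X2 w \<le> \<kappa> * (E w)\<^sup>2" .
    have "0 \<le> (2 * \<kappa> * E w - C1 * (\<delta> w)\<^sup>2)\<^sup>2" by simp
    then have "C1 * (\<delta> w)\<^sup>2 * E w - \<kappa> * (E w)\<^sup>2 \<le> (C1\<^sup>2 / (4 * \<kappa>)) * \<delta> w ^ 4"
      using \<kappa> by (simp add: field_simps power2_eq_square power4_eq_xxxx)
    with * q x1 x2 show ?case by (simp add: mult_ac)
  qed
  then show ?thesis by blast
qed

text \<open>
  In the application, \<open>V\<close> is the exact value at the maximizer \<open>ub\<close> and \<open>V'\<close> the exact value at the trial point.  Maximality bounds
  \<open>V\<close> from below by \<open>V'\<close>; \<open>value_le\<close> bounds it from above.  The maximizer enters only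
  through its boundedness.
\<close>
theorem maximum_expansion:
  assumes ub: "\<And>r. bnd (ub r)" and off: "\<forall>\<^sub>F w in F. \<forall>r. r \<notin> S \<longrightarrow> ub r w = 0"
    and V: "(\<lambda>w. V w - f (\<lambda>r. ub r w) w) \<in> O[F](\<lambda>w. \<delta> w ^ 3)"
    and V': "(\<lambda>w. V' w - f (\<lambda>r. ut r w) w) \<in> O[F](\<lambda>w. \<delta> w ^ 3)"
    and le: "\<forall>\<^sub>F w in F. V' w \<le> V w"
  shows "(\<lambda>w. 2 * V w - P w) \<in> O[F](\<lambda>w. \<delta> w ^ 3)"
proof -
  obtain C0 where C0: "\<forall>\<^sub>F w in F. f (\<lambda>r. ub r w) w \<le> f (\<lambda>r. ut r w) w + C0 * \<delta> w ^ 4"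
    using value_le[OF ub off] by blast
  obtain C1 where C1: "C1 > 0" "\<forall>\<^sub>F w in F. norm (V w - f (\<lambda>r. ub r w) w) \<le> C1 * norm (\<delta> w ^ 3)"
    using V by (rule landau_o.bigE)
  obtain C2 where C2: "C2 > 0" "\<forall>\<^sub>F w in F. norm (V' w - f (\<lambda>r. ut r w) w) \<le> C2 * norm (\<delta> w ^ 3)"
    using V' by (rule landau_o.bigE)
  have "\<forall>\<^sub>F w in F. norm (V w - f (\<lambda>r. ut r w) w) \<le> (C1 + C2 + \<bar>C0\<bar>) * norm (\<delta> w ^ 3)"
    using C0 C1(2) C2(2) le \<delta>_pos \<delta>_less[OF zero_less_one]
  proof eventually_elim
    case (elim w)
    have "C0 * \<delta> w ^ 4 \<le> \<bar>C0\<bar> * \<delta> w ^ 4" using elim by (intro mult_right_mono) auto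
    also have "\<dots> \<le> \<bar>C0\<bar> * \<delta> w ^ 3" using elim by (intro mult_left_mono power_decreasing) auto
    finally have "C0 * \<delta> w ^ 4 \<le> \<bar>C0\<bar> * \<delta> w ^ 3" .
    moreover have "0 \<le> C1 * \<delta> w ^ 3" "0 \<le> C2 * \<delta> w ^ 3" "0 \<le> \<bar>C0\<bar> * \<delta> w ^ 3"
      using elim C1(1) C2(1) by auto
    moreover have "norm (\<delta> w ^ 3) = \<delta> w ^ 3" using elim by simp
    ultimately show ?case using elim(1-4) unfolding real_norm_def abs_le_iff distrib_right by linarith
  qed
  then have "(\<lambda>w. V w - f (\<lambda>r. ut r w) w) \<in> O[F](\<lambda>w. \<delta> w ^ 3)" by (rule landau_o.bigI[rotated]) (use C1 C2 in auto)
  then have "(\<lambda>w. (V w - f (\<lambda>r. ut r w) w) * 2 + (2 * f (\<lambda>r. ut r w) w - P w)) \<in> O[F](\<lambda>w. \<delta> w ^ 3)"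
    by (rule sum_in_bigo(1)[OF big_cmult value_at_ut])
  then show ?thesis by (simp add: algebra_simps)
qed

end

section \<open>Iterated directional derivatives and the Taylor formula\<close>

lemma pds_Nil [simp]: "pds [] f = f" and pds_Cons [simp]: "pds (v # vs) f = pd v (pds vs f)"
  by (simp_all add: pds_def)

lemma pd_eqI: "((\<lambda>t. f (x + t *\<^sub>R v)) has_real_derivative d) (at 0) \<Longrightarrow> pd v f x = d"
  unfolding pd_def by (rule DERIV_imp_deriv)

lemma pd_cong_ev:
  assumes "\<forall>\<^sub>F z in nhds x. f z = g z"
  shows "pd v f x = pd v g x"
  unfolding pd_def
proof (rule deriv_cong_ev)
  have "((\<lambda>t. x + t *\<^sub>R v) \<longlongrightarrow> x + 0 *\<^sub>R v) (nhds 0)" by (intro tendsto_intros filterlim_ident)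
  then have "filterlim (\<lambda>t. x + t *\<^sub>R v) (nhds x) (nhds 0)" by simp
  from eventually_compose_filterlim[OF assms this]
  show "\<forall>\<^sub>F t in nhds 0. f (x + t *\<^sub>R v) = g (x + t *\<^sub>R v)" .
qed simp

lemma pd_cong_open: "open S \<Longrightarrow> x \<in> S \<Longrightarrow> (\<And>z. z \<in> S \<Longrightarrow> f z = g z) \<Longrightarrow> pd v f x = pd v g x"
  by (rule pd_cong_ev) (auto simp: eventually_nhds)

lemma has_derivative_pd:
  assumes "open S" "g differentiable_on S" "x \<in> S"
  obtains g' where "(g has_derivative g') (at x)" "\<And>v. pd v g x = g' v"
proof -
  obtain g' where g': "(g has_derivative g') (at x)"
    using assms by (metis at_within_open differentiable_def differentiable_on_def)
  have "pd v g x = g' v" for v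
  proof (rule pd_eqI)
    have "((\<lambda>t. x + t *\<^sub>R v) has_derivative (\<lambda>t. t *\<^sub>R v)) (at 0)"
      by (auto intro!: derivative_eq_intros)
    moreover have "(g has_derivative g') (at (x + 0 *\<^sub>R v))" using g' by simp
    ultimately have "((\<lambda>t. g (x + t *\<^sub>R v)) has_derivative (\<lambda>t. g' (t *\<^sub>R v))) (at 0)"
      by (rule has_derivative_compose)
    moreover have "(\<lambda>t. g' (t *\<^sub>R v)) = (*) (g' v)"
      using has_derivative_bounded_linear[OF g'] by (auto simp: linear_simps)
    ultimately show "((\<lambda>t. g (x + t *\<^sub>R v)) has_real_derivative g' v) (at 0)"
      unfolding has_field_derivative_def by simp
  qed
  with g' that show thesis by blast
qed

lemma DERIV_along_line:
  fixes e :: "'i::finite \<Rightarrow> 'v::real_normed_vector"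
  assumes "open S" "g differentiable_on S" "x + t *\<^sub>R (\<Sum>i\<in>UNIV. u i *\<^sub>R e i) \<in> S"
  shows "((\<lambda>t. g (x + t *\<^sub>R (\<Sum>i\<in>UNIV. u i *\<^sub>R e i))) has_real_derivative
     (\<Sum>i\<in>UNIV. u i * pd (e i) g (x + t *\<^sub>R (\<Sum>i\<in>UNIV. u i *\<^sub>R e i)))) (at t)"
proof -
  let ?v = "\<Sum>i\<in>UNIV. u i *\<^sub>R e i"
  obtain g' where g': "(g has_derivative g') (at (x + t *\<^sub>R ?v))" "\<And>v. pd v g (x + t *\<^sub>R ?v) = g' v"
    using has_derivative_pd[OF assms] by metis
  interpret bounded_linear g' by (rule has_derivative_bounded_linear[OF g'(1)])
  have "((\<lambda>t. x + t *\<^sub>R ?v) has_derivative (\<lambda>t. t *\<^sub>R ?v)) (at t)"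
    by (auto intro!: derivative_eq_intros)
  then have "((\<lambda>t. g (x + t *\<^sub>R ?v)) has_derivative (\<lambda>t. g' (t *\<^sub>R ?v))) (at t)"
    using g'(1) by (rule has_derivative_compose[where f = "\<lambda>t. x + t *\<^sub>R ?v" and g = g])
  moreover have "(\<lambda>t. g' (t *\<^sub>R ?v)) = (*) (\<Sum>i\<in>UNIV. u i * pd (e i) g (x + t *\<^sub>R ?v))"
    by (rule ext) (simp add: g'(2) scaleR sum)
  ultimately show ?thesis unfolding has_field_derivative_def by simp
qed

lemma DERIV_along_vector:
  assumes "open S" "g differentiable_on S" "x + t *\<^sub>R v \<in> S"
  shows "((\<lambda>t. g (x + t *\<^sub>R v)) has_real_derivative pd v g (x + t *\<^sub>R v)) (at t)"
  using DERIV_along_line[of S g x t "\<lambda>_::unit. 1" "\<lambda>_. v"] assms by (simp add: UNIV_unit)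

text \<open>
  The mean value theorem, first along \<open>u\<close> and then along \<open>v\<close>.
\<close>
lemma second_difference:
  fixes f :: "'v::real_normed_vector \<Rightarrow> real"
  assumes S: "open S" and f: "f differentiable_on S" and uf: "pd u f differentiable_on S" and s: "s > 0"
    and mem: "\<And>\<alpha> \<beta>. 0 \<le> \<alpha> \<Longrightarrow> \<alpha> \<le> s \<Longrightarrow> 0 \<le> \<beta> \<Longrightarrow> \<beta> \<le> s \<Longrightarrow> x + \<alpha> *\<^sub>R u + \<beta> *\<^sub>R v \<in> S"
  obtains \<alpha> \<beta> where "0 \<le> \<alpha>" "\<alpha> \<le> s" "0 \<le> \<beta>" "\<beta> \<le> s"
    "f (x + s *\<^sub>R u + s *\<^sub>R v) - f (x + s *\<^sub>R u) - f (x + s *\<^sub>R v) + f x = s * s * pd v (pd u f) (x + \<alpha> *\<^sub>R u + \<beta> *\<^sub>R v)"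
proof -
  have d1: "((\<lambda>\<alpha>. f ((x + s *\<^sub>R v) + \<alpha> *\<^sub>R u) - f (x + \<alpha> *\<^sub>R u)) has_real_derivative
      pd u f ((x + s *\<^sub>R v) + \<alpha> *\<^sub>R u) - pd u f (x + \<alpha> *\<^sub>R u)) (at \<alpha>)" if "0 \<le> \<alpha>" "\<alpha> \<le> s" for \<alpha>
    using mem[of \<alpha> s] mem[of \<alpha> 0] that s
    by (intro DERIV_diff DERIV_along_vector[OF S f]) (auto simp: algebra_simps)
  obtain \<alpha> where a: "0 < \<alpha>" "\<alpha> < s"
    "(f ((x + s *\<^sub>R v) + s *\<^sub>R u) - f (x + s *\<^sub>R u)) - (f ((x + s *\<^sub>R v) + 0 *\<^sub>R u) - f (x + 0 *\<^sub>R u))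
       = (s - 0) * (pd u f ((x + s *\<^sub>R v) + \<alpha> *\<^sub>R u) - pd u f (x + \<alpha> *\<^sub>R u))"
    using MVT2[OF s d1] by blast
  have d2: "((\<lambda>\<beta>. pd u f ((x + \<alpha> *\<^sub>R u) + \<beta> *\<^sub>R v)) has_real_derivative pd v (pd u f) ((x + \<alpha> *\<^sub>R u) + \<beta> *\<^sub>R v)) (at \<beta>)"
    if "0 \<le> \<beta>" "\<beta> \<le> s" for \<beta>
    using mem[of \<alpha> \<beta>] that a by (intro DERIV_along_vector[OF S uf]) auto
  obtain \<beta> where b: "0 < \<beta>" "\<beta> < s"
    "pd u f ((x + \<alpha> *\<^sub>R u) + s *\<^sub>R v) - pd u f ((x + \<alpha> *\<^sub>R u) + 0 *\<^sub>R v) = (s - 0) * pd v (pd u f) ((x + \<alpha> *\<^sub>R u) + \<beta> *\<^sub>R v)"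
    using MVT2[OF s d2] by blast
  show thesis
    by (rule that[of \<alpha> \<beta>]) (use a b in \<open>auto simp: algebra_simps\<close>)
qed

text \<open>
  The second difference is symmetric in the two directions, so that the two mixed derivatives agree at points arbitrarily
  close to \<open>x\<close>; continuity carries the equality to \<open>x\<close>.
\<close>
theorem pd_commute:
  fixes f :: "'v::real_normed_vector \<Rightarrow> real"
  assumes S: "open S" "x \<in> S" and f: "f differentiable_on S" and uf: "pd u f differentiable_on S" "pd v f differentiable_on S"
    and c: "continuous_on S (pd v (pd u f))" "continuous_on S (pd u (pd v f))"
  shows "pd v (pd u f) x = pd u (pd v f) x"
proof (rule ccontr)
  assume "pd v (pd u f) x \<noteq> pd u (pd v f) x"
  define e where "e = \<bar>pd v (pd u f) x - pd u (pd v f) x\<bar> / 2"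
  have e: "e > 0" using \<open>_ \<noteq> _\<close> by (simp add: e_def)
  have "\<forall>\<^sub>F z in nhds x. z \<in> S \<and> dist (pd v (pd u f) z) (pd v (pd u f) x) < e \<and> dist (pd u (pd v f) z) (pd u (pd v f) x) < e"
  proof (intro eventually_conj)
    show "\<forall>\<^sub>F z in nhds x. z \<in> S" using S by (rule eventually_nhds_in_open)
    have "isCont (pd v (pd u f)) x" "isCont (pd u (pd v f)) x"
      using c S by (auto simp: continuous_on_eq_continuous_at)
    then show "\<forall>\<^sub>F z in nhds x. dist (pd v (pd u f) z) (pd v (pd u f) x) < e"
        "\<forall>\<^sub>F z in nhds x. dist (pd u (pd v f) z) (pd u (pd v f) x) < e"
      by (auto simp: isCont_def tendsto_at_iff_tendsto_nhds dest: tendstoD[OF _ e])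
  qed
  then obtain r where r: "r > 0" and near: "\<And>z. dist z x < r \<Longrightarrow> z \<in> S \<and> dist (pd v (pd u f) z) (pd v (pd u f) x) < e \<and> dist (pd u (pd v f) z) (pd u (pd v f) x) < e"
    unfolding eventually_nhds_metric by blast
  define s where "s = r / (2 * (norm u + norm v + 1))"
  have n: "norm u + norm v + 1 > 0" by (simp add: add_nonneg_pos)
  have s: "s > 0" using r n by (simp add: s_def)
  have close: "dist (x + \<alpha> *\<^sub>R u + \<beta> *\<^sub>R v) x < r" if "0 \<le> \<alpha>" "\<alpha> \<le> s" "0 \<le> \<beta>" "\<beta> \<le> s" for \<alpha> \<beta>
  proof -
    have "dist (x + \<alpha> *\<^sub>R u + \<beta> *\<^sub>R v) x = norm (\<alpha> *\<^sub>R u + \<beta> *\<^sub>R v)" by (simp add: dist_norm add.assoc)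
    also have "\<dots> \<le> \<alpha> * norm u + \<beta> * norm v" using that by (metis abs_of_nonneg norm_scaleR norm_triangle_ineq)
    also have "\<dots> \<le> s * norm u + s * norm v" using that by (intro add_mono mult_right_mono) auto
    also have "\<dots> \<le> s * (norm u + norm v + 1)" using s by (simp add: algebra_simps)
    also have "\<dots> = r / 2" unfolding s_def using n by (metis (no_types) less_irrefl mult.commute nonzero_mult_div_cancel_right mult_divide_mult_cancel_right times_divide_eq_left)
    also have "\<dots> < r" using r by simp
    finally show ?thesis .
  qed
  obtain \<alpha> \<beta> where 1: "0 \<le> \<alpha>" "\<alpha> \<le> s" "0 \<le> \<beta>" "\<beta> \<le> s"
    "f (x + s *\<^sub>R u + s *\<^sub>R v) - f (x + s *\<^sub>R u) - f (x + s *\<^sub>R v) + f x = s * s * pd v (pd u f) (x + \<alpha> *\<^sub>R u + \<beta> *\<^sub>R v)"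
    using second_difference[OF S(1) f uf(1) s] near close by metis
  have close': "dist (x + \<alpha> *\<^sub>R v + \<beta> *\<^sub>R u) x < r" if "0 \<le> \<alpha>" "\<alpha> \<le> s" "0 \<le> \<beta>" "\<beta> \<le> s" for \<alpha> \<beta>
    using close[of \<beta> \<alpha>] that by (simp add: algebra_simps)
  obtain \<alpha>' \<beta>' where 2: "0 \<le> \<alpha>'" "\<alpha>' \<le> s" "0 \<le> \<beta>'" "\<beta>' \<le> s"
    "f (x + s *\<^sub>R v + s *\<^sub>R u) - f (x + s *\<^sub>R v) - f (x + s *\<^sub>R u) + f x = s * s * pd u (pd v f) (x + \<alpha>' *\<^sub>R v + \<beta>' *\<^sub>R u)"
    using second_difference[OF S(1) f uf(2) s] near close' by metis
  have "s * s * pd v (pd u f) (x + \<alpha> *\<^sub>R u + \<beta> *\<^sub>R v) = s * s * pd u (pd v f) (x + \<alpha>' *\<^sub>R v + \<beta>' *\<^sub>R u)"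
    unfolding 1(5)[symmetric] 2(5)[symmetric] by (simp add: algebra_simps)
  then have eq: "pd v (pd u f) (x + \<alpha> *\<^sub>R u + \<beta> *\<^sub>R v) = pd u (pd v f) (x + \<alpha>' *\<^sub>R v + \<beta>' *\<^sub>R u)"
    using s by simp
  have "dist (pd v (pd u f) (x + \<alpha> *\<^sub>R u + \<beta> *\<^sub>R v)) (pd v (pd u f) x) < e"
    using near[OF close[OF 1(1-4)]] by blast
  moreover have "dist (pd u (pd v f) (x + \<alpha>' *\<^sub>R v + \<beta>' *\<^sub>R u)) (pd u (pd v f) x) < e"
    using near[OF close'[OF 2(1-4)]] by blast
  ultimately show False unfolding eq e_def dist_real_def by (auto simp: abs_real_def split: if_splits)
qed

lemma C_k_onD:
  assumes "C_k_on k S f" "set vs \<subseteq> Basis"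
  shows "length vs < k \<Longrightarrow> pds vs f differentiable_on S" "length vs \<le> k \<Longrightarrow> continuous_on S (pds vs f)"
  using assms unfolding C_k_on_def by auto

lemma pds_swap:
  assumes "open S" "x \<in> S" "C_k_on k S f" "u \<in> Basis" "v \<in> Basis" "set vs \<subseteq> Basis" "length vs + 2 \<le> k"
  shows "pds (u # v # vs) f x = pds (v # u # vs) f x"
  using C_k_onD(1)[OF assms(3), of vs] C_k_onD(1)[OF assms(3), of "u # vs"] C_k_onD(1)[OF assms(3), of "v # vs"]
    C_k_onD(2)[OF assms(3), of "u # v # vs"] C_k_onD(2)[OF assms(3), of "v # u # vs"] assms
  by (auto intro!: pd_commute[of S])

text \<open>
  The \<open>k\<close>-th derivative at 0 of \<open>t \<mapsto> f (x + t \<Sum>i. u i e i)\<close>.  Indexing by lists gives the iterated derivatives in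
  the form in which the assumptions on the log-likelihood refer to them.
\<close>
definition taylor_term :: "('i::finite \<Rightarrow> 'v::real_normed_vector) \<Rightarrow> ('v \<Rightarrow> real) \<Rightarrow> ('i \<Rightarrow> real) \<Rightarrow> nat \<Rightarrow> 'v \<Rightarrow> real" where
  "taylor_term e f u k x = (\<Sum>is | length is = k. (\<Prod>i\<leftarrow>is. u i) * pds (map e is) f x)"

lemma finite_length_eq: "finite {is :: 'i::finite list. length is = k}"
  using finite_lists_length_eq[of "UNIV :: 'i set" k] by simp

lemma sum_lists_Suc:
  "(\<Sum>is | length is = Suc k. F is) = (\<Sum>i\<in>(UNIV :: 'i::finite set). \<Sum>is | length is = k. (F (i # is) :: 'c::comm_monoid_add))"
proof -
  have "(\<Sum>i\<in>(UNIV :: 'i set). \<Sum>is | length is = k. F (i # is)) = (\<Sum>p\<in>UNIV \<times> {is. length is = k}. F (fst p # snd p))"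
    by (simp add: sum.cartesian_product case_prod_beta)
  also have "\<dots> = (\<Sum>is | length is = Suc k. F is)"
    by (rule sum.reindex_bij_betw[where h = "\<lambda>p. fst p # snd p"])
       (auto intro!: bij_betwI[where g = "\<lambda>l. (hd l, tl l)"] simp: length_Suc_conv)
  finally show ?thesis ..
qed

lemma DERIV_taylor_term:
  fixes e :: "'i::finite \<Rightarrow> 'v::euclidean_space"
  assumes "open S" "C_k_on m S f" "range e \<subseteq> Basis" "k < m" "x + t *\<^sub>R (\<Sum>i\<in>UNIV. u i *\<^sub>R e i) \<in> S"
  shows "((\<lambda>t. taylor_term e f u k (x + t *\<^sub>R (\<Sum>i\<in>UNIV. u i *\<^sub>R e i))) has_real_derivative
     taylor_term e f u (Suc k) (x + t *\<^sub>R (\<Sum>i\<in>UNIV. u i *\<^sub>R e i))) (at t)"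
proof -
  let ?v = "\<Sum>i\<in>UNIV. u i *\<^sub>R e i"
  have "((\<lambda>t. taylor_term e f u k (x + t *\<^sub>R ?v)) has_real_derivative
     (\<Sum>is | length is = k. (\<Prod>i\<leftarrow>is. u i) * (\<Sum>i\<in>UNIV. u i * pd (e i) (pds (map e is) f) (x + t *\<^sub>R ?v)))) (at t)"
    unfolding taylor_term_def
  proof (intro DERIV_sum DERIV_cmult DERIV_along_line[OF assms(1) _ assms(5)])
    fix "is" :: "'i list" assume "is \<in> {is. length is = k}"
    then show "pds (map e is) f differentiable_on S"
      using assms(3,4) by (intro C_k_onD(1)[OF assms(2)]) auto
  qed
  also have "(\<Sum>is | length is = k. (\<Prod>i\<leftarrow>is. u i) * (\<Sum>i\<in>UNIV. u i * pd (e i) (pds (map e is) f) (x + t *\<^sub>R ?v)))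
     = taylor_term e f u (Suc k) (x + t *\<^sub>R ?v)"
    unfolding taylor_term_def sum_lists_Suc by (subst sum.swap) (simp add: sum_distrib_left mult_ac)
  finally show ?thesis .
qed

theorem taylor_expansion:
  fixes e :: "'i::finite \<Rightarrow> 'v::euclidean_space"
  assumes "open S" "C_k_on m S f" "range e \<subseteq> Basis" "0 < m"
    and seg: "\<And>t. 0 \<le> t \<Longrightarrow> t \<le> 1 \<Longrightarrow> x + t *\<^sub>R (\<Sum>i\<in>UNIV. u i *\<^sub>R e i) \<in> S"
  obtains t where "0 < t" "t < 1"
    "f (x + (\<Sum>i\<in>UNIV. u i *\<^sub>R e i)) = (\<Sum>k<m. taylor_term e f u k x / fact k)
       + taylor_term e f u m (x + t *\<^sub>R (\<Sum>i\<in>UNIV. u i *\<^sub>R e i)) / fact m"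
proof -
  let ?v = "\<Sum>i\<in>UNIV. u i *\<^sub>R e i"
  have "\<exists>t::real>0. t < 1 \<and> taylor_term e f u 0 (x + 1 *\<^sub>R ?v) = (\<Sum>k<m. taylor_term e f u k (x + 0 *\<^sub>R ?v) / fact k * 1 ^ k)
     + taylor_term e f u m (x + t *\<^sub>R ?v) / fact m * 1 ^ m"
    using assms by (intro Maclaurin[where diff = "\<lambda>k t. taylor_term e f u k (x + t *\<^sub>R ?v)"])
      (auto intro!: DERIV_taylor_term[of S])
  then show thesis using that by (auto simp: taylor_term_def)
qed

lemma taylor_term_forms:
  "taylor_term e f u 0 x = f x"
  "taylor_term e f u (Suc 0) x = form1 (\<lambda>r. pds [e r] f x) u"
  "taylor_term e f u 2 x = form2 (\<lambda>r s. pds [e r, e s] f x) u u"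
  "taylor_term e f u 3 x = form3 (\<lambda>r s t. pds [e r, e s, e t] f x) u u u"
  "taylor_term e f u 4 x = form4 (\<lambda>r s t z. pds [e r, e s, e t, e z] f x) u u u u"
proof -
  have n: "2 = Suc (Suc 0)" "3 = Suc (Suc (Suc 0))" "4 = Suc (Suc (Suc (Suc 0)))" by simp_all
  note defs = taylor_term_def form1_def form2_def form3_def form4_def
  show "taylor_term e f u 0 x = f x" "taylor_term e f u (Suc 0) x = form1 (\<lambda>r. pds [e r] f x) u"
    unfolding defs sum_lists_Suc by (simp_all add: mult_ac)
  show "taylor_term e f u 2 x = form2 (\<lambda>r s. pds [e r, e s] f x) u u"
    "taylor_term e f u 3 x = form3 (\<lambda>r s t. pds [e r, e s, e t] f x) u u u"
    "taylor_term e f u 4 x = form4 (\<lambda>r s t z. pds [e r, e s, e t, e z] f x) u u u u"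
    unfolding defs n sum_lists_Suc by (simp_all add: mult_ac)
qed

lemma taylor_term_le:
  fixes e :: "'i::finite \<Rightarrow> 'v::real_normed_vector"
  assumes "\<And>is. length is = k \<Longrightarrow> \<bar>pds (map e is) f x\<bar> \<le> K" "\<And>i. \<bar>u i\<bar> \<le> U"
  shows "\<bar>taylor_term e f u k x\<bar> \<le> real (card {is :: 'i list. length is = k}) * (U ^ k * K)"
proof -
  have "U \<ge> 0" using assms(2) abs_ge_zero order_trans by blast
  have p: "\<bar>\<Prod>i\<leftarrow>is. u i\<bar> \<le> U ^ length is" for "is"
    by (induction "is") (use assms(2) \<open>U \<ge> 0\<close> in \<open>auto simp: abs_mult intro!: mult_mono\<close>)
  have "\<bar>taylor_term e f u k x\<bar> \<le> (\<Sum>is :: 'i list | length is = k. U ^ k * K)"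
  proof -
    have "\<bar>taylor_term e f u k x\<bar> \<le> (\<Sum>is | length is = k. \<bar>(\<Prod>i\<leftarrow>is. u i) * pds (map e is) f x\<bar>)"
      unfolding taylor_term_def by (rule sum_abs)
    also have "\<dots> \<le> (\<Sum>is :: 'i list | length is = k. U ^ k * K)"
    proof (rule sum_mono)
      fix "is" :: "'i list" assume "is \<in> {is. length is = k}"
      then show "\<bar>(\<Prod>i\<leftarrow>is. u i) * pds (map e is) f x\<bar> \<le> U ^ k * K"
        using p[of "is"] assms(1)[of "is"] \<open>U \<ge> 0\<close> by (auto simp: abs_mult intro!: mult_mono)
    qed
    finally show ?thesis .
  qed
  then show ?thesis by simp
qed

text \<open>
  A directional derivative is the pointwise limit of measurable difference quotients.
\<close>
lemma borel_measurable_pd: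
  fixes f :: "'y \<Rightarrow> 'v::real_normed_vector \<Rightarrow> real"
  assumes S: "open S" "x \<in> S" and meas: "\<And>x. x \<in> S \<Longrightarrow> (\<lambda>y. f y x) \<in> borel_measurable M"
    and diff: "\<And>y. y \<in> space M \<Longrightarrow> f y differentiable_on S"
  shows "(\<lambda>y. pd v (f y) x) \<in> borel_measurable M"
proof -
  define h where "h k = 1 / real (Suc k)" for k
  have h: "h \<longlonglongrightarrow> 0" unfolding h_def using LIMSEQ_inverse_real_of_nat by (simp add: divide_inverse)
  define F where "F k y = (if x + h k *\<^sub>R v \<in> S then (f y (x + h k *\<^sub>R v) - f y x) / h k else 0)" for k y
  have "(\<lambda>k. x + h k *\<^sub>R v) \<longlonglongrightarrow> x + 0 *\<^sub>R v" by (intro tendsto_intros h)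
  then have ev: "\<forall>\<^sub>F k in sequentially. x + h k *\<^sub>R v \<in> S"
    using S by (auto dest: topological_tendstoD)
  show ?thesis
  proof (rule borel_measurable_LIMSEQ_real)
    fix y assume y: "y \<in> space M"
    have "((\<lambda>t. f y (x + t *\<^sub>R v)) has_real_derivative pd v (f y) (x + 0 *\<^sub>R v)) (at 0)"
      using S diff[OF y] by (intro DERIV_along_vector[of S]) auto
    then have "((\<lambda>t. (f y (x + t *\<^sub>R v) - f y x) / t) \<longlongrightarrow> pd v (f y) x) (at 0)"
      by (simp add: DERIV_def)
    moreover have "filterlim h (at 0) sequentially"
      using h by (auto simp: filterlim_at h_def)
    ultimately have "(\<lambda>k. (f y (x + h k *\<^sub>R v) - f y x) / h k) \<longlonglongrightarrow> pd v (f y) x"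
      by (rule filterlim_compose)
    then show "(\<lambda>k. F k y) \<longlonglongrightarrow> pd v (f y) x"
      by (rule Lim_transform_eventually) (use ev in \<open>eventually_elim, simp add: F_def\<close>)
  next
    fix k show "F k \<in> borel_measurable M"
      unfolding F_def using meas S(2) by (cases "x + h k *\<^sub>R v \<in> S") auto
  qed
qed

lemma borel_measurable_pds:
  fixes f :: "'y \<Rightarrow> 'v::euclidean_space \<Rightarrow> real"
  assumes S: "open S" "x \<in> S" and meas: "\<And>x. x \<in> S \<Longrightarrow> (\<lambda>y. f y x) \<in> borel_measurable M"
    and diff: "\<And>y. y \<in> space M \<Longrightarrow> C_k_on k S (f y)" and vs: "set vs \<subseteq> Basis" "length vs \<le> k"
  shows "(\<lambda>y. pds vs (f y) x) \<in> borel_measurable M"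
  using vs S(2)
proof (induction vs arbitrary: x)
  case Nil then show ?case using meas by simp
next
  case (Cons v vs)
  have "(\<lambda>y. pd v (pds vs (f y)) x) \<in> borel_measurable M"
    by (rule borel_measurable_pd[OF S(1) Cons.prems(3)]) (use Cons in \<open>auto intro!: C_k_onD(1)[OF diff]\<close>)
  then show ?case by simp
qed

section \<open>Joint cumulants of centred variables\<close>

text \<open>
  For centred variables the blocks with one element drop out of a joint cumulant.  Up to order
  four, what remains is the trivial partition and, for four variables, the three pairings.
\<close>
lemma partition_no_singletons:
  assumes fin: "finite A" and p: "partition_on A \<pi>" and ns: "\<And>B. B \<in> \<pi> \<Longrightarrow> card B \<noteq> 1"
  shows "2 * card \<pi> \<le> card A"
proof -
  have f: "finite B" if "B \<in> \<pi>" for B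
    using that p fin by (auto simp: partition_on_def intro: finite_subset)
  have "card B \<ge> 2" if "B \<in> \<pi>" for B
  proof -
    have "card B \<noteq> 0" using that p f by (auto simp: partition_on_def)
    with ns[OF that] show ?thesis by linarith
  qed
  then have "(\<Sum>B\<in>\<pi>. 2) \<le> (\<Sum>B\<in>\<pi>. card B)" by (rule sum_mono)
  also have "\<dots> = card A" using product_partition[OF p f] by simp
  finally show ?thesis by simp
qed

lemma partition_single:
  assumes "partition_on A \<pi>" "card \<pi> = 1"
  shows "\<pi> = {A}"
proof -
  obtain B where B: "\<pi> = {B}" using assms(2) by (auto simp: card_1_singleton_iff)
  then have "A = B" using assms(1) by (simp add: partition_on_def)
  then show ?thesis using B by simp
qed

lemma partitions_4:
  "{\<pi>. partition_on {..<4::nat} \<pi> \<and> (\<forall>B\<in>\<pi>. card B \<noteq> 1)} = {{{..<4}}, {{0,1},{2,3}}, {{0,2},{1,3}}, {{0,3},{1,2}}}"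
proof (intro equalityI subsetI)
  fix \<pi> assume "\<pi> \<in> {\<pi>. partition_on {..<4::nat} \<pi> \<and> (\<forall>B\<in>\<pi>. card B \<noteq> 1)}"
  then have p: "partition_on {..<4::nat} \<pi>" and ns: "\<And>B. B \<in> \<pi> \<Longrightarrow> card B \<noteq> 1" by auto
  have fin: "finite \<pi>" using finite_elements[OF _ p] by simp
  have ne: "(0::nat) \<in> \<Union>\<pi>" using p by (simp add: partition_on_def)
  then have "card \<pi> \<noteq> 0" using fin by auto
  moreover have "card \<pi> \<le> 2" using partition_no_singletons[OF _ p ns] by simp
  ultimately consider "card \<pi> = 1" | "card \<pi> = 2" by linarith
  then show "\<pi> \<in> {{{..<4}}, {{0,1},{2,3}}, {{0,2},{1,3}}, {{0,3},{1,2}}}"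
  proof cases
    case 1 then show ?thesis using partition_single[OF p] by simp
  next
    case 2
    obtain B where B: "B \<in> \<pi>" "0 \<in> B" using ne by blast
    obtain C where C: "\<pi> = {B, C}" "B \<noteq> C"
      using 2 B(1) by (metis card_2_iff doubleton_eq_iff insertE singletonD)
    have dj: "B \<inter> C = {}" using p C by (auto simp: partition_on_def disjoint_def)
    have un: "B \<union> C = {..<4}" using p C by (auto simp: partition_on_def)
    have fB: "finite B" "finite C" using un by (metis finite_Un finite_lessThan)+
    have c4: "card B + card C = 4" using card_Un_disjoint[OF fB dj] un by simp
    have "card B \<noteq> 0" "card C \<noteq> 0" using p C fB by (auto simp: partition_on_def)
    moreover have "card B \<noteq> 1" "card C \<noteq> 1" using ns C by auto
    ultimately have "card B = 2" using c4 by linarith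
    then obtain j where j: "B = {0, j}" "j \<noteq> 0" using B(2) by (auto simp: card_2_iff)
    have "j \<in> B \<union> C" using j(1) by simp
    then have "j < 4" unfolding un by simp
    have n4: "{..<4::nat} = {0,1,2,3}" by auto
    have "C = (B \<union> C) - B" using dj by blast
    then have "C = {..<4} - B" unfolding un .
    then have C4: "C = {0,1,2,3} - {0, j}" unfolding n4 j(1) .
    consider "j = 1" | "j = 2" | "j = 3" using j(2) \<open>j < 4\<close> by linarith
    then show ?thesis
    proof cases
      case 1
      then have "C = {2, 3}" using C4 by auto
      then show ?thesis using C(1) j(1) 1 by simp
    next
      case 2
      then have "C = {1, 3}" using C4 by auto
      then show ?thesis using C(1) j(1) 2 by simp
    next
      case 3
      then have "C = {1, 2}" using C4 by auto
      then show ?thesis using C(1) j(1) 3 by simp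
    qed
  qed
next
  fix \<pi> :: "nat set set" assume \<pi>: "\<pi> \<in> {{{..<4}}, {{0,1},{2,3}}, {{0,2},{1,3}}, {{0,3},{1,2}}}"
  have two: "partition_on {..<4::nat} {{0, a}, {b, c}} \<and> (\<forall>B\<in>{{0, a}, {b, c}}. card B \<noteq> 1)"
    if "{..<4::nat} = {0, a, b, c}" "distinct [0, a, b, c]" for a b c
    unfolding that(1) partition_on_def disjoint_def using that(2) by (simp add: insert_commute)
  have n4: "{..<4::nat} = {0, 1, 2, 3}" "{..<4::nat} = {0, 2, 1, 3}" "{..<4::nat} = {0, 3, 1, 2}" by auto
  have one: "partition_on {..<4::nat} {{..<4}} \<and> (\<forall>B\<in>{{..<4::nat}}. card B \<noteq> 1)"
    using partition_on_space[of "{..<4::nat}"] by (simp add: lessThan_empty_iff)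
  from \<pi> show "\<pi> \<in> {\<pi>. partition_on {..<4::nat} \<pi> \<and> (\<forall>B\<in>\<pi>. card B \<noteq> 1)}"
  proof (elim insertE emptyE)
    show "?thesis" if "\<pi> = {{..<4}}" using one unfolding that by simp
    show "?thesis" if "\<pi> = {{0,1},{2,3}}" using two[OF n4(1)] unfolding that by simp
    show "?thesis" if "\<pi> = {{0,2},{1,3}}" using two[OF n4(2)] unfolding that by simp
    show "?thesis" if "\<pi> = {{0,3},{1,2}}" using two[OF n4(3)] unfolding that by simp
  qed
qed

lemma joint_cumulant_centred:
  assumes "\<And>i. i < length Xs \<Longrightarrow> (\<integral>y. (Xs ! i) y \<partial>M) = 0"
  shows "joint_cumulant M Xs = (\<Sum>\<pi> | partition_on {..<length Xs} \<pi> \<and> (\<forall>B\<in>\<pi>. card B \<noteq> 1).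
        (-1) ^ (card \<pi> - 1) * fact (card \<pi> - 1) * (\<Prod>J\<in>\<pi>. \<integral>y. (\<Prod>i\<in>J. (Xs ! i) y) \<partial>M))"
  unfolding joint_cumulant_def
proof (rule sum.mono_neutral_right)
  show "finite {\<pi>. partition_on {..<length Xs} \<pi>}" by (rule finitely_many_partition_on) simp
  show "\<forall>\<pi>\<in>{\<pi>. partition_on {..<length Xs} \<pi>} - {\<pi>. partition_on {..<length Xs} \<pi> \<and> (\<forall>B\<in>\<pi>. card B \<noteq> 1)}.
      (- 1) ^ (card \<pi> - 1) * fact (card \<pi> - 1) * (\<Prod>J\<in>\<pi>. \<integral>y. (\<Prod>i\<in>J. (Xs ! i) y) \<partial>M) = 0"
  proof
    fix \<pi> assume "\<pi> \<in> {\<pi>. partition_on {..<length Xs} \<pi>} - {\<pi>. partition_on {..<length Xs} \<pi> \<and> (\<forall>B\<in>\<pi>. card B \<noteq> 1)}"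
    then obtain B where p: "partition_on {..<length Xs} \<pi>" and B: "B \<in> \<pi>" "card B = 1" by auto
    then obtain i where i: "B = {i}" by (auto simp: card_1_singleton_iff)
    have "i < length Xs" using p B i by (auto simp: partition_on_def)
    then have "(\<integral>y. (\<Prod>i\<in>B. (Xs ! i) y) \<partial>M) = 0" using assms i by simp
    moreover have "finite \<pi>" using finite_elements[OF _ p] by simp
    ultimately have "(\<Prod>J\<in>\<pi>. \<integral>y. (\<Prod>i\<in>J. (Xs ! i) y) \<partial>M) = 0" using B(1) by (auto simp: prod_zero_iff)
    then show "(- 1) ^ (card \<pi> - 1) * fact (card \<pi> - 1) * (\<Prod>J\<in>\<pi>. \<integral>y. (\<Prod>i\<in>J. (Xs ! i) y) \<partial>M) = 0" by simp
  qed
qed auto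

lemma partitions_small:
  assumes "0 < k" "k < 4"
  shows "{\<pi>. partition_on {..<k::nat} \<pi> \<and> (\<forall>B\<in>\<pi>. card B \<noteq> 1)} = (if k = 1 then {} else {{{..<k}}})"
proof (intro equalityI subsetI)
  fix \<pi> assume "\<pi> \<in> {\<pi>. partition_on {..<k::nat} \<pi> \<and> (\<forall>B\<in>\<pi>. card B \<noteq> 1)}"
  then have p: "partition_on {..<k} \<pi>" and ns: "\<And>B. B \<in> \<pi> \<Longrightarrow> card B \<noteq> 1" by auto
  have fin: "finite \<pi>" using finite_elements[OF _ p] by simp
  have "(0::nat) \<in> \<Union>\<pi>" using p assms by (simp add: partition_on_def)
  then have "card \<pi> \<noteq> 0" using fin by auto
  moreover have "2 * card \<pi> \<le> k" using partition_no_singletons[OF _ p ns] by simp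
  ultimately have "card \<pi> = 1" "k \<noteq> 1" using assms by linarith+
  then show "\<pi> \<in> (if k = 1 then {} else {{{..<k}}})" using partition_single[OF p] by simp
next
  fix \<pi> assume "\<pi> \<in> (if k = 1 then {} else {{{..<k}}})"
  then show "\<pi> \<in> {\<pi>. partition_on {..<k::nat} \<pi> \<and> (\<forall>B\<in>\<pi>. card B \<noteq> 1)}"
    using assms by (auto simp: partition_on_def disjoint_def split: if_splits)
qed

lemma joint_cumulant_2:
  assumes "(\<integral>y. X y \<partial>M) = 0" "(\<integral>y. Y y \<partial>M) = 0"
  shows "joint_cumulant M [X, Y] = (\<integral>y. X y * Y y \<partial>M)"
proof -
  have "joint_cumulant M [X, Y] = (\<Sum>\<pi> | partition_on {..<length [X, Y]} \<pi> \<and> (\<forall>B\<in>\<pi>. card B \<noteq> 1).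
        (-1) ^ (card \<pi> - 1) * fact (card \<pi> - 1) * (\<Prod>J\<in>\<pi>. \<integral>y. (\<Prod>i\<in>J. ([X, Y] ! i) y) \<partial>M))"
    by (rule joint_cumulant_centred) (use assms in \<open>auto simp: less_Suc_eq\<close>)
  moreover have "{..<2::nat} = {0, 1}" by auto
  ultimately show ?thesis using partitions_small[of 2] by (simp add: numeral_2_eq_2)
qed

lemma joint_cumulant_3:
  assumes "(\<integral>y. X y \<partial>M) = 0" "(\<integral>y. Y y \<partial>M) = 0" "(\<integral>y. Z y \<partial>M) = 0"
  shows "joint_cumulant M [X, Y, Z] = (\<integral>y. X y * Y y * Z y \<partial>M)"
proof -
  have "joint_cumulant M [X, Y, Z] = (\<Sum>\<pi> | partition_on {..<length [X, Y, Z]} \<pi> \<and> (\<forall>B\<in>\<pi>. card B \<noteq> 1).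
        (-1) ^ (card \<pi> - 1) * fact (card \<pi> - 1) * (\<Prod>J\<in>\<pi>. \<integral>y. (\<Prod>i\<in>J. ([X, Y, Z] ! i) y) \<partial>M))"
    by (rule joint_cumulant_centred) (use assms in \<open>auto simp: less_Suc_eq\<close>)
  moreover have n3: "{..<3::nat} = {0, 1, 2}" by auto
  moreover have len: "length [X, Y, Z] = 3" by simp
  moreover have "{\<pi>. partition_on {..<3::nat} \<pi> \<and> (\<forall>B\<in>\<pi>. card B \<noteq> 1)} = {{{..<3}}}"
    using partitions_small[of 3] by simp
  ultimately show ?thesis by (simp only:) (simp add: n3 mult.assoc)
qed

lemma joint_cumulant_4:
  assumes "(\<integral>y. X y \<partial>M) = 0" "(\<integral>y. Y y \<partial>M) = 0" "(\<integral>y. Z y \<partial>M) = 0" "(\<integral>y. U y \<partial>M) = 0"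
  shows "joint_cumulant M [X, Y, Z, U] = (\<integral>y. X y * Y y * Z y * U y \<partial>M)
     - (\<integral>y. X y * Y y \<partial>M) * (\<integral>y. Z y * U y \<partial>M) - (\<integral>y. X y * Z y \<partial>M) * (\<integral>y. Y y * U y \<partial>M)
     - (\<integral>y. X y * U y \<partial>M) * (\<integral>y. Y y * Z y \<partial>M)"
proof -
  have n4: "{..<4::nat} = {0, 1, 2, 3}" by auto
  have len: "length [X, Y, Z, U] = 4" by simp
  have "joint_cumulant M [X, Y, Z, U] = (\<Sum>\<pi> | partition_on {..<length [X, Y, Z, U]} \<pi> \<and> (\<forall>B\<in>\<pi>. card B \<noteq> 1).
        (-1) ^ (card \<pi> - 1) * fact (card \<pi> - 1) * (\<Prod>J\<in>\<pi>. \<integral>y. (\<Prod>i\<in>J. ([X, Y, Z, U] ! i) y) \<partial>M))"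
    by (rule joint_cumulant_centred) (use assms in \<open>auto simp: less_Suc_eq\<close>)
  also have "\<dots> = (\<Sum>\<pi>\<in>{{{..<4}}, {{0,1},{2,3}}, {{0,2},{1,3}}, {{0,3},{1,2}}}.
        (-1) ^ (card \<pi> - 1) * fact (card \<pi> - 1) * (\<Prod>J\<in>\<pi>. \<integral>y. (\<Prod>i\<in>J. ([X, Y, Z, U] ! i) y) \<partial>M))"
    unfolding len partitions_4 ..
  finally show ?thesis
    unfolding n4 by (simp add: doubleton_eq_iff insert_eq_iff insert_commute mult.assoc)
qed

section \<open>Chi-square probabilities and conditional probabilities\<close>

text \<open>
  For positive \<open>x\<close> and factors within 1/2 of 1 the thresholds \<open>x / (1 + a)\<close> stay in \<open>[2x/3, 2x]\<close>, away from
  the possible singularity of the density at 0.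
\<close>
lemma chi_square_Lipschitz:
  assumes "0 < k"
  shows "\<exists>C. \<forall>a b. \<bar>a\<bar> \<le> 1/2 \<longrightarrow> \<bar>b\<bar> \<le> 1/2 \<longrightarrow>
    \<bar>measure (chi_square k) {u. (1 + a) * u \<le> x} - measure (chi_square k) {u. (1 + b) * u \<le> x}\<bar> \<le> C * \<bar>a - b\<bar>"
proof -
  define p where "p = (\<lambda>x::real. if x > 0 then x powr (k / 2 - 1) * exp (- x / 2) / (2 powr (k / 2) * Gamma (k / 2)) else 0)"
  have chi: "chi_square k = density lborel (\<lambda>x. ennreal (p x))" by (simp add: chi_square_def p_def)
  have pm [measurable]: "p \<in> borel_measurable borel" unfolding p_def by measurable
  have sets [simp]: "sets (chi_square k) = sets borel" by (simp add: chi)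
  have set: "{u. (1 + a) * u \<le> x} = {..x / (1 + a)}" if "\<bar>a\<bar> \<le> 1/2" for a
    using that by (auto simp: field_simps abs_le_iff)
  show ?thesis
  proof (cases "x > 0")
    case False
    have "measure (chi_square k) {u. (1 + a) * u \<le> x} = 0" if "\<bar>a\<bar> \<le> 1/2" for a
    proof -
      have "x / (1 + a) \<le> 0" using that False by (intro divide_nonpos_pos) (auto simp: abs_le_iff)
      then have "emeasure (chi_square k) {..x / (1 + a)} = 0"
        unfolding chi by (subst emeasure_density) (auto intro!: nn_integral_zero' AE_I2 simp: p_def indicator_def)
      then show ?thesis unfolding set[OF that] measure_def by simp
    qed
    then show ?thesis by (intro exI[of _ 0]) auto
  next
    case True
    have "continuous_on {2 * x / 3..2 * x} (\<lambda>x. x powr (k / 2 - 1) * exp (- x / 2) / (2 powr (k / 2) * Gamma (k / 2)))"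
      using True assms by (intro continuous_intros) (auto simp: Gamma_eq_zero_iff elim!: nonpos_Ints_cases)
    then have "bounded ((\<lambda>x. x powr (k / 2 - 1) * exp (- x / 2) / (2 powr (k / 2) * Gamma (k / 2))) ` {2 * x / 3..2 * x})"
      by (intro compact_imp_bounded compact_continuous_image) auto
    then obtain B where B: "\<And>u. u\<in>{2 * x / 3..2 * x} \<Longrightarrow> \<bar>u powr (k / 2 - 1) * exp (- u / 2) / (2 powr (k / 2) * Gamma (k / 2))\<bar> \<le> B"
      unfolding bounded_iff real_norm_def by blast
    then have pB: "p u \<le> B" if "u \<in> {2 * x / 3..2 * x}" for u
    proof -
      have "u > 0" using that True by (auto intro: less_le_trans[rotated])
      then have "p u = u powr (k / 2 - 1) * exp (- u / 2) / (2 powr (k / 2) * Gamma (k / 2))" by (simp add: p_def)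
      also have "\<dots> \<le> B" using B[OF that] by (rule order_trans[OF abs_ge_self])
      finally show ?thesis .
    qed
    have B0: "B \<ge> 0" using order_trans[OF abs_ge_zero B[of x]] True by simp
    have *: "\<bar>measure (chi_square k) {..t} - measure (chi_square k) {..s}\<bar> \<le> B * (t - s)"
      if st: "2 * x / 3 \<le> s" "s \<le> t" "t \<le> 2 * x" for s t
    proof -
      have "emeasure (chi_square k) {s<..t} = (\<integral>\<^sup>+u. ennreal (p u) * indicator {s<..t} u \<partial>lborel)"
        unfolding chi by (subst emeasure_density) auto
      also have "\<dots> \<le> (\<integral>\<^sup>+u. ennreal B * indicator {s<..t} u \<partial>lborel)"
        using pB st by (intro nn_integral_mono) (auto simp: indicator_def intro!: ennreal_leI)
      also have "\<dots> = ennreal (B * (t - s))" using st B0 by (simp add: nn_integral_cmult_indicator ennreal_mult)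
      finally have le: "emeasure (chi_square k) {s<..t} \<le> ennreal (B * (t - s))" .
      have "{..t} = {..s} \<union> {s<..t}" using st by auto
      then have eq: "emeasure (chi_square k) {..t} = emeasure (chi_square k) {..s} + emeasure (chi_square k) {s<..t}"
        by (simp only:) (rule plus_emeasure[symmetric], auto)
      have fin: "emeasure (chi_square k) {s<..t} \<noteq> \<infinity>" using le by (metis ennreal_less_top infinity_ennreal_def leD)
      show ?thesis
      \<comment> \<open>A set of infinite measure has \<open>measure\<close> 0, so in that case both values are 0.\<close>
      proof (cases "emeasure (chi_square k) {..s} = \<infinity>")
        case True
        then have "measure (chi_square k) {..t} = 0" "measure (chi_square k) {..s} = 0"
          unfolding measure_def eq by simp_all
        then show ?thesis using B0 st by simp
      next
        case False
        then have "measure (chi_square k) {..t} = measure (chi_square k) {..s} + measure (chi_square k) {s<..t}"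
          unfolding measure_def eq using fin by (intro enn2real_plus) (auto simp: top.not_eq_extremum)
        moreover have "measure (chi_square k) {s<..t} \<le> B * (t - s)"
          unfolding measure_def using le B0 st by (intro enn2real_leI) auto
        ultimately show ?thesis by simp
      qed
    qed
    have rng: "2 * x / 3 \<le> x / (1 + a) \<and> x / (1 + a) \<le> 2 * x" if "\<bar>a\<bar> \<le> 1/2" for a
    proof -
      have a: "1 / 2 \<le> 1 + a" "1 + a \<le> 3 / 2" using that by (auto simp: abs_le_iff)
      have "x * (1 / 2) \<le> x * (1 + a)" "x * (1 + a) \<le> x * (3 / 2)"
        using a True by (auto intro!: mult_left_mono)
      then show ?thesis using a(1) by (simp add: pos_divide_le_eq pos_le_divide_eq)
    qed
    have "\<bar>measure (chi_square k) {u. (1 + a) * u \<le> x} - measure (chi_square k) {u. (1 + b) * u \<le> x}\<bar> \<le> B * (4 * x) * \<bar>a - b\<bar>"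
      if ab: "\<bar>a\<bar> \<le> 1/2" "\<bar>b\<bar> \<le> 1/2" for a b
    proof -
      have "\<bar>measure (chi_square k) {..x / (1 + a)} - measure (chi_square k) {..x / (1 + b)}\<bar> \<le> B * \<bar>x / (1 + a) - x / (1 + b)\<bar>"
        using *[of "x / (1 + a)" "x / (1 + b)"] *[of "x / (1 + b)" "x / (1 + a)"] rng[OF ab(1)] rng[OF ab(2)]
        by (cases "x / (1 + a) \<le> x / (1 + b)") (auto simp: abs_minus_commute)
      also have "x / (1 + a) - x / (1 + b) = x * (b - a) * (1 / (1 + a)) * (1 / (1 + b))"
      proof -
        have "1 + a \<noteq> 0" "1 + b \<noteq> 0" using ab by (auto simp: abs_le_iff)
        then show ?thesis by (simp add: divide_simps) (simp add: algebra_simps)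
      qed
      also have "\<bar>\<dots>\<bar> = x * \<bar>a - b\<bar> * \<bar>1 / (1 + a)\<bar> * \<bar>1 / (1 + b)\<bar>"
        using True by (simp add: abs_mult abs_minus_commute)
      also have "B * \<dots> \<le> B * (x * \<bar>a - b\<bar> * 2 * 2)"
      proof -
        have "1 / 2 \<le> 1 + a" "1 / 2 \<le> 1 + b" using ab by (auto simp: abs_le_iff)
        then have "\<bar>1 / (1 + a)\<bar> \<le> 2" "\<bar>1 / (1 + b)\<bar> \<le> 2" by (auto simp: field_simps)
        then show ?thesis using True B0 by (intro mult_left_mono mult_mono) auto
      qed
      finally show ?thesis unfolding set[OF ab(1)] set[OF ab(2)] by (simp add: mult_ac)
    qed
    then show ?thesis by blast
  qed
qed

lemma space_dist_of [simp]: "space (dist_of D n \<mu> \<theta>) = space \<mu>" and sets_dist_of [simp]: "sets (dist_of D n \<mu> \<theta>) = sets \<mu>"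
  by (simp_all add: dist_of_def)

lemma prob_space_truth: "model D n \<Longrightarrow> prob_space (truth D n)"
  by (auto simp: model_def truth_def)

text \<open>
  The disintegration in \<open>cond_dist\<close>, tested on preimages of measurable sets, is the defining property
  of the conditional probability.
\<close>
lemma cond_exp_eq_kernel:
  assumes m: "model D n" and a: "anc D n \<in> measurable (leb n) (anc_space D n)" and c: "cond_dist D n"
    and E [measurable]: "E \<in> sets (leb n)"
  shows "AE y in truth D n. real_cond_exp (truth D n) (vimage_algebra (space (leb n)) (anc D n) (anc_space D n)) (indicator E) y
     = measure (dist_of D n (cbase D n (anc D n y)) (theta0 D)) E"
proof -
  define M where "M = truth D n"
  define F where "F = vimage_algebra (space (leb n)) (anc D n) (anc_space D n)"
  define K where "K b = dist_of D n (cbase D n b) (theta0 D)" for b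
  interpret M: prob_space M unfolding M_def by (rule prob_space_truth[OF m])
  have sM: "sets M = sets (leb n)" "space M = space (leb n)" by (simp_all add: M_def truth_def)
  have am: "anc D n \<in> measurable M (anc_space D n)" using a measurable_cong_sets[OF sM(1) refl] by blast
  have th: "theta0 D \<in> Theta D" using m by (simp add: model_def)
  have K: "K \<in> measurable (anc_space D n) (prob_algebra (leb n))"
    using c th unfolding cond_dist_def K_def by blast
  have c': "emeasure M (E' \<inter> anc D n -` C) = (\<integral>\<^sup>+b\<in>C. emeasure (K b) E' \<partial>distr M (anc_space D n) (anc D n))"
    if "E' \<in> sets (leb n)" "C \<in> sets (anc_space D n)" for E' C
    using c th that unfolding cond_dist_def K_def M_def truth_def by blast
  have Kp: "b \<in> space (anc_space D n) \<Longrightarrow> prob_space (K b)" for b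
    using measurable_space[OF K] by (auto simp: space_prob_algebra)
  have asp: "y \<in> space (leb n) \<Longrightarrow> anc D n y \<in> space (anc_space D n)" for y using measurable_space[OF a] .
  have sub: "subalgebra M F"
    unfolding subalgebra_def F_def sM space_vimage_algebra
  proof (intro conjI refl)
    show "sets (vimage_algebra (space (leb n)) (anc D n) (anc_space D n)) \<subseteq> sets (leb n)"
      using a by (auto simp: sets_vimage_algebra2 asp Pi_iff intro: measurable_sets)
  qed
  interpret S: finite_measure_subalgebra M F by standard (rule sub)
  have Km: "(\<lambda>b. emeasure (K b) E) \<in> borel_measurable (anc_space D n)"
    using measurable_prob_algebraD[OF K] measurable_emeasure_subprob_algebra[OF E] by (rule measurable_compose)
  have Kr: "(\<lambda>b. measure (K b) E) \<in> borel_measurable (anc_space D n)"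
    unfolding measure_def using Km by measurable
  have aF: "anc D n \<in> measurable F (anc_space D n)" unfolding F_def by (rule measurable_vimage_algebra1) (use asp in auto)
  have gF: "(\<lambda>y. measure (K (anc D n y)) E) \<in> borel_measurable F"
    by (rule measurable_compose[OF aF Kr])
  have gM: "(\<lambda>y. measure (K (anc D n y)) E) \<in> borel_measurable M"
    by (rule measurable_compose[OF am Kr])
  have "AE y in M. real_cond_exp M F (indicator E) y = measure (K (anc D n y)) E"
  proof (rule S.real_cond_exp_charact)
    show "integrable M (indicator E :: _ \<Rightarrow> real)" using E sM by (simp add: M.emeasure_finite less_top[symmetric])
    show "integrable M (\<lambda>y. measure (K (anc D n y)) E)"
    proof (rule M.integrable_const_bound[where B = 1])
      show "AE y in M. norm (measure (K (anc D n y)) E) \<le> 1"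
        using Kp asp sM by (intro AE_I2) (auto simp: prob_space.prob_le_1)
    qed (rule gM)
    fix A assume "A \<in> sets F"
    then obtain C where C: "C \<in> sets (anc_space D n)" "A = anc D n -` C \<inter> space (leb n)"
      unfolding F_def using asp by (auto simp: sets_vimage_algebra2 Pi_iff)
    have AM [measurable]: "A \<in> sets M" using sub \<open>A \<in> sets F\<close> by (auto simp: subalgebra_def)
    have EM [measurable]: "E \<in> sets M" using E sM by simp
    have "(\<integral>y\<in>A. measure (K (anc D n y)) E \<partial>M) = enn2real (\<integral>\<^sup>+y. ennreal (indicator A y * measure (K (anc D n y)) E) \<partial>M)"
      unfolding set_lebesgue_integral_def using gM by (subst integral_eq_nn_integral) auto
    also have "(\<integral>\<^sup>+y. ennreal (indicator A y * measure (K (anc D n y)) E) \<partial>M)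
        = (\<integral>\<^sup>+y. emeasure (K (anc D n y)) E * indicator C (anc D n y) \<partial>M)"
    proof (rule nn_integral_cong)
      fix y assume "y \<in> space M"
      then interpret K: prob_space "K (anc D n y)" using Kp asp sM by simp
      show "ennreal (indicator A y * measure (K (anc D n y)) E) = emeasure (K (anc D n y)) E * indicator C (anc D n y)"
        using \<open>y \<in> space M\<close> sM C(2) by (auto simp: indicator_def K.emeasure_eq_measure)
    qed
    also have "\<dots> = (\<integral>\<^sup>+b\<in>C. emeasure (K b) E \<partial>distr M (anc_space D n) (anc D n))"
      using Km am C(1) by (subst nn_integral_distr) auto
    also have "\<dots> = emeasure M (E \<inter> anc D n -` C)" using c'[OF E C(1)] by simp
    also have "E \<inter> anc D n -` C = E \<inter> A" using C(2) sets.sets_into_space[OF E] by auto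
    finally show "(\<integral>y\<in>A. indicator E y \<partial>M) = (\<integral>y\<in>A. measure (K (anc D n y)) E \<partial>M)"
      unfolding set_lebesgue_integral_def
      by (simp add: measure_def[symmetric] indicator_inter_arith[symmetric] Int_commute)
  qed (rule gF)
  then show ?thesis unfolding M_def F_def K_def .
qed

section \<open>Bartlett identities\<close>

text \<open>
  An expectation under \<open>\<theta>\<close> as an integral with respect to a measure that does not depend on \<open>\<theta>\<close>; this is
  the form in which it can be differentiated.
\<close>
definition mom where
  "mom D n \<mu> vs \<theta> = (\<integral>z. (\<Prod>v\<leftarrow>vs. dv D n v \<theta> z) * pdf D n \<theta> z \<partial>\<mu>)"

lemma par_axis_Basis: "par_axis r \<in> Basis"
  by (cases r) (auto simp: Basis_prod_def axis_in_Basis_iff)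

lemma axis_Basis: "(axis a 1 :: real ^ 'n) \<in> Basis"
  by (simp add: axis_in_Basis_iff)

text \<open>
  The index of the derivative of \<open>dv D n v\<close> in coordinate \<open>r\<close>.  The value \<open>None\<close> stands for the derivative
  0 of the adjustment in a nuisance coordinate.
\<close>
fun dv_shift :: "'q + 'p \<Rightarrow> ('q, 'p) idx \<Rightarrow> ('q, 'p) idx option" where
  "dv_shift r (Inl rs) = Some (Inl (r # rs))"
| "dv_shift (Inl b) (Inr as) = Some (Inr (b # as))"
| "dv_shift (Inr _) (Inr as) = None"

fun idx_order_lt :: "('q, 'p) idx \<Rightarrow> bool" where
  "idx_order_lt (Inl rs) \<longleftrightarrow> length rs < 5"
| "idx_order_lt (Inr as) \<longleftrightarrow> length as < 3"

lemma idx_upto_mono: "v \<in> idx_upto j k \<Longrightarrow> j \<le> j' \<Longrightarrow> k \<le> k' \<Longrightarrow> v \<in> idx_upto j' k'"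
  by (auto simp: idx_upto_def)

lemma idx_upto_4_2: "set vs \<subseteq> idx_upto 4 2 \<Longrightarrow> set vs \<subseteq> idx_upto 5 3"
  using idx_upto_mono[of _ 4 2 5 3] by auto

text \<open>
  The measure \<open>\<mu>\<close> is Lebesgue measure or the dominating measure given a value of the ancillary statistic.  The
  densities with respect to both are the same functions \<open>pdf D n \<theta>\<close>, so that the unconditional and the
  conditional case are treated at once.
\<close>
locale sampling =
  fixes D :: "('q::finite, 'p::finite, 'c) problem" and n :: nat and \<mu> :: "sample measure"
  assumes model: "model D n" and adjustment: "adjustment D n" and sets_\<mu>: "sets \<mu> = sets (leb n)"
    and prob: "\<And>\<theta>. \<theta> \<in> Theta D \<Longrightarrow> prob_space (dist_of D n \<mu> \<theta>)"
begin

lemma open_Theta: "open (Theta D)" and theta0: "theta0 D \<in> Theta D"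
  and Ck: "\<And>y. y \<in> space (leb n) \<Longrightarrow> C_k_on 5 (Theta D) (loglik D n y)"
  and pdf_nonneg: "\<And>\<theta> y. \<theta> \<in> Theta D \<Longrightarrow> y \<in> space (leb n) \<Longrightarrow> 0 \<le> pdf D n \<theta> y"
  and pdf_pos: "\<And>\<theta> \<theta>' y. \<theta> \<in> Theta D \<Longrightarrow> \<theta>' \<in> Theta D \<Longrightarrow> y \<in> space (leb n) \<Longrightarrow> 0 < pdf D n \<theta> y \<longleftrightarrow> 0 < pdf D n \<theta>' y"
  and pdf_meas': "\<And>\<theta>. \<theta> \<in> Theta D \<Longrightarrow> pdf D n \<theta> \<in> borel_measurable (leb n)"
  using model unfolding model_def by blast+

lemma space_\<mu>: "space \<mu> = space (leb n)" using sets_\<mu> by (rule sets_eq_imp_space_eq)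

lemma meas_\<mu>: "f \<in> borel_measurable (leb n) \<Longrightarrow> f \<in> borel_measurable \<mu>" for f :: "_ \<Rightarrow> real"
  using measurable_cong_sets[OF sets_\<mu> refl] by blast

lemma ev_Theta: "\<forall>\<^sub>F \<theta> in nhds (theta0 D). \<theta> \<in> Theta D"
  using open_Theta theta0 by (rule eventually_nhds_in_open)

lemma open_fst_Theta: "open (fst ` Theta D)"
  using open_Theta by (rule open_image_fst)

lemma Ck_adj: "y \<in> space (leb n) \<Longrightarrow> C_k_on 3 (fst ` Theta D) (adj D n y)"
  using adjustment unfolding adjustment_def by blast

lemma dv_meas:
  assumes "\<theta> \<in> Theta D" "case v of Inl rs \<Rightarrow> length rs \<le> 5 | Inr as \<Rightarrow> length as \<le> 3"
  shows "(\<lambda>z. dv D n v \<theta> z) \<in> borel_measurable \<mu>"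
proof (rule meas_\<mu>, cases v)
  case (Inl rs)
  have "(\<lambda>z. pds (map par_axis rs) (loglik D n z) \<theta>) \<in> borel_measurable (leb n)"
  proof (rule borel_measurable_pds[OF open_Theta assms(1)])
    fix x assume "x \<in> Theta D"
    then show "(\<lambda>y. loglik D n y x) \<in> borel_measurable (leb n)"
      unfolding loglik_def using pdf_meas' by measurable
  qed (use assms(2) Inl par_axis_Basis Ck in auto)
  then show "(\<lambda>z. dv D n v \<theta> z) \<in> borel_measurable (leb n)" using Inl by simp
next
  case (Inr as)
  have "(\<lambda>z. pds (map (\<lambda>a. axis a 1) as) (adj D n z) (fst \<theta>)) \<in> borel_measurable (leb n)"
    by (rule borel_measurable_pds[OF open_fst_Theta])
       (use assms Inr axis_Basis Ck_adj adjustment in \<open>auto simp: adjustment_def\<close>)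
  then show "(\<lambda>z. dv D n v \<theta> z) \<in> borel_measurable (leb n)" using Inr by simp
qed

lemma prod_dv_meas:
  assumes "\<theta> \<in> Theta D" "set vs \<subseteq> idx_upto 5 3"
  shows "(\<lambda>z. \<Prod>v\<leftarrow>vs. dv D n v \<theta> z) \<in> borel_measurable \<mu>"
  using assms(2)
proof (induction vs)
  case (Cons v vs)
  then have "(\<lambda>z. dv D n v \<theta> z) \<in> borel_measurable \<mu>"
    by (intro dv_meas[OF assms(1)]) (auto simp: idx_upto_def)
  with Cons show ?case by simp
qed simp

lemma pdf_meas: "\<theta> \<in> Theta D \<Longrightarrow> pdf D n \<theta> \<in> borel_measurable \<mu>"
  using pdf_meas' meas_\<mu> by blast

lemma integral_dist:
  assumes "\<theta> \<in> Theta D" "f \<in> borel_measurable \<mu>"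
  shows "(\<integral>z. f z \<partial>dist_of D n \<mu> \<theta>) = (\<integral>z. f z * pdf D n \<theta> z \<partial>\<mu>)"
    "integrable (dist_of D n \<mu> \<theta>) f \<longleftrightarrow> integrable \<mu> (\<lambda>z. f z * pdf D n \<theta> z)"
proof -
  have "AE z in \<mu>. 0 \<le> pdf D n \<theta> z" using pdf_nonneg[OF assms(1)] by (intro AE_I2) (simp add: space_\<mu>)
  note d = assms(2) pdf_meas[OF assms(1)] this
  show "(\<integral>z. f z \<partial>dist_of D n \<mu> \<theta>) = (\<integral>z. f z * pdf D n \<theta> z \<partial>\<mu>)"
    unfolding dist_of_def integral_density[OF d] by (simp add: mult.commute)
  show "integrable (dist_of D n \<mu> \<theta>) f \<longleftrightarrow> integrable \<mu> (\<lambda>z. f z * pdf D n \<theta> z)"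
    unfolding dist_of_def integrable_density[OF d] by (simp add: mult.commute)
qed

lemma mean_mom:
  assumes "\<theta> \<in> Theta D" "v \<in> idx_upto 5 3"
  shows "mean D n \<mu> v \<theta> = mom D n \<mu> [v] \<theta>"
  using prod_dv_meas[OF assms(1), of "[v]"] assms by (simp add: mean_def mom_def integral_dist)

lemma mom_Nil: "\<theta> \<in> Theta D \<Longrightarrow> mom D n \<mu> [] \<theta> = 1"
  using integral_dist(1)[of \<theta> "\<lambda>_. 1"] prob_space.prob_space[OF prob, of \<theta>] by (simp add: mom_def)

text \<open>
  The rule \<open>\<partial>p = (\<partial> log p) p\<close> also holds at sample points of zero density: such a point has zero density
  at every parameter value.
\<close>
lemma DERIV_pdf:
  assumes "\<theta> \<in> Theta D" "z \<in> space \<mu>"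
  shows "((\<lambda>t. pdf D n (\<theta> + t *\<^sub>R par_axis r) z) has_real_derivative dv D n (Inl [r]) \<theta> z * pdf D n \<theta> z) (at 0)"
proof -
  have z: "z \<in> space (leb n)" using assms space_\<mu> by simp
  define V where "V = (\<lambda>t::real. \<theta> + t *\<^sub>R par_axis r) -` Theta D"
  have V: "open V" "0 \<in> V" unfolding V_def using assms(1)
    by (auto intro!: open_vimage open_Theta continuous_intros)
  have "pds [] (loglik D n z) differentiable_on Theta D" by (rule C_k_onD(1)[OF Ck[OF z]]) auto
  then have d: "((\<lambda>t. loglik D n z (\<theta> + t *\<^sub>R par_axis r)) has_real_derivative dv D n (Inl [r]) \<theta> z) (at 0)"
    using DERIV_along_vector[OF open_Theta, of "loglik D n z" \<theta> 0 "par_axis r"] assms(1) by simp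
  show ?thesis
  proof (cases "0 < pdf D n \<theta> z")
    case True
    have eq: "exp (loglik D n z (\<theta> + 0 *\<^sub>R par_axis r)) * dv D n (Inl [r]) \<theta> z = dv D n (Inl [r]) \<theta> z * pdf D n \<theta> z"
      using True by (simp add: loglik_def)
    have "((\<lambda>t. exp (loglik D n z (\<theta> + t *\<^sub>R par_axis r))) has_real_derivative
        dv D n (Inl [r]) \<theta> z * pdf D n \<theta> z) (at 0)"
      by (rule DERIV_fun_exp[OF d, unfolded eq])
    then show ?thesis
    proof (rule has_field_derivative_transform_within_open[OF _ V])
      fix t assume "t \<in> V"
      then have "0 < pdf D n (\<theta> + t *\<^sub>R par_axis r) z"
        using True assms(1) z pdf_pos unfolding V_def by blast
      then show "exp (loglik D n z (\<theta> + t *\<^sub>R par_axis r)) = pdf D n (\<theta> + t *\<^sub>R par_axis r) z"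
        by (simp add: loglik_def)
    qed
  next
    case False
    have 0: "pdf D n \<theta>' z = 0" if "\<theta>' \<in> Theta D" for \<theta>'
      using False pdf_pos[OF assms(1) that z] pdf_nonneg[OF that z] by simp
    have "((\<lambda>t. 0) has_real_derivative dv D n (Inl [r]) \<theta> z * pdf D n \<theta> z) (at 0)"
      using 0[OF assms(1)] by simp
    then show ?thesis
      by (rule has_field_derivative_transform_within_open[OF _ V]) (use 0 in \<open>auto simp: V_def\<close>)
  qed
qed

definition ddv :: "'q + 'p \<Rightarrow> ('q, 'p) idx \<Rightarrow> ('q, 'p) par \<Rightarrow> sample \<Rightarrow> real" where
  "ddv r v \<theta> z = (case dv_shift r v of None \<Rightarrow> 0 | Some w \<Rightarrow> dv D n w \<theta> z)"

lemma DERIV_dv: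
  assumes "\<theta> \<in> Theta D" "z \<in> space \<mu>" "idx_order_lt v"
  shows "((\<lambda>t. dv D n v (\<theta> + t *\<^sub>R par_axis r) z) has_real_derivative ddv r v \<theta> z) (at 0)"
proof (cases v)
  case (Inl rs)
  have z: "z \<in> space (leb n)" using assms space_\<mu> by simp
  have "pds (map par_axis rs) (loglik D n z) differentiable_on Theta D"
    by (rule C_k_onD(1)[OF Ck[OF z]]) (use par_axis_Basis assms(3) Inl in auto)
  then show ?thesis
    using DERIV_along_vector[OF open_Theta, of "pds (map par_axis rs) (loglik D n z)" \<theta> 0 "par_axis r"] assms(1) Inl
    by (simp add: ddv_def)
next
  case (Inr as)
  have z: "z \<in> space (leb n)" using assms space_\<mu> by simp
  have d: "pds (map (\<lambda>a. axis a 1) as) (adj D n z) differentiable_on fst ` Theta D"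
    by (rule C_k_onD(1)[OF Ck_adj[OF z]]) (use axis_Basis assms(3) Inr in auto)
  show ?thesis
  proof (cases r)
    fix b assume b: "r = Inl b"
    have "fst \<theta> + 0 *\<^sub>R axis b 1 \<in> fst ` Theta D" using assms(1) by simp
    from DERIV_along_vector[OF open_fst_Theta d this] show ?thesis using b Inr
      by (simp add: ddv_def)
  next
    fix i assume "r = Inr i"
    then show ?thesis using Inr by (simp add: ddv_def)
  qed
qed

abbreviation "N \<equiv> dist_of D n \<mu> (theta0 D)"

end

locale bartlett = sampling D n \<mu> for D :: "('q::finite, 'p::finite, 'c) problem" and n \<mu> +
  assumes inter: "\<And>vs. length vs \<le> 2 \<Longrightarrow> set vs \<subseteq> idx_upto 3 1 \<Longrightarrow> \<forall>\<^sub>F \<theta> in nhds (theta0 D). \<forall>r.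
          let h = (\<lambda>\<theta> z. (\<Prod>v\<leftarrow>vs. dv D n v \<theta> z) * pdf D n \<theta> z)
          in integrable \<mu> (h \<theta>) \<and>
             integrable \<mu> (\<lambda>z. pd (par_axis r) (\<lambda>\<theta>. h \<theta> z) \<theta>) \<and>
             ((\<lambda>t. \<integral>z. h (\<theta> + t *\<^sub>R par_axis r) z \<partial>\<mu>) has_real_derivative
                (\<integral>z. pd (par_axis r) (\<lambda>\<theta>. h \<theta> z) \<theta> \<partial>\<mu>)) (at 0)"
    and integrable_prod: "\<And>vs. length vs \<le> 4 \<Longrightarrow> set vs \<subseteq> idx_upto 4 2 \<Longrightarrow>
          integrable (dist_of D n \<mu> (theta0 D)) (\<lambda>z. \<Prod>v\<leftarrow>vs. dv D n v (theta0 D) z)"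
    and mean_score: "\<And>r. mean D n \<mu> (Inl [r]) (theta0 D) = 0"
begin

lemma DERIV_mom:
  assumes "length vs \<le> 2" "set vs \<subseteq> idx_upto 3 1"
  shows "\<forall>\<^sub>F \<theta> in nhds (theta0 D). \<forall>r.
     integrable \<mu> (\<lambda>z. (\<Prod>v\<leftarrow>vs. dv D n v \<theta> z) * pdf D n \<theta> z) \<and>
     integrable \<mu> (\<lambda>z. pd (par_axis r) (\<lambda>\<theta>. (\<Prod>v\<leftarrow>vs. dv D n v \<theta> z) * pdf D n \<theta> z) \<theta>) \<and>
     ((\<lambda>t. mom D n \<mu> vs (\<theta> + t *\<^sub>R par_axis r)) has_real_derivative
       (\<integral>z. pd (par_axis r) (\<lambda>\<theta>. (\<Prod>v\<leftarrow>vs. dv D n v \<theta> z) * pdf D n \<theta> z) \<theta> \<partial>\<mu>)) (at 0)"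
  using inter[OF assms] unfolding mom_def Let_def .

lemma idx_lt: "v \<in> idx_upto 3 1 \<Longrightarrow> idx_order_lt v"
  by (auto simp: idx_upto_def)

lemma pd_weighted_one:
  assumes "\<theta> \<in> Theta D" "z \<in> space \<mu>" "idx_order_lt v"
  shows "pd (par_axis r) (\<lambda>\<theta>. (\<Prod>v\<leftarrow>[v]. dv D n v \<theta> z) * pdf D n \<theta> z) \<theta>
     = ddv r v \<theta> z * pdf D n \<theta> z + dv D n (Inl [r]) \<theta> z * dv D n v \<theta> z * pdf D n \<theta> z"
  by (rule pd_eqI)
     (rule derivative_eq_intros DERIV_dv[OF assms] DERIV_pdf[OF assms(1,2)] refl | simp add: algebra_simps)+

lemma pd_weighted_two:
  assumes "\<theta> \<in> Theta D" "z \<in> space \<mu>" "idx_order_lt v" "idx_order_lt w"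
  shows "pd (par_axis r) (\<lambda>\<theta>. (\<Prod>v\<leftarrow>[v, w]. dv D n v \<theta> z) * pdf D n \<theta> z) \<theta>
     = ddv r v \<theta> z * dv D n w \<theta> z * pdf D n \<theta> z + dv D n v \<theta> z * ddv r w \<theta> z * pdf D n \<theta> z
       + dv D n (Inl [r]) \<theta> z * dv D n v \<theta> z * dv D n w \<theta> z * pdf D n \<theta> z"
  by (rule pd_eqI)
     (rule derivative_eq_intros DERIV_dv[OF assms(1,2,3)] DERIV_dv[OF assms(1,2,4)] DERIV_pdf[OF assms(1,2)] refl | simp add: algebra_simps)+

text \<open>
  From \<open>\<integral>p = 1\<close>.  The identity is needed in a neighbourhood of the true value because it is
  differentiated again.
\<close>
lemma score_mean_near: "\<forall>\<^sub>F \<theta> in nhds (theta0 D). \<forall>r. mom D n \<mu> [Inl [r]] \<theta> = 0"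
proof -
  have "\<forall>\<^sub>F \<theta> in nhds (theta0 D). \<forall>r. ((\<lambda>t. mom D n \<mu> [] (\<theta> + t *\<^sub>R par_axis r)) has_real_derivative
       (\<integral>z. pd (par_axis r) (\<lambda>\<theta>. (\<Prod>v\<leftarrow>[]. dv D n v \<theta> z) * pdf D n \<theta> z) \<theta> \<partial>\<mu>)) (at 0)"
    by (rule eventually_mono[OF DERIV_mom[of "[]"]]) auto
  with ev_Theta show ?thesis
  proof eventually_elim
    case (elim \<theta>)
    show ?case
    proof
      fix r
      have "(\<integral>z. pd (par_axis r) (\<lambda>\<theta>. (\<Prod>v\<leftarrow>[]. dv D n v \<theta> z) * pdf D n \<theta> z) \<theta> \<partial>\<mu>) = mom D n \<mu> [Inl [r]] \<theta>"
        unfolding mom_def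
      proof (rule Bochner_Integration.integral_cong[OF refl])
        fix z assume "z \<in> space \<mu>"
        from DERIV_pdf[OF elim(1) this] show "pd (par_axis r) (\<lambda>\<theta>. (\<Prod>v\<leftarrow>[]. dv D n v \<theta> z) * pdf D n \<theta> z) \<theta>
           = (\<Prod>v\<leftarrow>[Inl [r]]. dv D n v \<theta> z) * pdf D n \<theta> z"
          by (intro pd_eqI) simp
      qed
      moreover have "pd (par_axis r) (mom D n \<mu> []) \<theta> = pd (par_axis r) (\<lambda>_. 1) \<theta>"
        by (rule pd_cong_open[OF open_Theta elim(1)]) (rule mom_Nil)
      moreover have "pd (par_axis r) (\<lambda>_. 1) \<theta> = 0" by (simp add: pd_def)
      ultimately show "mom D n \<mu> [Inl [r]] \<theta> = 0" using pd_eqI[OF elim(2)[rule_format, of r]] by simp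
    qed
  qed
qed

lemma DERIV_mom1:
  assumes v: "v \<in> idx_upto 3 1"
  shows "\<forall>\<^sub>F \<theta> in nhds (theta0 D). \<forall>r. ((\<lambda>t. mom D n \<mu> [v] (\<theta> + t *\<^sub>R par_axis r)) has_real_derivative
     (\<integral>z. ddv r v \<theta> z * pdf D n \<theta> z \<partial>\<mu>) + mom D n \<mu> [Inl [r], v] \<theta>) (at 0)"
proof -
  have "\<forall>\<^sub>F \<theta> in nhds (theta0 D). \<forall>r. integrable \<mu> (\<lambda>z. (\<Prod>v\<leftarrow>[Inl [r], v]. dv D n v \<theta> z) * pdf D n \<theta> z)"
  proof (rule eventually_all_finite)
    fix r show "\<forall>\<^sub>F \<theta> in nhds (theta0 D). integrable \<mu> (\<lambda>z. (\<Prod>v\<leftarrow>[Inl [r], v]. dv D n v \<theta> z) * pdf D n \<theta> z)"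
      by (rule eventually_mono[OF DERIV_mom[of "[Inl [r], v]"]]) (use v in \<open>auto simp: idx_upto_def\<close>)
  qed
  moreover have "\<forall>\<^sub>F \<theta> in nhds (theta0 D). \<forall>r.
     integrable \<mu> (\<lambda>z. pd (par_axis r) (\<lambda>\<theta>. (\<Prod>v\<leftarrow>[v]. dv D n v \<theta> z) * pdf D n \<theta> z) \<theta>) \<and>
     ((\<lambda>t. mom D n \<mu> [v] (\<theta> + t *\<^sub>R par_axis r)) has_real_derivative
       (\<integral>z. pd (par_axis r) (\<lambda>\<theta>. (\<Prod>v\<leftarrow>[v]. dv D n v \<theta> z) * pdf D n \<theta> z) \<theta> \<partial>\<mu>)) (at 0)"
    by (rule eventually_mono[OF DERIV_mom[of "[v]"]]) (use v in auto)
  ultimately show ?thesis using ev_Theta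
  proof eventually_elim
    case (elim \<theta>)
    show ?case
    proof
      fix r
      let ?h = "\<lambda>z. pd (par_axis r) (\<lambda>\<theta>. (\<Prod>v\<leftarrow>[v]. dv D n v \<theta> z) * pdf D n \<theta> z) \<theta>"
      let ?a = "\<lambda>z. (\<Prod>v\<leftarrow>[Inl [r], v]. dv D n v \<theta> z) * pdf D n \<theta> z"
      have i: "integrable \<mu> ?h" "integrable \<mu> ?a" using elim by blast+
      have "(\<integral>z. ddv r v \<theta> z * pdf D n \<theta> z \<partial>\<mu>) = (\<integral>z. ?h z - ?a z \<partial>\<mu>)"
        by (rule Bochner_Integration.integral_cong[OF refl]) (use pd_weighted_one[OF elim(3) _ idx_lt[OF v], of _ r] in simp)
      also have "\<dots> = (\<integral>z. ?h z \<partial>\<mu>) - mom D n \<mu> [Inl [r], v] \<theta>"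
        using i by (subst Bochner_Integration.integral_diff) (auto simp: mom_def)
      finally show "((\<lambda>t. mom D n \<mu> [v] (\<theta> + t *\<^sub>R par_axis r)) has_real_derivative
          (\<integral>z. ddv r v \<theta> z * pdf D n \<theta> z \<partial>\<mu>) + mom D n \<mu> [Inl [r], v] \<theta>) (at 0)"
        using elim(2) by simp
    qed
  qed
qed

lemma mom_Inl: "(\<integral>z. ddv r (Inl rs) \<theta> z * pdf D n \<theta> z \<partial>\<mu>) = mom D n \<mu> [Inl (r # rs)] \<theta>"
  by (simp add: ddv_def mom_def)

lemma integrable_weighted: "length vs \<le> 4 \<Longrightarrow> set vs \<subseteq> idx_upto 4 2 \<Longrightarrow>
   integrable \<mu> (\<lambda>z. (\<Prod>v\<leftarrow>vs. dv D n v (theta0 D) z) * pdf D n (theta0 D) z)"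
  using integrable_prod[of vs] prod_dv_meas[OF theta0 idx_upto_4_2]
  by (subst integral_dist(2)[OF theta0, symmetric]) auto

lemma DERIV_mom2:
  assumes "v = Inl rs" "w = Inl ss" "1 \<le> length rs" "length rs \<le> 3" "1 \<le> length ss" "length ss \<le> 3"
  shows "((\<lambda>t. mom D n \<mu> [v, w] (theta0 D + t *\<^sub>R par_axis r)) has_real_derivative
     mom D n \<mu> [Inl (r # rs), w] (theta0 D) + mom D n \<mu> [v, Inl (r # ss)] (theta0 D) + mom D n \<mu> [Inl [r], v, w] (theta0 D)) (at 0)"
proof -
  have vw: "v \<in> idx_upto 3 1" "w \<in> idx_upto 3 1" using assms by (auto simp: idx_upto_def)
  have d: "((\<lambda>t. mom D n \<mu> [v, w] (theta0 D + t *\<^sub>R par_axis r)) has_real_derivative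
       (\<integral>z. pd (par_axis r) (\<lambda>\<theta>. (\<Prod>v\<leftarrow>[v, w]. dv D n v \<theta> z) * pdf D n \<theta> z) (theta0 D) \<partial>\<mu>)) (at 0)"
    using eventually_nhds_x_imp_x[OF DERIV_mom[of "[v, w]"]] vw by simp
  let ?a = "\<lambda>vs z. (\<Prod>v\<leftarrow>vs. dv D n v (theta0 D) z) * pdf D n (theta0 D) z"
  have i: "integrable \<mu> (?a [Inl (r # rs), w])" "integrable \<mu> (?a [v, Inl (r # ss)])" "integrable \<mu> (?a [Inl [r], v, w])"
    using assms by (intro integrable_weighted; auto simp: idx_upto_def)+
  have "(\<integral>z. pd (par_axis r) (\<lambda>\<theta>. (\<Prod>v\<leftarrow>[v, w]. dv D n v \<theta> z) * pdf D n \<theta> z) (theta0 D) \<partial>\<mu>)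
     = (\<integral>z. ?a [Inl (r # rs), w] z + ?a [v, Inl (r # ss)] z + ?a [Inl [r], v, w] z \<partial>\<mu>)"
  proof (rule Bochner_Integration.integral_cong[OF refl])
    fix z assume "z \<in> space \<mu>"
    from pd_weighted_two[OF theta0 this idx_lt[OF vw(1)] idx_lt[OF vw(2)], of r]
    show "pd (par_axis r) (\<lambda>\<theta>. (\<Prod>v\<leftarrow>[v, w]. dv D n v \<theta> z) * pdf D n \<theta> z) (theta0 D)
       = ?a [Inl (r # rs), w] z + ?a [v, Inl (r # ss)] z + ?a [Inl [r], v, w] z"
      using assms(1,2) by (simp add: ddv_def)
  qed
  also have "\<dots> = mom D n \<mu> [Inl (r # rs), w] (theta0 D) + mom D n \<mu> [v, Inl (r # ss)] (theta0 D) + mom D n \<mu> [Inl [r], v, w] (theta0 D)"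
    unfolding mom_def using i by (subst Bochner_Integration.integral_add Bochner_Integration.integral_add Bochner_Integration.integrable_add; simp)+
  finally show ?thesis using d by simp
qed

text \<open>
  From the vanishing mean of the score; again near the true value, for one more differentiation.
\<close>
lemma score_cov_near: "\<forall>\<^sub>F \<theta> in nhds (theta0 D). \<forall>r s. mom D n \<mu> [Inl [r], Inl [s]] \<theta> = - mom D n \<mu> [Inl [r, s]] \<theta>"
proof -
  have "\<forall>\<^sub>F \<theta> in nhds (theta0 D). \<forall>s r. ((\<lambda>t. mom D n \<mu> [Inl [s]] (\<theta> + t *\<^sub>R par_axis r)) has_real_derivative
     (\<integral>z. ddv r (Inl [s]) \<theta> z * pdf D n \<theta> z \<partial>\<mu>) + mom D n \<mu> [Inl [r], Inl [s]] \<theta>) (at 0)"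
    by (intro eventually_all_finite DERIV_mom1) (auto simp: idx_upto_def)
  moreover have "\<forall>\<^sub>F \<theta> in nhds (theta0 D). \<forall>\<^sub>F \<theta> in nhds \<theta>. \<forall>r. mom D n \<mu> [Inl [r]] \<theta> = 0"
    using score_mean_near by (simp add: eventually_eventually)
  ultimately show ?thesis
  proof eventually_elim
    case (elim \<theta>)
    have "mom D n \<mu> [Inl [r], Inl [s]] \<theta> = - mom D n \<mu> [Inl [r, s]] \<theta>" for r s
    proof -
      have "pd (par_axis r) (mom D n \<mu> [Inl [s]]) \<theta> = pd (par_axis r) (\<lambda>_. 0) \<theta>"
        by (rule pd_cong_ev) (use elim(2) in \<open>auto elim: eventually_mono\<close>)
      also have "\<dots> = 0" by (simp add: pd_def)
      finally show ?thesis
        using pd_eqI[OF elim(1)[rule_format, of s r]] by (simp only: mom_Inl)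
    qed
    then show ?case by blast
  qed
qed

abbreviation "E f \<equiv> (\<integral>z. f z \<partial>N)"
abbreviation "c v \<equiv> cent D n \<mu> v"
abbreviation "\<kappa> v \<equiv> mean D n \<mu> v (theta0 D)"

sublocale N: prob_space N by (rule prob[OF theta0])

lemma prob_N: "N.prob (space \<mu>) = 1"
  using N.prob_space by simp

lemma E_prod: "length vs \<le> 4 \<Longrightarrow> set vs \<subseteq> idx_upto 4 2 \<Longrightarrow> E (\<lambda>z. \<Prod>v\<leftarrow>vs. dv D n v (theta0 D) z) = mom D n \<mu> vs (theta0 D)"
  unfolding mom_def using prod_dv_meas[OF theta0 idx_upto_4_2] by (intro integral_dist(1)[OF theta0]) auto

lemma c_score: "c (Inl [r]) z = dv D n (Inl [r]) (theta0 D) z"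
  by (simp add: cent_def mean_score)

lemma E_c: "v \<in> idx_upto 4 2 \<Longrightarrow> E (c v) = 0"
  using integrable_prod[of "[v]"] by (simp add: cent_def prob_N mean_def)

lemma E_c2:
  assumes "v \<in> idx_upto 4 2" "w \<in> idx_upto 4 2"
  shows "E (\<lambda>z. c v z * c w z) = mom D n \<mu> [v, w] (theta0 D) - \<kappa> v * \<kappa> w"
proof -
  let ?d = "\<lambda>v z. dv D n v (theta0 D) z"
  have i: "integrable N (\<lambda>z. ?d v z * ?d w z)" "integrable N (?d v)" "integrable N (?d w)"
    using integrable_prod[of "[v, w]"] integrable_prod[of "[v]"] integrable_prod[of "[w]"] assms by simp_all
  have "E (\<lambda>z. c v z * c w z) = E (\<lambda>z. ?d v z * ?d w z - \<kappa> w * ?d v z - \<kappa> v * ?d w z + \<kappa> v * \<kappa> w)"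
    by (simp add: cent_def algebra_simps)
  also have "\<dots> = E (\<lambda>z. ?d v z * ?d w z) - \<kappa> w * E (?d v) - \<kappa> v * E (?d w) + \<kappa> v * \<kappa> w"
    using i by (simp add: prob_N)
  also have "E (\<lambda>z. ?d v z * ?d w z) = mom D n \<mu> [v, w] (theta0 D)" using E_prod[of "[v, w]"] assms by simp
  finally show ?thesis by (simp add: mean_def)
qed

lemma score_cov: "E (\<lambda>z. c (Inl [r]) z * c (Inl [s]) z) = - \<kappa> (Inl [r, s])"
  using eventually_nhds_x_imp_x[OF score_cov_near] mean_mom[OF theta0, of "Inl [r, s]"]
  by (subst E_c2) (auto simp: mean_score idx_upto_def)

lemma pd_mean:
  assumes "v \<in> idx_upto 3 1"
  shows "\<forall>\<^sub>F \<theta> in nhds (theta0 D). pd (par_axis r) (mean D n \<mu> v) \<theta> = (\<integral>z. ddv r v \<theta> z * pdf D n \<theta> z \<partial>\<mu>) + mom D n \<mu> [Inl [r], v] \<theta>"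
  using DERIV_mom1[OF assms] ev_Theta
proof eventually_elim
  case (elim \<theta>)
  have "pd (par_axis r) (mean D n \<mu> v) \<theta> = pd (par_axis r) (mom D n \<mu> [v]) \<theta>"
    by (rule pd_cong_open[OF open_Theta elim(2)]) (use assms in \<open>auto intro!: mean_mom simp: idx_upto_def\<close>)
  then show ?case using pd_eqI[OF elim(1)[rule_format, of r]] by simp
qed

text \<open>
  Differentiation of the mean of a log-likelihood derivative \<open>v\<close> in \<open>\<theta>\<^sup>t\<close> gives the mean of the next derivative and, from the
  density, the covariance of \<open>v\<close> with the score.
\<close>
lemma cov_with_score:
  assumes "v = Inl rs" "1 \<le> length rs" "length rs \<le> 3"
  shows "E (\<lambda>z. c v z * c (Inl [t]) z) = pds [par_axis t] (mean D n \<mu> v) (theta0 D) - \<kappa> (Inl (t # rs))"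
proof -
  have v: "v \<in> idx_upto 3 1" "v \<in> idx_upto 4 2" using assms by (auto simp: idx_upto_def)
  have "E (\<lambda>z. c v z * c (Inl [t]) z) = E (\<lambda>z. c (Inl [t]) z * c v z)" by (simp add: mult.commute)
  also have "\<dots> = mom D n \<mu> [Inl [t], v] (theta0 D)"
    using v(2) by (subst E_c2) (auto simp: mean_score idx_upto_def)
  finally show ?thesis
    using eventually_nhds_x_imp_x[OF pd_mean[OF v(1), of t]] mean_mom[OF theta0, of "Inl (t # rs)"] assms
    by (simp add: mom_Inl idx_upto_def)
qed

lemma cov_adj_score:
  "E (\<lambda>z. c (Inr [a]) z * c (Inl [t]) z) = pds [par_axis t] (mean D n \<mu> (Inr [a])) (theta0 D)
     - (case t of Inl b \<Rightarrow> \<kappa> (Inr [b, a]) | Inr _ \<Rightarrow> 0)"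
proof -
  let ?v = "Inr [a]"
  have v: "?v \<in> idx_upto 3 1" "?v \<in> idx_upto 4 2" by (auto simp: idx_upto_def)
  have "E (\<lambda>z. c ?v z * c (Inl [t]) z) = E (\<lambda>z. c (Inl [t]) z * c ?v z)" by (simp add: mult.commute)
  also have "\<dots> = mom D n \<mu> [Inl [t], ?v] (theta0 D)"
    using v(2) by (subst E_c2) (auto simp: mean_score idx_upto_def)
  finally have 1: "E (\<lambda>z. c ?v z * c (Inl [t]) z) = mom D n \<mu> [Inl [t], ?v] (theta0 D)" .
  have 2: "(\<integral>z. ddv t ?v (theta0 D) z * pdf D n (theta0 D) z \<partial>\<mu>) = (case t of Inl b \<Rightarrow> \<kappa> (Inr [b, a]) | Inr _ \<Rightarrow> 0)"
    using mean_mom[OF theta0, of "Inr [b, a]" for b] by (cases t) (auto simp: ddv_def mom_def idx_upto_def)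
  show ?thesis unfolding 1 2[symmetric]
    using eventually_nhds_x_imp_x[OF pd_mean[OF v(1), of t]] by simp
qed

text \<open>
  One derivative of the second Bartlett identity \<open>\<lambda>\<^sub>r\<^sub>s = - E(l\<^sub>r l\<^sub>s)\<close>.
\<close>
lemma third_score_moment:
  "E (\<lambda>z. c (Inl [t]) z * c (Inl [r]) z * c (Inl [s]) z) = - pds [par_axis t] (mean D n \<mu> (Inl [r, s])) (theta0 D)
     - E (\<lambda>z. c (Inl [t, r]) z * c (Inl [s]) z) - E (\<lambda>z. c (Inl [r]) z * c (Inl [t, s]) z)"
proof -
  have "pd (par_axis t) (mean D n \<mu> (Inl [r, s])) (theta0 D) = pd (par_axis t) (\<lambda>\<theta>. - mom D n \<mu> [Inl [r], Inl [s]] \<theta>) (theta0 D)"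
  proof (rule pd_cong_ev)
    show "\<forall>\<^sub>F \<theta> in nhds (theta0 D). mean D n \<mu> (Inl [r, s]) \<theta> = - mom D n \<mu> [Inl [r], Inl [s]] \<theta>"
      using score_cov_near ev_Theta by eventually_elim (auto simp: mean_mom idx_upto_def)
  qed
  also have "\<dots> = - (mom D n \<mu> [Inl [t, r], Inl [s]] (theta0 D) + mom D n \<mu> [Inl [r], Inl [t, s]] (theta0 D)
      + mom D n \<mu> [Inl [t], Inl [r], Inl [s]] (theta0 D))"
    by (intro pd_eqI DERIV_minus DERIV_mom2) auto
  finally have 1: "pds [par_axis t] (mean D n \<mu> (Inl [r, s])) (theta0 D) = \<dots>" by simp
  have 2: "E (\<lambda>z. c (Inl [t]) z * c (Inl [r]) z * c (Inl [s]) z) = mom D n \<mu> [Inl [t], Inl [r], Inl [s]] (theta0 D)"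
    using E_prod[of "[Inl [t], Inl [r], Inl [s]]"] by (simp add: c_score idx_upto_def mult.assoc)
  show ?thesis unfolding 1 2 by (simp add: E_c2 idx_upto_def mean_score)
qed

text \<open>
  The second \<open>\<theta>\<close>-derivative of \<open>\<lambda>\<^sub>r\<^sub>s\<close> produces the third moment and the covariance of second derivatives
  only as a sum.  Neither is determined by means alone; the sum is, and it is the sum that
  occurs in the expectation of the likelihood ratio polynomial.
\<close>
lemma mixed_third_moment:
  "E (\<lambda>z. c (Inl [r, s]) z * c (Inl [t]) z * c (Inl [u]) z) + E (\<lambda>z. c (Inl [r, s]) z * c (Inl [t, u]) z)
   = pds [par_axis t, par_axis u] (mean D n \<mu> (Inl [r, s])) (theta0 D) - \<kappa> (Inl [t, u, r, s])
     - E (\<lambda>z. c (Inl [u, r, s]) z * c (Inl [t]) z) - E (\<lambda>z. c (Inl [t, r, s]) z * c (Inl [u]) z)"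
proof -
  let ?m = "\<lambda>vs. mom D n \<mu> vs (theta0 D)"
  let ?d = "\<lambda>v z. dv D n v (theta0 D) z"
  have idx: "Inl [r, s] \<in> idx_upto 3 1" "Inl [u, r, s] \<in> idx_upto 3 1" by (auto simp: idx_upto_def)
  have "pd (par_axis t) (pd (par_axis u) (mean D n \<mu> (Inl [r, s]))) (theta0 D)
     = pd (par_axis t) (\<lambda>\<theta>. mom D n \<mu> [Inl [u, r, s]] \<theta> + mom D n \<mu> [Inl [u], Inl [r, s]] \<theta>) (theta0 D)"
    by (rule pd_cong_ev) (use pd_mean[OF idx(1), of u] in \<open>simp add: mom_Inl\<close>)
  also have "\<dots> = ((\<integral>z. ddv t (Inl [u, r, s]) (theta0 D) z * pdf D n (theta0 D) z \<partial>\<mu>) + ?m [Inl [t], Inl [u, r, s]])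
      + (?m [Inl [t, u], Inl [r, s]] + ?m [Inl [u], Inl [t, r, s]] + ?m [Inl [t], Inl [u], Inl [r, s]])"
    by (intro pd_eqI DERIV_add DERIV_mom2 eventually_nhds_x_imp_x[OF DERIV_mom1[OF idx(2)], rule_format]) auto
  finally have 1: "pds [par_axis t, par_axis u] (mean D n \<mu> (Inl [r, s])) (theta0 D) = ?m [Inl [t, u, r, s]] + ?m [Inl [t], Inl [u, r, s]]
      + (?m [Inl [t, u], Inl [r, s]] + ?m [Inl [u], Inl [t, r, s]] + ?m [Inl [t], Inl [u], Inl [r, s]])"
    by (simp only: mom_Inl pds_Cons pds_Nil)
  have i: "integrable N (\<lambda>z. ?d (Inl [t]) z * (?d (Inl [u]) z * ?d (Inl [r, s]) z))" "integrable N (\<lambda>z. ?d (Inl [t]) z * ?d (Inl [u]) z)"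
    using integrable_prod[of "[Inl [t], Inl [u], Inl [r, s]]"] integrable_prod[of "[Inl [t], Inl [u]]"] by (simp_all add: idx_upto_def)
  have "E (\<lambda>z. c (Inl [r, s]) z * c (Inl [t]) z * c (Inl [u]) z)
     = E (\<lambda>z. ?d (Inl [t]) z * (?d (Inl [u]) z * ?d (Inl [r, s]) z) - \<kappa> (Inl [r, s]) * (?d (Inl [t]) z * ?d (Inl [u]) z))"
    by (rule Bochner_Integration.integral_cong[OF refl]) (simp only: c_score, simp add: cent_def algebra_simps)
  also have "\<dots> = E (\<lambda>z. ?d (Inl [t]) z * (?d (Inl [u]) z * ?d (Inl [r, s]) z)) - \<kappa> (Inl [r, s]) * E (\<lambda>z. ?d (Inl [t]) z * ?d (Inl [u]) z)"
    using i by simp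
  also have "\<dots> = ?m [Inl [t], Inl [u], Inl [r, s]] - \<kappa> (Inl [r, s]) * ?m [Inl [t], Inl [u]]"
    using E_prod[of "[Inl [t], Inl [u], Inl [r, s]]"] E_prod[of "[Inl [t], Inl [u]]"] by (simp add: idx_upto_def)
  also have "?m [Inl [t], Inl [u]] = - \<kappa> (Inl [t, u])"
    using eventually_nhds_x_imp_x[OF score_cov_near] mean_mom[OF theta0, of "Inl [t, u]"] by (simp add: idx_upto_def)
  finally have 2: "E (\<lambda>z. c (Inl [r, s]) z * c (Inl [t]) z * c (Inl [u]) z)
     = ?m [Inl [t], Inl [u], Inl [r, s]] + \<kappa> (Inl [r, s]) * \<kappa> (Inl [t, u])" by simp
  have sw: "mom D n \<mu> [v, w] (theta0 D) = mom D n \<mu> [w, v] (theta0 D)" for v w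
    by (simp add: mom_def mult_ac)
  show ?thesis unfolding 1 2
    using sw[of "Inl [t, u]" "Inl [r, s]"] sw[of "Inl [t]" "Inl [u, r, s]"] sw[of "Inl [u]" "Inl [t, r, s]"]
      mean_mom[OF theta0, of "Inl [t, u, r, s]"]
    by (simp add: E_c2 idx_upto_def mean_score)
qed

end

section \<open>The likelihood ratio polynomial\<close>

text \<open>
  \<open>C\<close> is the class of admissible coefficients: all numbers when only integrability matters, and those of
  order \<open>O\<^sub>p(1)\<close> that depend on the sample through the conditioning statistic when remainders are compared.
\<close>
locale coeff_ring =
  fixes C :: "('k \<Rightarrow> real) \<Rightarrow> bool"
  assumes C_const: "C (\<lambda>_. a)" and C_add: "C f \<Longrightarrow> C g \<Longrightarrow> C (\<lambda>k. f k + g k)" and C_mult: "C f \<Longrightarrow> C g \<Longrightarrow> C (\<lambda>k. f k * g k)"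
begin

lemma C_sum: "finite I \<Longrightarrow> (\<And>i. i \<in> I \<Longrightarrow> C (f i)) \<Longrightarrow> C (\<lambda>k. \<Sum>i\<in>I. f i k)"
  by (induction I rule: finite_induct) (auto intro: C_const C_add)

text \<open>
  Monomials are lists rather than multisets.  The coefficients are then not unique, but
  multiplication is concatenation.
\<close>
definition polyd :: "'i set \<Rightarrow> ('i \<Rightarrow> 'k \<Rightarrow> 'z \<Rightarrow> real) \<Rightarrow> nat \<Rightarrow> ('k \<Rightarrow> 'z \<Rightarrow> real) \<Rightarrow> bool" where
  "polyd J Z d X \<longleftrightarrow> (\<exists>c. (\<forall>m. C (c m)) \<and>
     (\<forall>k z. X k z = (\<Sum>m | set m \<subseteq> J \<and> length m \<le> d. c m k * (\<Prod>v\<leftarrow>m. Z v k z))))"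

lemma polyd_mono:
  assumes J: "finite J" and X: "polyd J Z d X" and le: "d \<le> d'"
  shows "polyd J Z d' X"
proof -
  obtain c where c: "\<And>m. C (c m)" "\<And>k z. X k z = (\<Sum>m | set m \<subseteq> J \<and> length m \<le> d. c m k * (\<Prod>v\<leftarrow>m. Z v k z))"
    using X unfolding polyd_def by blast
  have "X k z = (\<Sum>m | set m \<subseteq> J \<and> length m \<le> d'. (if length m \<le> d then c m k else 0) * (\<Prod>v\<leftarrow>m. Z v k z))" for k z
    unfolding c(2) using le finite_lists_length_le[OF J, of d']
    by (intro sum.mono_neutral_cong_left) auto
  moreover have "C (\<lambda>k. if length m \<le> d then c m k else 0)" for m
    using c(1) C_const by (cases "length m \<le> d") auto
  ultimately show ?thesis unfolding polyd_def by (intro exI[of _ "\<lambda>m k. if length m \<le> d then c m k else 0"]) blast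
qed

lemma polyd_const:
  assumes J: "finite J" and a: "C a" shows "polyd J Z d (\<lambda>k z. a k)"
proof -
  have "a k = (\<Sum>m | set m \<subseteq> J \<and> length m \<le> d. (if m = [] then a k else 0) * (\<Prod>v\<leftarrow>m. Z v k z))" for k z
  proof -
    have "(\<Sum>m | set m \<subseteq> J \<and> length m \<le> d. (if m = [] then a k else 0) * (\<Prod>v\<leftarrow>m. Z v k z))
      = (\<Sum>m | set m \<subseteq> J \<and> length m \<le> d. if m = [] then a k else 0)" by (intro sum.cong) auto
    then show ?thesis using finite_lists_length_le[OF J, of d] by simp
  qed
  moreover have "C (\<lambda>k. if m = [] then a k else 0)" for m :: "'i list"
    using a C_const by (cases "m = []") auto
  ultimately show ?thesis unfolding polyd_def by (intro exI[of _ "\<lambda>m k. if m = [] then a k else 0"]) blast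
qed

lemma polyd_var:
  assumes J: "finite J" and v: "v \<in> J" and d: "1 \<le> d" shows "polyd J Z d (Z v)"
proof -
  have "Z v k z = (\<Sum>m | set m \<subseteq> J \<and> length m \<le> d. (if m = [v] then 1 else 0) * (\<Prod>v\<leftarrow>m. Z v k z))" for k z
  proof -
    have "(\<Sum>m | set m \<subseteq> J \<and> length m \<le> d. (if m = [v] then 1 else 0) * (\<Prod>v\<leftarrow>m. Z v k z))
      = (\<Sum>m | set m \<subseteq> J \<and> length m \<le> d. if m = [v] then Z v k z else 0)" by (intro sum.cong) auto
    then show ?thesis using finite_lists_length_le[OF J, of d] v d by simp
  qed
  moreover have "C (\<lambda>k. if m = [v] then 1 else 0)" for m
    using C_const by (cases "m = [v]") auto
  ultimately show ?thesis unfolding polyd_def by (intro exI[of _ "\<lambda>m k. if m = [v] then 1 else 0"]) blast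
qed

lemma polyd_add:
  assumes "polyd J Z d X" "polyd J Z d Y" shows "polyd J Z d (\<lambda>k z. X k z + Y k z)"
proof -
  obtain c where c: "\<And>m. C (c m)" "\<And>k z. X k z = (\<Sum>m | set m \<subseteq> J \<and> length m \<le> d. c m k * (\<Prod>v\<leftarrow>m. Z v k z))"
    using assms unfolding polyd_def by blast
  obtain c' where c': "\<And>m. C (c' m)" "\<And>k z. Y k z = (\<Sum>m | set m \<subseteq> J \<and> length m \<le> d. c' m k * (\<Prod>v\<leftarrow>m. Z v k z))"
    using assms unfolding polyd_def by blast
  show ?thesis unfolding polyd_def c(2) c'(2)
    by (rule exI[of _ "\<lambda>m k. c m k + c' m k"]) (use c(1) c'(1) in \<open>auto intro: C_add simp: distrib_right sum.distrib\<close>)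
qed

lemma polyd_sum:
  assumes "finite J" "finite I" "\<And>i. i \<in> I \<Longrightarrow> polyd J Z d (X i)" shows "polyd J Z d (\<lambda>k z. \<Sum>i\<in>I. X i k z)"
  using assms(2,3)
proof (induction I rule: finite_induct)
  case empty then show ?case using polyd_const[OF assms(1) C_const[of 0]] by simp
qed (auto intro: polyd_add)

lemma polyd_mult:
  assumes J: "finite J" and "polyd J Z d1 X" "polyd J Z d2 Y" shows "polyd J Z (d1 + d2) (\<lambda>k z. X k z * Y k z)"
proof -
  obtain c where c: "\<And>m. C (c m)" "\<And>k z. X k z = (\<Sum>m | set m \<subseteq> J \<and> length m \<le> d1. c m k * (\<Prod>v\<leftarrow>m. Z v k z))"
    using assms unfolding polyd_def by blast
  obtain c' where c': "\<And>m. C (c' m)" "\<And>k z. Y k z = (\<Sum>m | set m \<subseteq> J \<and> length m \<le> d2. c' m k * (\<Prod>v\<leftarrow>m. Z v k z))"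
    using assms unfolding polyd_def by blast
  let ?L = "\<lambda>d. {m. set m \<subseteq> J \<and> length m \<le> d}"
  have fin: "finite (?L d)" for d using finite_lists_length_le[OF J] .
  let ?I = "\<lambda>m. {p \<in> ?L d1 \<times> ?L d2. fst p @ snd p = m}"
  define e where "e m k = (\<Sum>p\<in>?I m. c (fst p) k * c' (snd p) k)" for m k
  have Ce: "C (e m)" for m
    unfolding e_def using fin by (intro C_sum C_mult c(1) c'(1)) auto
  have "X k z * Y k z = (\<Sum>m\<in>?L (d1 + d2). e m k * (\<Prod>v\<leftarrow>m. Z v k z))" for k z
  proof -
    have "X k z * Y k z = (\<Sum>p\<in>?L d1 \<times> ?L d2. c (fst p) k * c' (snd p) k * (\<Prod>v\<leftarrow>fst p @ snd p. Z v k z))"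
      unfolding c(2) c'(2) sum_product sum.cartesian_product by (simp add: case_prod_beta mult_ac)
    also have "\<dots> = (\<Sum>m\<in>?L (d1 + d2). \<Sum>p\<in>?I m. c (fst p) k * c' (snd p) k * (\<Prod>v\<leftarrow>fst p @ snd p. Z v k z))"
      by (rule sum.group[symmetric]) (use fin in \<open>auto\<close>)
    also have "\<dots> = (\<Sum>m\<in>?L (d1 + d2). e m k * (\<Prod>v\<leftarrow>m. Z v k z))"
      unfolding e_def sum_distrib_right by (intro sum.cong refl) auto
    finally show ?thesis .
  qed
  then show ?thesis unfolding polyd_def using Ce by blast
qed

lemma polyd_cmult:
  assumes "finite J" "C a" "polyd J Z d X" shows "polyd J Z d (\<lambda>k z. a k * X k z)"
  using polyd_mult[OF assms(1) polyd_const[OF assms(1,2), of _ 0] assms(3)] by simp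

end

text \<open>
  The functions \<open>h\<close>, \<open>g\<close> and \<open>P\<close> of the expansion of a maximum, at a single point of the filter.
\<close>
definition lr_h where "lr_h G Z1 r = - (\<Sum>s\<in>UNIV. G r s * Z1 s)" for Z1 :: "'r::finite \<Rightarrow> real"
definition lr_g where "lr_g Z2 \<mu>3 \<beta> h r = (\<Sum>s\<in>UNIV. Z2 r s * h s) + (\<Sum>s\<in>UNIV. \<Sum>t\<in>UNIV. \<mu>3 r s t * h s * h t) / 2 + \<beta> r"
  for h :: "'r::finite \<Rightarrow> real"

definition lr_poly :: "real \<Rightarrow> ('r::finite \<Rightarrow> 'r \<Rightarrow> real) \<Rightarrow> ('r \<Rightarrow> 'r \<Rightarrow> 'r \<Rightarrow> real) \<Rightarrow> ('r \<Rightarrow> 'r \<Rightarrow> 'r \<Rightarrow> 'r \<Rightarrow> real) \<Rightarrow>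
    ('r \<Rightarrow> real) \<Rightarrow> ('r \<Rightarrow> 'r \<Rightarrow> real) \<Rightarrow> ('r \<Rightarrow> real) \<Rightarrow> ('r \<Rightarrow> 'r \<Rightarrow> real) \<Rightarrow> ('r \<Rightarrow> 'r \<Rightarrow> 'r \<Rightarrow> real) \<Rightarrow> ('r \<Rightarrow> real) \<Rightarrow> real" where
  "lr_poly d G \<mu>3 \<mu>4 \<beta> \<beta>2 Z1 Z2 Z3 Zb = (let h = lr_h G Z1; g = lr_g Z2 \<mu>3 \<beta> h in
     - form2 G Z1 Z1 + d * (form2 Z2 h h + form3 \<mu>3 h h h / 3 + 2 * form1 \<beta> h)
     + d\<^sup>2 * (form3 Z3 h h h / 3 + form4 \<mu>4 h h h h / 12 + 2 * form1 Zb h + form2 \<beta>2 h h - form2 G g g))"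

lemma (in lik_expansion) P_eq_lr_poly:
  "P w = lr_poly (\<delta> w) (\<lambda>r s. G r s w) (\<lambda>r s t. \<mu>3 r s t w) (\<lambda>r s t z. \<mu>4 r s t z w) (\<lambda>r. \<beta> r w) (\<lambda>r s. \<beta>2 r s w)
     (\<lambda>r. Z1 r w) (\<lambda>r s. Z2 r s w) (\<lambda>r s t. Z3 r s t w) (\<lambda>r. Zb r w)"
proof -
  have h: "lr_h (\<lambda>r s. G r s w) (\<lambda>r. Z1 r w) = (\<lambda>r. h r w)" by (simp add: lr_h_def h_def fun_eq_iff)
  have g: "lr_g (\<lambda>r s. Z2 r s w) (\<lambda>r s t. \<mu>3 r s t w) (\<lambda>r. \<beta> r w) (\<lambda>r. h r w) = (\<lambda>r. g r w)"
    by (simp add: lr_g_def g_def fun_eq_iff)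
  show ?thesis unfolding lr_poly_def Let_def h g P_def q1_def q2_def by simp
qed

context coeff_ring begin

lemma polyd_lr_poly:
  fixes Z1 :: "'r::finite \<Rightarrow> 'k \<Rightarrow> 'z \<Rightarrow> real"
  assumes J: "finite J"
    and C: "C d" "\<And>r s. C (G r s)" "\<And>r s t. C (\<mu>3 r s t)" "\<And>r s t u. C (\<mu>4 r s t u)" "\<And>r. C (\<beta> r)" "\<And>r s. C (\<beta>2 r s)"
    and Z: "\<And>r. polyd J Z 1 (Z1 r)" "\<And>r s. polyd J Z 1 (Z2 r s)" "\<And>r s t. polyd J Z 1 (Z3 r s t)" "\<And>r. polyd J Z 1 (Zb r)"
  shows "polyd J Z 4 (\<lambda>k z. lr_poly (d k) (\<lambda>r s. G r s k) (\<lambda>r s t. \<mu>3 r s t k) (\<lambda>r s t u. \<mu>4 r s t u k) (\<lambda>r. \<beta> r k) (\<lambda>r s. \<beta>2 r s k)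
     (\<lambda>r. Z1 r k z) (\<lambda>r s. Z2 r s k z) (\<lambda>r s t. Z3 r s t k z) (\<lambda>r. Zb r k z))"
proof -
  define h where "h r k z = lr_h (\<lambda>r s. G r s k) (\<lambda>r. Z1 r k z) r" for r k z
  define g where "g r k z = lr_g (\<lambda>r s. Z2 r s k z) (\<lambda>r s t. \<mu>3 r s t k) (\<lambda>r. \<beta> r k) (\<lambda>r. h r k z) r" for r k z
  note cm = polyd_cmult[OF J] and sm = polyd_sum[OF J finite] and ad = polyd_add
  note mu = polyd_mult[OF J]
  have cs: "polyd J Z d X \<Longrightarrow> polyd J Z d (\<lambda>k z. c * X k z)" for d X and c :: real
    by (rule cm[OF C_const])
  have mn: "polyd J Z d X \<Longrightarrow> d \<le> 4 \<Longrightarrow> polyd J Z 4 X" for d X by (rule polyd_mono[OF J])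
  have h: "polyd J Z 1 (h r)" for r
  proof -
    have "polyd J Z 1 (\<lambda>k z. (-1) * (\<Sum>s\<in>UNIV. G r s k * Z1 s k z))" by (intro cs sm cm C Z)
    moreover have "(\<lambda>k z. (-1) * (\<Sum>s\<in>UNIV. G r s k * Z1 s k z)) = h r" by (simp add: h_def lr_h_def fun_eq_iff)
    ultimately show ?thesis by metis
  qed
  have hh: "polyd J Z 2 (\<lambda>k z. h r k z * h s k z)" for r s using mu[OF h h] by (simp add: numeral_2_eq_2)
  have hhh: "polyd J Z 3 (\<lambda>k z. h r k z * h s k z * h t k z)" for r s t using mu[OF hh h] by simp
  have hhhh: "polyd J Z 4 (\<lambda>k z. h r k z * h s k z * h t k z * h u k z)" for r s t u using mu[OF hhh h] by simp
  have g: "polyd J Z 2 (g r)" for r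
  proof -
    have zh: "polyd J Z 2 (\<lambda>k z. Z2 r s k z * h s k z)" for s using mu[OF Z(2) h] by (simp add: numeral_2_eq_2)
    have "polyd J Z 2 (\<lambda>k z. (\<Sum>s\<in>UNIV. Z2 r s k z * h s k z)
       + (1/2) * (\<Sum>s\<in>UNIV. \<Sum>t\<in>UNIV. \<mu>3 r s t k * (h s k z * h t k z)) + \<beta> r k)"
      by (intro ad cs sm cm C zh hh polyd_const[OF J])
    moreover have "(\<lambda>k z. (\<Sum>s\<in>UNIV. Z2 r s k z * h s k z)
       + (1/2) * (\<Sum>s\<in>UNIV. \<Sum>t\<in>UNIV. \<mu>3 r s t k * (h s k z * h t k z)) + \<beta> r k) = g r"
      by (simp add: g_def lr_g_def fun_eq_iff mult.assoc)
    ultimately show ?thesis by metis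
  qed
  have zz: "polyd J Z 4 (\<lambda>k z. Z1 r k z * Z1 s k z)" for r s by (rule mn[OF mu[OF Z(1) Z(1)]]) simp
  have z2hh: "polyd J Z 4 (\<lambda>k z. Z2 r s k z * (h r k z * h s k z))" for r s by (rule mn[OF mu[OF Z(2) hh]]) simp
  have z3hhh: "polyd J Z 4 (\<lambda>k z. Z3 r s t k z * (h r k z * h s k z * h t k z))" for r s t by (rule mn[OF mu[OF Z(3) hhh]]) simp
  have zbh: "polyd J Z 4 (\<lambda>k z. Zb r k z * h r k z)" for r by (rule mn[OF mu[OF Z(4) h]]) simp
  have gg: "polyd J Z 4 (\<lambda>k z. g r k z * g s k z)" for r s by (rule mn[OF mu[OF g g]]) simp
  note h4 = mn[OF h] and hh4 = mn[OF hh] and hhh4 = mn[OF hhh]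
  have "polyd J Z 4 (\<lambda>k z. (-1) * (\<Sum>r\<in>UNIV. \<Sum>s\<in>UNIV. G r s k * (Z1 r k z * Z1 s k z))
     + (d k * ((\<Sum>r\<in>UNIV. \<Sum>s\<in>UNIV. Z2 r s k z * (h r k z * h s k z))
        + (1/3) * (\<Sum>r\<in>UNIV. \<Sum>s\<in>UNIV. \<Sum>t\<in>UNIV. \<mu>3 r s t k * (h r k z * h s k z * h t k z))
        + 2 * (\<Sum>r\<in>UNIV. \<beta> r k * h r k z))
     + d k * (d k * ((1/3) * (\<Sum>r\<in>UNIV. \<Sum>s\<in>UNIV. \<Sum>t\<in>UNIV. Z3 r s t k z * (h r k z * h s k z * h t k z))
        + (1/12) * (\<Sum>r\<in>UNIV. \<Sum>s\<in>UNIV. \<Sum>t\<in>UNIV. \<Sum>u\<in>UNIV. \<mu>4 r s t u k * (h r k z * h s k z * h t k z * h u k z))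
        + 2 * (\<Sum>r\<in>UNIV. Zb r k z * h r k z)
        + (\<Sum>r\<in>UNIV. \<Sum>s\<in>UNIV. \<beta>2 r s k * (h r k z * h s k z))
        + (-1) * (\<Sum>r\<in>UNIV. \<Sum>s\<in>UNIV. G r s k * (g r k z * g s k z))))))"
    by (intro ad cs sm cm C zz z2hh z3hhh zbh gg h4 hh4 hhh4 hhhh) simp_all
  moreover have "lr_poly (d k) (\<lambda>r s. G r s k) (\<lambda>r s t. \<mu>3 r s t k) (\<lambda>r s t u. \<mu>4 r s t u k) (\<lambda>r. \<beta> r k) (\<lambda>r s. \<beta>2 r s k)
     (\<lambda>r. Z1 r k z) (\<lambda>r s. Z2 r s k z) (\<lambda>r s t. Z3 r s t k z) (\<lambda>r. Zb r k z)
    = (-1) * (\<Sum>r\<in>UNIV. \<Sum>s\<in>UNIV. G r s k * (Z1 r k z * Z1 s k z))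
     + (d k * ((\<Sum>r\<in>UNIV. \<Sum>s\<in>UNIV. Z2 r s k z * (h r k z * h s k z))
        + (1/3) * (\<Sum>r\<in>UNIV. \<Sum>s\<in>UNIV. \<Sum>t\<in>UNIV. \<mu>3 r s t k * (h r k z * h s k z * h t k z))
        + 2 * (\<Sum>r\<in>UNIV. \<beta> r k * h r k z))
     + d k * (d k * ((1/3) * (\<Sum>r\<in>UNIV. \<Sum>s\<in>UNIV. \<Sum>t\<in>UNIV. Z3 r s t k z * (h r k z * h s k z * h t k z))
        + (1/12) * (\<Sum>r\<in>UNIV. \<Sum>s\<in>UNIV. \<Sum>t\<in>UNIV. \<Sum>u\<in>UNIV. \<mu>4 r s t u k * (h r k z * h s k z * h t k z * h u k z))
        + 2 * (\<Sum>r\<in>UNIV. Zb r k z * h r k z)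
        + (\<Sum>r\<in>UNIV. \<Sum>s\<in>UNIV. \<beta>2 r s k * (h r k z * h s k z))
        + (-1) * (\<Sum>r\<in>UNIV. \<Sum>s\<in>UNIV. G r s k * (g r k z * g s k z)))))" for k z
    unfolding lr_poly_def Let_def h_def[symmetric] g_def[symmetric] form1_def form2_def form3_def form4_def
    by (simp add: mult.assoc power2_eq_square algebra_simps)
  ultimately show ?thesis by (simp only:)
qed

end

text \<open>
  The fourth joint cumulant of centred variables.
\<close>
definition kappa4 :: "'z measure \<Rightarrow> ('z \<Rightarrow> real) \<Rightarrow> ('z \<Rightarrow> real) \<Rightarrow> ('z \<Rightarrow> real) \<Rightarrow> ('z \<Rightarrow> real) \<Rightarrow> real" where
  "kappa4 M X Y U V = (\<integral>z. X z * Y z * U z * V z \<partial>M) - (\<integral>z. X z * Y z \<partial>M) * (\<integral>z. U z * V z \<partial>M)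
     - (\<integral>z. X z * U z \<partial>M) * (\<integral>z. Y z * V z \<partial>M) - (\<integral>z. X z * V z \<partial>M) * (\<integral>z. Y z * U z \<partial>M)"

lemma kappa4_swap: "kappa4 M X Y U V = kappa4 M Y X U V" "kappa4 M X Y U V = kappa4 M X U Y V" "kappa4 M X Y U V = kappa4 M X Y V U"
  by (simp_all add: kappa4_def mult_ac)

section \<open>Expectation of the likelihood ratio polynomial\<close>

definition raise_index where "raise_index G K t = - (\<Sum>u\<in>UNIV. G t u * K u)" for K :: "'r::finite \<Rightarrow> real"

text \<open>
  The part of \<open>E(g\<^sub>r g\<^sub>s)\<close> that depends only on means and on the covariances \<open>C2\<close> of second derivatives with \<open>h\<close>;
  the rest consists of covariances of second derivatives and of fourth cumulants.
\<close>
definition omega_grad where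
  "omega_grad G \<mu>3 \<beta> C2 r s =
     (\<Sum>t\<in>UNIV. \<Sum>u\<in>UNIV. C2 r t t * C2 s u u + C2 r t u * C2 s u t)
     - (\<Sum>t\<in>UNIV. \<Sum>u\<in>UNIV. \<Sum>v\<in>UNIV. \<mu>3 s u v * (C2 r t t * G u v + C2 r t u * G t v + C2 r t v * G t u)) / 2
     - (\<Sum>t\<in>UNIV. \<Sum>u\<in>UNIV. \<Sum>v\<in>UNIV. \<mu>3 r u v * (C2 s t t * G u v + C2 s t u * G t v + C2 s t v * G t u)) / 2
     + (\<Sum>t\<in>UNIV. \<Sum>u\<in>UNIV. \<Sum>v\<in>UNIV. \<Sum>w\<in>UNIV. \<mu>3 r t u * \<mu>3 s v w * (G t u * G v w + G t v * G u w + G t w * G u v)) / 4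
     + \<beta> s * ((\<Sum>t\<in>UNIV. C2 r t t) - (\<Sum>t\<in>UNIV. \<Sum>u\<in>UNIV. \<mu>3 r t u * G t u) / 2)
     + \<beta> r * ((\<Sum>t\<in>UNIV. C2 s t t) - (\<Sum>t\<in>UNIV. \<Sum>u\<in>UNIV. \<mu>3 s t u * G t u) / 2)
     + \<beta> r * \<beta> s"
  for G :: "'r::finite \<Rightarrow> 'r \<Rightarrow> real"

text \<open>
  The coefficient of \<open>d\<^sup>2\<close> in the expectation of \<open>lr_poly\<close>.  \<open>K2\<close>, \<open>K3\<close> and \<open>Kb\<close> are the covariances of \<open>Z2\<close>, \<open>Z3\<close>
  and \<open>Zb\<close> with the score \<open>Z1\<close>, \<open>k3\<close> is the third moment of the score divided by \<open>d\<close>, and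
  \<open>Q r s t u = E(Z2 r s Z1 t Z1 u) / d + E(Z2 r s Z2 t u)\<close>.
\<close>
definition omega where
  "omega G \<mu>3 \<mu>4 \<beta> \<beta>2 K2 K3 Kb k3 Q =
     (\<Sum>r\<in>UNIV. \<Sum>s\<in>UNIV. \<Sum>t\<in>UNIV. \<Sum>u\<in>UNIV. G r t * G s u * Q r s t u)
     - (\<Sum>r\<in>UNIV. \<Sum>s\<in>UNIV. \<Sum>t\<in>UNIV. \<mu>3 r s t * (\<Sum>a\<in>UNIV. \<Sum>b\<in>UNIV. \<Sum>c\<in>UNIV. G r a * G s b * G t c * k3 a b c)) / 3
     - (\<Sum>r\<in>UNIV. \<Sum>s\<in>UNIV. \<Sum>t\<in>UNIV. raise_index G (K3 r s t) r * G s t + raise_index G (K3 r s t) s * G r t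
          + raise_index G (K3 r s t) t * G r s) / 3
     + (\<Sum>r\<in>UNIV. \<Sum>s\<in>UNIV. \<Sum>t\<in>UNIV. \<Sum>u\<in>UNIV. \<mu>4 r s t u * (G r s * G t u + G r t * G s u + G r u * G s t)) / 12
     + 2 * (\<Sum>r\<in>UNIV. raise_index G (Kb r) r)
     - (\<Sum>r\<in>UNIV. \<Sum>s\<in>UNIV. \<beta>2 r s * G r s)
     - (\<Sum>r\<in>UNIV. \<Sum>s\<in>UNIV. G r s * omega_grad G \<mu>3 \<beta> (\<lambda>r s. raise_index G (K2 r s)) r s)"
  for G :: "'r::finite \<Rightarrow> 'r \<Rightarrow> real"

text \<open>
  The contribution of the fourth cumulants to the expectation, of smaller order than \<open>omega\<close>.
\<close>
definition lr_rem_grad where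
  "lr_rem_grad M \<mu>3 h Z2 r s = (\<Sum>t\<in>UNIV. \<Sum>u\<in>UNIV. kappa4 M (Z2 r t) (h t) (Z2 s u) (h u))
   + (\<Sum>t\<in>UNIV. \<Sum>u\<in>UNIV. \<Sum>v\<in>UNIV. \<mu>3 s u v * kappa4 M (Z2 r t) (h t) (h u) (h v)) / 2
   + (\<Sum>t\<in>UNIV. \<Sum>u\<in>UNIV. \<Sum>v\<in>UNIV. \<mu>3 r u v * kappa4 M (Z2 s t) (h t) (h u) (h v)) / 2
   + (\<Sum>t\<in>UNIV. \<Sum>u\<in>UNIV. \<Sum>v\<in>UNIV. \<Sum>w\<in>UNIV. \<mu>3 r t u * \<mu>3 s v w * kappa4 M (h t) (h u) (h v) (h w)) / 4"
  for h :: "'r::finite \<Rightarrow> 'z \<Rightarrow> real"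

definition lr_rem where
  "lr_rem M G \<mu>3 \<mu>4 h Z2 Z3 = (\<Sum>r\<in>UNIV. \<Sum>s\<in>UNIV. \<Sum>t\<in>UNIV. kappa4 M (Z3 r s t) (h r) (h s) (h t)) / 3
  + (\<Sum>r\<in>UNIV. \<Sum>s\<in>UNIV. \<Sum>t\<in>UNIV. \<Sum>u\<in>UNIV. \<mu>4 r s t u * kappa4 M (h r) (h s) (h t) (h u)) / 12
  - (\<Sum>r\<in>UNIV. \<Sum>s\<in>UNIV. G r s * lr_rem_grad M \<mu>3 h Z2 r s)"
  for h :: "'r::finite \<Rightarrow> 'z \<Rightarrow> real"

lemma sum_product12: "(\<Sum>t\<in>A. f t) * (\<Sum>u\<in>B. \<Sum>v\<in>C. g u v) = (\<Sum>t\<in>A. \<Sum>u\<in>B. \<Sum>v\<in>C. f t * (g u v :: real))"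
  by (simp add: sum_distrib_left[symmetric] sum_distrib_right[symmetric])
lemma sum_product22: "(\<Sum>t\<in>A. \<Sum>u\<in>B. f t u) * (\<Sum>v\<in>C. \<Sum>w\<in>E. g v w) = (\<Sum>t\<in>A. \<Sum>u\<in>B. \<Sum>v\<in>C. \<Sum>w\<in>E. f t u * (g v w :: real))"
  by (simp add: sum_distrib_left[symmetric] sum_distrib_right[symmetric])
lemma sum_product3: "(\<Sum>t\<in>A. f t) * (\<Sum>u\<in>B. g u) * (\<Sum>v\<in>C. x v) = (\<Sum>t\<in>A. \<Sum>u\<in>B. \<Sum>v\<in>C. f t * g u * (x v :: real))"
  by (simp add: sum_distrib_left[symmetric] sum_distrib_right[symmetric] mult.assoc)

text \<open>
  The assumption \<open>mixed\<close> is the definition of \<open>Q\<close>, solved for the third moment.  The set \<open>atoms\<close> contains the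
  variables whose products of up to four factors have to be integrable.
\<close>
locale moments = prob_space M for M :: "'z measure" +
  fixes S :: "'r::finite set" and d :: real and G \<Lambda> :: "'r \<Rightarrow> 'r \<Rightarrow> real" and \<mu>3 :: "'r \<Rightarrow> 'r \<Rightarrow> 'r \<Rightarrow> real"
    and \<mu>4 :: "'r \<Rightarrow> 'r \<Rightarrow> 'r \<Rightarrow> 'r \<Rightarrow> real" and \<beta> :: "'r \<Rightarrow> real" and \<beta>2 :: "'r \<Rightarrow> 'r \<Rightarrow> real"
    and Z1 Zb :: "'r \<Rightarrow> 'z \<Rightarrow> real" and Z2 :: "'r \<Rightarrow> 'r \<Rightarrow> 'z \<Rightarrow> real" and Z3 :: "'r \<Rightarrow> 'r \<Rightarrow> 'r \<Rightarrow> 'z \<Rightarrow> real"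
    and k3 :: "'r \<Rightarrow> 'r \<Rightarrow> 'r \<Rightarrow> real" and Q :: "'r \<Rightarrow> 'r \<Rightarrow> 'r \<Rightarrow> 'r \<Rightarrow> real"
    and atoms :: "('z \<Rightarrow> real) set"
  assumes fin: "finite atoms" and atoms: "\<And>r. Z1 r \<in> atoms" "\<And>r. Zb r \<in> atoms" "\<And>r s. Z2 r s \<in> atoms" "\<And>r s t. Z3 r s t \<in> atoms"
    and int: "\<And>fs. length fs \<le> 4 \<Longrightarrow> set fs \<subseteq> atoms \<Longrightarrow> integrable M (\<lambda>z. \<Prod>f\<leftarrow>fs. f z)"
    and centred: "\<And>r. expectation (Z1 r) = 0"
    and cov: "\<And>r s. expectation (\<lambda>z. Z1 r z * Z1 s z) = - \<Lambda> r s"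
    and third: "\<And>r s t. expectation (\<lambda>z. Z1 r z * Z1 s z * Z1 t z) = d * k3 r s t"
    and mixed: "\<And>r s t u. expectation (\<lambda>z. Z2 r s z * Z1 t z * Z1 u z) = d * (Q r s t u - expectation (\<lambda>z. Z2 r s z * Z2 t u z))"
    and G_off: "\<And>r s. r \<notin> S \<or> s \<notin> S \<Longrightarrow> G r s = 0"
    and G_inv: "\<And>r t. r \<in> S \<Longrightarrow> t \<in> S \<Longrightarrow> (\<Sum>s\<in>UNIV. \<Lambda> r s * G s t) = (if r = t then 1 else 0)"
begin

lemma \<Lambda>_sym: "\<Lambda> r s = \<Lambda> s r"
  using cov[of r s] cov[of s r] by (simp add: mult.commute)

lemma G_inv': "(\<Sum>u\<in>UNIV. x u * (\<Sum>s\<in>UNIV. \<Lambda> u s * G s t)) = x t" if "\<And>u. u \<notin> S \<Longrightarrow> x u = 0" "t \<in> S"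
proof -
  have "(\<Sum>u\<in>UNIV. x u * (\<Sum>s\<in>UNIV. \<Lambda> u s * G s t)) = (\<Sum>u\<in>UNIV. if u = t then x u else 0)"
  proof (rule sum.cong[OF refl])
    fix u show "x u * (\<Sum>s\<in>UNIV. \<Lambda> u s * G s t) = (if u = t then x u else 0)"
      using that G_inv[of u t] by (cases "u \<in> S") auto
  qed
  then show ?thesis by simp
qed

lemma G_sym: "G r t = G t r"
proof (cases "r \<in> S \<and> t \<in> S")
  case True
  have "G t r = (\<Sum>u\<in>UNIV. G u r * (\<Sum>s\<in>UNIV. \<Lambda> u s * G s t))"
    using True G_off by (subst G_inv') auto
  also have "\<dots> = (\<Sum>u\<in>UNIV. \<Sum>s\<in>UNIV. G u r * \<Lambda> u s * G s t)" by (simp add: sum_distrib_left mult.assoc)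
  also have "\<dots> = (\<Sum>s\<in>UNIV. G s t * (\<Sum>u\<in>UNIV. \<Lambda> s u * G u r))"
    by (subst sum.swap) (simp add: sum_distrib_left \<Lambda>_sym mult_ac)
  also have "\<dots> = G r t" using True G_off by (subst G_inv') auto
  finally show ?thesis ..
qed (auto simp: G_off)

text \<open>
  Polynomials in the atoms with arbitrary real coefficients; the coefficients have no argument to depend on,
  whence the type \<open>unit\<close>.
\<close>
definition pol :: "nat \<Rightarrow> ('z \<Rightarrow> real) \<Rightarrow> bool" where
  "pol k X = coeff_ring.polyd (\<lambda>_::unit \<Rightarrow> real. True) atoms (\<lambda>f _ z. f z) k (\<lambda>_. X)"

sublocale T: coeff_ring "\<lambda>_::unit \<Rightarrow> real. True" by standard auto

lemma pol_integrable: "pol 4 X \<Longrightarrow> integrable M X"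
proof -
  assume "pol 4 X"
  then obtain c where c: "\<And>z. X z = (\<Sum>m | set m \<subseteq> atoms \<and> length m \<le> 4. c m () * (\<Prod>v\<leftarrow>m. v z))"
    unfolding pol_def T.polyd_def by blast
  have "integrable M (\<lambda>z. \<Sum>m | set m \<subseteq> atoms \<and> length m \<le> 4. c m () * (\<Prod>v\<leftarrow>m. v z))"
    by (intro Bochner_Integration.integrable_sum integrable_mult_right int) auto
  then show ?thesis unfolding c[symmetric] by simp
qed

definition lin :: "('z \<Rightarrow> real) \<Rightarrow> bool" where "lin = pol 1"

lemma pol_mult: "pol i X \<Longrightarrow> pol j Y \<Longrightarrow> pol (i + j) (\<lambda>z. X z * Y z)"
  unfolding pol_def by (rule T.polyd_mult[OF fin])

lemma pol_le: "pol i X \<Longrightarrow> i \<le> 4 \<Longrightarrow> integrable M X"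
  using T.polyd_mono[OF fin, of "\<lambda>f _ z. f z" i "\<lambda>_. X" 4] pol_integrable[of X] unfolding pol_def by blast

lemma int1: "lin X \<Longrightarrow> integrable M X" unfolding lin_def by (rule pol_le[of 1]) auto
lemma int2: "lin X \<Longrightarrow> lin Y \<Longrightarrow> integrable M (\<lambda>z. X z * Y z)"
  unfolding lin_def by (rule pol_le[OF pol_mult]) auto
lemma int3: "lin X \<Longrightarrow> lin Y \<Longrightarrow> lin U \<Longrightarrow> integrable M (\<lambda>z. X z * Y z * U z)"
  unfolding lin_def by (rule pol_le[OF pol_mult[OF pol_mult]]) auto
lemma int4: "lin X \<Longrightarrow> lin Y \<Longrightarrow> lin U \<Longrightarrow> lin V \<Longrightarrow> integrable M (\<lambda>z. X z * Y z * U z * V z)"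
  unfolding lin_def by (rule pol_le[OF pol_mult[OF pol_mult[OF pol_mult]]]) auto

lemma lin_atom: "X \<in> atoms \<Longrightarrow> lin X"
  unfolding lin_def pol_def using T.polyd_var[OF fin, of X 1 "\<lambda>f _ z. f z"] by simp

lemma lin_Z [simp]: "lin (Z1 r)" "lin (Zb r)" "lin (Z2 r s)" "lin (Z3 r s t)"
  by (simp_all add: lin_atom atoms)

definition h where "h r z = lr_h G (\<lambda>r. Z1 r z) r"
lemma h_eq_lr_h: "h = (\<lambda>r z. lr_h G (\<lambda>r. Z1 r z) r)"
  by (simp add: h_def fun_eq_iff)

text \<open>
  The summands of \<open>g\<close> that are quadratic in the variables.
\<close>
definition a where "a r z = (\<Sum>s\<in>UNIV. Z2 r s z * h s z)"
definition b where "b r z = (\<Sum>s\<in>UNIV. \<Sum>t\<in>UNIV. \<mu>3 r s t * h s z * h t z) / 2"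

lemma lin_h [simp]: "lin (h r)"
proof -
  have "lin (\<lambda>z. (\<Sum>s\<in>UNIV. (- G r s) * Z1 s z))"
    unfolding pol_def lin_def by (intro T.polyd_sum[OF fin finite] T.polyd_cmult[OF fin]) (use lin_Z(1) in \<open>simp_all add: pol_def lin_def\<close>)
  moreover have "(\<lambda>z. (\<Sum>s\<in>UNIV. (- G r s) * Z1 s z)) = h r" by (simp add: h_def lr_h_def fun_eq_iff sum_negf)
  ultimately show ?thesis by simp
qed

lemma h_eq: "h r z = (\<Sum>s\<in>UNIV. (- G r s) * Z1 s z)"
  by (simp add: h_def lr_h_def sum_negf)

lemma intc:
  "lin X \<Longrightarrow> integrable M (\<lambda>z. k * X z)"
  "lin X \<Longrightarrow> lin Y \<Longrightarrow> integrable M (\<lambda>z. k * X z * Y z)"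
  "lin X \<Longrightarrow> lin Y \<Longrightarrow> lin U \<Longrightarrow> integrable M (\<lambda>z. k * X z * Y z * U z)"
  "lin X \<Longrightarrow> lin Y \<Longrightarrow> lin U \<Longrightarrow> lin V \<Longrightarrow> integrable M (\<lambda>z. k * X z * Y z * U z * V z)"
  using int1[of X] int2[of X Y] int3[of X Y U] int4[of X Y U V] by (simp_all add: mult.assoc)

lemma Ec:
  fixes k :: real
  shows "expectation (\<lambda>z. k * X z) = k * expectation X"
  "expectation (\<lambda>z. k * X z * Y z) = k * expectation (\<lambda>z. X z * Y z)"
  "expectation (\<lambda>z. k * X z * Y z * U z) = k * expectation (\<lambda>z. X z * Y z * U z)"
  "expectation (\<lambda>z. k * X z * Y z * U z * V z) = k * expectation (\<lambda>z. X z * Y z * U z * V z)"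
  by (simp_all add: mult.assoc)

lemma E4: "expectation (\<lambda>z. X z * Y z * U z * V z) = kappa4 M X Y U V + expectation (\<lambda>z. X z * Y z) * expectation (\<lambda>z. U z * V z)
   + expectation (\<lambda>z. X z * U z) * expectation (\<lambda>z. Y z * V z) + expectation (\<lambda>z. X z * V z) * expectation (\<lambda>z. Y z * U z)"
  by (simp add: kappa4_def)

lemma kappa4_h:
  assumes "lin Y" "lin U" "lin V"
  shows "kappa4 M (h r) Y U V = (\<Sum>s\<in>UNIV. (- G r s) * kappa4 M (Z1 s) Y U V)"
proof -
  have 4: "expectation (\<lambda>z. h r z * Y z * U z * V z) = (\<Sum>s\<in>UNIV. (- G r s) * expectation (\<lambda>z. Z1 s z * Y z * U z * V z))"
    using assms by (simp add: h_eq sum_distrib_right intc(4) Ec(4) sum_negf)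
  have 2: "expectation (\<lambda>z. h r z * X z) = (\<Sum>s\<in>UNIV. (- G r s) * expectation (\<lambda>z. Z1 s z * X z))" if "lin X" for X
    using that by (simp add: h_eq sum_distrib_right intc(2) Ec(2) sum_negf)
  show ?thesis
    unfolding kappa4_def 4 2[OF assms(1)] 2[OF assms(2)] 2[OF assms(3)]
    by (simp add: sum_distrib_right sum_distrib_left right_diff_distrib sum_subtractf sum.distrib sum_negf mult_ac)
qed

lemma E_h: "lin X \<Longrightarrow> expectation (\<lambda>z. X z * h r z) = raise_index G (\<lambda>s. expectation (\<lambda>z. X z * Z1 s z)) r"
proof -
  assume X: "lin X"
  have "expectation (\<lambda>z. X z * h r z) = expectation (\<lambda>z. \<Sum>s\<in>UNIV. (- G r s) * X z * Z1 s z)"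
    by (simp add: h_def lr_h_def sum_distrib_left sum_negf mult_ac)
  also have "\<dots> = (\<Sum>s\<in>UNIV. (- G r s) * expectation (\<lambda>z. X z * Z1 s z))"
    by (subst Bochner_Integration.integral_sum) (simp_all only: intc(2)[OF X lin_Z(1)] Ec)
  finally show ?thesis by (simp add: raise_index_def sum_negf)
qed

text \<open>
  The score has covariance matrix \<open>- \<Lambda>\<close>, and \<open>G \<Lambda> G = G\<close>.
\<close>
lemma E_hh: "expectation (\<lambda>z. h r z * h s z) = - G r s"
proof -
  have *: "expectation (\<lambda>z. h r z * Z1 t z) = (\<Sum>u\<in>UNIV. G r u * \<Lambda> u t)" for t
    using E_h[OF lin_Z(1), of t r] by (simp add: raise_index_def cov sum_negf mult.commute \<Lambda>_sym)
  have "expectation (\<lambda>z. h r z * h s z) = - (\<Sum>t\<in>UNIV. G s t * (\<Sum>u\<in>UNIV. G r u * \<Lambda> u t))"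
    by (simp add: E_h raise_index_def *)
  also have "\<dots> = - (\<Sum>u\<in>UNIV. G r u * (\<Sum>t\<in>UNIV. \<Lambda> u t * G t s))"
    unfolding sum_distrib_left by (subst sum.swap) (simp add: G_sym[of s] mult_ac)
  also have "\<dots> = - G r s"
  proof (cases "s \<in> S")
    case True then show ?thesis using G_off by (subst G_inv') auto
  next
    case False then show ?thesis using G_off by simp
  qed
  finally show ?thesis .
qed

lemma E_Zhh: "lin X \<Longrightarrow> expectation (\<lambda>z. X z * h r z * h s z) = (\<Sum>t\<in>UNIV. \<Sum>u\<in>UNIV. G r t * G s u * expectation (\<lambda>z. X z * Z1 t z * Z1 u z))"
proof -
  assume X: "lin X"
  have "expectation (\<lambda>z. X z * h r z * h s z) = expectation (\<lambda>z. \<Sum>t\<in>UNIV. \<Sum>u\<in>UNIV. (G r t * G s u) * X z * Z1 t z * Z1 u z)"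
    by (rule Bochner_Integration.integral_cong[OF refl]) (unfold mult.assoc h_eq sum_product, simp add: sum_distrib_left mult_ac)
  also have "\<dots> = (\<Sum>t\<in>UNIV. \<Sum>u\<in>UNIV. G r t * G s u * expectation (\<lambda>z. X z * Z1 t z * Z1 u z))"
    by (subst Bochner_Integration.integral_sum Bochner_Integration.integral_sum | simp only: intc(3)[OF X lin_Z(1) lin_Z(1)] Ec Bochner_Integration.integrable_sum)+
  finally show ?thesis .
qed

lemma E_hhh: "expectation (\<lambda>z. h r z * h s z * h t z) = - d * (\<Sum>a\<in>UNIV. \<Sum>b\<in>UNIV. \<Sum>c\<in>UNIV. G r a * G s b * G t c * k3 a b c)"
proof -
  have "expectation (\<lambda>z. h r z * h s z * h t z) = expectation (\<lambda>z. \<Sum>a\<in>UNIV. \<Sum>b\<in>UNIV. \<Sum>c\<in>UNIV. (- (G r a * G s b * G t c)) * Z1 a z * Z1 b z * Z1 c z)"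
    by (rule Bochner_Integration.integral_cong[OF refl]) (simp only: h_eq sum_product3, simp add: mult_ac)
  also have "\<dots> = (\<Sum>a\<in>UNIV. \<Sum>b\<in>UNIV. \<Sum>c\<in>UNIV. (- (G r a * G s b * G t c)) * (d * k3 a b c))"
    by (subst Bochner_Integration.integral_sum | simp only: intc(3)[OF lin_Z(1) lin_Z(1) lin_Z(1)] Ec third Bochner_Integration.integrable_sum)+
  finally show ?thesis by (simp add: sum_distrib_left sum_negf mult_ac)
qed

lemma E_h1: "expectation (h r) = 0"
proof -
  have "expectation (h r) = expectation (\<lambda>z. \<Sum>s\<in>UNIV. (- G r s) * Z1 s z)"
    by (rule Bochner_Integration.integral_cong[OF refl]) (simp add: h_def lr_h_def sum_negf)
  also have "\<dots> = 0"
    by (subst Bochner_Integration.integral_sum) (simp_all only: intc(1)[OF lin_Z(1)] Ec centred mult_zero_right sum.neutral_const)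
  finally show ?thesis .
qed

definition "C2 r s = raise_index G (\<lambda>t. expectation (\<lambda>z. Z2 r s z * Z1 t z))"
definition "C3 r s t = raise_index G (\<lambda>u. expectation (\<lambda>z. Z3 r s t z * Z1 u z))"

lemma E_Z2h: "expectation (\<lambda>z. Z2 r s z * h t z) = C2 r s t" "expectation (\<lambda>z. h t z * Z2 r s z) = C2 r s t"
  using E_h[OF lin_Z(3), of r s t] by (simp_all add: C2_def mult.commute)
lemma E_Z3h: "expectation (\<lambda>z. Z3 r s t z * h u z) = C3 r s t u"
  by (simp add: E_h C3_def)

lemma E_Z2hhh: "expectation (\<lambda>z. Z2 r s z * h t z * h u z * h v z) = kappa4 M (Z2 r s) (h t) (h u) (h v)
    - (C2 r s t * G u v + C2 r s u * G t v + C2 r s v * G t u)"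
  unfolding E4 E_Z2h E_hh by simp
lemma E_Z3hhh: "expectation (\<lambda>z. Z3 r s x z * h t z * h u z * h v z) = kappa4 M (Z3 r s x) (h t) (h u) (h v)
    - (C3 r s x t * G u v + C3 r s x u * G t v + C3 r s x v * G t u)"
  unfolding E4 E_Z3h E_hh by simp
lemma E_hhhh: "expectation (\<lambda>z. h t z * h u z * h v z * h w z) = kappa4 M (h t) (h u) (h v) (h w)
    + (G t u * G v w + G t v * G u w + G t w * G u v)"
  unfolding E4 E_hh by simp

abbreviation "rem_grad \<equiv> lr_rem_grad M \<mu>3 h Z2"

lemma Ea: "integrable M (a r)" "expectation (a r) = (\<Sum>t\<in>UNIV. C2 r t t)"
  unfolding a_def by (auto simp: int2 E_Z2h)

lemma Eb: "integrable M (b r)" "expectation (b r) = - (\<Sum>t\<in>UNIV. \<Sum>u\<in>UNIV. \<mu>3 r t u * G t u) / 2"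
  unfolding b_def by (auto simp: intc(2) Ec(2) E_hh sum_negf)

lemma Eaa: "integrable M (\<lambda>z. a r z * a s z)"
  "expectation (\<lambda>z. a r z * a s z) = (\<Sum>t\<in>UNIV. \<Sum>u\<in>UNIV. kappa4 M (Z2 r t) (h t) (Z2 s u) (h u) + C2 r t t * C2 s u u
     - expectation (\<lambda>z. Z2 r t z * Z2 s u z) * G t u + C2 r t u * C2 s u t)"
proof -
  have *: "(\<lambda>z. a r z * a s z) = (\<lambda>z. \<Sum>t\<in>UNIV. \<Sum>u\<in>UNIV. Z2 r t z * h t z * Z2 s u z * h u z)"
    by (simp add: a_def sum_product mult.assoc fun_eq_iff)
  show "integrable M (\<lambda>z. a r z * a s z)" unfolding * by (auto simp: int4)
  show "expectation (\<lambda>z. a r z * a s z) = (\<Sum>t\<in>UNIV. \<Sum>u\<in>UNIV. kappa4 M (Z2 r t) (h t) (Z2 s u) (h u) + C2 r t t * C2 s u u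
     - expectation (\<lambda>z. Z2 r t z * Z2 s u z) * G t u + C2 r t u * C2 s u t)"
    unfolding * by (simp add: int4 E4 E_Z2h E_hh)
qed

lemma Eab: "integrable M (\<lambda>z. a r z * b s z)"
  "expectation (\<lambda>z. a r z * b s z) = (\<Sum>t\<in>UNIV. \<Sum>u\<in>UNIV. \<Sum>v\<in>UNIV. \<mu>3 s u v * kappa4 M (Z2 r t) (h t) (h u) (h v)) / 2
    - (\<Sum>t\<in>UNIV. \<Sum>u\<in>UNIV. \<Sum>v\<in>UNIV. \<mu>3 s u v * (C2 r t t * G u v + C2 r t u * G t v + C2 r t v * G t u)) / 2"
proof -
  have *: "(\<lambda>z. a r z * b s z) = (\<lambda>z. (\<Sum>t\<in>UNIV. \<Sum>u\<in>UNIV. \<Sum>v\<in>UNIV. \<mu>3 s u v * Z2 r t z * h t z * h u z * h v z) / 2)"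
    unfolding a_def b_def times_divide_eq_right sum_product12 by (simp add: mult_ac)
  show "integrable M (\<lambda>z. a r z * b s z)" unfolding * by (auto simp: intc(4))
  show "expectation (\<lambda>z. a r z * b s z) = (\<Sum>t\<in>UNIV. \<Sum>u\<in>UNIV. \<Sum>v\<in>UNIV. \<mu>3 s u v * kappa4 M (Z2 r t) (h t) (h u) (h v)) / 2
    - (\<Sum>t\<in>UNIV. \<Sum>u\<in>UNIV. \<Sum>v\<in>UNIV. \<mu>3 s u v * (C2 r t t * G u v + C2 r t u * G t v + C2 r t v * G t u)) / 2"
    unfolding * by (simp add: intc(4) Ec(4) E_Z2hhh right_diff_distrib sum_subtractf diff_divide_distrib)
qed

lemma Ebb: "integrable M (\<lambda>z. b r z * b s z)"
  "expectation (\<lambda>z. b r z * b s z) = (\<Sum>t\<in>UNIV. \<Sum>u\<in>UNIV. \<Sum>v\<in>UNIV. \<Sum>w\<in>UNIV. \<mu>3 r t u * \<mu>3 s v w * kappa4 M (h t) (h u) (h v) (h w)) / 4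
    + (\<Sum>t\<in>UNIV. \<Sum>u\<in>UNIV. \<Sum>v\<in>UNIV. \<Sum>w\<in>UNIV. \<mu>3 r t u * \<mu>3 s v w * (G t u * G v w + G t v * G u w + G t w * G u v)) / 4"
proof -
  have *: "(\<lambda>z. b r z * b s z) = (\<lambda>z. (\<Sum>t\<in>UNIV. \<Sum>u\<in>UNIV. \<Sum>v\<in>UNIV. \<Sum>w\<in>UNIV. (\<mu>3 r t u * \<mu>3 s v w) * h t z * h u z * h v z * h w z) / 4)"
    unfolding b_def times_divide_times_eq sum_product22 by (simp add: mult_ac)
  show "integrable M (\<lambda>z. b r z * b s z)" unfolding * by (auto simp: intc(4))
  show "expectation (\<lambda>z. b r z * b s z) = (\<Sum>t\<in>UNIV. \<Sum>u\<in>UNIV. \<Sum>v\<in>UNIV. \<Sum>w\<in>UNIV. \<mu>3 r t u * \<mu>3 s v w * kappa4 M (h t) (h u) (h v) (h w)) / 4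
    + (\<Sum>t\<in>UNIV. \<Sum>u\<in>UNIV. \<Sum>v\<in>UNIV. \<Sum>w\<in>UNIV. \<mu>3 r t u * \<mu>3 s v w * (G t u * G v w + G t v * G u w + G t w * G u v)) / 4"
    unfolding * by (simp add: intc(4) Ec(4) E_hhhh distrib_left[of "\<mu>3 _ _ _ * \<mu>3 _ _ _" "kappa4 _ _ _ _ _"] sum.distrib add_divide_distrib)
qed

definition g where "g r z = a r z + b r z + \<beta> r"

lemma Egg: "integrable M (\<lambda>z. g r z * g s z)"
  "expectation (\<lambda>z. g r z * g s z) = rem_grad r s + omega_grad G \<mu>3 \<beta> C2 r s
     - (\<Sum>t\<in>UNIV. \<Sum>u\<in>UNIV. expectation (\<lambda>z. Z2 r t z * Z2 s u z) * G t u)"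
proof -
  have *: "(\<lambda>z. g r z * g s z) = (\<lambda>z. a r z * a s z + a r z * b s z + a s z * b r z + b r z * b s z
     + \<beta> s * (a r z + b r z) + \<beta> r * (a s z + b s z) + \<beta> r * \<beta> s)"
    by (simp add: g_def algebra_simps fun_eq_iff)
  note i = Ea(1) Eb(1) Eaa(1) Eab(1) Ebb(1)
  show "integrable M (\<lambda>z. g r z * g s z)" unfolding * by (simp add: i)
  have "expectation (\<lambda>z. g r z * g s z) = expectation (\<lambda>z. a r z * a s z) + expectation (\<lambda>z. a r z * b s z) + expectation (\<lambda>z. a s z * b r z)
     + expectation (\<lambda>z. b r z * b s z) + \<beta> s * (expectation (a r) + expectation (b r)) + \<beta> r * (expectation (a s) + expectation (b s)) + \<beta> r * \<beta> s"
    unfolding * by (simp add: i prob_space)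
  then show "expectation (\<lambda>z. g r z * g s z) = rem_grad r s + omega_grad G \<mu>3 \<beta> C2 r s
     - (\<Sum>t\<in>UNIV. \<Sum>u\<in>UNIV. expectation (\<lambda>z. Z2 r t z * Z2 s u z) * G t u)"
    unfolding Eaa(2) Eab(2) Ebb(2) Ea(2) Eb(2) lr_rem_grad_def omega_grad_def
    by (simp add: sum.distrib sum_subtractf)
qed

abbreviation "rem \<equiv> lr_rem M G \<mu>3 \<mu>4 h Z2 Z3"

lemma trace: "(\<Sum>r\<in>UNIV. \<Sum>s\<in>UNIV. G r s * \<Lambda> r s) = real (card S)"
proof -
  have "(\<Sum>r\<in>UNIV. \<Sum>s\<in>UNIV. G r s * \<Lambda> r s) = (\<Sum>r\<in>UNIV. if r \<in> S then 1 else 0)"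
  proof (rule sum.cong[OF refl])
    fix r show "(\<Sum>s\<in>UNIV. G r s * \<Lambda> r s) = (if r \<in> S then 1 else 0)"
      using G_inv[of r r] G_off[of r] by (auto simp: G_sym[of r] mult.commute)
  qed
  then show ?thesis by (simp add: sum.If_cases)
qed

text \<open>
  Write \<open>B\<close> for the contraction of the covariances of second derivatives with two factors \<open>G\<close>.  It enters with
  coefficient \<open>- d\<^sup>2\<close> through \<open>d E(Z2(h, h))\<close>, by the definition of \<open>Q\<close>, and with coefficient \<open>d\<^sup>2\<close> through
  \<open>- d\<^sup>2 E(G(g, g))\<close>.  So it cancels, and the expectation depends on second derivatives only through \<open>Q\<close>
  and their covariances with the score.
\<close>
theorem expectation_lr_poly:
  "integrable M (\<lambda>z. lr_poly d G \<mu>3 \<mu>4 \<beta> \<beta>2 (\<lambda>r. Z1 r z) (\<lambda>r s. Z2 r s z) (\<lambda>r s t. Z3 r s t z) (\<lambda>r. Zb r z))" (is ?I)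
  "expectation (\<lambda>z. lr_poly d G \<mu>3 \<mu>4 \<beta> \<beta>2 (\<lambda>r. Z1 r z) (\<lambda>r s. Z2 r s z) (\<lambda>r s t. Z3 r s t z) (\<lambda>r. Zb r z))
    = real (card S) + d\<^sup>2 * omega G \<mu>3 \<mu>4 \<beta> \<beta>2 (\<lambda>r s t. expectation (\<lambda>z. Z2 r s z * Z1 t z))
        (\<lambda>r s t u. expectation (\<lambda>z. Z3 r s t z * Z1 u z)) (\<lambda>r s. expectation (\<lambda>z. Zb r z * Z1 s z)) k3 Q + d\<^sup>2 * rem" (is ?E)
proof -
  have hh: "(\<lambda>r. h r z) = lr_h G (\<lambda>r. Z1 r z)" for z by (simp add: h_def)
  have gg: "(\<lambda>r. g r z) = lr_g (\<lambda>r s. Z2 r s z) \<mu>3 \<beta> (\<lambda>r. h r z)" for z by (simp add: g_def a_def b_def lr_g_def fun_eq_iff)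
  have *: "(\<lambda>z. lr_poly d G \<mu>3 \<mu>4 \<beta> \<beta>2 (\<lambda>r. Z1 r z) (\<lambda>r s. Z2 r s z) (\<lambda>r s t. Z3 r s t z) (\<lambda>r. Zb r z))
    = (\<lambda>z. - form2 G (\<lambda>r. Z1 r z) (\<lambda>r. Z1 r z)
       + d * (form2 (\<lambda>r s. Z2 r s z) (\<lambda>r. h r z) (\<lambda>r. h r z) + form3 \<mu>3 (\<lambda>r. h r z) (\<lambda>r. h r z) (\<lambda>r. h r z) / 3 + 2 * form1 \<beta> (\<lambda>r. h r z))
       + d\<^sup>2 * (form3 (\<lambda>r s t. Z3 r s t z) (\<lambda>r. h r z) (\<lambda>r. h r z) (\<lambda>r. h r z) / 3
            + form4 \<mu>4 (\<lambda>r. h r z) (\<lambda>r. h r z) (\<lambda>r. h r z) (\<lambda>r. h r z) / 12 + 2 * form1 (\<lambda>r. Zb r z) (\<lambda>r. h r z)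
            + form2 \<beta>2 (\<lambda>r. h r z) (\<lambda>r. h r z) - form2 G (\<lambda>r. g r z) (\<lambda>r. g r z)))"
    by (simp add: lr_poly_def Let_def hh gg)
  have 1: "integrable M (\<lambda>z. form2 G (\<lambda>r. Z1 r z) (\<lambda>r. Z1 r z))" "expectation (\<lambda>z. form2 G (\<lambda>r. Z1 r z) (\<lambda>r. Z1 r z)) = - real (card S)"
    unfolding form2_def trace[symmetric] by (simp_all add: intc(2) Ec(2) cov sum_negf)
  have 2: "integrable M (\<lambda>z. form2 (\<lambda>r s. Z2 r s z) (\<lambda>r. h r z) (\<lambda>r. h r z))"
    "expectation (\<lambda>z. form2 (\<lambda>r s. Z2 r s z) (\<lambda>r. h r z) (\<lambda>r. h r z))
      = d * (\<Sum>r\<in>UNIV. \<Sum>s\<in>UNIV. \<Sum>t\<in>UNIV. \<Sum>u\<in>UNIV. G r t * G s u * Q r s t u)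
        - d * (\<Sum>r\<in>UNIV. \<Sum>s\<in>UNIV. \<Sum>t\<in>UNIV. \<Sum>u\<in>UNIV. G r t * G s u * expectation (\<lambda>z. Z2 r s z * Z2 t u z))"
    unfolding form2_def by (simp_all add: int3 E_Zhh mixed) (simp add: sum_distrib_left right_diff_distrib sum_subtractf mult_ac)
  have 3: "integrable M (\<lambda>z. form3 \<mu>3 (\<lambda>r. h r z) (\<lambda>r. h r z) (\<lambda>r. h r z))"
    "expectation (\<lambda>z. form3 \<mu>3 (\<lambda>r. h r z) (\<lambda>r. h r z) (\<lambda>r. h r z))
      = - d * (\<Sum>r\<in>UNIV. \<Sum>s\<in>UNIV. \<Sum>t\<in>UNIV. \<mu>3 r s t * (\<Sum>a\<in>UNIV. \<Sum>b\<in>UNIV. \<Sum>c\<in>UNIV. G r a * G s b * G t c * k3 a b c))"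
    unfolding form3_def by (simp_all add: intc(3) Ec(3) E_hhh) (simp add: sum_distrib_left sum_negf mult_ac)
  have 4: "integrable M (\<lambda>z. form1 \<beta> (\<lambda>r. h r z))" "expectation (\<lambda>z. form1 \<beta> (\<lambda>r. h r z)) = 0"
    unfolding form1_def by (simp_all add: int1[OF lin_h] E_h1)
  have 5: "integrable M (\<lambda>z. form3 (\<lambda>r s t. Z3 r s t z) (\<lambda>r. h r z) (\<lambda>r. h r z) (\<lambda>r. h r z))"
    "expectation (\<lambda>z. form3 (\<lambda>r s t. Z3 r s t z) (\<lambda>r. h r z) (\<lambda>r. h r z) (\<lambda>r. h r z))
      = (\<Sum>r\<in>UNIV. \<Sum>s\<in>UNIV. \<Sum>t\<in>UNIV. kappa4 M (Z3 r s t) (h r) (h s) (h t))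
        - (\<Sum>r\<in>UNIV. \<Sum>s\<in>UNIV. \<Sum>t\<in>UNIV. C3 r s t r * G s t + C3 r s t s * G r t + C3 r s t t * G r s)"
    unfolding form3_def by (simp_all add: int4 E_Z3hhh sum_subtractf)
  have 6: "integrable M (\<lambda>z. form4 \<mu>4 (\<lambda>r. h r z) (\<lambda>r. h r z) (\<lambda>r. h r z) (\<lambda>r. h r z))"
    "expectation (\<lambda>z. form4 \<mu>4 (\<lambda>r. h r z) (\<lambda>r. h r z) (\<lambda>r. h r z) (\<lambda>r. h r z))
      = (\<Sum>r\<in>UNIV. \<Sum>s\<in>UNIV. \<Sum>t\<in>UNIV. \<Sum>u\<in>UNIV. \<mu>4 r s t u * kappa4 M (h r) (h s) (h t) (h u))
        + (\<Sum>r\<in>UNIV. \<Sum>s\<in>UNIV. \<Sum>t\<in>UNIV. \<Sum>u\<in>UNIV. \<mu>4 r s t u * (G r s * G t u + G r t * G s u + G r u * G s t))"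
    unfolding form4_def by (simp_all add: intc(4) Ec(4) E_hhhh distrib_left[of "\<mu>4 _ _ _ _" "kappa4 _ _ _ _ _"] sum.distrib)
  have 7: "integrable M (\<lambda>z. form1 (\<lambda>r. Zb r z) (\<lambda>r. h r z))"
    "expectation (\<lambda>z. form1 (\<lambda>r. Zb r z) (\<lambda>r. h r z)) = (\<Sum>r\<in>UNIV. raise_index G (\<lambda>s. expectation (\<lambda>z. Zb r z * Z1 s z)) r)"
    unfolding form1_def by (simp_all add: int2 E_h)
  have 8: "integrable M (\<lambda>z. form2 \<beta>2 (\<lambda>r. h r z) (\<lambda>r. h r z))"
    "expectation (\<lambda>z. form2 \<beta>2 (\<lambda>r. h r z) (\<lambda>r. h r z)) = - (\<Sum>r\<in>UNIV. \<Sum>s\<in>UNIV. \<beta>2 r s * G r s)"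
    unfolding form2_def by (simp_all add: intc(2) Ec(2) E_hh sum_negf)
  have 9: "integrable M (\<lambda>z. form2 G (\<lambda>r. g r z) (\<lambda>r. g r z))"
    "expectation (\<lambda>z. form2 G (\<lambda>r. g r z) (\<lambda>r. g r z)) = (\<Sum>r\<in>UNIV. \<Sum>s\<in>UNIV. G r s * rem_grad r s) + (\<Sum>r\<in>UNIV. \<Sum>s\<in>UNIV. G r s * omega_grad G \<mu>3 \<beta> C2 r s)
       - (\<Sum>r\<in>UNIV. \<Sum>s\<in>UNIV. \<Sum>t\<in>UNIV. \<Sum>u\<in>UNIV. G r t * G s u * expectation (\<lambda>z. Z2 r s z * Z2 t u z))"
  proof -
    have i: "integrable M (\<lambda>z. G r s * g r z * g s z)" "expectation (\<lambda>z. G r s * g r z * g s z) = G r s * expectation (\<lambda>z. g r z * g s z)" for r s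
      using Egg(1)[of r s] by (simp_all add: mult.assoc)
    show "integrable M (\<lambda>z. form2 G (\<lambda>r. g r z) (\<lambda>r. g r z))" unfolding form2_def by (simp add: i)
    have "(\<Sum>r\<in>UNIV. \<Sum>s\<in>UNIV. G r s * (\<Sum>t\<in>UNIV. \<Sum>u\<in>UNIV. expectation (\<lambda>z. Z2 r t z * Z2 s u z) * G t u))
       = (\<Sum>r\<in>UNIV. \<Sum>s\<in>UNIV. \<Sum>t\<in>UNIV. \<Sum>u\<in>UNIV. G r s * G t u * expectation (\<lambda>z. Z2 r t z * Z2 s u z))"
      by (simp add: sum_distrib_left mult_ac)
    also have "\<dots> = (\<Sum>r\<in>UNIV. \<Sum>s\<in>UNIV. \<Sum>t\<in>UNIV. \<Sum>u\<in>UNIV. G r t * G s u * expectation (\<lambda>z. Z2 r s z * Z2 t u z))"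
      by (rule sum.cong[OF refl], rule sum.swap)
    finally have sw: "(\<Sum>r\<in>UNIV. \<Sum>s\<in>UNIV. G r s * (\<Sum>t\<in>UNIV. \<Sum>u\<in>UNIV. expectation (\<lambda>z. Z2 r t z * Z2 s u z) * G t u)) = \<dots>" .
    show "expectation (\<lambda>z. form2 G (\<lambda>r. g r z) (\<lambda>r. g r z)) = (\<Sum>r\<in>UNIV. \<Sum>s\<in>UNIV. G r s * rem_grad r s) + (\<Sum>r\<in>UNIV. \<Sum>s\<in>UNIV. G r s * omega_grad G \<mu>3 \<beta> C2 r s)
       - (\<Sum>r\<in>UNIV. \<Sum>s\<in>UNIV. \<Sum>t\<in>UNIV. \<Sum>u\<in>UNIV. G r t * G s u * expectation (\<lambda>z. Z2 r s z * Z2 t u z))"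
      unfolding form2_def sw[symmetric] by (simp add: i Egg(2) right_diff_distrib distrib_left sum.distrib sum_subtractf)
  qed
  \<comment> \<open>\<open>B\<close> is the contraction of the covariances of second derivatives that cancels.\<close>
  have alg: "- (- c) + d * (d * q - d * B + (- d * m) / 3 + 2 * 0)
      + d\<^sup>2 * ((k - c3) / 3 + (k4 + g4) / 12 + 2 * b' + - b2 - (R + W - B))
    = c + d\<^sup>2 * (q - m / 3 - c3 / 3 + g4 / 12 + 2 * b' - b2 - W) + d\<^sup>2 * (k / 3 + k4 / 12 - R)" for c q B m k c3 k4 g4 b' b2 R W :: real
    by (simp add: field_simps power2_eq_square)
  note ints = 1(1) 2(1) 3(1) 4(1) 5(1) 6(1) 7(1) 8(1) 9(1)
  show ?I unfolding * by (simp add: ints)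
  have "expectation (\<lambda>z. lr_poly d G \<mu>3 \<mu>4 \<beta> \<beta>2 (\<lambda>r. Z1 r z) (\<lambda>r s. Z2 r s z) (\<lambda>r s t. Z3 r s t z) (\<lambda>r. Zb r z))
    = - expectation (\<lambda>z. form2 G (\<lambda>r. Z1 r z) (\<lambda>r. Z1 r z))
       + d * (expectation (\<lambda>z. form2 (\<lambda>r s. Z2 r s z) (\<lambda>r. h r z) (\<lambda>r. h r z)) + expectation (\<lambda>z. form3 \<mu>3 (\<lambda>r. h r z) (\<lambda>r. h r z) (\<lambda>r. h r z)) / 3
            + 2 * expectation (\<lambda>z. form1 \<beta> (\<lambda>r. h r z)))
       + d\<^sup>2 * (expectation (\<lambda>z. form3 (\<lambda>r s t. Z3 r s t z) (\<lambda>r. h r z) (\<lambda>r. h r z) (\<lambda>r. h r z)) / 3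
            + expectation (\<lambda>z. form4 \<mu>4 (\<lambda>r. h r z) (\<lambda>r. h r z) (\<lambda>r. h r z) (\<lambda>r. h r z)) / 12 + 2 * expectation (\<lambda>z. form1 (\<lambda>r. Zb r z) (\<lambda>r. h r z))
            + expectation (\<lambda>z. form2 \<beta>2 (\<lambda>r. h r z) (\<lambda>r. h r z)) - expectation (\<lambda>z. form2 G (\<lambda>r. g r z) (\<lambda>r. g r z)))"
    unfolding * by (simp add: ints)
  then show ?E
    unfolding 1(2) 2(2) 3(2) 4(2) 5(2) 6(2) 7(2) 8(2) 9(2) omega_def lr_rem_def C2_def[abs_def] C3_def
    by (simp only: alg)
qed

end

section \<open>Stability of the correction and inverses of coercive forms\<close>

context scale begin

text \<open>
  Polynomial operations preserve this relation between bounded quantities, so that it passes from the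
  ingredients of \<open>omega\<close> to its value.
\<close>
definition close :: "('w \<Rightarrow> real) \<Rightarrow> ('w \<Rightarrow> real) \<Rightarrow> bool" where
  "close X Y \<longleftrightarrow> bnd X \<and> bnd Y \<and> (\<lambda>w. X w - Y w) \<in> O[F](\<delta>)"

lemma close_refl: "bnd X \<Longrightarrow> close X X" by (simp add: close_def)
lemma close_const: "close (\<lambda>_. a) (\<lambda>_. a)" by (rule close_refl) simp
lemma close_add: "close X X' \<Longrightarrow> close Y Y' \<Longrightarrow> close (\<lambda>w. X w + Y w) (\<lambda>w. X' w + Y' w)"
  unfolding close_def using sum_in_bigo(1)[of "\<lambda>w. X w - X' w" F \<delta> "\<lambda>w. Y w - Y' w"]
  by (auto intro: bnd_intros simp: algebra_simps)
lemma close_minus: "close X X' \<Longrightarrow> close (\<lambda>w. - X w) (\<lambda>w. - X' w)"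
  unfolding close_def using landau_o.big.uminus_in_iff[of "\<lambda>w. X w - X' w" F \<delta>]
  by (auto intro: bnd_intros simp: algebra_simps)
lemma close_diff: "close X X' \<Longrightarrow> close Y Y' \<Longrightarrow> close (\<lambda>w. X w - Y w) (\<lambda>w. X' w - Y' w)"
  using close_add[OF _ close_minus, of X X' Y Y'] by simp
lemma close_mult:
  assumes "close X X'" "close Y Y'" shows "close (\<lambda>w. X w * Y w) (\<lambda>w. X' w * Y' w)"
proof -
  have "(\<lambda>w. (X w - X' w) * Y w) \<in> O[F](\<lambda>w. \<delta> w * 1)" by (rule big_prod2) (use assms in \<open>simp_all add: close_def\<close>)
  moreover have "(\<lambda>w. X' w * (Y w - Y' w)) \<in> O[F](\<lambda>w. 1 * \<delta> w)" by (rule big_prod2) (use assms in \<open>simp_all add: close_def\<close>)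
  ultimately have "(\<lambda>w. (X w - X' w) * Y w + X' w * (Y w - Y' w)) \<in> O[F](\<delta>)"
    by (intro sum_in_bigo) simp_all
  then show ?thesis using assms unfolding close_def by (auto intro: bnd_intros simp: algebra_simps)
qed
lemma close_sum: "(\<And>r. close (X r) (Y r)) \<Longrightarrow> close (\<lambda>w. \<Sum>r\<in>(UNIV :: 'r::finite set). X r w) (\<lambda>w. \<Sum>r\<in>UNIV. Y r w)"
  unfolding close_def by (auto simp flip: sum_subtractf intro!: big_sum_fin)
lemma close_divide: "close X X' \<Longrightarrow> close (\<lambda>w. X w / a) (\<lambda>w. X' w / a)"
  using close_mult[OF _ close_const, of X X' "inverse a"] by (simp add: divide_inverse)
lemmas close_intros = close_add close_minus close_diff close_mult close_sum close_divide close_const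

lemma close_raise:
  assumes "\<And>r s. close (\<lambda>w. G w r s) (\<lambda>w. G' w r s)" "\<And>s. close (\<lambda>w. K w s) (\<lambda>w. K' w s)"
  shows "close (\<lambda>w. raise_index (G w) (K w) t) (\<lambda>w. raise_index (G' w) (K' w) t)"
  unfolding raise_index_def by (intro close_intros assms)

lemma close_omega:
  fixes G :: "'w \<Rightarrow> 'r::finite \<Rightarrow> 'r \<Rightarrow> real"
  assumes G: "\<And>r s. close (\<lambda>w. G w r s) (\<lambda>w. G' w r s)" 
    and m3: "\<And>r s t. close (\<lambda>w. \<mu>3 w r s t) (\<lambda>w. \<mu>3' w r s t)" 
    and m4: "\<And>r s t u. close (\<lambda>w. \<mu>4 w r s t u) (\<lambda>w. \<mu>4' w r s t u)" 
    and b: "\<And>r. close (\<lambda>w. \<beta> w r) (\<lambda>w. \<beta>' w r)" 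
    and b2: "\<And>r s. close (\<lambda>w. \<beta>2 w r s) (\<lambda>w. \<beta>2' w r s)" 
    and K2: "\<And>r s t. close (\<lambda>w. K2 w r s t) (\<lambda>w. K2' w r s t)" 
    and K3: "\<And>r s t u. close (\<lambda>w. K3 w r s t u) (\<lambda>w. K3' w r s t u)" 
    and Kb: "\<And>r s. close (\<lambda>w. Kb w r s) (\<lambda>w. Kb' w r s)" 
    and k3: "\<And>r s t. close (\<lambda>w. k3 w r s t) (\<lambda>w. k3' w r s t)" 
    and Q: "\<And>r s t u. close (\<lambda>w. Q w r s t u) (\<lambda>w. Q' w r s t u)" 
  shows "close (\<lambda>w. omega (G w) (\<mu>3 w) (\<mu>4 w) (\<beta> w) (\<beta>2 w) (K2 w) (K3 w) (Kb w) (k3 w) (Q w))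
    (\<lambda>w. omega (G' w) (\<mu>3' w) (\<mu>4' w) (\<beta>' w) (\<beta>2' w) (K2' w) (K3' w) (Kb' w) (k3' w) (Q' w))"
proof -
  have C2: "close (\<lambda>w. raise_index (G w) (K2 w r s) t) (\<lambda>w. raise_index (G' w) (K2' w r s) t)" for r s t
    by (rule close_raise[OF G K2])
  have C3: "close (\<lambda>w. raise_index (G w) (K3 w r s t) u) (\<lambda>w. raise_index (G' w) (K3' w r s t) u)" for r s t u
    by (rule close_raise[OF G K3])
  have Cb: "close (\<lambda>w. raise_index (G w) (Kb w r) t) (\<lambda>w. raise_index (G' w) (Kb' w r) t)" for r t
    by (rule close_raise[OF G Kb])
  have og: "close (\<lambda>w. omega_grad (G w) (\<mu>3 w) (\<beta> w) (\<lambda>r s. raise_index (G w) (K2 w r s)) r s)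
     (\<lambda>w. omega_grad (G' w) (\<mu>3' w) (\<beta>' w) (\<lambda>r s. raise_index (G' w) (K2' w r s)) r s)" for r s
    unfolding omega_grad_def by (intro close_intros G m3 b C2)
  show ?thesis
    unfolding omega_def by (intro close_intros G m3 m4 b2 k3 Q C3 Cb og)
qed

end

text \<open>
  The inverse of the \<open>S\<close>-block, extended by 0.  The block is first completed by \<open>- 1\<close> on the diagonal outside
  \<open>S\<close>, which makes it a negative definite matrix of full size without mixing the blocks.
\<close>
definition Ginv :: "'r::finite set \<Rightarrow> ('r \<Rightarrow> 'r \<Rightarrow> real) \<Rightarrow> 'r \<Rightarrow> 'r \<Rightarrow> real" where
  "Ginv S \<Lambda> r s = (if r \<in> S \<and> s \<in> S then
     matrix_inv (\<chi> r s. if r \<in> S \<and> s \<in> S then \<Lambda> r s else if r = s then -1 else 0) $ r $ s else 0)"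

lemma Ginv_off: "r \<notin> S \<or> s \<notin> S \<Longrightarrow> Ginv S \<Lambda> r s = 0"
  by (auto simp: Ginv_def)

lemma Ginv_inverse:
  fixes \<Lambda> :: "'r::finite \<Rightarrow> 'r \<Rightarrow> real"
  assumes c: "c > 0" and coercive: "\<And>u. form2 \<Lambda> u u \<le> - c * (\<Sum>r\<in>UNIV. (u r)\<^sup>2)"
  shows "r \<in> S \<Longrightarrow> t \<in> S \<Longrightarrow> (\<Sum>s\<in>UNIV. \<Lambda> r s * Ginv S \<Lambda> s t) = (if r = t then 1 else 0)"
    and "r \<in> S \<Longrightarrow> t \<in> S \<Longrightarrow> (\<Sum>s\<in>UNIV. Ginv S \<Lambda> r s * \<Lambda> s t) = (if r = t then 1 else 0)"
proof -
  define A :: "real ^ 'r ^ 'r" where "A = (\<chi> r s. if r \<in> S \<and> s \<in> S then \<Lambda> r s else if r = s then -1 else 0)"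
  have "x = 0" if "A *v x = 0" for x
  proof -
    define u where "u r = (if r \<in> S then x $ r else 0)" for r
    have "0 = (\<Sum>r\<in>UNIV. x $ r * (A *v x) $ r)" using that by simp
    also have "\<dots> = (\<Sum>r\<in>UNIV. \<Sum>s\<in>UNIV. \<Lambda> r s * u r * u s + (if r = s \<and> r \<notin> S then - (x $ r)\<^sup>2 else 0))"
      unfolding matrix_vector_mult_def A_def
      by (auto simp: sum_distrib_left u_def power2_eq_square intro!: sum.cong)
    also have "\<dots> = form2 \<Lambda> u u + (\<Sum>r\<in>UNIV. if r \<notin> S then - (x $ r)\<^sup>2 else 0)"
    proof -
      have "(\<Sum>s\<in>UNIV. if r = s \<and> r \<notin> S then - (x $ r)\<^sup>2 else 0) = (if r \<notin> S then - (x $ r)\<^sup>2 else 0)" for r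
        by (cases "r \<in> S") simp_all
      then show ?thesis unfolding form2_def sum.distrib by simp
    qed
    also have "\<dots> \<le> - c * (\<Sum>r\<in>UNIV. (u r)\<^sup>2) - (\<Sum>r\<in>UNIV. if r \<notin> S then (x $ r)\<^sup>2 else 0)"
    proof -
      have "(\<Sum>r\<in>UNIV. if r \<notin> S then - (x $ r)\<^sup>2 else 0) = - (\<Sum>r\<in>UNIV. if r \<notin> S then (x $ r)\<^sup>2 else 0)"
        unfolding sum_negf[symmetric] by (rule sum.cong) auto
      then show ?thesis using coercive[of u] by simp
    qed
    finally have 0: "c * (\<Sum>r\<in>UNIV. (u r)\<^sup>2) + (\<Sum>r\<in>UNIV. if r \<notin> S then (x $ r)\<^sup>2 else 0) \<le> 0" by simp
    have nn: "0 \<le> (\<Sum>r\<in>UNIV. (u r)\<^sup>2)" "0 \<le> (\<Sum>r\<in>UNIV. if r \<notin> S then (x $ r)\<^sup>2 else 0)"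
      by (auto intro!: sum_nonneg)
    then have "c * (\<Sum>r\<in>UNIV. (u r)\<^sup>2) = 0" "(\<Sum>r\<in>UNIV. if r \<notin> S then (x $ r)\<^sup>2 else 0) = 0"
      using 0 c mult_nonneg_nonneg[of c "\<Sum>r\<in>UNIV. (u r)\<^sup>2"] by linarith+
    then have "\<And>r. u r = 0" "\<And>r. r \<notin> S \<Longrightarrow> x $ r = 0"
      using c by (auto simp: sum_nonneg_eq_0_iff split: if_splits)
    then show "x = 0" by (auto simp: vec_eq_iff u_def) metis
  qed
  then have inv: "invertible A"
    unfolding invertible_left_inverse matrix_left_invertible_ker by blast
  have "A ** matrix_inv A = mat 1" "matrix_inv A ** A = mat 1"
    using someI_ex[OF inv[unfolded invertible_def]] unfolding matrix_inv_def by auto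
  then have r: "(\<Sum>s\<in>UNIV. A $ r $ s * matrix_inv A $ s $ t) = (if r = t then 1 else 0)"
    and l: "(\<Sum>s\<in>UNIV. matrix_inv A $ r $ s * A $ s $ t) = (if r = t then 1 else 0)" for r t
    by (auto simp: matrix_matrix_mult_def mat_def vec_eq_iff)
  have G: "Ginv S \<Lambda> r s = (if r \<in> S \<and> s \<in> S then matrix_inv A $ r $ s else 0)" for r s
    by (simp add: Ginv_def A_def)
  show "(\<Sum>s\<in>UNIV. \<Lambda> r s * Ginv S \<Lambda> s t) = (if r = t then 1 else 0)" if "r \<in> S" "t \<in> S" for r t
    unfolding r[of r t, symmetric] G by (rule sum.cong) (use that in \<open>auto simp: A_def\<close>)
  show "(\<Sum>s\<in>UNIV. Ginv S \<Lambda> r s * \<Lambda> s t) = (if r = t then 1 else 0)" if "r \<in> S" "t \<in> S" for r t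
    unfolding l[of r t, symmetric] G by (rule sum.cong) (use that in \<open>auto simp: A_def\<close>)
qed

text \<open>
  For the column \<open>u\<close> of the inverse with index \<open>t\<close>, coercivity gives \<open>c |u|\<^sup>2 \<le> |u t|\<close>.
\<close>
lemma Ginv_bound:
  fixes \<Lambda> :: "'r::finite \<Rightarrow> 'r \<Rightarrow> real"
  assumes c: "c > 0" and coercive: "\<And>u. form2 \<Lambda> u u \<le> - c * (\<Sum>r\<in>UNIV. (u r)\<^sup>2)"
  shows "\<bar>Ginv S \<Lambda> r t\<bar> \<le> 1 / c"
proof (cases "t \<in> S")
  case False then show ?thesis using c by (simp add: Ginv_off)
next
  case True
  define u where "u s = Ginv S \<Lambda> s t" for s
  have "form2 \<Lambda> u u = (\<Sum>r\<in>UNIV. u r * (\<Sum>s\<in>UNIV. \<Lambda> r s * u s))"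
    by (simp add: form2_def sum_distrib_left mult_ac)
  also have "\<dots> = (\<Sum>r\<in>UNIV. if r = t then u r else 0)"
  proof (rule sum.cong[OF refl])
    fix r show "u r * (\<Sum>s\<in>UNIV. \<Lambda> r s * u s) = (if r = t then u r else 0)"
      using Ginv_inverse(1)[OF c coercive _ True, of r] Ginv_off[of r S t \<Lambda>] True by (cases "r \<in> S") (auto simp: u_def)
  qed
  finally have f: "form2 \<Lambda> u u = u t" by simp
  have m: "(u r)\<^sup>2 \<le> (\<Sum>r\<in>UNIV. (u r)\<^sup>2)" for r by (rule member_le_sum) auto
  have 1: "c * (\<Sum>r\<in>UNIV. (u r)\<^sup>2) \<le> \<bar>u t\<bar>" using coercive[of u] f by simp
  have cm: "c * (u r)\<^sup>2 \<le> \<bar>u t\<bar>" for r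
    by (rule order_trans[OF mult_left_mono[OF m] 1]) (use c in simp)
  have "c * (u t)\<^sup>2 \<le> \<bar>u t\<bar>" by (rule cm)
  then have "\<bar>u t\<bar> * (c * \<bar>u t\<bar>) \<le> \<bar>u t\<bar> * 1" by (simp add: power2_eq_square mult_ac)
  then have ut: "c * \<bar>u t\<bar> \<le> 1" by (cases "u t = 0") auto
  have "(c * \<bar>u r\<bar>)\<^sup>2 = c * (c * (u r)\<^sup>2)" by (simp add: power2_eq_square)
  also have "\<dots> \<le> c * \<bar>u t\<bar>" using c cm by (intro mult_left_mono) auto
  also have "\<dots> \<le> 1" by (rule ut)
  finally have "c * \<bar>u r\<bar> \<le> 1" using c by (simp add: power2_le_imp_le[where y = 1])
  then show ?thesis using c by (simp add: u_def field_simps)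
qed

text \<open>
  The resolvent identity \<open>G - G' = G (\<Lambda>' - \<Lambda>) G'\<close>.
\<close>
lemma Ginv_diff:
  fixes \<Lambda> \<Lambda>' :: "'r::finite \<Rightarrow> 'r \<Rightarrow> real"
  assumes c: "c > 0" and 1: "\<And>u. form2 \<Lambda> u u \<le> - c * (\<Sum>r\<in>UNIV. (u r)\<^sup>2)"
    and c': "c' > 0" and 2: "\<And>u. form2 \<Lambda>' u u \<le> - c' * (\<Sum>r\<in>UNIV. (u r)\<^sup>2)"
  shows "Ginv S \<Lambda> r t - Ginv S \<Lambda>' r t = (\<Sum>a\<in>UNIV. \<Sum>b\<in>UNIV. Ginv S \<Lambda> r a * (\<Lambda>' a b - \<Lambda> a b) * Ginv S \<Lambda>' b t)"
proof (cases "r \<in> S \<and> t \<in> S")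
  case False
  then show ?thesis by (auto simp: Ginv_off)
next
  case True
  let ?G = "Ginv S \<Lambda>" let ?G' = "Ginv S \<Lambda>'"
  have "(\<Sum>a\<in>UNIV. \<Sum>b\<in>UNIV. ?G r a * \<Lambda>' a b * ?G' b t) = (\<Sum>a\<in>UNIV. ?G r a * (\<Sum>b\<in>UNIV. \<Lambda>' a b * ?G' b t))"
    by (simp add: sum_distrib_left mult.assoc)
  also have "\<dots> = (\<Sum>a\<in>UNIV. if a = t then ?G r a else 0)"
  proof (rule sum.cong[OF refl])
    fix a show "?G r a * (\<Sum>b\<in>UNIV. \<Lambda>' a b * ?G' b t) = (if a = t then ?G r a else 0)"
      using Ginv_inverse(1)[OF c' 2, of a S t] Ginv_off[of r S a \<Lambda>] True by (cases "a \<in> S") auto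
  qed
  finally have a: "(\<Sum>a\<in>UNIV. \<Sum>b\<in>UNIV. ?G r a * \<Lambda>' a b * ?G' b t) = ?G r t" by simp
  have "(\<Sum>a\<in>UNIV. \<Sum>b\<in>UNIV. ?G r a * \<Lambda> a b * ?G' b t) = (\<Sum>b\<in>UNIV. (\<Sum>a\<in>UNIV. ?G r a * \<Lambda> a b) * ?G' b t)"
    by (subst sum.swap) (simp add: sum_distrib_right)
  also have "\<dots> = (\<Sum>b\<in>UNIV. if r = b then ?G' b t else 0)"
  proof (rule sum.cong[OF refl])
    fix b show "(\<Sum>a\<in>UNIV. ?G r a * \<Lambda> a b) * ?G' b t = (if r = b then ?G' b t else 0)"
      using Ginv_inverse(2)[OF c 1, of r S b] Ginv_off[of b S t \<Lambda>'] True by (cases "b \<in> S") auto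
  qed
  finally have b: "(\<Sum>a\<in>UNIV. \<Sum>b\<in>UNIV. ?G r a * \<Lambda> a b * ?G' b t) = ?G' r t" by simp
  show ?thesis by (simp add: right_diff_distrib left_diff_distrib sum_subtractf a b)
qed

text \<open>
  A negative semidefinite form whose inverse has small entries is quantitatively negative definite:
  with \<open>\<Lambda> v = u\<close>, expand \<open>\<Lambda>(u + t v, u + t v) \<le> 0\<close> and use \<open>\<Lambda>(u, v) = |u|\<^sup>2\<close> and the bound \<open>- \<Lambda>(v, v) \<le> B d |u|\<^sup>2\<close>
  that the entries of the inverse provide.
\<close>
lemma coercive_from_inverse:
  fixes A :: "real ^ 'r::finite ^ 'r" and \<Lambda> :: "'r \<Rightarrow> 'r \<Rightarrow> real"
  assumes A: "A = (\<chi> r s. m * \<Lambda> r s)" and inv: "invertible A" and m: "m > 0" and B: "B > 0"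
    and bound: "\<And>r s. \<bar>matrix_inv A $ r $ s\<bar> \<le> B / m" and sym: "\<And>r s. \<Lambda> r s = \<Lambda> s r"
    and neg: "\<And>u. form2 \<Lambda> u u \<le> 0"
  shows "form2 \<Lambda> u u \<le> - (1 / (B * real CARD('r))) * (\<Sum>r\<in>UNIV. (u r)\<^sup>2)"
proof -
  define d where "d = real CARD('r)"
  have d: "d > 0" by (simp add: d_def)
  have "A ** matrix_inv A = mat 1"
    using someI_ex[OF inv[unfolded invertible_def]] unfolding matrix_inv_def by auto
  define v where "v r = m * (\<Sum>s\<in>UNIV. matrix_inv A $ r $ s * u s)" for r
  have Lv: "(\<Sum>s\<in>UNIV. \<Lambda> r s * v s) = u r" for r
  proof -
    have "(\<Sum>s\<in>UNIV. \<Lambda> r s * v s) = (\<Sum>s\<in>UNIV. \<Sum>t\<in>UNIV. A $ r $ s * matrix_inv A $ s $ t * u t)"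
      by (simp add: v_def A sum_distrib_left mult_ac)
    also have "\<dots> = (\<Sum>t\<in>UNIV. (A ** matrix_inv A) $ r $ t * u t)"
      by (subst sum.swap) (simp add: matrix_matrix_mult_def sum_distrib_right)
    also have "\<dots> = (\<Sum>t\<in>UNIV. if r = t then u t else 0)"
      unfolding \<open>A ** matrix_inv A = mat 1\<close> by (intro sum.cong) (auto simp: mat_def)
    finally show ?thesis by simp
  qed
  define U where "U = (\<Sum>r\<in>UNIV. (u r)\<^sup>2)"
  have f2: "form2 \<Lambda> x v = (\<Sum>r\<in>UNIV. x r * u r)" for x
  proof -
    have "form2 \<Lambda> x v = (\<Sum>r\<in>UNIV. x r * (\<Sum>s\<in>UNIV. \<Lambda> r s * v s))"
      by (simp add: form2_def sum_distrib_left mult_ac)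
    then show ?thesis by (simp add: Lv)
  qed
  have uv: "form2 \<Lambda> u v = U" by (simp add: f2 U_def power2_eq_square)
  have "\<bar>form2 \<Lambda> v v\<bar> = \<bar>\<Sum>r\<in>UNIV. \<Sum>s\<in>UNIV. m * matrix_inv A $ r $ s * u s * u r\<bar>"
    unfolding f2 by (simp add: v_def sum_distrib_left sum_distrib_right mult_ac)
  also have "\<dots> \<le> (\<Sum>r\<in>UNIV. \<Sum>s\<in>UNIV. \<bar>m * matrix_inv A $ r $ s * u s * u r\<bar>)"
    by (rule order_trans[OF sum_abs]) (intro sum_mono sum_abs)
  also have "\<dots> \<le> (\<Sum>r\<in>UNIV. \<Sum>s\<in>UNIV. B * \<bar>u s\<bar> * \<bar>u r\<bar>)"
  proof (intro sum_mono)
    fix r s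
    have "m * \<bar>matrix_inv A $ r $ s\<bar> \<le> B" using bound[of r s] m by (simp add: field_simps)
    then show "\<bar>m * matrix_inv A $ r $ s * u s * u r\<bar> \<le> B * \<bar>u s\<bar> * \<bar>u r\<bar>"
      using m by (simp add: abs_mult mult_right_mono)
  qed
  also have "\<dots> = B * (\<Sum>r\<in>UNIV. \<bar>u r\<bar>)\<^sup>2"
    by (simp add: power2_eq_square sum_product sum_distrib_left mult_ac)
  also have "\<dots> \<le> B * (U * d)"
    using sum_squared_le_sum_of_squares[of "\<lambda>r. \<bar>u r\<bar>" UNIV] B by (simp add: U_def d_def)
  finally have vv: "- form2 \<Lambda> v v \<le> B * d * U" by (simp add: mult_ac)
  \<comment> \<open>This value maximizes \<open>2 t - t\<^sup>2 B d\<close>, the factor of \<open>- U\<close> in the resulting bound.\<close>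
  define t where "t = 1 / (B * d)"
  have "form2 \<Lambda> (\<lambda>r. u r + t * v r) (\<lambda>r. u r + t * v r) \<le> 0" by (rule neg)
  then have 1: "form2 \<Lambda> u u + 2 * (t * U) + t * t * form2 \<Lambda> v v \<le> 0"
    using form2_sym[of \<Lambda> v u] sym uv by (simp add: form_add form_scale algebra_simps)
  have "t * t * - form2 \<Lambda> v v \<le> t * t * (B * d * U)" using vv by (intro mult_left_mono) auto
  also have "\<dots> = t * U" using B d by (simp add: t_def)
  finally have "form2 \<Lambda> u u \<le> - (t * U)" using 1 by simp
  then show ?thesis by (simp add: t_def U_def d_def)
qed

section \<open>Standardized derivatives\<close>

text \<open>
  In the names below, \<open>lamh\<close> is \<open>\<lambda>/n\<close>, \<open>betav\<close> and \<open>betam\<close> are the means of first and second derivatives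
  of the adjustment, and \<open>Zstd\<close> stands for \<open>n\<^sup>-\<^sup>1\<^sup>/\<^sup>2 l\<close> and \<open>n\<^sup>1\<^sup>/\<^sup>2 b\<close>.  Quantities belonging to the adjustment are
  indexed by all coordinates, with value 0 at nuisance coordinates, to match those of the log-likelihood.
  \<open>lr_approx D n \<mu> S\<close> is the polynomial that approximates twice the largest increase of the adjusted
  log-likelihood when the coordinates in \<open>S\<close> vary, \<open>Omega\<close> is the coefficient of \<open>1/n\<close> in its expectation and
  \<open>Omega_rem\<close> collects the fourth cumulants.  \<open>Qmix\<close> is the sum that \<open>mixed_third_moment\<close> evaluates.
\<close>
definition lamh where
  "lamh D n \<mu> rs = mean D n \<mu> (Inl rs) (theta0 D) / real n"
definition Gmat where
  "Gmat D n \<mu> S = Ginv S (\<lambda>r s. lamh D n \<mu> [r, s])"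
definition betav :: "('q::finite, 'p::finite, 'c) problem \<Rightarrow> nat \<Rightarrow> sample measure \<Rightarrow> 'q + 'p \<Rightarrow> real" where
  "betav D n \<mu> r = (case r of Inl a \<Rightarrow> mean D n \<mu> (Inr [a]) (theta0 D) | Inr _ \<Rightarrow> 0)"
definition betam :: "('q::finite, 'p::finite, 'c) problem \<Rightarrow> nat \<Rightarrow> sample measure \<Rightarrow> 'q + 'p \<Rightarrow> 'q + 'p \<Rightarrow> real" where
  "betam D n \<mu> r s = (case r of Inl a \<Rightarrow> (case s of Inl b \<Rightarrow> mean D n \<mu> (Inr [a, b]) (theta0 D) | Inr _ \<Rightarrow> 0) | Inr _ \<Rightarrow> 0)"
definition Zstd where
  "Zstd D n \<mu> v z = cvar D n \<mu> v z / sqrt (real n)"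
definition Zadj :: "('q::finite, 'p::finite, 'c) problem \<Rightarrow> nat \<Rightarrow> sample measure \<Rightarrow> 'q + 'p \<Rightarrow> sample \<Rightarrow> real" where
  "Zadj D n \<mu> r z = (case r of Inl a \<Rightarrow> Zstd D n \<mu> (Inr [a]) z | Inr _ \<Rightarrow> 0)"
definition EN where
  "EN D n \<mu> f = (\<integral>z. f z \<partial>dist_of D n \<mu> (theta0 D))"
definition Kcov where
  "Kcov D n \<mu> v s = EN D n \<mu> (\<lambda>z. Zstd D n \<mu> v z * Zstd D n \<mu> (Inl [s]) z)"
definition Kadj where
  "Kadj D n \<mu> r s = EN D n \<mu> (\<lambda>z. Zadj D n \<mu> r z * Zstd D n \<mu> (Inl [s]) z)"
definition skew where
  "skew D n \<mu> r s t = sqrt (real n) * EN D n \<mu> (\<lambda>z. Zstd D n \<mu> (Inl [r]) z * Zstd D n \<mu> (Inl [s]) z * Zstd D n \<mu> (Inl [t]) z)"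
definition Qmix where
  "Qmix D n \<mu> r s t u = sqrt (real n) * EN D n \<mu> (\<lambda>z. Zstd D n \<mu> (Inl [r, s]) z * Zstd D n \<mu> (Inl [t]) z * Zstd D n \<mu> (Inl [u]) z)
     + EN D n \<mu> (\<lambda>z. Zstd D n \<mu> (Inl [r, s]) z * Zstd D n \<mu> (Inl [t, u]) z)"
definition lr_approx where
  "lr_approx D n \<mu> S z = lr_poly (1 / sqrt (real n)) (Gmat D n \<mu> S) (\<lambda>r s t. lamh D n \<mu> [r, s, t]) (\<lambda>r s t u. lamh D n \<mu> [r, s, t, u])
     (betav D n \<mu>) (betam D n \<mu>) (\<lambda>r. Zstd D n \<mu> (Inl [r]) z) (\<lambda>r s. Zstd D n \<mu> (Inl [r, s]) z) (\<lambda>r s t. Zstd D n \<mu> (Inl [r, s, t]) z)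
     (\<lambda>r. Zadj D n \<mu> r z)"
definition Omega where
  "Omega D n \<mu> S = omega (Gmat D n \<mu> S) (\<lambda>r s t. lamh D n \<mu> [r, s, t]) (\<lambda>r s t u. lamh D n \<mu> [r, s, t, u])
     (betav D n \<mu>) (betam D n \<mu>) (\<lambda>r s t. Kcov D n \<mu> (Inl [r, s]) t) (\<lambda>r s t u. Kcov D n \<mu> (Inl [r, s, t]) u)
     (Kadj D n \<mu>) (skew D n \<mu>) (Qmix D n \<mu>)"
definition hfun where
  "hfun D n \<mu> S r z = lr_h (Gmat D n \<mu> S) (\<lambda>r. Zstd D n \<mu> (Inl [r]) z) r"
definition Omega_rem where
  "Omega_rem D n \<mu> S = lr_rem (dist_of D n \<mu> (theta0 D)) (Gmat D n \<mu> S) (\<lambda>r s t. lamh D n \<mu> [r, s, t]) (\<lambda>r s t u. lamh D n \<mu> [r, s, t, u])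
     (hfun D n \<mu> S) (\<lambda>r s. Zstd D n \<mu> (Inl [r, s])) (\<lambda>r s t. Zstd D n \<mu> (Inl [r, s, t]))"

lemma finite_lists_between: "finite {l :: 'a::finite list. 1 \<le> length l \<and> length l \<le> m}"
  by (rule finite_subset[OF _ finite_lists_length_le[of "UNIV :: 'a set" m]]) auto

lemma finite_idx_upto: "finite (idx_upto j k :: ('q::finite, 'p::finite) idx set)"
  unfolding idx_upto_def by (intro finite_UnI finite_imageI finite_lists_between)

lemma idx_mem [simp]: "Inl [r] \<in> idx_upto 4 2" "Inl [r, s] \<in> idx_upto 4 2" "Inl [r, s, t] \<in> idx_upto 4 2"
   "Inl [r, s, t, u] \<in> idx_upto 4 2" "Inr [a] \<in> idx_upto 4 2" "Inr [a, b] \<in> idx_upto 4 2"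
  by (auto simp: idx_upto_def)

context bartlett begin

definition std_factor :: "('q, 'p) idx \<Rightarrow> real" where
  "std_factor v = (case v of Inl _ \<Rightarrow> 1 / sqrt (real n) | Inr _ \<Rightarrow> sqrt (real n))"

lemma Zs_eq: "0 < n \<Longrightarrow> Zstd D n \<mu> v z = std_factor v * c v z"
  by (cases v) (simp_all add: Zstd_def std_factor_def field_simps)

lemma Zs_Inl: "Zstd D n \<mu> (Inl rs) z = c (Inl rs) z / sqrt (real n)"
  by (simp add: Zstd_def)

lemma integrable_mixed:
  assumes "0 < n" "length us + length vs \<le> 4" "set us \<subseteq> idx_upto 4 2" "set vs \<subseteq> idx_upto 4 2"
  shows "integrable N (\<lambda>z. (\<Prod>u\<leftarrow>us. dv D n u (theta0 D) z) * (\<Prod>v\<leftarrow>vs. Zstd D n \<mu> v z))"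
  using assms(2-4)
proof (induction vs arbitrary: us)
  case Nil
  then show ?case using integrable_prod[of us] by simp
next
  case (Cons v vs)
  have 1: "integrable N (\<lambda>z. (\<Prod>u\<leftarrow>us @ [v]. dv D n u (theta0 D) z) * (\<Prod>v\<leftarrow>vs. Zstd D n \<mu> v z))"
    by (rule Cons.IH) (use Cons.prems in auto)
  have 2: "integrable N (\<lambda>z. (\<Prod>u\<leftarrow>us. dv D n u (theta0 D) z) * (\<Prod>v\<leftarrow>vs. Zstd D n \<mu> v z))"
    by (rule Cons.IH) (use Cons.prems in auto)
  have "(\<lambda>z. (\<Prod>u\<leftarrow>us. dv D n u (theta0 D) z) * (\<Prod>v\<leftarrow>v # vs. Zstd D n \<mu> v z))
    = (\<lambda>z. std_factor v * ((\<Prod>u\<leftarrow>us @ [v]. dv D n u (theta0 D) z) * (\<Prod>v\<leftarrow>vs. Zstd D n \<mu> v z))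
        - std_factor v * \<kappa> v * ((\<Prod>u\<leftarrow>us. dv D n u (theta0 D) z) * (\<Prod>v\<leftarrow>vs. Zstd D n \<mu> v z)))"
    by (simp add: Zs_eq[OF assms(1)] cent_def algebra_simps fun_eq_iff)
  then show ?case using 1 2 by simp
qed

text \<open>
  The zero function is the derivative of the adjustment in a nuisance coordinate.
\<close>
definition atoms :: "(sample \<Rightarrow> real) set" where
  "atoms = Zstd D n \<mu> ` idx_upto 4 2 \<union> {\<lambda>_. 0}"

lemma integrable_atoms:
  assumes "0 < n" "length fs \<le> 4" "set fs \<subseteq> atoms"
  shows "integrable N (\<lambda>z. \<Prod>f\<leftarrow>fs. f z)"
proof (cases "(\<lambda>_. 0) \<in> set fs")
  case True
  then have "(\<Prod>f\<leftarrow>fs. f z) = 0" for z by (force simp: prod_list_zero_iff image_iff)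
  then show ?thesis by simp
next
  case False
  then have "\<forall>f\<in>set fs. \<exists>v. v \<in> idx_upto 4 2 \<and> f = Zstd D n \<mu> v" using assms(3) by (auto simp: atoms_def)
  then obtain g where g: "\<And>f. f \<in> set fs \<Longrightarrow> g f \<in> idx_upto 4 2 \<and> f = Zstd D n \<mu> (g f)" by metis
  have "integrable N (\<lambda>z. (\<Prod>u\<leftarrow>[]. dv D n u (theta0 D) z) * (\<Prod>v\<leftarrow>map g fs. Zstd D n \<mu> v z))"
    by (rule integrable_mixed) (use assms g in auto)
  moreover have "(\<Prod>u\<leftarrow>[]. dv D n u (theta0 D) z) * (\<Prod>v\<leftarrow>map g fs. Zstd D n \<mu> v z) = (\<Prod>f\<leftarrow>fs. f z)" for z
  proof -
    have "map (\<lambda>v. Zstd D n \<mu> v z) (map g fs) = map (\<lambda>f. f z) fs"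
      unfolding map_map by (rule map_cong[OF refl]) (metis comp_apply g)
    then show ?thesis by (simp del: map_map)
  qed
  ultimately show ?thesis by (simp only:)
qed

lemma E_Zs: "0 < n \<Longrightarrow> v \<in> idx_upto 4 2 \<Longrightarrow> E (Zstd D n \<mu> v) = 0"
  using E_c[of v] Zs_eq[of v] by simp

lemma Zadj_atom: "Zadj D n \<mu> r \<in> atoms"
  by (cases r) (auto simp: Zadj_def[abs_def] atoms_def)

lemma moments_instance:
  assumes n: "0 < n" and cc: "cc > 0" and coercive: "\<And>u. form2 (\<lambda>r s. lamh D n \<mu> [r, s]) u u \<le> - cc * (\<Sum>r\<in>UNIV. (u r)\<^sup>2)"
  shows "moments N S (1 / sqrt (real n)) (Gmat D n \<mu> S) (\<lambda>r s. lamh D n \<mu> [r, s]) (\<lambda>r. Zstd D n \<mu> (Inl [r])) (Zadj D n \<mu>)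
    (\<lambda>r s. Zstd D n \<mu> (Inl [r, s])) (\<lambda>r s t. Zstd D n \<mu> (Inl [r, s, t])) (skew D n \<mu>) (Qmix D n \<mu>) atoms"
proof unfold_locales
  have sn: "sqrt (real n) \<noteq> 0" using n by simp
  show "finite atoms" unfolding atoms_def by (intro finite_UnI finite_imageI finite_idx_upto) simp
  show "Zstd D n \<mu> (Inl [r]) \<in> atoms" "Zstd D n \<mu> (Inl [r, s]) \<in> atoms" "Zstd D n \<mu> (Inl [r, s, t]) \<in> atoms" for r s t
    by (auto simp: atoms_def)
  show "Zadj D n \<mu> r \<in> atoms" for r by (rule Zadj_atom)
  show "integrable N (\<lambda>z. \<Prod>f\<leftarrow>fs. f z)" if "length fs \<le> 4" "set fs \<subseteq> atoms" for fs
    using integrable_atoms[OF n that] .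
  show "E (Zstd D n \<mu> (Inl [r])) = 0" for r using E_Zs[OF n] by simp
  show "E (\<lambda>z. Zstd D n \<mu> (Inl [r]) z * Zstd D n \<mu> (Inl [s]) z) = - lamh D n \<mu> [r, s]" for r s
    using score_cov[of r s] n by (simp add: Zs_Inl lamh_def real_div_sqrt)
  show "E (\<lambda>z. Zstd D n \<mu> (Inl [r]) z * Zstd D n \<mu> (Inl [s]) z * Zstd D n \<mu> (Inl [t]) z) = 1 / sqrt (real n) * skew D n \<mu> r s t" for r s t
    using sn by (simp add: skew_def EN_def)
  show "E (\<lambda>z. Zstd D n \<mu> (Inl [r, s]) z * Zstd D n \<mu> (Inl [t]) z * Zstd D n \<mu> (Inl [u]) z)
      = 1 / sqrt (real n) * (Qmix D n \<mu> r s t u - E (\<lambda>z. Zstd D n \<mu> (Inl [r, s]) z * Zstd D n \<mu> (Inl [t, u]) z))" for r s t u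
    using sn by (simp add: Qmix_def EN_def)
  show "r \<notin> S \<or> s \<notin> S \<Longrightarrow> Gmat D n \<mu> S r s = 0" for r s by (simp add: Gmat_def Ginv_off)
  show "r \<in> S \<Longrightarrow> t \<in> S \<Longrightarrow> (\<Sum>s\<in>UNIV. lamh D n \<mu> [r, s] * Gmat D n \<mu> S s t) = (if r = t then 1 else 0)" for r t
    unfolding Gmat_def by (rule Ginv_inverse(1)[OF cc coercive])
qed

lemma expectation_lr_approx:
  assumes n: "0 < n" and cc: "cc > 0" and coercive: "\<And>u. form2 (\<lambda>r s. lamh D n \<mu> [r, s]) u u \<le> - cc * (\<Sum>r\<in>UNIV. (u r)\<^sup>2)"
  shows "integrable N (lr_approx D n \<mu> S)"
    "E (lr_approx D n \<mu> S) = real (card S) + (1 / sqrt (real n))\<^sup>2 * Omega D n \<mu> S + (1 / sqrt (real n))\<^sup>2 * Omega_rem D n \<mu> S"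
proof -
  interpret m: moments N S "1 / sqrt (real n)" "Gmat D n \<mu> S" "\<lambda>r s. lamh D n \<mu> [r, s]" "\<lambda>r s t. lamh D n \<mu> [r, s, t]"
    "\<lambda>r s t u. lamh D n \<mu> [r, s, t, u]" "betav D n \<mu>" "betam D n \<mu>" "\<lambda>r. Zstd D n \<mu> (Inl [r])" "Zadj D n \<mu>"
    "\<lambda>r s. Zstd D n \<mu> (Inl [r, s])" "\<lambda>r s t. Zstd D n \<mu> (Inl [r, s, t])" "skew D n \<mu>" "Qmix D n \<mu>" atoms
    by (rule moments_instance[OF assms])
  show "integrable N (lr_approx D n \<mu> S)" using m.expectation_lr_poly(1) unfolding lr_approx_def[abs_def] .
  have h: "m.h = hfun D n \<mu> S" unfolding m.h_eq_lr_h by (simp add: hfun_def fun_eq_iff)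
  show "E (lr_approx D n \<mu> S) = real (card S) + (1 / sqrt (real n))\<^sup>2 * Omega D n \<mu> S + (1 / sqrt (real n))\<^sup>2 * Omega_rem D n \<mu> S"
    using m.expectation_lr_poly(2) unfolding h lr_approx_def[abs_def] Omega_def Omega_rem_def Kcov_def Kadj_def EN_def .
qed

definition linear_vars :: "('q + 'p) set \<Rightarrow> (sample \<Rightarrow> real) set" where
  "linear_vars S = Zstd D n \<mu> ` idx_upto 4 2 \<union> range (hfun D n \<mu> S)"

lemma kappa4_hfun:
  assumes n: "0 < n" and cc: "cc > 0" and coercive: "\<And>u. form2 (\<lambda>r s. lamh D n \<mu> [r, s]) u u \<le> - cc * (\<Sum>r\<in>UNIV. (u r)\<^sup>2)"
    and "Y \<in> linear_vars S" "U \<in> linear_vars S" "V \<in> linear_vars S"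
  shows "kappa4 N (hfun D n \<mu> S r) Y U V = (\<Sum>s\<in>UNIV. (- Gmat D n \<mu> S r s) * kappa4 N (Zstd D n \<mu> (Inl [s])) Y U V)"
proof -
  interpret m: moments N S "1 / sqrt (real n)" "Gmat D n \<mu> S" "\<lambda>r s. lamh D n \<mu> [r, s]" "\<lambda>r s t. lamh D n \<mu> [r, s, t]"
    "\<lambda>r s t u. lamh D n \<mu> [r, s, t, u]" "betav D n \<mu>" "betam D n \<mu>" "\<lambda>r. Zstd D n \<mu> (Inl [r])" "Zadj D n \<mu>"
    "\<lambda>r s. Zstd D n \<mu> (Inl [r, s])" "\<lambda>r s t. Zstd D n \<mu> (Inl [r, s, t])" "skew D n \<mu>" "Qmix D n \<mu>" atoms
    by (rule moments_instance[OF assms(1-3)])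
  have h: "m.h = hfun D n \<mu> S" unfolding m.h_eq_lr_h by (simp add: hfun_def fun_eq_iff)
  have "m.lin X" if "X \<in> linear_vars S" for X
    using that unfolding linear_vars_def
  proof
    assume "X \<in> Zstd D n \<mu> ` idx_upto 4 2"
    then have "X \<in> atoms" by (simp add: atoms_def)
    then show ?thesis by (rule m.lin_atom)
  next
    assume "X \<in> range (hfun D n \<mu> S)"
    then show ?thesis using m.lin_h unfolding h by auto
  qed
  then show ?thesis using m.kappa4_h[of Y U V r] assms(4-6) unfolding h by blast
qed

lemma E_cvar: "v \<in> idx_upto 4 2 \<Longrightarrow> E (cvar D n \<mu> v) = 0"
  using E_c[of v] by (cases v) simp_all

lemma cumulant_2: "0 < n \<Longrightarrow> v \<in> idx_upto 4 2 \<Longrightarrow> w \<in> idx_upto 4 2 \<Longrightarrow>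
   E (\<lambda>z. Zstd D n \<mu> v z * Zstd D n \<mu> w z) = joint_cumulant N (map (cvar D n \<mu>) [v, w]) / real n"
  using joint_cumulant_2[where X = "cvar D n \<mu> v" and Y = "cvar D n \<mu> w" and M = N] E_cvar
  by (simp add: Zstd_def real_div_sqrt)

lemma cumulant_3: "0 < n \<Longrightarrow> v \<in> idx_upto 4 2 \<Longrightarrow> w \<in> idx_upto 4 2 \<Longrightarrow> x \<in> idx_upto 4 2 \<Longrightarrow>
   sqrt (real n) * E (\<lambda>z. Zstd D n \<mu> v z * Zstd D n \<mu> w z * Zstd D n \<mu> x z) = joint_cumulant N (map (cvar D n \<mu>) [v, w, x]) / real n"
  using joint_cumulant_3[where X = "cvar D n \<mu> v" and Y = "cvar D n \<mu> w" and Z = "cvar D n \<mu> x" and M = N] E_cvar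
  by (simp add: Zstd_def field_simps)

lemma cumulant_4:
  assumes "0 < n" "v \<in> idx_upto 4 2" "w \<in> idx_upto 4 2" "x \<in> idx_upto 4 2" "y \<in> idx_upto 4 2"
  shows "kappa4 N (Zstd D n \<mu> v) (Zstd D n \<mu> w) (Zstd D n \<mu> x) (Zstd D n \<mu> y) = joint_cumulant N (map (cvar D n \<mu>) [v, w, x, y]) / real n / real n"
proof -
  let ?c = "cvar D n \<mu>"
  have s: "sqrt (real n) * sqrt (real n) = real n" by simp
  have "kappa4 N (Zstd D n \<mu> v) (Zstd D n \<mu> w) (Zstd D n \<mu> x) (Zstd D n \<mu> y) = kappa4 N (?c v) (?c w) (?c x) (?c y) / real n / real n"
    using assms(1) by (simp add: kappa4_def Zstd_def diff_divide_distrib)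
  then show ?thesis
    using joint_cumulant_4[where X = "?c v" and Y = "?c w" and Z = "?c x" and U = "?c y" and M = N] E_cvar assms
    by (simp add: kappa4_def)
qed

end

section \<open>Orders of the moments\<close>

definition rootn :: "nat \<times> 's \<Rightarrow> real" where "rootn w = 1 / sqrt (real (fst w))"

locale sample_filter =
  fixes F :: "(nat \<times> 's) filter"
  assumes F_le: "F \<le> filtercomap fst sequentially"
begin

lemma ev_n: "(\<forall>\<^sub>F n in sequentially. Q n) \<Longrightarrow> \<forall>\<^sub>F w in F. Q (fst w)"
  by (rule filter_leD[OF F_le]) (auto simp: eventually_filtercomap)

lemma ev_pos: "\<forall>\<^sub>F w in F. 0 < fst w"
  by (rule ev_n) (rule eventually_gt_at_top)

sublocale scale F rootn
proof
  show "\<forall>\<^sub>F w in F. 0 < rootn w" using ev_pos by eventually_elim (simp add: rootn_def)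
  have "filterlim fst sequentially F"
    unfolding filterlim_iff using ev_n by blast
  moreover have "(\<lambda>n. 1 / sqrt (real n)) \<longlonglongrightarrow> 0"
    by (intro tendsto_divide_0[OF tendsto_const] filterlim_at_top_imp_at_infinity filterlim_compose[OF sqrt_at_top filterlim_real_sequentially])
  ultimately show "(rootn \<longlongrightarrow> 0) F"
    unfolding rootn_def[abs_def] by (rule filterlim_compose[rotated])
qed

lemma big_n_bnd:
  assumes "X \<in> O[F](\<lambda>w. real (fst w))" shows "bnd (\<lambda>w. X w / real (fst w))"
proof -
  have "\<forall>\<^sub>F w in F. real (fst w) \<noteq> 0" using ev_pos by eventually_elim simp
  from landau_o.big.divide_right[OF this assms] have "(\<lambda>w. X w / real (fst w)) \<in> O[F](\<lambda>w. real (fst w) / real (fst w))" .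
  also have "O[F](\<lambda>w. real (fst w) / real (fst w)) = O[F](\<lambda>_. 1)"
    by (rule landau_o.big.cong) (use ev_pos in \<open>eventually_elim, simp\<close>)
  finally show ?thesis .
qed

lemma rootn_powr: "\<forall>\<^sub>F w in F. real (fst w) powr (- (real k / 2)) = rootn w ^ k"
  using ev_pos
proof eventually_elim
  case (elim w)
  then have "rootn w ^ k = (real (fst w) powr (- (1/2))) powr real k"
    by (simp add: rootn_def powr_half_sqrt powr_minus_divide powr_realpow)
  also have "\<dots> = real (fst w) powr (- (1/2) * real k)" by (simp only: powr_powr)
  finally show ?case by simp
qed

lemma O_powr: "O[F](\<lambda>w. real (fst w) powr (- (real k / 2))) = O[F](\<lambda>w. rootn w ^ k)"
  by (rule landau_o.big.cong) (rule rootn_powr)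

lemma bnd_mult_big: "bnd f \<Longrightarrow> g \<in> O[F](h) \<Longrightarrow> (\<lambda>w. f w * g w) \<in> O[F](h)"
  using big_prod2[of f F "\<lambda>_. 1" g h] by simp

lemma big_div: "f \<in> O[F](g) \<Longrightarrow> (\<lambda>w. (f w :: real) / c) \<in> O[F](g)"
  using big_cmult[of f F g "inverse c"] by (simp add: divide_inverse)

end

text \<open>
  The assumed orders of means and cumulants along one filter.  The measure \<open>mu w\<close> may
  depend on the sample, as the dominating measure given the ancillary statistic does.
\<close>
locale moment_orders = sample_filter F for F :: "(nat \<times> sample) filter" +
  fixes D :: "('q::finite, 'p::finite, 'c) problem" and mu :: "nat \<times> sample \<Rightarrow> sample measure" and c :: real
  assumes bart: "\<forall>\<^sub>F w in F. bartlett D (fst w) (mu w)"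
    and mean_L: "\<And>rs. 2 \<le> length rs \<Longrightarrow> length rs \<le> 4 \<Longrightarrow> (\<lambda>w. mean D (fst w) (mu w) (Inl rs) (theta0 D)) \<in> O[F](\<lambda>w. real (fst w))"
    and mean_B: "\<And>as. 1 \<le> length as \<Longrightarrow> length as \<le> 2 \<Longrightarrow> (\<lambda>w. mean D (fst w) (mu w) (Inr as) (theta0 D)) \<in> O[F](\<lambda>_. 1)"
    and cumulants: "\<And>vs. vs \<noteq> [] \<Longrightarrow> length vs \<le> 4 \<Longrightarrow> set vs \<subseteq> idx_upto 4 2 \<Longrightarrow>
        (\<lambda>w. joint_cumulant (dist_of D (fst w) (mu w) (theta0 D)) (map (cvar D (fst w) (mu w)) vs)) \<in> O[F](\<lambda>w. real (fst w))"
    and c_pos: "c > 0"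
    and coercive: "\<forall>\<^sub>F w in F. \<forall>u. form2 (\<lambda>r s. lamh D (fst w) (mu w) [r, s]) u u \<le> - c * (\<Sum>r\<in>UNIV. (u r)\<^sup>2)"
begin

abbreviation "NN w \<equiv> dist_of D (fst w) (mu w) (theta0 D)"

lemma lamh_bnd: "2 \<le> length rs \<Longrightarrow> length rs \<le> 4 \<Longrightarrow> bnd (\<lambda>w. lamh D (fst w) (mu w) rs)"
  unfolding lamh_def by (rule big_n_bnd) (rule mean_L)

lemma Gmat_bnd: "bnd (\<lambda>w. Gmat D (fst w) (mu w) S r s)"
proof (rule landau_o.bigI[of "1 / c"])
  show "\<forall>\<^sub>F w in F. norm (Gmat D (fst w) (mu w) S r s) \<le> 1 / c * norm (1::real)"
    using coercive unfolding Gmat_def by eventually_elim (auto intro!: Ginv_bound[OF c_pos])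
qed (use c_pos in simp)

lemma betav_bnd: "bnd (\<lambda>w. betav D (fst w) (mu w) r)"
  unfolding betav_def using mean_B by (cases r) auto
lemma betam_bnd: "bnd (\<lambda>w. betam D (fst w) (mu w) r s)"
  unfolding betam_def using mean_B by (cases r; cases s) auto

lemma cov_bnd: "v \<in> idx_upto 4 2 \<Longrightarrow> v' \<in> idx_upto 4 2 \<Longrightarrow>
   bnd (\<lambda>w. EN D (fst w) (mu w) (\<lambda>z. Zstd D (fst w) (mu w) v z * Zstd D (fst w) (mu w) v' z))"
  using big_n_bnd[OF cumulants[of "[v, v']"]]
  by (subst landau_o.big.in_cong[where g = "\<lambda>w. joint_cumulant (NN w) (map (cvar D (fst w) (mu w)) [v, v']) / real (fst w)"])
     (use bart ev_pos in \<open>eventually_elim, simp add: EN_def bartlett.cumulant_2\<close>, simp)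

lemma third_bnd: "v \<in> idx_upto 4 2 \<Longrightarrow> v' \<in> idx_upto 4 2 \<Longrightarrow> x \<in> idx_upto 4 2 \<Longrightarrow>
   bnd (\<lambda>w. sqrt (real (fst w)) * EN D (fst w) (mu w) (\<lambda>z. Zstd D (fst w) (mu w) v z * Zstd D (fst w) (mu w) v' z * Zstd D (fst w) (mu w) x z))"
  using big_n_bnd[OF cumulants[of "[v, v', x]"]]
  by (subst landau_o.big.in_cong[where g = "\<lambda>w. joint_cumulant (NN w) (map (cvar D (fst w) (mu w)) [v, v', x]) / real (fst w)"])
     (use bart ev_pos in \<open>eventually_elim, simp add: EN_def bartlett.cumulant_3\<close>, simp)

lemma Kcov_bnd: "v \<in> idx_upto 4 2 \<Longrightarrow> bnd (\<lambda>w. Kcov D (fst w) (mu w) v s)"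
  unfolding Kcov_def by (rule cov_bnd) simp_all
lemma Kadj_bnd: "bnd (\<lambda>w. Kadj D (fst w) (mu w) r s)"
  unfolding Kadj_def Zadj_def using cov_bnd by (cases r) (simp_all add: EN_def)
lemma skew_bnd: "bnd (\<lambda>w. skew D (fst w) (mu w) r s t)"
  unfolding skew_def by (rule third_bnd) simp_all
lemma Qmix_bnd: "bnd (\<lambda>w. Qmix D (fst w) (mu w) r s t u)"
  unfolding Qmix_def by (intro bnd_add third_bnd cov_bnd) simp_all

text \<open>
  A fourth cumulant of standardized variables is of order \<open>1/n\<close>.  The arguments \<open>h\<close> are linear
  combinations of scores with bounded coefficients and are reduced to scores one at a time.
\<close>
abbreviation small4 :: "(nat \<times> sample \<Rightarrow> sample \<Rightarrow> real) \<Rightarrow> (nat \<times> sample \<Rightarrow> sample \<Rightarrow> real) \<Rightarrow> (nat \<times> sample \<Rightarrow> sample \<Rightarrow> real) \<Rightarrow> (nat \<times> sample \<Rightarrow> sample \<Rightarrow> real) \<Rightarrow> bool" where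
  "small4 X Y U V \<equiv> (\<lambda>w. kappa4 (NN w) (X w) (Y w) (U w) (V w)) \<in> O[F](\<lambda>w. (rootn w)\<^sup>2)"

abbreviation "Zw v \<equiv> \<lambda>w. Zstd D (fst w) (mu w) v"
abbreviation "hw S r \<equiv> \<lambda>w. hfun D (fst w) (mu w) S r"

lemma small4_Z:
  assumes "v1 \<in> idx_upto 4 2" "v2 \<in> idx_upto 4 2" "v3 \<in> idx_upto 4 2" "v4 \<in> idx_upto 4 2"
  shows "small4 (Zw v1) (Zw v2) (Zw v3) (Zw v4)"
proof -
  let ?J = "\<lambda>w. joint_cumulant (NN w) (map (cvar D (fst w) (mu w)) [v1, v2, v3, v4]) / real (fst w)"
  have "(\<lambda>w. ?J w * (rootn w)\<^sup>2) \<in> O[F](\<lambda>w. (rootn w)\<^sup>2)"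
    by (rule bnd_mult_big[OF big_n_bnd[OF cumulants]]) (use assms in simp_all)
  moreover have "\<forall>\<^sub>F w in F. kappa4 (NN w) (Zw v1 w) (Zw v2 w) (Zw v3 w) (Zw v4 w) = ?J w * (rootn w)\<^sup>2"
    using bart ev_pos
    by eventually_elim (use assms in \<open>simp add: bartlett.cumulant_4 rootn_def power_divide\<close>)
  ultimately show ?thesis by (subst landau_o.big.in_cong)
qed

lemma small4_step:
  assumes "\<And>s. small4 (Zw (Inl [s])) Y U V"
    and "\<forall>\<^sub>F w in F. Y w \<in> bartlett.linear_vars D (fst w) (mu w) S \<and> U w \<in> bartlett.linear_vars D (fst w) (mu w) S \<and> V w \<in> bartlett.linear_vars D (fst w) (mu w) S"
  shows "small4 (hw S r) Y U V"
proof -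
  have "(\<lambda>w. \<Sum>s\<in>UNIV. (- Gmat D (fst w) (mu w) S r s) * kappa4 (NN w) (Zw (Inl [s]) w) (Y w) (U w) (V w)) \<in> O[F](\<lambda>w. (rootn w)\<^sup>2)"
    by (intro big_sum_fin bnd_mult_big bnd_minus Gmat_bnd assms)
  moreover have "\<forall>\<^sub>F w in F. kappa4 (NN w) (hw S r w) (Y w) (U w) (V w)
     = (\<Sum>s\<in>UNIV. (- Gmat D (fst w) (mu w) S r s) * kappa4 (NN w) (Zw (Inl [s]) w) (Y w) (U w) (V w))"
    using bart ev_pos coercive assms(2)
    by eventually_elim (rule bartlett.kappa4_hfun[OF _ _ c_pos], auto)
  ultimately show ?thesis by (subst landau_o.big.in_cong)
qed

lemma linear_vars_mem: "v \<in> idx_upto 4 2 \<Longrightarrow> \<forall>\<^sub>F w in F. Zw v w \<in> bartlett.linear_vars D (fst w) (mu w) S"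
  "\<forall>\<^sub>F w in F. hw S r w \<in> bartlett.linear_vars D (fst w) (mu w) S"
  using bart by (auto elim!: eventually_mono simp: bartlett.linear_vars_def)

lemma small4_hZZZ: "v2 \<in> idx_upto 4 2 \<Longrightarrow> v3 \<in> idx_upto 4 2 \<Longrightarrow> v4 \<in> idx_upto 4 2 \<Longrightarrow> small4 (hw S r) (Zw v2) (Zw v3) (Zw v4)"
  by (intro small4_step small4_Z eventually_conj linear_vars_mem) simp_all

lemma small4_hhZZ:
  assumes "v3 \<in> idx_upto 4 2" "v4 \<in> idx_upto 4 2" shows "small4 (hw S r) (hw S s) (Zw v3) (Zw v4)"
proof (rule small4_step)
  show "small4 (Zw (Inl [t])) (hw S s) (Zw v3) (Zw v4)" for t
    using small4_hZZZ[of "Inl [t]" v3 v4 S s] assms by (simp add: kappa4_swap(1)[of _ "Zstd _ _ _ _"])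
qed (intro eventually_conj linear_vars_mem assms)

lemma small4_hhhZ:
  assumes "v4 \<in> idx_upto 4 2" shows "small4 (hw S r) (hw S s) (hw S t) (Zw v4)"
proof (rule small4_step)
  show "small4 (Zw (Inl [a])) (hw S s) (hw S t) (Zw v4)" for a
    using small4_hhZZ[of "Inl [a]" v4 S s t] assms
    by (simp add: kappa4_swap(1)[of _ "Zstd _ _ _ _" "hfun _ _ _ _ _"] kappa4_swap(2)[of _ "hfun _ _ _ _ _" "Zstd _ _ _ _" "hfun _ _ _ _ _"])
qed (intro eventually_conj linear_vars_mem assms)

lemma small4_hhhh: "small4 (hw S r) (hw S s) (hw S t) (hw S u)"
proof (rule small4_step)
  show "small4 (Zw (Inl [a])) (hw S s) (hw S t) (hw S u)" for a
    using small4_hhhZ[of "Inl [a]" S s t u]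
    by (simp add: kappa4_swap(1)[of _ "Zstd _ _ _ _" "hfun _ _ _ _ _"] kappa4_swap(2)[of _ "hfun _ _ _ _ _" "Zstd _ _ _ _" "hfun _ _ _ _ _"]
        kappa4_swap(3)[of _ "hfun _ _ _ _ _" "hfun _ _ _ _ _" "Zstd _ _ _ _" "hfun _ _ _ _ _"])
qed (intro eventually_conj linear_vars_mem)

lemma small4_Zhhh: "v \<in> idx_upto 4 2 \<Longrightarrow> small4 (Zw v) (hw S s) (hw S t) (hw S u)"
  using small4_hhhZ[of v S s t u]
  by (simp add: kappa4_swap(1)[of _ "Zstd _ _ _ _" "hfun _ _ _ _ _"] kappa4_swap(2)[of _ "hfun _ _ _ _ _" "Zstd _ _ _ _" "hfun _ _ _ _ _"]
        kappa4_swap(3)[of _ "hfun _ _ _ _ _" "hfun _ _ _ _ _" "Zstd _ _ _ _" "hfun _ _ _ _ _"])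

lemma small4_ZhZh: "v \<in> idx_upto 4 2 \<Longrightarrow> v' \<in> idx_upto 4 2 \<Longrightarrow> small4 (Zw v) (hw S s) (Zw v') (hw S u)"
  using small4_hhZZ[of v v' S s u]
  by (simp add: kappa4_swap(1)[of _ "Zstd _ _ _ _" "hfun _ _ _ _ _"] kappa4_swap(3)[of _ "hfun _ _ _ _ _" "Zstd _ _ _ _" "Zstd _ _ _ _" "hfun _ _ _ _ _"]
     kappa4_swap(2)[of _ "hfun _ _ _ _ _" "Zstd _ _ _ _" "hfun _ _ _ _ _"] kappa4_swap(3)[of _ _ _ "Zstd _ _ _ _" "hfun _ _ _ _ _"])

lemma Omega_rem_small: "(\<lambda>w. Omega_rem D (fst w) (mu w) S) \<in> O[F](\<lambda>w. (rootn w)\<^sup>2)"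
  unfolding Omega_rem_def lr_rem_def lr_rem_grad_def
  by (intro sum_in_bigo big_sum_fin big_div bnd_mult_big bnd_mult Gmat_bnd lamh_bnd small4_hhhh small4_Zhhh small4_ZhZh) simp_all

lemma expectation_lr_approx:
  "(\<lambda>w. EN D (fst w) (mu w) (lr_approx D (fst w) (mu w) S) - (real (card S) + (rootn w)\<^sup>2 * Omega D (fst w) (mu w) S)) \<in> O[F](\<lambda>w. rootn w ^ 4)"
  "\<forall>\<^sub>F w in F. integrable (NN w) (lr_approx D (fst w) (mu w) S)"
proof -
  have "(\<lambda>w. (rootn w)\<^sup>2 * Omega_rem D (fst w) (mu w) S) \<in> O[F](\<lambda>w. (rootn w)\<^sup>2 * (rootn w)\<^sup>2)"
    by (rule big_prod2[OF _ Omega_rem_small]) simp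
  moreover have "\<forall>\<^sub>F w in F. EN D (fst w) (mu w) (lr_approx D (fst w) (mu w) S) - (real (card S) + (rootn w)\<^sup>2 * Omega D (fst w) (mu w) S)
     = (rootn w)\<^sup>2 * Omega_rem D (fst w) (mu w) S"
    using bart ev_pos coercive
  proof eventually_elim
    case (elim w)
    then show ?case using bartlett.expectation_lr_approx(2)[OF elim(1,2) c_pos, of S] by (simp add: EN_def rootn_def)
  qed
  moreover have "(\<lambda>w. (rootn w)\<^sup>2 * (rootn w)\<^sup>2) = (\<lambda>w. rootn w ^ 4)" by (simp flip: power_add)
  ultimately show "(\<lambda>w. EN D (fst w) (mu w) (lr_approx D (fst w) (mu w) S) - (real (card S) + (rootn w)\<^sup>2 * Omega D (fst w) (mu w) S)) \<in> O[F](\<lambda>w. rootn w ^ 4)"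
    by (subst landau_o.big.in_cong) auto
  show "\<forall>\<^sub>F w in F. integrable (NN w) (lr_approx D (fst w) (mu w) S)"
    using bart ev_pos coercive by eventually_elim (rule bartlett.expectation_lr_approx(1)[OF _ _ c_pos], auto)
qed

end

section \<open>Taylor expansion of the adjusted log-likelihood\<close>

lemma form_coeff:
  "form1 (\<lambda>r. a * A1 r + b * B1 r) u = a * form1 A1 u + b * form1 B1 u"
  "form2 (\<lambda>r s. a * A2 r s + b * B2 r s) u v = a * form2 A2 u v + b * form2 B2 u v"
  "form3 (\<lambda>r s t. a * A3 r s t + b * B3 r s t) u v x = a * form3 A3 u v x + b * form3 B3 u v x"
  "form4 (\<lambda>r s t z. a * A4 r s t z + b * B4 r s t z) u v x y = a * form4 A4 u v x y + b * form4 B4 u v x y"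
  by (simp_all add: form1_def form2_def form3_def form4_def algebra_simps sum.distrib sum_distrib_left)

text \<open>
  The function \<open>f\<close> of the expansion of a maximum, at a single point of the filter.
\<close>
definition lr_f where
  "lr_f d Z1 \<Lambda> Z2 \<mu>3 \<beta> Z3 \<mu>4 Zb \<beta>2 u = form1 Z1 u + form2 \<Lambda> u u / 2
     + d * (form2 Z2 u u / 2 + form3 \<mu>3 u u u / 6 + form1 \<beta> u)
     + d\<^sup>2 * (form3 Z3 u u u / 6 + form4 \<mu>4 u u u u / 24 + form1 Zb u + form2 \<beta>2 u u / 2)"

lemma (in lik_expansion) f_eq_lr_f:
  "f u w = lr_f (\<delta> w) (\<lambda>r. Z1 r w) (\<lambda>r s. \<Lambda> r s w) (\<lambda>r s. Z2 r s w) (\<lambda>r s t. \<mu>3 r s t w) (\<lambda>r. \<beta> r w)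
     (\<lambda>r s t. Z3 r s t w) (\<lambda>r s t z. \<mu>4 r s t z w) (\<lambda>r. Zb r w) (\<lambda>r s. \<beta>2 r s w) u"
  by (simp add: f_def q0_def q1_def q2_def lr_f_def)

lemma sum_Inl: "(\<Sum>r\<in>(UNIV :: ('q::finite + 'p::finite) set). case r of Inl a \<Rightarrow> f a | Inr _ \<Rightarrow> 0) = (\<Sum>a\<in>UNIV. (f a :: 'x::comm_monoid_add))"
proof -
  have "(\<Sum>r\<in>(UNIV :: ('q + 'p) set). case r of Inl a \<Rightarrow> f a | Inr _ \<Rightarrow> 0) = (\<Sum>r\<in>range (Inl :: 'q \<Rightarrow> 'q + 'p). case r of Inl a \<Rightarrow> f a | Inr _ \<Rightarrow> 0)"
    by (rule sum.mono_neutral_right) (auto split: sum.split)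
  also have "\<dots> = (\<Sum>a\<in>UNIV. f a)" by (subst sum.reindex) (auto simp: inj_on_def)
  finally show ?thesis .
qed

text \<open>
  The first two derivatives of the adjustment as a function of the whole parameter.
\<close>
definition adj1 :: "('q::finite, 'p::finite, 'c) problem \<Rightarrow> nat \<Rightarrow> sample \<Rightarrow> 'q + 'p \<Rightarrow> real" where
  "adj1 D n y r = (case r of Inl a \<Rightarrow> dv D n (Inr [a]) (theta0 D) y | Inr _ \<Rightarrow> 0)"
definition adj2 :: "('q::finite, 'p::finite, 'c) problem \<Rightarrow> nat \<Rightarrow> sample \<Rightarrow> 'q + 'p \<Rightarrow> 'q + 'p \<Rightarrow> real" where
  "adj2 D n y r s = (case r of Inl a \<Rightarrow> (case s of Inl b \<Rightarrow> dv D n (Inr [a, b]) (theta0 D) y | Inr _ \<Rightarrow> 0) | Inr _ \<Rightarrow> 0)"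

lemma form1_adj1:
  fixes D :: "('q::finite, 'p::finite, 'c) problem" and h :: "'q + 'p \<Rightarrow> real"
  shows "form1 (\<lambda>a. dv D n (Inr [a]) (theta0 D) y) (\<lambda>a. h (Inl a)) = form1 (adj1 D n y) h"
proof -
  have "form1 (adj1 D n y) h = (\<Sum>r\<in>(UNIV :: ('q + 'p) set). case r of Inl a \<Rightarrow> dv D n (Inr [a]) (theta0 D) y * h (Inl a) | Inr _ \<Rightarrow> 0)"
    unfolding form1_def adj1_def by (rule sum.cong) (auto split: sum.split)
  then show ?thesis by (simp add: sum_Inl form1_def)
qed

lemma form2_adj2:
  fixes D :: "('q::finite, 'p::finite, 'c) problem" and h :: "'q + 'p \<Rightarrow> real"
  shows "form2 (\<lambda>a b. dv D n (Inr [a, b]) (theta0 D) y) (\<lambda>a. h (Inl a)) (\<lambda>a. h (Inl a)) = form2 (adj2 D n y) h h"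
proof -
  have i: "(\<Sum>s\<in>UNIV. adj2 D n y (Inl a) s * h (Inl a) * h s) = (\<Sum>b\<in>UNIV. dv D n (Inr [a, b]) (theta0 D) y * h (Inl a) * h (Inl b))" for a
  proof -
    have "(\<Sum>s\<in>UNIV. adj2 D n y (Inl a) s * h (Inl a) * h s)
      = (\<Sum>s\<in>(UNIV :: ('q + 'p) set). case s of Inl b \<Rightarrow> dv D n (Inr [a, b]) (theta0 D) y * h (Inl a) * h (Inl b) | Inr _ \<Rightarrow> 0)"
      unfolding adj2_def by (rule sum.cong) (auto split: sum.split)
    then show ?thesis by (simp add: sum_Inl)
  qed
  have "form2 (adj2 D n y) h h = (\<Sum>r\<in>(UNIV :: ('q + 'p) set). case r of Inl a \<Rightarrow> (\<Sum>s\<in>UNIV. adj2 D n y (Inl a) s * h (Inl a) * h s) | Inr _ \<Rightarrow> 0)"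
    unfolding form2_def by (rule sum.cong) (auto split: sum.split simp: adj2_def)
  then show ?thesis by (simp add: sum_Inl form2_def i)
qed

definition shift_par where
  "shift_par D v = theta0 D + (\<Sum>r\<in>UNIV. v r *\<^sub>R par_axis r)"

definition Lbar where
  "Lbar D n y \<theta> = loglik D n y \<theta> + adj D n y (fst \<theta>)"

lemma norm_par_axis: "norm (par_axis r) = 1"
  using par_axis_Basis by (rule norm_Basis)

lemma fst_sum_axis:
  fixes v :: "'q::finite + 'p::finite \<Rightarrow> real"
  shows "fst (\<Sum>r\<in>UNIV. v r *\<^sub>R par_axis r) = (\<Sum>a\<in>UNIV. v (Inl a) *\<^sub>R axis a 1)"
proof -
  have "fst (\<Sum>r\<in>UNIV. v r *\<^sub>R par_axis r) = (\<Sum>r\<in>UNIV. v r *\<^sub>R fst (par_axis r))"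
    by (simp add: fst_sum)
  also have "\<dots> = (\<Sum>r\<in>(UNIV :: ('q + 'p) set). case r of Inl a \<Rightarrow> v (Inl a) *\<^sub>R axis a 1 | Inr _ \<Rightarrow> 0)"
    by (rule sum.cong) (auto split: sum.split)
  finally show ?thesis by (simp add: sum_Inl)
qed

context sampling begin

lemma near_in_Theta:
  assumes "cball (theta0 D) \<epsilon> \<subseteq> Theta D" "(\<Sum>r\<in>UNIV. \<bar>v r\<bar>) \<le> \<epsilon>" "0 \<le> t" "t \<le> 1"
  shows "theta0 D + t *\<^sub>R (\<Sum>r\<in>UNIV. v r *\<^sub>R par_axis r) \<in> cball (theta0 D) \<epsilon>"
proof -
  have "norm (t *\<^sub>R (\<Sum>r\<in>UNIV. v r *\<^sub>R par_axis r)) \<le> 1 * norm (\<Sum>r\<in>UNIV. v r *\<^sub>R par_axis r)"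
    unfolding norm_scaleR using assms by (intro mult_right_mono) auto
  also have "\<dots> \<le> (\<Sum>r\<in>UNIV. norm (v r *\<^sub>R par_axis r))" unfolding mult_1 by (rule norm_sum)
  also have "\<dots> = (\<Sum>r\<in>UNIV. \<bar>v r\<bar>)" by (simp add: norm_par_axis)
  finally show ?thesis using assms(2) by (simp add: dist_norm)
qed

text \<open>
  The continuity of the derivatives on the compact ball makes the set bounded, without which a supremum would be
  meaningless.
\<close>
lemma sup_bound:
  assumes y: "y \<in> space (leb n)" and cb: "cball (theta0 D) \<epsilon> \<subseteq> Theta D" and \<theta>: "\<theta> \<in> cball (theta0 D) \<epsilon>"
    and v: "case v of Inl rs \<Rightarrow> length rs \<le> 5 | Inr as \<Rightarrow> length as \<le> 3"
  shows "\<bar>dv D n v \<theta> y\<bar> \<le> (SUP \<theta>\<in>cball (theta0 D) \<epsilon>. \<bar>dv D n v \<theta> y\<bar>)"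
proof (rule cSUP_upper[OF \<theta>])
  have "continuous_on (Theta D) (\<lambda>\<theta>. dv D n v \<theta> y)"
  proof (cases v)
    case (Inl rs)
    then show ?thesis using C_k_onD(2)[OF Ck[OF y], of "map par_axis rs"] par_axis_Basis v by auto
  next
    case (Inr as)
    have "continuous_on (fst ` Theta D) (pds (map (\<lambda>a. axis a 1) as) (adj D n y))"
      using Inr v axis_Basis by (intro C_k_onD(2)[OF Ck_adj[OF y]]) auto
    then have "continuous_on (Theta D) (\<lambda>\<theta>. pds (map (\<lambda>a. axis a 1) as) (adj D n y) (fst \<theta>))"
      by (rule continuous_on_compose2) (auto intro!: continuous_intros)
    then show ?thesis using Inr by simp
  qed
  then have "continuous_on (cball (theta0 D) \<epsilon>) (\<lambda>\<theta>. \<bar>dv D n v \<theta> y\<bar>)"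
    using cb by (intro continuous_intros) (rule continuous_on_subset)
  then have "compact ((\<lambda>\<theta>. \<bar>dv D n v \<theta> y\<bar>) ` cball (theta0 D) \<epsilon>)"
    by (rule compact_continuous_image) simp
  then show "bdd_above ((\<lambda>\<theta>. \<bar>dv D n v \<theta> y\<bar>) ` cball (theta0 D) \<epsilon>)"
    by (intro bounded_imp_bdd_above compact_imp_bounded)
qed

lemma taylor_loglik:
  fixes v :: "'q + 'p \<Rightarrow> real"
  assumes y: "y \<in> space (leb n)" and cb: "cball (theta0 D) \<epsilon> \<subseteq> Theta D" and small: "(\<Sum>r\<in>UNIV. \<bar>v r\<bar>) \<le> \<epsilon>"
    and U: "\<And>r. \<bar>v r\<bar> \<le> U"
  shows "\<bar>loglik D n y (shift_par D v) - loglik D n y (theta0 D)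
     - (form1 (\<lambda>r. dv D n (Inl [r]) (theta0 D) y) v + form2 (\<lambda>r s. dv D n (Inl [r, s]) (theta0 D) y) v v / 2
        + form3 (\<lambda>r s t. dv D n (Inl [r, s, t]) (theta0 D) y) v v v / 6
        + form4 (\<lambda>r s t z. dv D n (Inl [r, s, t, z]) (theta0 D) y) v v v v / 24)\<bar>
   \<le> real (card {rs :: ('q + 'p) list. length rs = 5})
       * (U ^ 5 * (\<Sum>rs | length rs = 5. SUP \<theta>\<in>cball (theta0 D) \<epsilon>. \<bar>dv D n (Inl rs) \<theta> y\<bar>)) / 120"
proof -
  let ?s = "\<Sum>r\<in>UNIV. v r *\<^sub>R par_axis r"
  have seg: "theta0 D + t *\<^sub>R ?s \<in> Theta D" if "0 \<le> t" "t \<le> 1" for t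
    using near_in_Theta[OF cb small that] cb by blast
  obtain t where t: "0 < t" "t < 1"
    "loglik D n y (theta0 D + ?s) = (\<Sum>k<5. taylor_term par_axis (loglik D n y) v k (theta0 D) / fact k)
       + taylor_term par_axis (loglik D n y) v 5 (theta0 D + t *\<^sub>R ?s) / fact 5"
    using taylor_expansion[OF open_Theta Ck[OF y], of par_axis "theta0 D" v] par_axis_Basis seg by (auto simp: image_subset_iff)
  let ?K = "\<Sum>rs | length rs = 5. SUP \<theta>\<in>cball (theta0 D) \<epsilon>. \<bar>dv D n (Inl rs :: ('q, 'p) idx) \<theta> y\<bar>"
  have near: "theta0 D + t *\<^sub>R ?s \<in> cball (theta0 D) \<epsilon>" using near_in_Theta[OF cb small] t by simp
  have sup0: "0 \<le> (SUP \<theta>\<in>cball (theta0 D) \<epsilon>. \<bar>dv D n (Inl rs :: ('q, 'p) idx) \<theta> y\<bar>)" if "length rs = 5" for rs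
    using order_trans[OF abs_ge_zero sup_bound[OF y cb near, of "Inl rs"]] that by simp
  have "\<bar>taylor_term par_axis (loglik D n y) v 5 (theta0 D + t *\<^sub>R ?s)\<bar> \<le> real (card {rs :: ('q + 'p) list. length rs = 5}) * (U ^ 5 * ?K)"
  proof (rule taylor_term_le[OF _ U])
    fix rs :: "('q + 'p) list" assume l: "length rs = 5"
    have "\<bar>dv D n (Inl rs) (theta0 D + t *\<^sub>R ?s) y\<bar> \<le> (SUP \<theta>\<in>cball (theta0 D) \<epsilon>. \<bar>dv D n (Inl rs) \<theta> y\<bar>)"
      by (rule sup_bound[OF y cb near]) (use l in simp)
    also have "\<dots> \<le> ?K" by (rule member_le_sum) (use l sup0 finite_length_eq in auto)
    finally show "\<bar>pds (map par_axis rs) (loglik D n y) (theta0 D + t *\<^sub>R ?s)\<bar> \<le> ?K" by simp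
  qed
  moreover have "(\<Sum>k<5. taylor_term par_axis (loglik D n y) v k (theta0 D) / fact k)
     = loglik D n y (theta0 D) + (form1 (\<lambda>r. dv D n (Inl [r]) (theta0 D) y) v + form2 (\<lambda>r s. dv D n (Inl [r, s]) (theta0 D) y) v v / 2
        + form3 (\<lambda>r s t. dv D n (Inl [r, s, t]) (theta0 D) y) v v v / 6
        + form4 (\<lambda>r s t z. dv D n (Inl [r, s, t, z]) (theta0 D) y) v v v v / 24)"
  proof -
    have five: "{..<5::nat} = {0, Suc 0, 2, 3, 4}" by auto
    show ?thesis unfolding five by (simp add: taylor_term_forms fact_numeral)
  qed
  ultimately show ?thesis unfolding shift_par_def t(3) by (simp add: fact_numeral field_simps)
qed

lemma taylor_adj:
  fixes v :: "'q + 'p \<Rightarrow> real"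
  assumes y: "y \<in> space (leb n)" and cb: "cball (theta0 D) \<epsilon> \<subseteq> Theta D" and small: "(\<Sum>r\<in>UNIV. \<bar>v r\<bar>) \<le> \<epsilon>"
    and U: "\<And>r. \<bar>v r\<bar> \<le> U"
  shows "\<bar>adj D n y (fst (shift_par D v)) - adj D n y (fst (theta0 D)) - (form1 (adj1 D n y) v + form2 (adj2 D n y) v v / 2)\<bar>
   \<le> real (card {as :: 'q list. length as = 3})
       * (U ^ 3 * (\<Sum>as | length as = 3. SUP \<theta>\<in>cball (theta0 D) \<epsilon>. \<bar>dv D n (Inr as) \<theta> y\<bar>)) / 6"
proof -
  let ?s = "\<Sum>r\<in>UNIV. v r *\<^sub>R par_axis r"
  let ?e = "\<lambda>a::'q. axis a 1 :: real ^ 'q"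
  let ?q = "\<Sum>a\<in>UNIV. v (Inl a) *\<^sub>R ?e a"
  have fs: "fst (theta0 D + t *\<^sub>R ?s) = fst (theta0 D) + t *\<^sub>R ?q" for t by (simp add: fst_sum_axis)
  have seg: "fst (theta0 D) + t *\<^sub>R ?q \<in> fst ` Theta D" if "0 \<le> t" "t \<le> 1" for t
    unfolding fs[symmetric] using near_in_Theta[OF cb small that] cb by blast
  obtain t where t: "0 < t" "t < 1"
    "adj D n y (fst (theta0 D) + ?q) = (\<Sum>k<3. taylor_term ?e (adj D n y) (\<lambda>a. v (Inl a)) k (fst (theta0 D)) / fact k)
       + taylor_term ?e (adj D n y) (\<lambda>a. v (Inl a)) 3 (fst (theta0 D) + t *\<^sub>R ?q) / fact 3"
    using taylor_expansion[OF open_fst_Theta Ck_adj[OF y], of ?e "fst (theta0 D)" "\<lambda>a. v (Inl a)"] axis_Basis seg by (auto simp: image_subset_iff)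
  let ?K = "\<Sum>as | length as = 3. SUP \<theta>\<in>cball (theta0 D) \<epsilon>. \<bar>dv D n (Inr as :: ('q, 'p) idx) \<theta> y\<bar>"
  have near: "theta0 D + t *\<^sub>R ?s \<in> cball (theta0 D) \<epsilon>" using near_in_Theta[OF cb small] t by simp
  have sup0: "0 \<le> (SUP \<theta>\<in>cball (theta0 D) \<epsilon>. \<bar>dv D n (Inr as :: ('q, 'p) idx) \<theta> y\<bar>)" if "length as = 3" for as
    using order_trans[OF abs_ge_zero sup_bound[OF y cb near, of "Inr as"]] that by simp
  have "\<bar>taylor_term ?e (adj D n y) (\<lambda>a. v (Inl a)) 3 (fst (theta0 D) + t *\<^sub>R ?q)\<bar> \<le> real (card {as :: 'q list. length as = 3}) * (U ^ 3 * ?K)"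
  proof (rule taylor_term_le[OF _ U])
    fix as :: "'q list" assume l: "length as = 3"
    have "\<bar>dv D n (Inr as) (theta0 D + t *\<^sub>R ?s) y\<bar> \<le> (SUP \<theta>\<in>cball (theta0 D) \<epsilon>. \<bar>dv D n (Inr as) \<theta> y\<bar>)"
      by (rule sup_bound[OF y cb near]) (use l in simp)
    also have "\<dots> \<le> ?K" by (rule member_le_sum) (use l sup0 finite_length_eq in auto)
    finally show "\<bar>pds (map ?e as) (adj D n y) (fst (theta0 D) + t *\<^sub>R ?q)\<bar> \<le> ?K" by (simp add: fst_sum_axis)
  qed
  moreover have "(\<Sum>k<3. taylor_term ?e (adj D n y) (\<lambda>a. v (Inl a)) k (fst (theta0 D)) / fact k)
     = adj D n y (fst (theta0 D)) + (form1 (adj1 D n y) v + form2 (adj2 D n y) v v / 2)"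
  proof -
    have three: "{..<3::nat} = {0, Suc 0, 2}" by auto
    show ?thesis unfolding three form1_adj1[symmetric] form2_adj2[symmetric] by (simp add: taylor_term_forms fact_numeral)
  qed
  moreover have "fst (shift_par D v) = fst (theta0 D) + ?q" by (simp add: shift_par_def fst_sum_axis)
  ultimately show ?thesis unfolding t(3) by (simp add: fact_numeral field_simps t(3))
qed

lemma dv_sym2: "y \<in> space (leb n) \<Longrightarrow> dv D n (Inl [r, s]) (theta0 D) y = dv D n (Inl [s, r]) (theta0 D) y"
  using pds_swap[OF open_Theta theta0 Ck par_axis_Basis par_axis_Basis, of y "[]"] by simp

lemma dv_sym12: "y \<in> space (leb n) \<Longrightarrow> dv D n (Inl [r, s, t]) (theta0 D) y = dv D n (Inl [s, r, t]) (theta0 D) y"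
  using pds_swap[OF open_Theta theta0 Ck par_axis_Basis par_axis_Basis, of y "[par_axis t]"] par_axis_Basis[of t] by simp

lemma dv_sym23: "y \<in> space (leb n) \<Longrightarrow> dv D n (Inl [r, s, t]) (theta0 D) y = dv D n (Inl [r, t, s]) (theta0 D) y"
proof -
  assume y: "y \<in> space (leb n)"
  have "pd (par_axis r) (pds [par_axis s, par_axis t] (loglik D n y)) (theta0 D)
     = pd (par_axis r) (pds [par_axis t, par_axis s] (loglik D n y)) (theta0 D)"
    by (rule pd_cong_open[OF open_Theta theta0]) (use pds_swap[OF open_Theta _ Ck[OF y] par_axis_Basis par_axis_Basis, of _ "[]"] in simp)
  then show ?thesis by simp
qed

lemma mean_cong:
  assumes "\<And>y. y \<in> space (leb n) \<Longrightarrow> dv D n v (theta0 D) y = dv D n v' (theta0 D) y"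
  shows "mean D n \<mu> v (theta0 D) = mean D n \<mu> v' (theta0 D)"
  unfolding mean_def by (rule Bochner_Integration.integral_cong) (use assms space_\<mu> in auto)

lemma sym_lamh: "lamh D n \<mu> [r, s] = lamh D n \<mu> [s, r]" "lamh D n \<mu> [r, s, t] = lamh D n \<mu> [s, r, t]"
   "lamh D n \<mu> [r, s, t] = lamh D n \<mu> [r, t, s]"
  unfolding lamh_def
  using mean_cong[OF dv_sym2, of r s] mean_cong[OF dv_sym12, of r s t] mean_cong[OF dv_sym23, of r s t] by simp_all

lemma sym_Zs: "y \<in> space (leb n) \<Longrightarrow> Zstd D n \<mu> (Inl [r, s]) y = Zstd D n \<mu> (Inl [s, r]) y"
  using mean_cong[OF dv_sym2, of r s] dv_sym2[of y r s] by (simp add: Zstd_def cent_def)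

end

definition Zadj2 :: "('q::finite, 'p::finite, 'c) problem \<Rightarrow> nat \<Rightarrow> sample measure \<Rightarrow> 'q + 'p \<Rightarrow> 'q + 'p \<Rightarrow> sample \<Rightarrow> real" where
  "Zadj2 D n \<mu> r s z = (case r of Inl a \<Rightarrow> (case s of Inl b \<Rightarrow> Zstd D n \<mu> (Inr [a, b]) z | Inr _ \<Rightarrow> 0) | Inr _ \<Rightarrow> 0)"

definition lik_approx where
  "lik_approx D n \<mu> z u = lr_f (1 / sqrt (real n)) (\<lambda>r. Zstd D n \<mu> (Inl [r]) z) (\<lambda>r s. lamh D n \<mu> [r, s]) (\<lambda>r s. Zstd D n \<mu> (Inl [r, s]) z)
     (\<lambda>r s t. lamh D n \<mu> [r, s, t]) (betav D n \<mu>) (\<lambda>r s t. Zstd D n \<mu> (Inl [r, s, t]) z) (\<lambda>r s t u. lamh D n \<mu> [r, s, t, u])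
     (\<lambda>r. Zadj D n \<mu> r z) (betam D n \<mu>) u"

context bartlett begin

lemma dv_decomp:
  assumes n: "0 < n"
  shows "dv D n (Inl rs) (theta0 D) z = real n * lamh D n \<mu> rs + sqrt (real n) * Zstd D n \<mu> (Inl rs) z"
    "adj1 D n z r = 1 * betav D n \<mu> r + 1 / sqrt (real n) * Zadj D n \<mu> r z"
    "adj2 D n z r s = 1 * betam D n \<mu> r s + 1 / sqrt (real n) * Zadj2 D n \<mu> r s z"
proof -
  have sn: "sqrt (real n) * sqrt (real n) = real n" "sqrt (real n) \<noteq> 0" using n by simp_all
  show "dv D n (Inl rs) (theta0 D) z = real n * lamh D n \<mu> rs + sqrt (real n) * Zstd D n \<mu> (Inl rs) z"
    using n by (simp add: lamh_def Zstd_def cent_def)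
  have *: "Zstd D n \<mu> (Inr as) z / sqrt (real n) = cent D n \<mu> (Inr as) z" for as
    using n by (simp add: Zstd_def)
  show "adj1 D n z r = 1 * betav D n \<mu> r + 1 / sqrt (real n) * Zadj D n \<mu> r z"
    by (cases r) (simp_all add: adj1_def betav_def Zadj_def * cent_def)
  show "adj2 D n z r s = 1 * betam D n \<mu> r s + 1 / sqrt (real n) * Zadj2 D n \<mu> r s z"
    by (cases r; cases s) (simp_all add: adj2_def betam_def Zadj2_def * cent_def)
qed

text \<open>
  In the Taylor polynomial the derivatives are split into means and deviations.  A deviation is of smaller order than
  the mean by a factor \<open>n\<^sup>-\<^sup>1\<^sup>/\<^sup>2\<close>, so that those of the fourth derivatives of the log-likelihood and of the second derivatives of the
  adjustment are not part of the approximation but of the remainder.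
\<close>
lemma taylor_forms_eq:
  assumes n: "0 < n" and s: "s = 1 / sqrt (real n)"
  shows "form1 (\<lambda>r. dv D n (Inl [r]) (theta0 D) y) (\<lambda>r. s * u r) + form2 (\<lambda>r s. dv D n (Inl [r, s]) (theta0 D) y) (\<lambda>r. s * u r) (\<lambda>r. s * u r) / 2
        + form3 (\<lambda>r s t. dv D n (Inl [r, s, t]) (theta0 D) y) (\<lambda>r. s * u r) (\<lambda>r. s * u r) (\<lambda>r. s * u r) / 6
        + form4 (\<lambda>r s t z. dv D n (Inl [r, s, t, z]) (theta0 D) y) (\<lambda>r. s * u r) (\<lambda>r. s * u r) (\<lambda>r. s * u r) (\<lambda>r. s * u r) / 24
     + (form1 (adj1 D n y) (\<lambda>r. s * u r) + form2 (adj2 D n y) (\<lambda>r. s * u r) (\<lambda>r. s * u r) / 2)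
   = lik_approx D n \<mu> y u + s ^ 3 * (form4 (\<lambda>r s t z. Zstd D n \<mu> (Inl [r, s, t, z]) y) u u u u / 24 + form2 (\<lambda>r s. Zadj2 D n \<mu> r s y) u u / 2)"
proof -
  have sp: "s > 0" using n s by simp
  have nn: "real n = 1 / s\<^sup>2" "sqrt (real n) = 1 / s" using n by (simp_all add: s power_divide)
  have l0: "lamh D n \<mu> [r] = 0" for r by (simp add: lamh_def mean_score)
  have z0: "form1 (\<lambda>r. 0) u = 0" by (simp add: form1_def)
  have a1: "adj1 D n y = (\<lambda>r. 1 * betav D n \<mu> r + s * Zadj D n \<mu> r y)" 
    unfolding dv_decomp(2)[OF n] s ..
  have a2: "adj2 D n y = (\<lambda>r t. 1 * betam D n \<mu> r t + s * Zadj2 D n \<mu> r t y)" 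
    unfolding dv_decomp(3)[OF n] s ..
  note e = dv_decomp(1)[OF n, unfolded nn(2), unfolded nn(1)]
  show ?thesis
    unfolding e a1 a2 form_coeff form_scale l0 z0 lik_approx_def lr_f_def s[symmetric]
    using sp by (simp add: field_simps power2_eq_square power3_eq_cube)
qed

end

text \<open>
  Besides the moments, the sample itself is under control: the standardized derivatives are bounded, and the
  derivatives in the Taylor remainders are bounded uniformly near the true value.
\<close>
locale sample_orders = moment_orders F D mu c
  for F :: "(nat \<times> sample) filter" and D :: "('q::finite, 'p::finite, 'c) problem" and mu c +
  fixes \<epsilon> :: real
  assumes Z_bnd: "\<And>v. v \<in> idx_upto 4 2 \<Longrightarrow> bnd (\<lambda>w. Zstd D (fst w) (mu w) v (snd w))"
    and in_space: "\<forall>\<^sub>F w in F. snd w \<in> space (leb (fst w))"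
    and eps: "\<epsilon> > 0" "cball (theta0 D) \<epsilon> \<subseteq> Theta D"
    and sup_L: "\<And>rs. length rs = 5 \<Longrightarrow> (\<lambda>w. SUP \<theta>\<in>cball (theta0 D) \<epsilon>. \<bar>dv D (fst w) (Inl rs) \<theta> (snd w)\<bar>) \<in> O[F](\<lambda>w. real (fst w))"
    and sup_B: "\<And>as. length as = 3 \<Longrightarrow> bnd (\<lambda>w. SUP \<theta>\<in>cball (theta0 D) \<epsilon>. \<bar>dv D (fst w) (Inr as) \<theta> (snd w)\<bar>)"
begin

lemma small_shift:
  fixes u :: "'q + 'p \<Rightarrow> nat \<times> sample \<Rightarrow> real"
  assumes u: "\<And>r. bnd (u r)" and e: "e > 0"
  shows "\<exists>U\<ge>0. \<forall>\<^sub>F w in F. (\<forall>r. \<bar>u r w\<bar> \<le> U) \<and> (\<Sum>r\<in>UNIV. \<bar>rootn w * u r w\<bar>) \<le> e"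
proof -
  have "bnd (\<lambda>w. \<Sum>r\<in>UNIV. \<bar>u r w\<bar>)" using u by (intro big_sum_fin) simp
  then obtain U where U: "U > 0" "\<forall>\<^sub>F w in F. norm (\<Sum>r\<in>UNIV. \<bar>u r w\<bar>) \<le> U * norm (1::real)" by (rule landau_o.bigE)
  have "e / U > 0" using e U(1) by simp
  have "\<forall>\<^sub>F w in F. (\<forall>r. \<bar>u r w\<bar> \<le> U) \<and> (\<Sum>r\<in>UNIV. \<bar>rootn w * u r w\<bar>) \<le> e"
    using U(2) \<delta>_pos \<delta>_less[OF \<open>e / U > 0\<close>]
  proof eventually_elim
    case (elim w)
    have S: "(\<Sum>r\<in>UNIV. \<bar>u r w\<bar>) \<le> U" using elim(1) e U(1) by (simp add: sum_nonneg)
    have "\<bar>u r w\<bar> \<le> U" for r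
      by (rule order_trans[OF _ S]) (rule member_le_sum, auto)
    moreover have "(\<Sum>r\<in>UNIV. \<bar>rootn w * u r w\<bar>) = rootn w * (\<Sum>r\<in>UNIV. \<bar>u r w\<bar>)"
      using elim(2) by (simp add: abs_mult sum_distrib_left)
    moreover have "rootn w * (\<Sum>r\<in>UNIV. \<bar>u r w\<bar>) \<le> e / U * U"
      using elim S U(1) e by (intro mult_mono) (auto simp: sum_nonneg)
    ultimately show ?case using U(1) by simp
  qed
  then show ?thesis using U(1) by (intro exI[of _ U]) auto
qed

abbreviation "Lb w \<theta> \<equiv> Lbar D (fst w) (snd w) \<theta>"

lemma taylor_Lbar:
  fixes u :: "'q + 'p \<Rightarrow> nat \<times> sample \<Rightarrow> real"
  assumes u: "\<And>r. bnd (u r)"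
  shows "(\<lambda>w. Lb w (shift_par D (\<lambda>r. rootn w * u r w)) - Lb w (theta0 D) - lik_approx D (fst w) (mu w) (snd w) (\<lambda>r. u r w)) \<in> O[F](\<lambda>w. rootn w ^ 3)"
proof -
  obtain U where U: "U \<ge> 0" "\<forall>\<^sub>F w in F. (\<forall>r. \<bar>u r w\<bar> \<le> U) \<and> (\<Sum>r\<in>UNIV. \<bar>rootn w * u r w\<bar>) \<le> \<epsilon>"
    using small_shift[of u, OF u eps(1)] by (elim exE conjE) (rule that)
  define KL where "KL w = (\<Sum>rs | length rs = 5. SUP \<theta>\<in>cball (theta0 D) \<epsilon>. \<bar>dv D (fst w) (Inl rs :: ('q, 'p) idx) \<theta> (snd w)\<bar>)" for w
  define KB where "KB w = (\<Sum>as | length as = 3. SUP \<theta>\<in>cball (theta0 D) \<epsilon>. \<bar>dv D (fst w) (Inr as :: ('q, 'p) idx) \<theta> (snd w)\<bar>)" for w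
  have KL: "bnd (\<lambda>w. KL w / real (fst w))" unfolding KL_def
    by (intro big_n_bnd big_sum_in_bigo sup_L) auto
  have KB: "bnd KB" unfolding KB_def
    by (intro big_sum_in_bigo sup_B) auto
  define X where "X w = form4 (\<lambda>r s t z. Zstd D (fst w) (mu w) (Inl [r, s, t, z]) (snd w)) (\<lambda>r. u r w) (\<lambda>r. u r w) (\<lambda>r. u r w) (\<lambda>r. u r w) * (1/24)
     + form2 (\<lambda>r s. Zadj2 D (fst w) (mu w) r s (snd w)) (\<lambda>r. u r w) (\<lambda>r. u r w) * (1/2)" for w
  have Za2: "bnd (\<lambda>w. Zadj2 D (fst w) (mu w) r s (snd w))" for r s
    unfolding Zadj2_def using Z_bnd by (cases r; cases s) simp_all
  have Z4: "bnd (\<lambda>w. Zstd D (fst w) (mu w) (Inl [r, s, t, z]) (snd w))" for r s t z by (rule Z_bnd) simp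
  have X4: "bnd (\<lambda>w. form4 (\<lambda>r s t z. Zstd D (fst w) (mu w) (Inl [r, s, t, z]) (snd w)) (\<lambda>r. u r w) (\<lambda>r. u r w) (\<lambda>r. u r w) (\<lambda>r. u r w))"
    using form4_big[OF Z4 u u u u] by simp
  have X2: "bnd (\<lambda>w. form2 (\<lambda>r s. Zadj2 D (fst w) (mu w) r s (snd w)) (\<lambda>r. u r w) (\<lambda>r. u r w))"
    using form2_big[OF Za2 u u] by simp
  have X: "bnd X" unfolding X_def by (rule bnd_add[OF big_cmult[OF X4] big_cmult[OF X2]])
  define c5 c3 where "c5 = real (card {rs :: ('q + 'p) list. length rs = 5})" and "c3 = real (card {as :: 'q list. length as = 3})"
  define R where "R w = rootn w ^ 3 * (c5 * U ^ 5 / 120 * (KL w / real (fst w)) + c3 * U ^ 3 / 6 * KB w + \<bar>X w\<bar>)" for w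
  have "R \<in> O[F](\<lambda>w. rootn w ^ 3 * 1)" unfolding R_def
    by (intro big_prod2 bnd_intros KL KB) (use X in simp_all)
  then have R: "R \<in> O[F](\<lambda>w. rootn w ^ 3)" by simp
  have "\<forall>\<^sub>F w in F. norm (Lb w (shift_par D (\<lambda>r. rootn w * u r w)) - Lb w (theta0 D) - lik_approx D (fst w) (mu w) (snd w) (\<lambda>r. u r w)) \<le> norm (R w)"
    using U(2) bart in_space ev_pos \<delta>_pos
  proof eventually_elim
    case (elim w)
    interpret b: bartlett D "fst w" "mu w" by (rule elim)
    let ?s = "rootn w" let ?n = "fst w" let ?y = "snd w" let ?v = "\<lambda>r. rootn w * u r w"
    have vU: "\<bar>?v r\<bar> \<le> ?s * U" for r using elim by (simp add: abs_mult)
    have small: "(\<Sum>r\<in>UNIV. \<bar>?v r\<bar>) \<le> \<epsilon>" using elim by blast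
    have s: "?s = 1 / sqrt (real ?n)" by (simp add: rootn_def)
    have ns: "?s ^ 5 * KL w = ?s ^ 3 * (KL w / real ?n)"
    proof -
      have "?s\<^sup>2 = 1 / real ?n" using elim by (simp add: s power_divide)
      then have "?s ^ 5 = ?s ^ 3 * (1 / real ?n)" by (metis (no_types) add_2_eq_Suc' eval_nat_numeral(3) numeral_plus_numeral power_add semiring_norm(5) add_num_simps)
      then show ?thesis by simp
    qed
    have Xs: "?s ^ 3 * X w = ?s ^ 3 * (form4 (\<lambda>r s t z. Zstd D (fst w) (mu w) (Inl [r, s, t, z]) (snd w)) (\<lambda>r. u r w) (\<lambda>r. u r w) (\<lambda>r. u r w) (\<lambda>r. u r w) / 24
     + form2 (\<lambda>r s. Zadj2 D (fst w) (mu w) r s (snd w)) (\<lambda>r. u r w) (\<lambda>r. u r w) / 2)" by (simp add: X_def)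
    note A = b.taylor_loglik[OF elim(3) eps(2) small vU, folded c5_def KL_def]
    note B = b.taylor_adj[OF elim(3) eps(2) small vU, folded c3_def KB_def]
    note E = b.taylor_forms_eq[OF elim(4) s, of ?y "\<lambda>r. u r w", folded Xs]
    have "\<bar>Lb w (shift_par D ?v) - Lb w (theta0 D) - lik_approx D ?n (mu w) ?y (\<lambda>r. u r w)\<bar>
        \<le> c5 * ((?s * U) ^ 5 * KL w) / 120 + c3 * ((?s * U) ^ 3 * KB w) / 6 + \<bar>?s ^ 3 * X w\<bar>"
      using A B E unfolding Lbar_def by linarith
    also have "(?s * U) ^ 5 * KL w = ?s ^ 3 * (KL w / real ?n) * U ^ 5"
      unfolding ns[symmetric] by (simp add: power_mult_distrib)
    also have "c5 * (?s ^ 3 * (KL w / real ?n) * U ^ 5) / 120 + c3 * ((?s * U) ^ 3 * KB w) / 6 + \<bar>?s ^ 3 * X w\<bar> = R w"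
      using elim(5) by (simp add: R_def power_mult_distrib abs_mult algebra_simps)
    finally show ?case by simp
  qed
  then show ?thesis by (intro landau_o.big_trans[OF _ R] landau_o.bigI[of 1]) auto
qed

lemma lik_expansion_instance:
  "lik_expansion F rootn S (\<lambda>r w. Zstd D (fst w) (mu w) (Inl [r]) (snd w)) (\<lambda>r w. betav D (fst w) (mu w) r)
    (\<lambda>r w. Zadj D (fst w) (mu w) r (snd w)) (\<lambda>r s w. Zstd D (fst w) (mu w) (Inl [r, s]) (snd w))
    (\<lambda>r s w. betam D (fst w) (mu w) r s) (\<lambda>r s w. lamh D (fst w) (mu w) [r, s]) (\<lambda>r s w. Gmat D (fst w) (mu w) S r s)
    (\<lambda>r s t w. Zstd D (fst w) (mu w) (Inl [r, s, t]) (snd w)) (\<lambda>r s t w. lamh D (fst w) (mu w) [r, s, t])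
    (\<lambda>r s t z w. lamh D (fst w) (mu w) [r, s, t, z]) c"
proof
  show "bnd (\<lambda>w. Zstd D (fst w) (mu w) (Inl [r]) (snd w))" "bnd (\<lambda>w. Zstd D (fst w) (mu w) (Inl [r, s]) (snd w))"
    "bnd (\<lambda>w. Zstd D (fst w) (mu w) (Inl [r, s, t]) (snd w))" for r s t by (simp_all add: Z_bnd)
  show "bnd (\<lambda>w. Zadj D (fst w) (mu w) r (snd w))" for r
    unfolding Zadj_def using Z_bnd by (cases r) simp_all
  show "bnd (\<lambda>w. betav D (fst w) (mu w) r)" "bnd (\<lambda>w. betam D (fst w) (mu w) r s)" for r s
    by (rule betav_bnd betam_bnd)+
  show "bnd (\<lambda>w. lamh D (fst w) (mu w) [r, s])" "bnd (\<lambda>w. lamh D (fst w) (mu w) [r, s, t])"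
    "bnd (\<lambda>w. lamh D (fst w) (mu w) [r, s, t, z])" for r s t z by (simp_all add: lamh_bnd)
  show "bnd (\<lambda>w. Gmat D (fst w) (mu w) S r s)" for r s by (rule Gmat_bnd)
  have samp: "\<forall>\<^sub>F w in F. sampling D (fst w) (mu w)"
    using bart by eventually_elim (simp add: bartlett_def)
  show "\<forall>\<^sub>F w in F. \<forall>r s. Zstd D (fst w) (mu w) (Inl [r, s]) (snd w) = Zstd D (fst w) (mu w) (Inl [s, r]) (snd w)"
    using samp in_space by eventually_elim (blast intro: sampling.sym_Zs)
  show "\<forall>\<^sub>F w in F. \<forall>r s. lamh D (fst w) (mu w) [r, s] = lamh D (fst w) (mu w) [s, r]"
    using samp by eventually_elim (blast intro: sampling.sym_lamh)
  show "\<forall>\<^sub>F w in F. \<forall>r s t. lamh D (fst w) (mu w) [r, s, t] = lamh D (fst w) (mu w) [s, r, t]"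
    using samp by eventually_elim (blast intro: sampling.sym_lamh)
  show "\<forall>\<^sub>F w in F. \<forall>r s t. lamh D (fst w) (mu w) [r, s, t] = lamh D (fst w) (mu w) [r, t, s]"
    using samp by eventually_elim (blast intro: sampling.sym_lamh)
  show "r \<notin> S \<or> s \<notin> S \<Longrightarrow> Gmat D (fst w) (mu w) S r s = 0" for r s w
    by (simp add: Gmat_def Ginv_off)
  show "\<forall>\<^sub>F w in F. \<forall>r\<in>S. \<forall>t\<in>S. (\<Sum>s\<in>UNIV. lamh D (fst w) (mu w) [r, s] * Gmat D (fst w) (mu w) S s t) = (if r = t then 1 else 0)"
    using coercive
  proof eventually_elim
    case (elim w)
    then have co: "form2 (\<lambda>r s. lamh D (fst w) (mu w) [r, s]) u u \<le> - c * (\<Sum>r\<in>UNIV. (u r)\<^sup>2)" for u by blast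
    show ?case unfolding Gmat_def using Ginv_inverse(1)[OF c_pos co] by blast
  qed
  show "\<forall>\<^sub>F w in F. \<forall>u. form2 (\<lambda>r s. lamh D (fst w) (mu w) [r, s]) u u \<le> - c * (\<Sum>r\<in>UNIV. (u r)\<^sup>2)"
    by (rule coercive)
qed (rule c_pos)

text \<open>
  The maximizer is compared with the trial point of the expansion, which eventually lies in the
  parameter space.
\<close>
theorem maximum_approx:
  assumes ub: "\<And>r. bnd (ub r)" and off: "\<forall>\<^sub>F w in F. \<forall>r. r \<notin> S \<longrightarrow> ub r w = 0"
    and max: "\<forall>\<^sub>F w in F. \<forall>v. (\<forall>r. r \<notin> S \<longrightarrow> v r = 0) \<longrightarrow> shift_par D v \<in> Theta D \<longrightarrow>
       Lb w (shift_par D v) \<le> Lb w (shift_par D (\<lambda>r. rootn w * ub r w))"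
  shows "(\<lambda>w. 2 * (Lb w (shift_par D (\<lambda>r. rootn w * ub r w)) - Lb w (theta0 D)) - lr_approx D (fst w) (mu w) S (snd w)) \<in> O[F](\<lambda>w. rootn w ^ 3)"
proof -
  interpret L: lik_expansion F rootn S "\<lambda>r w. Zstd D (fst w) (mu w) (Inl [r]) (snd w)" "\<lambda>r w. betav D (fst w) (mu w) r"
    "\<lambda>r w. Zadj D (fst w) (mu w) r (snd w)" "\<lambda>r s w. Zstd D (fst w) (mu w) (Inl [r, s]) (snd w)"
    "\<lambda>r s w. betam D (fst w) (mu w) r s" "\<lambda>r s w. lamh D (fst w) (mu w) [r, s]" "\<lambda>r s w. Gmat D (fst w) (mu w) S r s"
    "\<lambda>r s t w. Zstd D (fst w) (mu w) (Inl [r, s, t]) (snd w)" "\<lambda>r s t w. lamh D (fst w) (mu w) [r, s, t]"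
    "\<lambda>r s t z w. lamh D (fst w) (mu w) [r, s, t, z]" c
    by (rule lik_expansion_instance)
  have f: "L.f u w = lik_approx D (fst w) (mu w) (snd w) u" for u w
    by (simp add: L.f_eq_lr_f lik_approx_def rootn_def)
  have P: "L.P w = lr_approx D (fst w) (mu w) S (snd w)" for w
    by (simp add: L.P_eq_lr_poly lr_approx_def rootn_def)
  let ?V = "\<lambda>w. Lb w (shift_par D (\<lambda>r. rootn w * ub r w)) - Lb w (theta0 D)"
  let ?V' = "\<lambda>w. Lb w (shift_par D (\<lambda>r. rootn w * L.ut r w)) - Lb w (theta0 D)"
  have "\<forall>\<^sub>F w in F. ?V' w \<le> ?V w"
  proof -
    obtain U where "\<forall>\<^sub>F w in F. (\<forall>r. \<bar>L.ut r w\<bar> \<le> U) \<and> (\<Sum>r\<in>UNIV. \<bar>rootn w * L.ut r w\<bar>) \<le> \<epsilon>"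
      using small_shift[of L.ut, OF L.ut_bnd eps(1)] by (elim exE conjE) (rule that)
    then show ?thesis using max bart
    proof eventually_elim
      case (elim w)
      interpret b: bartlett D "fst w" "mu w" by (rule elim)
      have "shift_par D (\<lambda>r. rootn w * L.ut r w) \<in> cball (theta0 D) \<epsilon>"
        using b.near_in_Theta[OF eps(2), of "\<lambda>r. rootn w * L.ut r w" 1] elim(1) by (simp add: shift_par_def)
      then have "shift_par D (\<lambda>r. rootn w * L.ut r w) \<in> Theta D" using eps(2) by blast
      moreover have "\<forall>r. r \<notin> S \<longrightarrow> rootn w * L.ut r w = 0" by (simp add: L.ut_off)
      ultimately show ?case using elim(2) by simp
    qed
  qed
  from L.maximum_expansion[OF ub off _ _ this] show ?thesis
    unfolding f P using taylor_Lbar[of ub, OF ub] taylor_Lbar[of L.ut, OF L.ut_bnd] by blast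
qed

end

section \<open>The statistic as a difference of two maxima\<close>

definition coord :: "('q::finite, 'p::finite) par \<Rightarrow> 'q + 'p \<Rightarrow> real" where
  "coord x r = (case r of Inl a \<Rightarrow> fst x $ a | Inr i \<Rightarrow> snd x $ i)"

lemma coord_inner: "coord x r = x \<bullet> par_axis r"
  by (cases r) (simp_all add: coord_def inner_prod_def inner_axis)

lemma coord_le_norm: "\<bar>coord x r\<bar> \<le> norm x"
  unfolding coord_inner using Cauchy_Schwarz_ineq2[of x "par_axis r"] by (simp add: norm_par_axis)

lemma sum_coord: "(\<Sum>r\<in>UNIV. coord x r *\<^sub>R par_axis r) = (x :: ('q::finite, 'p::finite) par)"
proof -
  have s: "(\<Sum>r\<in>(UNIV :: ('q + 'p) set). g r) = (\<Sum>a\<in>UNIV. g (Inl a)) + (\<Sum>i\<in>UNIV. g (Inr i))" for g :: "'q + 'p \<Rightarrow> ('q, 'p) par"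
    by (simp add: UNIV_Plus_UNIV[symmetric] sum.Plus del: UNIV_Plus_UNIV)
  have v: "(\<Sum>i\<in>UNIV. x $ i *\<^sub>R axis i (1::real)) = x" for x :: "real ^ 'n::finite"
    by (simp add: vec_eq_iff axis_def if_distrib[of "\<lambda>z. _ * z"] cong: if_cong)
  show ?thesis
    unfolding s by (simp add: coord_def prod_eq_iff fst_sum snd_sum v)
qed

lemma shift_par_coord: "shift_par D (coord (\<theta> - theta0 D)) = \<theta>"
  by (simp add: shift_par_def sum_coord)

text \<open>
  The part of \<open>estimators\<close> that concerns the adjusted profile likelihood, at one sample.
\<close>
definition estimates_at where
  "estimates_at D n y \<longleftrightarrow>
     (\<forall>\<psi>\<in>fst ` Theta D. (\<psi>, cmle D n y \<psi>) \<in> Theta D \<and>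
        (\<forall>\<phi>. (\<psi>, \<phi>) \<in> Theta D \<longrightarrow> loglik D n y (\<psi>, \<phi>) \<le> loglik D n y (\<psi>, cmle D n y \<psi>))) \<and>
     psibar D n y \<in> fst ` Theta D \<and> (\<forall>\<psi>\<in>fst ` Theta D. adj_proflik D n y \<psi> \<le> adj_proflik D n y (psibar D n y))"

definition thetabar where
  "thetabar D n y = (psibar D n y, cmle D n y (psibar D n y))"
definition thetatilde where
  "thetatilde D n y = (fst (theta0 D), cmle D n y (fst (theta0 D)))"

text \<open>
  At its estimates the adjusted profile log-likelihood takes values of \<open>Lbar\<close>; measuring both of them from the true
  value gives the two maxima.
\<close>
lemma Wbar_Lbar: "Wbar D n y = 2 * (Lbar D n y (thetabar D n y) - Lbar D n y (theta0 D)) - 2 * (Lbar D n y (thetatilde D n y) - Lbar D n y (theta0 D))"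
  by (simp add: Wbar_def adj_proflik_def proflik_def Lbar_def thetabar_def thetatilde_def)

text \<open>
  Maximizing over the nuisance parameter and then over \<open>\<psi>\<close> is a joint maximization, also after adding
  a function of \<open>\<psi>\<close>.
\<close>
lemma thetabar_max: "estimates_at D n y \<Longrightarrow> \<theta> \<in> Theta D \<Longrightarrow> Lbar D n y \<theta> \<le> Lbar D n y (thetabar D n y)"
proof -
  assume e: "estimates_at D n y" and t: "\<theta> \<in> Theta D"
  obtain \<psi> \<phi> where \<theta>: "\<theta> = (\<psi>, \<phi>)" by (cases \<theta>)
  have "\<psi> \<in> fst ` Theta D" using t \<theta> by force
  then have "loglik D n y (\<psi>, \<phi>) \<le> loglik D n y (\<psi>, cmle D n y \<psi>)" "adj_proflik D n y \<psi> \<le> adj_proflik D n y (psibar D n y)"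
    using e t \<theta> unfolding estimates_at_def by auto
  then show ?thesis by (simp add: Lbar_def \<theta> thetabar_def adj_proflik_def proflik_def)
qed

lemma thetatilde_max: "estimates_at D n y \<Longrightarrow> \<theta> \<in> Theta D \<Longrightarrow> theta0 D \<in> Theta D \<Longrightarrow> fst \<theta> = fst (theta0 D) \<Longrightarrow> Lbar D n y \<theta> \<le> Lbar D n y (thetatilde D n y)"
  by (cases \<theta>) (force simp: estimates_at_def Lbar_def thetatilde_def)

context sample_orders begin

lemma ub_bnd:
  fixes x :: "nat \<times> sample \<Rightarrow> ('q, 'p) par"
  assumes "(\<lambda>w. norm (x w)) \<in> O[F](rootn)"
  shows "bnd (\<lambda>w. coord (x w) r / rootn w)"
proof -
  have "(\<lambda>w. coord (x w) r) \<in> O[F](\<lambda>w. norm (x w))"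
    by (rule landau_o.bigI[of 1]) (auto simp: coord_le_norm)
  then have "(\<lambda>w. coord (x w) r) \<in> O[F](rootn)" using assms by (rule landau_o.big_trans)
  moreover have nz: "\<forall>\<^sub>F w in F. rootn w \<noteq> 0" using \<delta>_pos by eventually_elim simp
  ultimately have "(\<lambda>w. coord (x w) r / rootn w) \<in> O[F](\<lambda>w. rootn w / rootn w)"
    by (intro landau_o.big.divide_right)
  also have "O[F](\<lambda>w. rootn w / rootn w) = O[F](\<lambda>_. 1)"
    by (rule landau_o.big.cong) (use nz in \<open>eventually_elim, simp\<close>)
  finally show ?thesis .
qed

lemma estimator_approx:
  fixes \<theta> :: "nat \<times> sample \<Rightarrow> ('q, 'p) par"
  assumes cons: "(\<lambda>w. norm (\<theta> w - theta0 D)) \<in> O[F](rootn)"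
    and off: "\<And>w r. r \<notin> S \<Longrightarrow> coord (\<theta> w - theta0 D) r = 0"
    and max: "\<forall>\<^sub>F w in F. \<forall>v. (\<forall>r. r \<notin> S \<longrightarrow> v r = 0) \<longrightarrow> shift_par D v \<in> Theta D \<longrightarrow> Lb w (shift_par D v) \<le> Lb w (\<theta> w)"
  shows "(\<lambda>w. 2 * (Lb w (\<theta> w) - Lb w (theta0 D)) - lr_approx D (fst w) (mu w) S (snd w)) \<in> O[F](\<lambda>w. rootn w ^ 3)"
proof -
  define ub where "ub r w = coord (\<theta> w - theta0 D) r / rootn w" for r w
  have eq: "\<forall>\<^sub>F w in F. shift_par D (\<lambda>r. rootn w * ub r w) = \<theta> w"
    using \<delta>_pos
  proof eventually_elim
    case (elim w)
    then have "(\<lambda>r. rootn w * ub r w) = coord (\<theta> w - theta0 D)" by (auto simp: ub_def fun_eq_iff)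
    then show ?case by (simp add: shift_par_coord)
  qed
  have "(\<lambda>w. 2 * (Lb w (shift_par D (\<lambda>r. rootn w * ub r w)) - Lb w (theta0 D)) - lr_approx D (fst w) (mu w) S (snd w)) \<in> O[F](\<lambda>w. rootn w ^ 3)"
  proof (rule maximum_approx)
    show "bnd (ub r)" for r unfolding ub_def by (rule ub_bnd[OF cons])
    show "\<forall>\<^sub>F w in F. \<forall>r. r \<notin> S \<longrightarrow> ub r w = 0" by (simp add: ub_def off)
    show "\<forall>\<^sub>F w in F. \<forall>v. (\<forall>r. r \<notin> S \<longrightarrow> v r = 0) \<longrightarrow> shift_par D v \<in> Theta D \<longrightarrow>
       Lb w (shift_par D v) \<le> Lb w (shift_par D (\<lambda>r. rootn w * ub r w))"
      using max eq by eventually_elim simp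
  qed
  moreover have "\<forall>\<^sub>F w in F. 2 * (Lb w (\<theta> w) - Lb w (theta0 D)) - lr_approx D (fst w) (mu w) S (snd w)
     = 2 * (Lb w (shift_par D (\<lambda>r. rootn w * ub r w)) - Lb w (theta0 D)) - lr_approx D (fst w) (mu w) S (snd w)"
    using eq by eventually_elim simp
  ultimately show ?thesis by (subst landau_o.big.in_cong)
qed

text \<open>
  Fixing \<open>\<psi>\<close> at the true value is the case of the expansion in which only the nuisance coordinates vary.
\<close>
theorem Wbar_approx:
  assumes est: "\<forall>\<^sub>F w in F. estimates_at D (fst w) (snd w)"
    and c1: "(\<lambda>w. norm (thetabar D (fst w) (snd w) - theta0 D)) \<in> O[F](rootn)"
    and c2: "(\<lambda>w. norm (thetatilde D (fst w) (snd w) - theta0 D)) \<in> O[F](rootn)"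
  shows "(\<lambda>w. Wbar D (fst w) (snd w) - (lr_approx D (fst w) (mu w) UNIV (snd w) - lr_approx D (fst w) (mu w) (range Inr) (snd w))) \<in> O[F](\<lambda>w. rootn w ^ 3)"
proof -
  have a: "(\<lambda>w. 2 * (Lb w (thetabar D (fst w) (snd w)) - Lb w (theta0 D)) - lr_approx D (fst w) (mu w) UNIV (snd w)) \<in> O[F](\<lambda>w. rootn w ^ 3)"
    by (rule estimator_approx[OF c1]) (use est in \<open>auto elim!: eventually_mono intro: thetabar_max\<close>)
  have b: "(\<lambda>w. 2 * (Lb w (thetatilde D (fst w) (snd w)) - Lb w (theta0 D)) - lr_approx D (fst w) (mu w) (range Inr) (snd w)) \<in> O[F](\<lambda>w. rootn w ^ 3)"
  proof (rule estimator_approx[OF c2])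
    show "coord (thetatilde D (fst w) (snd w) - theta0 D) r = 0" if "r \<notin> range Inr" for w r
      using that by (cases r) (auto simp: coord_def thetatilde_def)
    show "\<forall>\<^sub>F w in F. \<forall>v. (\<forall>r. r \<notin> range Inr \<longrightarrow> v r = 0) \<longrightarrow> shift_par D v \<in> Theta D \<longrightarrow>
       Lb w (shift_par D v) \<le> Lb w (thetatilde D (fst w) (snd w))"
      using est
    proof eventually_elim
      case (elim w)
      have "theta0 D \<in> Theta D" using eps by auto
      moreover have "fst (shift_par D v) = fst (theta0 D)" if "\<forall>r. r \<notin> range Inr \<longrightarrow> v r = 0" for v
      proof -
        have "v (Inl a) = 0" for a using that by auto
        then show ?thesis by (simp add: shift_par_def fst_sum_axis)
      qed
      ultimately show ?case using thetatilde_max[OF elim] by blast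
    qed
  qed
  show ?thesis using sum_in_bigo(2)[OF a b] unfolding Wbar_Lbar by (simp add: algebra_simps)
qed

end

section \<open>Coercivity of the information\<close>

context bartlett begin

text \<open>
  The matrix is minus the covariance matrix of the standardized score.
\<close>
lemma lamh_nonpos: "0 < n \<Longrightarrow> form2 (\<lambda>r s. lamh D n \<mu> [r, s]) u u \<le> 0"
proof -
  assume n: "0 < n"
  let ?Z = "\<lambda>r. Zstd D n \<mu> (Inl [r])"
  have i: "integrable N (\<lambda>z. ?Z r z * ?Z s z)" for r s
    using integrable_mixed[OF n, of "[]" "[Inl [r], Inl [s]]"] by simp
  have "0 \<le> E (\<lambda>z. (\<Sum>r\<in>UNIV. u r * ?Z r z)\<^sup>2)" by (rule Bochner_Integration.integral_nonneg) simp
  also have "E (\<lambda>z. (\<Sum>r\<in>UNIV. u r * ?Z r z)\<^sup>2) = E (\<lambda>z. \<Sum>r\<in>UNIV. \<Sum>s\<in>UNIV. u r * u s * (?Z r z * ?Z s z))"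
    by (rule Bochner_Integration.integral_cong) (simp_all add: power2_eq_square sum_product mult_ac)
  also have "\<dots> = (\<Sum>r\<in>UNIV. \<Sum>s\<in>UNIV. u r * u s * E (\<lambda>z. ?Z r z * ?Z s z))"
    using i by simp
  also have "\<dots> = (\<Sum>r\<in>UNIV. \<Sum>s\<in>UNIV. u r * u s * - lamh D n \<mu> [r, s])"
    using score_cov n by (simp add: Zs_Inl lamh_def real_div_sqrt)
  finally show ?thesis by (simp add: form2_def sum_negf mult_ac)
qed

end

text \<open>
  The order of the inverse of the information matrix keeps its eigenvalues away from 0 on the scale \<open>n\<close>.
\<close>
lemma coercive_unconditional:
  fixes D :: "('q::finite, 'p::finite, 'c) problem"
  assumes inv: "inverse_order D" and bart: "\<forall>\<^sub>F n in sequentially. bartlett D n (leb n)"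
  shows "\<exists>c>0. \<forall>\<^sub>F n in sequentially. \<forall>u. form2 (\<lambda>r s. lamh D n (leb n) [r, s]) u u \<le> - c * (\<Sum>r\<in>UNIV. (u r)\<^sup>2)"
proof -
  let ?A = "lambda_matrix D"
  have "\<exists>B>0. \<forall>\<^sub>F n in sequentially. \<bar>matrix_inv (?A n) $ r $ s\<bar> \<le> B * \<bar>1 / real n\<bar>" for r s
  proof -
    have "(\<lambda>n. matrix_inv (?A n) $ r $ s) \<in> O(\<lambda>n. 1 / real n)" using inv by (simp add: inverse_order_def)
    then obtain B where "B > 0" "\<forall>\<^sub>F n in sequentially. norm (matrix_inv (?A n) $ r $ s) \<le> B * norm (1 / real n)"
      by (rule landau_o.bigE)
    then show ?thesis unfolding real_norm_def by blast
  qed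
  note ex = this
  define B where "B r s = (SOME b. b > 0 \<and> (\<forall>\<^sub>F n in sequentially. \<bar>matrix_inv (?A n) $ r $ s\<bar> \<le> b * \<bar>1 / real n\<bar>))" for r s
  have B: "B r s > 0" "\<forall>\<^sub>F n in sequentially. \<bar>matrix_inv (?A n) $ r $ s\<bar> \<le> B r s * \<bar>1 / real n\<bar>" for r s
    using someI_ex[OF ex[of r s]] unfolding B_def by (rule conjunct1, rule conjunct2)
  define B0 where "B0 = (\<Sum>r\<in>UNIV. \<Sum>s\<in>UNIV. B r s)"
  have le: "B r s \<le> B0" for r s
  proof -
    have "B r s \<le> (\<Sum>s\<in>UNIV. B r s)" using B(1) by (intro member_le_sum) (auto intro: less_imp_le)
    also have "\<dots> \<le> B0" unfolding B0_def using B(1)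
      by (intro member_le_sum[of r UNIV "\<lambda>r. \<Sum>s\<in>UNIV. B r s"]) (auto intro!: sum_nonneg intro: less_imp_le[OF B(1)])
    finally show ?thesis .
  qed
  have B0: "B0 > 0" using less_le_trans[OF B(1) le] by blast
  have ev: "\<forall>\<^sub>F n in sequentially. \<forall>r s. \<bar>matrix_inv (?A n) $ r $ s\<bar> \<le> B r s * \<bar>1 / real n\<bar>"
    by (intro eventually_all_finite B(2))
  have i: "\<forall>\<^sub>F n in sequentially. invertible (?A n)" using inv by (simp add: inverse_order_def)
  have "\<forall>\<^sub>F n in sequentially. \<forall>u. form2 (\<lambda>r s. lamh D n (leb n) [r, s]) u u \<le> - (1 / (B0 * real CARD('q + 'p))) * (\<Sum>r\<in>UNIV. (u r)\<^sup>2)"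
    using ev i bart eventually_gt_at_top[of 0]
  proof eventually_elim
    case (elim n)
    interpret b: bartlett D n "leb n" by (rule elim)
    show ?case
    proof
      fix u
      show "form2 (\<lambda>r s. lamh D n (leb n) [r, s]) u u \<le> - (1 / (B0 * real CARD('q + 'p))) * (\<Sum>r\<in>UNIV. (u r)\<^sup>2)"
      proof (rule coercive_from_inverse[OF _ elim(2) _ B0])
        show "?A n = (\<chi> r s. real n * lamh D n (leb n) [r, s])" using elim(4) by (simp add: lambda_matrix_def lamh_def)
        show "real n > 0" using elim(4) by simp
        fix r s
        have "\<bar>matrix_inv (?A n) $ r $ s\<bar> \<le> B r s * \<bar>1 / real n\<bar>" using elim(1) by blast
        also have "\<dots> \<le> B0 * \<bar>1 / real n\<bar>" using le by (intro mult_right_mono) auto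
        finally show "\<bar>matrix_inv (?A n) $ r $ s\<bar> \<le> B0 / real n" by simp
        show "lamh D n (leb n) [r, s] = lamh D n (leb n) [s, r]" by (rule b.sym_lamh)
      next
        show "form2 (\<lambda>r s. lamh D n (leb n) [r, s]) u u \<le> 0" for u by (rule b.lamh_nonpos) (rule elim)
      qed
    qed
  qed
  moreover have "0 < real CARD('q + 'p)" unfolding of_nat_0_less_iff by (rule zero_less_card_finite)
  ultimately show ?thesis using divide_pos_pos[OF zero_less_one mult_pos_pos[OF B0]] by blast
qed

lemma (in scale) coercive_perturb:
  fixes A B :: "'r::finite \<Rightarrow> 'r \<Rightarrow> 'w \<Rightarrow> real"
  assumes c: "c > 0" and A: "\<forall>\<^sub>F w in F. \<forall>u. form2 (\<lambda>r s. A r s w) u u \<le> - c * (\<Sum>r\<in>UNIV. (u r)\<^sup>2)"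
    and d: "\<And>r s. (\<lambda>w. B r s w - A r s w) \<in> O[F](\<delta>)"
  shows "\<forall>\<^sub>F w in F. \<forall>u. form2 (\<lambda>r s. B r s w) u u \<le> - (c / 2) * (\<Sum>r\<in>UNIV. (u r)\<^sup>2)"
proof -
  define m where "m = real CARD('r)"
  have m: "m > 0" by (simp add: m_def)
  have "(\<lambda>w. \<Sum>r\<in>UNIV. \<Sum>s\<in>UNIV. \<bar>B r s w - A r s w\<bar>) \<in> O[F](\<delta>)"
    by (intro big_sum_fin) (use d in simp)
  then obtain C where C: "C > 0" "\<forall>\<^sub>F w in F. norm (\<Sum>r\<in>UNIV. \<Sum>s\<in>UNIV. \<bar>B r s w - A r s w\<bar>) \<le> C * norm (\<delta> w)" by (rule landau_o.bigE)
  have pos: "c / (2 * m * C) > 0" using c m C by simp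
  show ?thesis
    using A C(2) \<delta>_less[OF pos] \<delta>_pos
  proof eventually_elim
    case (elim w)
    \<comment> \<open>Each entry of the perturbation is at most \<open>c / (2 m)\<close>, which costs at most half of the constant.\<close>
    let ?D = "\<lambda>r s. B r s w - A r s w"
    have D: "\<bar>?D r s\<bar> \<le> c / (2 * m)" for r s
    proof -
      have "\<bar>?D r s\<bar> \<le> (\<Sum>s\<in>UNIV. \<bar>?D r s\<bar>)" by (rule member_le_sum) auto
      also have "\<dots> \<le> (\<Sum>r\<in>UNIV. \<Sum>s\<in>UNIV. \<bar>?D r s\<bar>)"
        by (rule member_le_sum[of r UNIV "\<lambda>r. \<Sum>s\<in>UNIV. \<bar>?D r s\<bar>"]) (auto intro: sum_nonneg)
      also have "\<dots> \<le> C * \<delta> w" using elim(2,4) by (simp add: sum_nonneg)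
      also have "\<dots> \<le> C * (c / (2 * m * C))" using elim(3) C(1) by (intro mult_left_mono) auto
      also have "\<dots> = c / (2 * m)" using C(1) by simp
      finally show ?thesis .
    qed
    show ?case
    proof
      fix u :: "'r \<Rightarrow> real"
      let ?U = "\<Sum>r\<in>UNIV. (u r)\<^sup>2"
      have "form2 ?D u u \<le> (\<Sum>r\<in>UNIV. \<Sum>s\<in>UNIV. c / (2 * m) * (\<bar>u r\<bar> * \<bar>u s\<bar>))"
        unfolding form2_def
      proof (intro sum_mono)
        fix r s
        have "?D r s * u r * u s \<le> \<bar>?D r s\<bar> * (\<bar>u r\<bar> * \<bar>u s\<bar>)"
          using abs_ge_self[of "?D r s * u r * u s"] by (simp add: abs_mult mult.assoc)
        also have "\<dots> \<le> c / (2 * m) * (\<bar>u r\<bar> * \<bar>u s\<bar>)" using D by (intro mult_right_mono) auto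
        finally show "?D r s * u r * u s \<le> c / (2 * m) * (\<bar>u r\<bar> * \<bar>u s\<bar>)" .
      qed
      also have "\<dots> = c / (2 * m) * (\<Sum>r\<in>UNIV. \<bar>u r\<bar>)\<^sup>2"
        unfolding power2_eq_square sum_product by (simp add: sum_distrib_left)
      also have "\<dots> \<le> c / (2 * m) * (?U * m)"
        using sum_squared_le_sum_of_squares[of "\<lambda>r. \<bar>u r\<bar>" UNIV] c m by (intro mult_left_mono) (auto simp: m_def)
      also have "\<dots> = c / 2 * ?U" using m by simp
      finally have "form2 ?D u u \<le> c / 2 * ?U" .
      moreover have "form2 (\<lambda>r s. B r s w) u u = form2 (\<lambda>r s. A r s w) u u + form2 ?D u u"
        by (simp add: form2_def algebra_simps sum_subtractf)
      ultimately show "form2 (\<lambda>r s. B r s w) u u \<le> - (c / 2) * ?U" using elim(1)[rule_format, of u] by (simp add: field_simps)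
    qed
  qed
qed

section \<open>Comparison of conditional and unconditional moments\<close>

text \<open>
  By the Bartlett identities all ingredients of \<open>Omega\<close> except the inverse \<open>Gmat\<close> are linear combinations of the following
  standardized \<open>\<theta>\<close>-derivatives of means, about which the relations between conditional and unconditional
  quantities are assumed.
\<close>
definition dlam where
  "dlam D n \<mu> ts rs = pds (map par_axis ts) (mean D n \<mu> (Inl rs)) (theta0 D) / real n"
definition dbet where
  "dbet D n \<mu> ts as = pds (map par_axis ts) (mean D n \<mu> (Inr as)) (theta0 D)"

context bartlett begin

lemma Kcov_eq:
  assumes n: "0 < n" and "1 \<le> length rs" "length rs \<le> 3"
  shows "Kcov D n \<mu> (Inl rs) t = dlam D n \<mu> [t] rs - lamh D n \<mu> (t # rs)"
proof -
  have "Kcov D n \<mu> (Inl rs) t = E (\<lambda>z. c (Inl rs) z * c (Inl [t]) z) / real n"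
    using n by (simp add: Kcov_def EN_def Zs_Inl real_div_sqrt)
  then show ?thesis using cov_with_score[OF refl assms(2,3), of t] by (simp add: dlam_def lamh_def diff_divide_distrib)
qed

lemma Kadj_eq:
  assumes n: "0 < n"
  shows "Kadj D n \<mu> r s = (case r of Inl a \<Rightarrow> dbet D n \<mu> [s] [a] - (case s of Inl b \<Rightarrow> dbet D n \<mu> [] [b, a] | Inr _ \<Rightarrow> 0) | Inr _ \<Rightarrow> 0)"
proof (cases r)
  case (Inl a)
  have "Zstd D n \<mu> (Inr [a]) z * Zstd D n \<mu> (Inl [s]) z = c (Inr [a]) z * c (Inl [s]) z" for z
    using n by (simp add: Zstd_def)
  then have "Kadj D n \<mu> r s = E (\<lambda>z. c (Inr [a]) z * c (Inl [s]) z)"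
    by (simp add: Kadj_def EN_def Zadj_def Inl)
  then show ?thesis using cov_adj_score[of a s] Inl by (simp add: dbet_def split: sum.split)
qed (simp add: Kadj_def Zadj_def EN_def)

lemma skew_eq:
  assumes n: "0 < n"
  shows "skew D n \<mu> r s t = - dlam D n \<mu> [r] [s, t] - Kcov D n \<mu> (Inl [r, s]) t - Kcov D n \<mu> (Inl [r, t]) s"
proof -
  have "skew D n \<mu> r s t = E (\<lambda>z. c (Inl [r]) z * c (Inl [s]) z * c (Inl [t]) z) / real n"
    using n by (simp add: skew_def EN_def Zs_Inl field_simps)
  moreover have "Kcov D n \<mu> (Inl [r, s]) t = E (\<lambda>z. c (Inl [r, s]) z * c (Inl [t]) z) / real n"
    "Kcov D n \<mu> (Inl [r, t]) s = E (\<lambda>z. c (Inl [s]) z * c (Inl [r, t]) z) / real n"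
    using n by (simp_all add: Kcov_def EN_def Zs_Inl real_div_sqrt mult.commute)
  ultimately show ?thesis using third_score_moment[of r s t] by (simp add: dlam_def diff_divide_distrib)
qed

lemma Qmix_eq:
  assumes n: "0 < n"
  shows "Qmix D n \<mu> r s t u = dlam D n \<mu> [t, u] [r, s] - lamh D n \<mu> [t, u, r, s] - Kcov D n \<mu> (Inl [u, r, s]) t - Kcov D n \<mu> (Inl [t, r, s]) u"
proof -
  have "Qmix D n \<mu> r s t u = (E (\<lambda>z. c (Inl [r, s]) z * c (Inl [t]) z * c (Inl [u]) z) + E (\<lambda>z. c (Inl [r, s]) z * c (Inl [t, u]) z)) / real n"
    using n by (simp add: Qmix_def EN_def Zs_Inl real_div_sqrt field_simps)
  moreover have "Kcov D n \<mu> (Inl [a, r, s]) b = E (\<lambda>z. c (Inl [a, r, s]) z * c (Inl [b]) z) / real n" for a b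
    using n by (simp add: Kcov_def EN_def Zs_Inl real_div_sqrt)
  ultimately show ?thesis using mixed_third_moment[of r s t u] by (simp add: dlam_def lamh_def diff_divide_distrib)
qed

end

text \<open>
  Two dominating measures along the same filter: below, \<open>mu\<close> is unconditional and \<open>mu'\<close> conditional.
\<close>
locale two_moment_orders = A: moment_orders F D mu c + B: moment_orders F D mu' c'
  for F :: "(nat \<times> sample) filter" and D :: "('q::finite, 'p::finite, 'c) problem" and mu c mu' c' +
  assumes rel_L: "\<And>rs ts. 2 \<le> length rs \<Longrightarrow> length rs + length ts \<le> 4 \<Longrightarrow>
      (\<lambda>w. dlam D (fst w) (mu' w) ts rs - dlam D (fst w) (mu w) ts rs) \<in> O[F](rootn)"
    and rel_B: "\<And>as ts. 1 \<le> length as \<Longrightarrow> length as + length ts \<le> 2 \<Longrightarrow>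
      (\<lambda>w. dbet D (fst w) (mu' w) ts as - dbet D (fst w) (mu w) ts as) \<in> O[F](rootn)"
begin

lemma lamh_dlam: "lamh D n \<mu> rs = dlam D n \<mu> [] rs"
  by (simp add: lamh_def dlam_def)

lemma lamh_close: "2 \<le> length rs \<Longrightarrow> length rs \<le> 4 \<Longrightarrow> A.close (\<lambda>w. lamh D (fst w) (mu' w) rs) (\<lambda>w. lamh D (fst w) (mu w) rs)"
  using rel_L[of rs "[]"] A.lamh_bnd B.lamh_bnd by (simp add: A.close_def lamh_dlam)

lemma close_evI:
  assumes "A.bnd X" "A.bnd Y" "Z \<in> O[F](rootn)" "\<forall>\<^sub>F w in F. X w - Y w = Z w"
  shows "A.close X Y"
  using assms landau_o.big.in_cong[OF assms(4)] by (simp add: A.close_def)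

lemma Gmat_close: "A.close (\<lambda>w. Gmat D (fst w) (mu' w) S r s) (\<lambda>w. Gmat D (fst w) (mu w) S r s)"
proof (rule close_evI)
  show "A.bnd (\<lambda>w. Gmat D (fst w) (mu' w) S r s)" "A.bnd (\<lambda>w. Gmat D (fst w) (mu w) S r s)"
    by (rule A.Gmat_bnd B.Gmat_bnd)+
  show "\<forall>\<^sub>F w in F. Gmat D (fst w) (mu' w) S r s - Gmat D (fst w) (mu w) S r s
    = (\<Sum>a\<in>UNIV. \<Sum>b\<in>UNIV. Gmat D (fst w) (mu' w) S r a * (lamh D (fst w) (mu w) [a, b] - lamh D (fst w) (mu' w) [a, b]) * Gmat D (fst w) (mu w) S b s)"
    using A.coercive B.coercive
  proof eventually_elim
    case (elim w)
    then show ?case unfolding Gmat_def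
      by (intro Ginv_diff[OF B.c_pos _ A.c_pos]) blast+
  qed
  have d: "(\<lambda>w. lamh D (fst w) (mu w) [a, b] - lamh D (fst w) (mu' w) [a, b]) \<in> O[F](rootn)" for a b
  proof -
    have "(\<lambda>w. - (lamh D (fst w) (mu' w) [a, b] - lamh D (fst w) (mu w) [a, b])) \<in> O[F](rootn)"
      using rel_L[of "[a, b]" "[]"] unfolding lamh_dlam landau_o.big.uminus_in_iff by simp
    then show ?thesis by simp
  qed
  have "(\<lambda>w. Gmat D (fst w) (mu' w) S r a * (lamh D (fst w) (mu w) [a, b] - lamh D (fst w) (mu' w) [a, b]) * Gmat D (fst w) (mu w) S b s) \<in> O[F](\<lambda>w. rootn w * 1)" for a b
    by (intro big_prod2 A.bnd_mult_big d A.Gmat_bnd B.Gmat_bnd)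
  then show "(\<lambda>w. \<Sum>a\<in>UNIV. \<Sum>b\<in>UNIV. Gmat D (fst w) (mu' w) S r a * (lamh D (fst w) (mu w) [a, b] - lamh D (fst w) (mu' w) [a, b]) * Gmat D (fst w) (mu w) S b s) \<in> O[F](rootn)"
    by (intro big_sum_fin) simp
qed

lemma zero_in_bigo: "(\<lambda>_. 0) \<in> O[F](g)" by simp

lemma betav_close: "A.close (\<lambda>w. betav D (fst w) (mu' w) r) (\<lambda>w. betav D (fst w) (mu w) r)"
  using A.betav_bnd[of r] B.betav_bnd[of r] rel_B[of "[a]" "[]" for a]
  by (cases r) (simp_all add: A.close_def betav_def dbet_def)

lemma betam_close: "A.close (\<lambda>w. betam D (fst w) (mu' w) r s) (\<lambda>w. betam D (fst w) (mu w) r s)"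
  using A.betam_bnd[of r s] B.betam_bnd[of r s] rel_B[of "[a, b]" "[]" for a b]
  by (cases r; cases s) (simp_all add: A.close_def betam_def dbet_def)

lemma diff_in_bigo: "f \<in> O[F](rootn) \<Longrightarrow> g \<in> O[F](rootn) \<Longrightarrow> (\<lambda>w. f w - g w :: real) \<in> O[F](rootn)"
  by (rule sum_in_bigo)

lemma Kcov_close:
  assumes "2 \<le> length rs" "length rs \<le> 3"
  shows "A.close (\<lambda>w. Kcov D (fst w) (mu' w) (Inl rs) t) (\<lambda>w. Kcov D (fst w) (mu w) (Inl rs) t)"
proof (rule close_evI)
  have i: "Inl rs \<in> idx_upto 4 2" using assms by (auto simp: idx_upto_def)
  show "A.bnd (\<lambda>w. Kcov D (fst w) (mu' w) (Inl rs) t)" "A.bnd (\<lambda>w. Kcov D (fst w) (mu w) (Inl rs) t)"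
    by (rule A.Kcov_bnd[OF i] B.Kcov_bnd[OF i])+
  show "(\<lambda>w. (dlam D (fst w) (mu' w) [t] rs - dlam D (fst w) (mu w) [t] rs) - (dlam D (fst w) (mu' w) [] (t # rs) - dlam D (fst w) (mu w) [] (t # rs))) \<in> O[F](rootn)"
    by (intro diff_in_bigo rel_L) (use assms in auto)
  show "\<forall>\<^sub>F w in F. Kcov D (fst w) (mu' w) (Inl rs) t - Kcov D (fst w) (mu w) (Inl rs) t
    = (dlam D (fst w) (mu' w) [t] rs - dlam D (fst w) (mu w) [t] rs) - (dlam D (fst w) (mu' w) [] (t # rs) - dlam D (fst w) (mu w) [] (t # rs))"
    using A.bart B.bart A.ev_pos by eventually_elim (use assms in \<open>simp add: bartlett.Kcov_eq lamh_dlam\<close>)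
qed

lemma Kadj_close: "A.close (\<lambda>w. Kadj D (fst w) (mu' w) r s) (\<lambda>w. Kadj D (fst w) (mu w) r s)"
proof (cases r)
  case (Inl a)
  let ?X = "\<lambda>w. case s of Inl b \<Rightarrow> dbet D (fst w) (mu' w) [] [b, a] - dbet D (fst w) (mu w) [] [b, a] | Inr _ \<Rightarrow> 0"
  have X: "?X \<in> O[F](rootn)" using rel_B[of "[b, a]" "[]" for b] by (cases s) simp_all
  show ?thesis
  proof (rule close_evI)
    show "A.bnd (\<lambda>w. Kadj D (fst w) (mu' w) r s)" "A.bnd (\<lambda>w. Kadj D (fst w) (mu w) r s)"
      by (rule A.Kadj_bnd B.Kadj_bnd)+
    show "(\<lambda>w. (dbet D (fst w) (mu' w) [s] [a] - dbet D (fst w) (mu w) [s] [a]) - ?X w) \<in> O[F](rootn)"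
      by (intro diff_in_bigo rel_B X) auto
    show "\<forall>\<^sub>F w in F. Kadj D (fst w) (mu' w) r s - Kadj D (fst w) (mu w) r s = (dbet D (fst w) (mu' w) [s] [a] - dbet D (fst w) (mu w) [s] [a]) - ?X w"
      using A.bart B.bart A.ev_pos by eventually_elim (simp add: bartlett.Kadj_eq Inl split: sum.split)
  qed
next
  case (Inr i)
  then show ?thesis using A.close_const[of 0] by (simp add: Kadj_def Zadj_def EN_def)
qed

lemma skew_close: "A.close (\<lambda>w. skew D (fst w) (mu' w) r s t) (\<lambda>w. skew D (fst w) (mu w) r s t)"
proof (rule close_evI)
  let ?K = "\<lambda>rs t w. Kcov D (fst w) (mu' w) (Inl rs) t - Kcov D (fst w) (mu w) (Inl rs) t"
  have K: "?K rs t \<in> O[F](rootn)" if "2 \<le> length rs" "length rs \<le> 3" for rs t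
    using Kcov_close[OF that, of t] by (simp add: A.close_def)
  show "A.bnd (\<lambda>w. skew D (fst w) (mu' w) r s t)" "A.bnd (\<lambda>w. skew D (fst w) (mu w) r s t)"
    by (rule A.skew_bnd B.skew_bnd)+
  show "(\<lambda>w. 0 - (dlam D (fst w) (mu' w) [r] [s, t] - dlam D (fst w) (mu w) [r] [s, t]) - ?K [r, s] t w - ?K [r, t] s w) \<in> O[F](rootn)"
    by (intro diff_in_bigo rel_L K zero_in_bigo) simp_all
  show "\<forall>\<^sub>F w in F. skew D (fst w) (mu' w) r s t - skew D (fst w) (mu w) r s t
     = 0 - (dlam D (fst w) (mu' w) [r] [s, t] - dlam D (fst w) (mu w) [r] [s, t]) - ?K [r, s] t w - ?K [r, t] s w"
    using A.bart B.bart A.ev_pos by eventually_elim (simp add: bartlett.skew_eq)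
qed

lemma Qmix_close: "A.close (\<lambda>w. Qmix D (fst w) (mu' w) r s t u) (\<lambda>w. Qmix D (fst w) (mu w) r s t u)"
proof (rule close_evI)
  let ?K = "\<lambda>rs t w. Kcov D (fst w) (mu' w) (Inl rs) t - Kcov D (fst w) (mu w) (Inl rs) t"
  have K: "?K rs t \<in> O[F](rootn)" if "2 \<le> length rs" "length rs \<le> 3" for rs t
    using Kcov_close[OF that, of t] by (simp add: A.close_def)
  show "A.bnd (\<lambda>w. Qmix D (fst w) (mu' w) r s t u)" "A.bnd (\<lambda>w. Qmix D (fst w) (mu w) r s t u)"
    by (rule A.Qmix_bnd B.Qmix_bnd)+
  show "(\<lambda>w. (dlam D (fst w) (mu' w) [t, u] [r, s] - dlam D (fst w) (mu w) [t, u] [r, s])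
      - (dlam D (fst w) (mu' w) [] [t, u, r, s] - dlam D (fst w) (mu w) [] [t, u, r, s]) - ?K [u, r, s] t w - ?K [t, r, s] u w) \<in> O[F](rootn)"
    by (intro diff_in_bigo rel_L K) simp_all
  show "\<forall>\<^sub>F w in F. Qmix D (fst w) (mu' w) r s t u - Qmix D (fst w) (mu w) r s t u
     = (dlam D (fst w) (mu' w) [t, u] [r, s] - dlam D (fst w) (mu w) [t, u] [r, s])
      - (dlam D (fst w) (mu' w) [] [t, u, r, s] - dlam D (fst w) (mu w) [] [t, u, r, s]) - ?K [u, r, s] t w - ?K [t, r, s] u w"
    using A.bart B.bart A.ev_pos by eventually_elim (simp add: bartlett.Qmix_eq lamh_dlam)
qed

text \<open>
  \<open>Omega\<close> is a polynomial in ingredients that are close for the two measures.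
\<close>
theorem Omega_close: "(\<lambda>w. Omega D (fst w) (mu' w) S - Omega D (fst w) (mu w) S) \<in> O[F](rootn)"
proof -
  have "A.close (\<lambda>w. Omega D (fst w) (mu' w) S) (\<lambda>w. Omega D (fst w) (mu w) S)"
    unfolding Omega_def
    by (intro A.close_omega Gmat_close lamh_close betav_close betam_close Kcov_close Kadj_close skew_close Qmix_close) simp_all
  then show ?thesis by (simp add: A.close_def)
qed

end

section \<open>Problems that are regular given a statistic\<close>

text \<open>
  The assumptions that are made both unconditionally (\<open>T\<close> trivial) and given the ancillary
  statistic.
\<close>
locale regular_problem =
  fixes D :: "('q::finite, 'p::finite, 'c) problem" and T :: "nat \<Rightarrow> sample \<Rightarrow> 't" and \<nu> :: "nat \<Rightarrow> 't \<Rightarrow> sample measure"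
  assumes model: "\<forall>\<^sub>F n in sequentially. model D n"
    and adjustment: "\<forall>\<^sub>F n in sequentially. adjustment D n"
    and estimators: "\<forall>\<^sub>F n in sequentially. estimators D n"
    and expansions: "expansions_valid D"
    and kernel: "\<forall>\<^sub>F n in sequentially. AE y in truth D n. sets (\<nu> n (T n y)) = sets (leb n) \<and>
        (\<forall>\<theta>\<in>Theta D. prob_space (dist_of D n (\<nu> n (T n y)) \<theta>))"
    and orders: "orders D T \<nu>" and interchange: "interchange D T \<nu>"
begin

abbreviation "P \<equiv> truth D"
abbreviation mu :: "nat \<times> sample \<Rightarrow> sample measure" where "mu w \<equiv> \<nu> (fst w) (T (fst w) (snd w))"

lemma P_prob: "\<forall>\<^sub>F n in sequentially. prob_space (P n)"
  using model by eventually_elim (rule prob_space_truth)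

lemma finite_short_lists: "finite A \<Longrightarrow> finite {vs. set vs \<subseteq> A \<and> length vs \<le> k}"
  by (rule finite_lists_length_le)

lemma tight_bartlett: "tight P (\<lambda>F. \<forall>\<^sub>F w in F. bartlett D (fst w) (mu w))"
proof -
  let ?A2 = "{vs :: ('q, 'p) idx list. set vs \<subseteq> idx_upto 3 1 \<and> length vs \<le> 2}"
  let ?A4 = "{vs :: ('q, 'p) idx list. set vs \<subseteq> idx_upto 4 2 \<and> length vs \<le> 4}"
  let ?I = "\<lambda>vs n y. \<forall>\<^sub>F \<theta> in nhds (theta0 D). \<forall>r.
          let \<mu> = \<nu> n (T n y);
              h = (\<lambda>\<theta> z. (\<Prod>v\<leftarrow>vs. dv D n v \<theta> z) * pdf D n \<theta> z)
          in integrable \<mu> (h \<theta>) \<and>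
             integrable \<mu> (\<lambda>z. pd (par_axis r) (\<lambda>\<theta>. h \<theta> z) \<theta>) \<and>
             ((\<lambda>t. \<integral>z. h (\<theta> + t *\<^sub>R par_axis r) z \<partial>\<mu>) has_real_derivative
                (\<integral>z. pd (par_axis r) (\<lambda>\<theta>. h \<theta> z) \<theta> \<partial>\<mu>)) (at 0)"
  let ?N = "\<lambda>vs n y. integrable (dist_of D n (\<nu> n (T n y)) (theta0 D)) (\<lambda>z. \<Prod>v\<leftarrow>vs. dv D n v (theta0 D) z)"
  let ?S = "\<lambda>r n y. mean D n (\<nu> n (T n y)) (Inl [r]) (theta0 D) = 0"
  have f2: "finite ?A2" and f4: "finite ?A4" by (intro finite_short_lists finite_idx_upto)+
  have 1: "tight P (\<lambda>F. \<forall>vs\<in>?A2. \<forall>\<^sub>F w in F. ?I vs (fst w) (snd w))"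
    using interchange unfolding interchange_def by (intro tight_ball[OF P_prob f2] tight_AE[OF P_prob]) simp
  have 2: "tight P (\<lambda>F. \<forall>vs\<in>?A4. \<forall>\<^sub>F w in F. ?N vs (fst w) (snd w))"
    using orders unfolding orders_def by (intro tight_ball[OF P_prob f4] tight_AE[OF P_prob]) simp
  have 3: "tight P (\<lambda>F. \<forall>r\<in>UNIV. \<forall>\<^sub>F w in F. ?S r (fst w) (snd w))"
    using orders unfolding orders_def by (intro tight_ball[OF P_prob finite] tight_AE[OF P_prob]) simp
  have 4: "tight P (\<lambda>F. \<forall>\<^sub>F w in F. sets (mu w) = sets (leb (fst w)) \<and> (\<forall>\<theta>\<in>Theta D. prob_space (dist_of D (fst w) (mu w) \<theta>)))"
    by (rule tight_AE[OF P_prob kernel])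
  have 5: "tight P (\<lambda>F. \<forall>\<^sub>F w in F. model D (fst w) \<and> adjustment D (fst w))"
    by (rule tight_AE[OF P_prob]) (use model adjustment in \<open>eventually_elim, simp\<close>)
  have "tight P (\<lambda>F. (\<forall>vs\<in>?A2. \<forall>\<^sub>F w in F. ?I vs (fst w) (snd w)) \<and> (\<forall>vs\<in>?A4. \<forall>\<^sub>F w in F. ?N vs (fst w) (snd w)) \<and>
     (\<forall>r\<in>UNIV. \<forall>\<^sub>F w in F. ?S r (fst w) (snd w)) \<and>
     (\<forall>\<^sub>F w in F. sets (mu w) = sets (leb (fst w)) \<and> (\<forall>\<theta>\<in>Theta D. prob_space (dist_of D (fst w) (mu w) \<theta>))) \<and>
     (\<forall>\<^sub>F w in F. model D (fst w) \<and> adjustment D (fst w)))"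
    by (intro tight_conj[OF P_prob] 1 2 3 4 5)
  then show ?thesis
  proof (rule tight_mono, elim conjE)
    fix F :: "(nat \<times> sample) filter"
    assume a1: "\<forall>vs\<in>?A2. \<forall>\<^sub>F w in F. ?I vs (fst w) (snd w)" and a2: "\<forall>vs\<in>?A4. \<forall>\<^sub>F w in F. ?N vs (fst w) (snd w)"
      and a3: "\<forall>r\<in>UNIV. \<forall>\<^sub>F w in F. ?S r (fst w) (snd w)"
      and a4: "\<forall>\<^sub>F w in F. sets (mu w) = sets (leb (fst w)) \<and> (\<forall>\<theta>\<in>Theta D. prob_space (dist_of D (fst w) (mu w) \<theta>))"
      and a5: "\<forall>\<^sub>F w in F. model D (fst w) \<and> adjustment D (fst w)"
    have b1: "\<forall>\<^sub>F w in F. \<forall>vs\<in>?A2. ?I vs (fst w) (snd w)" by (rule eventually_ball_finite[OF f2 a1])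
    have b2: "\<forall>\<^sub>F w in F. \<forall>vs\<in>?A4. ?N vs (fst w) (snd w)" by (rule eventually_ball_finite[OF f4 a2])
    have b3: "\<forall>\<^sub>F w in F. \<forall>r\<in>UNIV. ?S r (fst w) (snd w)" by (rule eventually_ball_finite[OF finite a3])
    show "\<forall>\<^sub>F w in F. bartlett D (fst w) (mu w)"
      using b1 b2 b3 a4 a5
    proof eventually_elim
      case (elim w)
      show ?case
      proof (intro bartlett.intro sampling.intro bartlett_axioms.intro)
        show "model D (fst w)" "adjustment D (fst w)" "sets (mu w) = sets (leb (fst w))"
          using elim(4,5) by blast+
        show "prob_space (dist_of D (fst w) (mu w) \<theta>)" if "\<theta> \<in> Theta D" for \<theta>
          using elim(4) that by blast
        show "mean D (fst w) (mu w) (Inl [r]) (theta0 D) = 0" for r using elim(3) by blast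
        show "integrable (dist_of D (fst w) (mu w) (theta0 D)) (\<lambda>z. \<Prod>v\<leftarrow>vs. dv D (fst w) v (theta0 D) z)"
          if "length vs \<le> 4" "set vs \<subseteq> idx_upto 4 2" for vs using elim(2) that by blast
        fix vs :: "('q, 'p) idx list" assume "length vs \<le> 2" "set vs \<subseteq> idx_upto 3 1"
        then have "?I vs (fst w) (snd w)" using elim(1) by blast
        then show "\<forall>\<^sub>F \<theta> in nhds (theta0 D). \<forall>r.
          let h = (\<lambda>\<theta> z. (\<Prod>v\<leftarrow>vs. dv D (fst w) v \<theta> z) * pdf D (fst w) \<theta> z)
          in integrable (mu w) (h \<theta>) \<and>
             integrable (mu w) (\<lambda>z. pd (par_axis r) (\<lambda>\<theta>. h \<theta> z) \<theta>) \<and>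
             ((\<lambda>t. \<integral>z. h (\<theta> + t *\<^sub>R par_axis r) z \<partial>mu w) has_real_derivative
                (\<integral>z. pd (par_axis r) (\<lambda>\<theta>. h \<theta> z) \<theta> \<partial>mu w)) (at 0)"
          unfolding Let_def .
      qed
    qed
  qed
qed

lemma tight_mean_L: "tight P (\<lambda>F. \<forall>rs\<in>{rs. 2 \<le> length rs \<and> length rs \<le> 4}.
    (\<lambda>w. mean D (fst w) (mu w) (Inl rs) (theta0 D)) \<in> O[F](\<lambda>w. real (fst w)))"
proof (rule tight_ball[OF P_prob])
  show "finite {rs :: ('q + 'p) list. 2 \<le> length rs \<and> length rs \<le> 4}"
    by (rule finite_subset[OF _ finite_lists_between[of 4]]) auto
  show "tight P (\<lambda>F. (\<lambda>w. mean D (fst w) (mu w) (Inl rs) (theta0 D)) \<in> O[F](\<lambda>w. real (fst w)))"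
    if "rs \<in> {rs. 2 \<le> length rs \<and> length rs \<le> 4}" for rs
    using orders that unfolding orders_def by (intro tight_bigOp[where X = "\<lambda>n y. mean D n (\<nu> n (T n y)) (Inl rs) (theta0 D)"]) simp
qed

lemma tight_mean_B: "tight P (\<lambda>F. \<forall>as\<in>{as. 1 \<le> length as \<and> length as \<le> 2}.
    (\<lambda>w. mean D (fst w) (mu w) (Inr as) (theta0 D)) \<in> O[F](\<lambda>w. 1))"
proof (rule tight_ball[OF P_prob finite_lists_between])
  show "tight P (\<lambda>F. (\<lambda>w. mean D (fst w) (mu w) (Inr as) (theta0 D)) \<in> O[F](\<lambda>w. 1))"
    if "as \<in> {as. 1 \<le> length as \<and> length as \<le> 2}" for as
    using orders that unfolding orders_def by (intro tight_bigOp[where X = "\<lambda>n y. mean D n (\<nu> n (T n y)) (Inr as) (theta0 D)" and a = "\<lambda>_. 1"]) simp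
qed

lemma tight_cumulants: "tight P (\<lambda>F. \<forall>vs\<in>{vs. set vs \<subseteq> idx_upto 4 2 \<and> length vs \<le> 4} - {[]}.
    (\<lambda>w. joint_cumulant (dist_of D (fst w) (mu w) (theta0 D)) (map (cvar D (fst w) (mu w)) vs)) \<in> O[F](\<lambda>w. real (fst w)))"
proof (rule tight_ball[OF P_prob])
  show "finite ({vs :: ('q, 'p) idx list. set vs \<subseteq> idx_upto 4 2 \<and> length vs \<le> 4} - {[]})"
    by (intro finite_Diff finite_short_lists finite_idx_upto)
  show "tight P (\<lambda>F. (\<lambda>w. joint_cumulant (dist_of D (fst w) (mu w) (theta0 D)) (map (cvar D (fst w) (mu w)) vs)) \<in> O[F](\<lambda>w. real (fst w)))"
    if "vs \<in> {vs. set vs \<subseteq> idx_upto 4 2 \<and> length vs \<le> 4} - {[]}" for vs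
    using orders that unfolding orders_def
    by (intro tight_bigOp[where X = "\<lambda>n y. joint_cumulant (dist_of D n (\<nu> n (T n y)) (theta0 D)) (map (cvar D n (\<nu> n (T n y))) vs)"]) simp
qed

lemma tight_cent_L: "tight P (\<lambda>F. \<forall>rs\<in>{rs. 1 \<le> length rs \<and> length rs \<le> 4}.
    (\<lambda>w. cent D (fst w) (mu w) (Inl rs) (snd w)) \<in> O[F](\<lambda>w. real (fst w) powr (1/2)))"
proof (rule tight_ball[OF P_prob finite_lists_between])
  show "tight P (\<lambda>F. (\<lambda>w. cent D (fst w) (mu w) (Inl rs) (snd w)) \<in> O[F](\<lambda>w. real (fst w) powr (1/2)))"
    if "rs \<in> {rs. 1 \<le> length rs \<and> length rs \<le> 4}" for rs
    using orders that unfolding orders_def by (intro tight_bigOp[where X = "\<lambda>n y. cent D n (\<nu> n (T n y)) (Inl rs) y" and a = "\<lambda>n. real n powr (1/2)"]) simp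
qed

lemma tight_cent_B: "tight P (\<lambda>F. \<forall>as\<in>{as. 1 \<le> length as \<and> length as \<le> 2}.
    (\<lambda>w. cent D (fst w) (mu w) (Inr as) (snd w)) \<in> O[F](\<lambda>w. real (fst w) powr (-1/2)))"
proof (rule tight_ball[OF P_prob finite_lists_between])
  show "tight P (\<lambda>F. (\<lambda>w. cent D (fst w) (mu w) (Inr as) (snd w)) \<in> O[F](\<lambda>w. real (fst w) powr (-1/2)))"
    if "as \<in> {as. 1 \<le> length as \<and> length as \<le> 2}" for as
    using orders that unfolding orders_def by (intro tight_bigOp[where X = "\<lambda>n y. cent D n (\<nu> n (T n y)) (Inr as) y" and a = "\<lambda>n. real n powr (-1/2)"]) simp
qed

end

text \<open>
  The information given the statistic is bounded away from 0.  Unconditionally this comes from the order of the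
  inverse, conditionally by perturbation from the unconditional case.
\<close>
locale coercive_problem = regular_problem D T \<nu>
  for D :: "('q::finite, 'p::finite, 'c) problem" and T :: "nat \<Rightarrow> sample \<Rightarrow> 't" and \<nu> +
  fixes c :: real
  assumes c_pos: "c > 0"
    and coercive: "tight (truth D) (\<lambda>F. \<forall>\<^sub>F w in F. \<forall>u. form2 (\<lambda>r s. lamh D (fst w) (\<nu> (fst w) (T (fst w) (snd w))) [r, s]) u u
        \<le> - c * (\<Sum>r\<in>UNIV. (u r)\<^sup>2))"
begin

lemma tight_moment_orders: "tight P (\<lambda>F. moment_orders F D mu c)"
proof -
  have "tight P (\<lambda>F. (\<forall>\<^sub>F w in F. bartlett D (fst w) (mu w)) \<and>
    (\<forall>rs\<in>{rs. 2 \<le> length rs \<and> length rs \<le> 4}. (\<lambda>w. mean D (fst w) (mu w) (Inl rs) (theta0 D)) \<in> O[F](\<lambda>w. real (fst w))) \<and>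
    (\<forall>as\<in>{as. 1 \<le> length as \<and> length as \<le> 2}. (\<lambda>w. mean D (fst w) (mu w) (Inr as) (theta0 D)) \<in> O[F](\<lambda>w. 1)) \<and>
    (\<forall>vs\<in>{vs. set vs \<subseteq> idx_upto 4 2 \<and> length vs \<le> 4} - {[]}.
       (\<lambda>w. joint_cumulant (dist_of D (fst w) (mu w) (theta0 D)) (map (cvar D (fst w) (mu w)) vs)) \<in> O[F](\<lambda>w. real (fst w))) \<and>
    (\<forall>\<^sub>F w in F. \<forall>u. form2 (\<lambda>r s. lamh D (fst w) (mu w) [r, s]) u u \<le> - c * (\<Sum>r\<in>UNIV. (u r)\<^sup>2)))"
    by (intro tight_conj[OF P_prob] tight_bartlett tight_mean_L tight_mean_B tight_cumulants coercive)
  then show ?thesis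
    by (rule tight_mono, unfold_locales) (use c_pos in auto)
qed

lemma tight_sample_orders:
  "\<exists>\<epsilon>. tight P (\<lambda>F. sample_orders F D mu c \<epsilon> \<and> (\<forall>\<^sub>F w in F. estimates_at D (fst w) (snd w)) \<and>
     (\<lambda>w. norm (thetabar D (fst w) (snd w) - theta0 D)) \<in> O[F](\<lambda>w. real (fst w) powr (-1/2)) \<and>
     (\<lambda>w. norm (thetatilde D (fst w) (snd w) - theta0 D)) \<in> O[F](\<lambda>w. real (fst w) powr (-1/2)))"
proof -
  obtain \<epsilon> where eps: "\<epsilon> > 0" "cball (theta0 D) \<epsilon> \<subseteq> Theta D"
    and supL: "\<And>rs. length rs = 5 \<Longrightarrow> bigOp P (\<lambda>n y. SUP \<theta>\<in>cball (theta0 D) \<epsilon>. \<bar>dv D n (Inl rs) \<theta> y\<bar>) (\<lambda>n. real n)"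
    and supB: "\<And>as. length as = 3 \<Longrightarrow> bigOp P (\<lambda>n y. SUP \<theta>\<in>cball (theta0 D) \<epsilon>. \<bar>dv D n (Inr as) \<theta> y\<bar>) (\<lambda>n. 1)"
    using expansions unfolding expansions_valid_def by (elim exE conjE) (rule that, auto)
  have tL: "tight P (\<lambda>F. \<forall>rs\<in>{rs. length rs = 5}. (\<lambda>w. SUP \<theta>\<in>cball (theta0 D) \<epsilon>. \<bar>dv D (fst w) (Inl rs) \<theta> (snd w)\<bar>) \<in> O[F](\<lambda>w. real (fst w)))"
    by (intro tight_ball[OF P_prob finite_length_eq] tight_bigOp supL) simp
  have tB: "tight P (\<lambda>F. \<forall>as\<in>{as. length as = 3}. (\<lambda>w. SUP \<theta>\<in>cball (theta0 D) \<epsilon>. \<bar>dv D (fst w) (Inr as) \<theta> (snd w)\<bar>) \<in> O[F](\<lambda>w. 1))"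
    by (intro tight_ball[OF P_prob finite_length_eq] tight_bigOp[where a = "\<lambda>_. 1"] supB) simp
  have est: "tight P (\<lambda>F. \<forall>\<^sub>F w in F. estimates_at D (fst w) (snd w) \<and> snd w \<in> space (leb (fst w)))"
  proof (rule tight_AE[OF P_prob])
    show "\<forall>\<^sub>F n in sequentially. AE y in P n. estimates_at D n y \<and> y \<in> space (leb n)"
      using estimators
    proof eventually_elim
      case (elim n)
      have "AE y in P n. y \<in> space (P n)" by (rule AE_space)
      moreover have "space (P n) = space (leb n)" by (simp add: truth_def)
      ultimately have "AE y in P n. y \<in> space (leb n)" by simp
      then show ?case using elim unfolding estimators_def estimates_at_def by auto
    qed
  qed
  have e1: "bigOp P (\<lambda>n y. norm (thetabar D n y - theta0 D)) (\<lambda>n. real n powr (-1/2))"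
    using expansions unfolding expansions_valid_def thetabar_def by blast
  have "norm (thetatilde D n y - theta0 D) = norm (cmle D n y (fst (theta0 D)) - snd (theta0 D))" for n y
    by (simp add: thetatilde_def norm_prod_def)
  then have e2: "bigOp P (\<lambda>n y. norm (thetatilde D n y - theta0 D)) (\<lambda>n. real n powr (-1/2))"
    using expansions unfolding expansions_valid_def by simp
  have "tight P (\<lambda>F. moment_orders F D mu c \<and>
    (\<forall>rs\<in>{rs. length rs = 5}. (\<lambda>w. SUP \<theta>\<in>cball (theta0 D) \<epsilon>. \<bar>dv D (fst w) (Inl rs) \<theta> (snd w)\<bar>) \<in> O[F](\<lambda>w. real (fst w))) \<and>
    (\<forall>as\<in>{as. length as = 3}. (\<lambda>w. SUP \<theta>\<in>cball (theta0 D) \<epsilon>. \<bar>dv D (fst w) (Inr as) \<theta> (snd w)\<bar>) \<in> O[F](\<lambda>w. 1)) \<and>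
    (\<forall>rs\<in>{rs. 1 \<le> length rs \<and> length rs \<le> 4}. (\<lambda>w. cent D (fst w) (mu w) (Inl rs) (snd w)) \<in> O[F](\<lambda>w. real (fst w) powr (1/2))) \<and>
    (\<forall>as\<in>{as. 1 \<le> length as \<and> length as \<le> 2}. (\<lambda>w. cent D (fst w) (mu w) (Inr as) (snd w)) \<in> O[F](\<lambda>w. real (fst w) powr (-1/2))) \<and>
    (\<forall>\<^sub>F w in F. estimates_at D (fst w) (snd w) \<and> snd w \<in> space (leb (fst w))) \<and>
    (\<lambda>w. norm (thetabar D (fst w) (snd w) - theta0 D)) \<in> O[F](\<lambda>w. real (fst w) powr (-1/2)) \<and>
    (\<lambda>w. norm (thetatilde D (fst w) (snd w) - theta0 D)) \<in> O[F](\<lambda>w. real (fst w) powr (-1/2)))"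
    by (intro tight_conj[OF P_prob] tight_moment_orders tL tB tight_cent_L tight_cent_B est tight_bigOp[OF e1] tight_bigOp[OF e2])
  then have "tight P (\<lambda>F. sample_orders F D mu c \<epsilon> \<and> (\<forall>\<^sub>F w in F. estimates_at D (fst w) (snd w)) \<and>
     (\<lambda>w. norm (thetabar D (fst w) (snd w) - theta0 D)) \<in> O[F](\<lambda>w. real (fst w) powr (-1/2)) \<and>
     (\<lambda>w. norm (thetatilde D (fst w) (snd w) - theta0 D)) \<in> O[F](\<lambda>w. real (fst w) powr (-1/2)))"
  proof (rule tight_mono, elim conjE)
    fix F :: "(nat \<times> sample) filter"
    assume mo: "moment_orders F D mu c"
      and sL: "\<forall>rs\<in>{rs. length rs = 5}. (\<lambda>w. SUP \<theta>\<in>cball (theta0 D) \<epsilon>. \<bar>dv D (fst w) (Inl rs) \<theta> (snd w)\<bar>) \<in> O[F](\<lambda>w. real (fst w))"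
      and sB: "\<forall>as\<in>{as. length as = 3}. (\<lambda>w. SUP \<theta>\<in>cball (theta0 D) \<epsilon>. \<bar>dv D (fst w) (Inr as) \<theta> (snd w)\<bar>) \<in> O[F](\<lambda>w. 1)"
      and cL: "\<forall>rs\<in>{rs. 1 \<le> length rs \<and> length rs \<le> 4}. (\<lambda>w. cent D (fst w) (mu w) (Inl rs) (snd w)) \<in> O[F](\<lambda>w. real (fst w) powr (1/2))"
      and cB: "\<forall>as\<in>{as. 1 \<le> length as \<and> length as \<le> 2}. (\<lambda>w. cent D (fst w) (mu w) (Inr as) (snd w)) \<in> O[F](\<lambda>w. real (fst w) powr (-1/2))"
      and est: "\<forall>\<^sub>F w in F. estimates_at D (fst w) (snd w) \<and> snd w \<in> space (leb (fst w))"
      and n1: "(\<lambda>w. norm (thetabar D (fst w) (snd w) - theta0 D)) \<in> O[F](\<lambda>w. real (fst w) powr (-1/2))"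
      and n2: "(\<lambda>w. norm (thetatilde D (fst w) (snd w) - theta0 D)) \<in> O[F](\<lambda>w. real (fst w) powr (-1/2))"
    interpret M: moment_orders F D mu c by (rule mo)
    have "sample_orders F D mu c \<epsilon>"
    proof unfold_locales
      show "\<epsilon> > 0" "cball (theta0 D) \<epsilon> \<subseteq> Theta D" by (rule eps)+
      show "\<forall>\<^sub>F w in F. snd w \<in> space (leb (fst w))" using est by eventually_elim simp
      show "(\<lambda>w. SUP \<theta>\<in>cball (theta0 D) \<epsilon>. \<bar>dv D (fst w) (Inl rs) \<theta> (snd w)\<bar>) \<in> O[F](\<lambda>w. real (fst w))" if "length rs = 5" for rs
        using sL that by blast
      show "(\<lambda>w. SUP \<theta>\<in>cball (theta0 D) \<epsilon>. \<bar>dv D (fst w) (Inr as) \<theta> (snd w)\<bar>) \<in> O[F](\<lambda>w. 1)" if "length as = 3" for as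
        using sB that by blast
      fix v :: "('q, 'p) idx" assume v: "v \<in> idx_upto 4 2"
      show "(\<lambda>w. Zstd D (fst w) (mu w) v (snd w)) \<in> O[F](\<lambda>_. 1)"
      proof (cases v)
        case (Inl rs)
        then have "(\<lambda>w. cent D (fst w) (mu w) (Inl rs) (snd w) * rootn w) \<in> O[F](\<lambda>w. real (fst w) powr (1/2) * rootn w)"
          using cL v by (intro big_prod2) (auto simp: idx_upto_def)
        also have "O[F](\<lambda>w. real (fst w) powr (1/2) * rootn w) = O[F](\<lambda>_. 1)"
          by (rule landau_o.big.cong) (use M.ev_pos in \<open>eventually_elim, simp add: rootn_def powr_half_sqrt\<close>)
        also have "(\<lambda>w. cent D (fst w) (mu w) (Inl rs) (snd w) * rootn w) = (\<lambda>w. Zstd D (fst w) (mu w) v (snd w))"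
          by (simp add: Zstd_def Inl rootn_def)
        finally show ?thesis .
      next
        case (Inr as)
        then have "(\<lambda>w. cent D (fst w) (mu w) (Inr as) (snd w) * sqrt (real (fst w))) \<in> O[F](\<lambda>w. real (fst w) powr (-1/2) * sqrt (real (fst w)))"
          using cB v by (intro big_prod2) (auto simp: idx_upto_def)
        also have "O[F](\<lambda>w. real (fst w) powr (-1/2) * sqrt (real (fst w))) = O[F](\<lambda>_. 1)"
          by (rule landau_o.big.cong) (use M.ev_pos in \<open>eventually_elim, simp add: powr_half_sqrt[symmetric] flip: powr_add\<close>)
        finally show ?thesis
          by (subst landau_o.big.in_cong) (use M.ev_pos in \<open>auto elim!: eventually_mono simp: Zstd_def Inr real_div_sqrt field_simps\<close>)
      qed
    qed
    then show "sample_orders F D mu c \<epsilon> \<and> (\<forall>\<^sub>F w in F. estimates_at D (fst w) (snd w)) \<and>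
     (\<lambda>w. norm (thetabar D (fst w) (snd w) - theta0 D)) \<in> O[F](\<lambda>w. real (fst w) powr (-1/2)) \<and>
     (\<lambda>w. norm (thetatilde D (fst w) (snd w) - theta0 D)) \<in> O[F](\<lambda>w. real (fst w) powr (-1/2))"
      using est n1 n2 by (auto elim!: eventually_mono)
  qed
  then show ?thesis by blast
qed

definition Wpoly :: "nat \<Rightarrow> 't \<Rightarrow> sample \<Rightarrow> real" where
  "Wpoly n t z = lr_approx D n (\<nu> n t) UNIV z - lr_approx D n (\<nu> n t) (range Inr) z"

lemma Wbar_Wpoly: "bigOp P (\<lambda>n y. Wbar D n y - Wpoly n (T n y) y) (\<lambda>n. real n powr (-3/2))"
proof (rule bigOp_tight)
  obtain \<epsilon> where t: "tight P (\<lambda>F. sample_orders F D mu c \<epsilon> \<and> (\<forall>\<^sub>F w in F. estimates_at D (fst w) (snd w)) \<and>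
     (\<lambda>w. norm (thetabar D (fst w) (snd w) - theta0 D)) \<in> O[F](\<lambda>w. real (fst w) powr (-1/2)) \<and>
     (\<lambda>w. norm (thetatilde D (fst w) (snd w) - theta0 D)) \<in> O[F](\<lambda>w. real (fst w) powr (-1/2)))"
    using tight_sample_orders by blast
  then show "tight P (\<lambda>F. (\<lambda>w. Wbar D (fst w) (snd w) - Wpoly (fst w) (T (fst w) (snd w)) (snd w)) \<in> O[F](\<lambda>w. real (fst w) powr (-3/2)))"
  proof (rule tight_mono, elim conjE)
    fix F :: "(nat \<times> sample) filter"
    assume so: "sample_orders F D mu c \<epsilon>" and est: "\<forall>\<^sub>F w in F. estimates_at D (fst w) (snd w)"
      and n1: "(\<lambda>w. norm (thetabar D (fst w) (snd w) - theta0 D)) \<in> O[F](\<lambda>w. real (fst w) powr (-1/2))"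
      and n2: "(\<lambda>w. norm (thetatilde D (fst w) (snd w) - theta0 D)) \<in> O[F](\<lambda>w. real (fst w) powr (-1/2))"
    interpret S: sample_orders F D mu c \<epsilon> by (rule so)
    have p1: "O[F](\<lambda>w. real (fst w) powr (-1/2)) = O[F](rootn)" using S.O_powr[of 1] by simp
    have p3: "O[F](\<lambda>w. real (fst w) powr (-3/2)) = O[F](\<lambda>w. rootn w ^ 3)" using S.O_powr[of 3] by simp
    show "(\<lambda>w. Wbar D (fst w) (snd w) - Wpoly (fst w) (T (fst w) (snd w)) (snd w)) \<in> O[F](\<lambda>w. real (fst w) powr (-3/2))"
      unfolding p3 Wpoly_def by (rule S.Wbar_approx[OF est n1[unfolded p1] n2[unfolded p1]])
  qed
qed simp

text \<open>
  Coefficients that depend on the sample only through the statistic, as the assumption on the expectation of remainders demands.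
\<close>
definition coef :: "(nat \<times> 't \<Rightarrow> real) \<Rightarrow> bool" where
  "coef f \<longleftrightarrow> bigOp P (\<lambda>n y. f (n, T n y)) (\<lambda>n. 1)"

lemma coef_tight: "coef f \<longleftrightarrow> tight P (\<lambda>F. (\<lambda>w. f (fst w, T (fst w) (snd w))) \<in> O[F](\<lambda>_. 1))"
  unfolding coef_def
  using tight_bigOp[of P "\<lambda>n y. f (n, T n y)" "\<lambda>_. 1"] bigOp_tight[of P "\<lambda>n y. f (n, T n y)" "\<lambda>_. 1"] by auto

lemma coef_moments:
  assumes "\<And>F. moment_orders F D mu c \<Longrightarrow> (\<lambda>w. f (fst w, T (fst w) (snd w))) \<in> O[F](\<lambda>_. 1)"
  shows "coef f"
  unfolding coef_tight using tight_moment_orders by (rule tight_mono) (rule assms)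

lemma coef_ring: "coeff_ring coef"
proof
  show "coef (\<lambda>_. a)" for a by (rule coef_moments) simp
  show "coef (\<lambda>k. f k + g k)" if "coef f" "coef g" for f g
    using tight_conj[OF P_prob that[unfolded coef_tight]] unfolding coef_tight by (rule tight_mono) (auto intro: sum_in_bigo)
  show "coef (\<lambda>k. f k * g k)" if "coef f" "coef g" for f g
    using tight_conj[OF P_prob that[unfolded coef_tight]] unfolding coef_tight
    by (rule tight_mono) (use big_prod2[where a = "\<lambda>_. 1" and b = "\<lambda>_. 1"] in auto)
qed

sublocale R: coeff_ring coef by (rule coef_ring)

abbreviation "Zk \<equiv> (\<lambda>v k z. Zstd D (fst k) (\<nu> (fst k) (snd k)) v z)"

lemma polyd_lr_approx: "R.polyd (idx_upto 4 2) Zk 4 (\<lambda>k z. lr_approx D (fst k) (\<nu> (fst k) (snd k)) S z)"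
proof -
  note J = finite_idx_upto[of 4 2, where 'q = 'q and 'p = 'p]
  have var: "R.polyd (idx_upto 4 2) Zk 1 (\<lambda>k z. Zstd D (fst k) (\<nu> (fst k) (snd k)) v z)" if "v \<in> idx_upto 4 2" for v
    by (rule R.polyd_var[OF J that]) simp
  have idx: "Inl [r] \<in> idx_upto 4 2" "Inl [r, s] \<in> idx_upto 4 2" "Inl [r, s, t] \<in> idx_upto 4 2" "Inr [a] \<in> idx_upto 4 2"
    for r s t :: "'q + 'p" and a :: 'q by (auto simp: idx_upto_def)
  have zb: "R.polyd (idx_upto 4 2) Zk 1 (\<lambda>k z. Zadj D (fst k) (\<nu> (fst k) (snd k)) r z)" for r
  proof (cases r)
    case (Inl a) then show ?thesis using var[OF idx(4)] by (simp add: Zadj_def)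
  next
    case (Inr i) then show ?thesis using R.polyd_const[OF J R.C_const[of 0], of Zk 1] by (simp add: Zadj_def)
  qed
  show ?thesis
    unfolding lr_approx_def
  proof (rule R.polyd_lr_poly[OF J])
    have "(\<lambda>w. rootn w) \<in> O[F](\<lambda>_. 1)" if "moment_orders F D mu c" for F
    proof -
      interpret M: moment_orders F D mu c by (rule that)
      show ?thesis by (rule M.\<delta>_bnd)
    qed
    then show "coef (\<lambda>k. 1 / sqrt (real (fst k)))"
      by (intro coef_moments) (simp add: rootn_def[abs_def])
    show "coef (\<lambda>k. Gmat D (fst k) (\<nu> (fst k) (snd k)) S r s)" for r s
      by (rule coef_moments) (use moment_orders.Gmat_bnd in force)
    show "coef (\<lambda>k. lamh D (fst k) (\<nu> (fst k) (snd k)) [r, s, t])" for r s t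
      by (rule coef_moments) (use moment_orders.lamh_bnd[where rs = "[r, s, t]"] in force)
    show "coef (\<lambda>k. lamh D (fst k) (\<nu> (fst k) (snd k)) [r, s, t, u])" for r s t u
      by (rule coef_moments) (use moment_orders.lamh_bnd[where rs = "[r, s, t, u]"] in force)
    show "coef (\<lambda>k. betav D (fst k) (\<nu> (fst k) (snd k)) r)" for r
      by (rule coef_moments) (use moment_orders.betav_bnd in force)
    show "coef (\<lambda>k. betam D (fst k) (\<nu> (fst k) (snd k)) r s)" for r s
      by (rule coef_moments) (use moment_orders.betam_bnd in force)
  qed (intro var idx zb)+
qed

lemma polyd_Wpoly: "R.polyd (idx_upto 4 2) Zk 4 (\<lambda>k z. Wpoly (fst k) (snd k) z)"
proof -
  note J = finite_idx_upto[of 4 2, where 'q = 'q and 'p = 'p]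
  have "R.polyd (idx_upto 4 2) Zk 4 (\<lambda>k z. lr_approx D (fst k) (\<nu> (fst k) (snd k)) UNIV z + (-1) * lr_approx D (fst k) (\<nu> (fst k) (snd k)) (range Inr) z)"
    by (intro R.polyd_add R.polyd_cmult[OF J] R.C_const polyd_lr_approx)
  then show ?thesis by (simp add: Wpoly_def)
qed

text \<open>
  The approximation is a polynomial of degree four in the standardized variables with coefficients of order
  \<open>O\<^sub>p(1)\<close>; the assumption on remainders applies to exactly such approximations.
\<close>
lemma remainder_expectation:
  assumes rp: "remainder_preserved D T \<nu>"
  shows "bigOp P (\<lambda>n y. \<integral>z. Wbar D n z - Wpoly n (T n y) z \<partial>dist_of D n (\<nu> n (T n y)) (theta0 D)) (\<lambda>n. real n powr (-3/2))"
proof -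
  obtain cc where cc: "\<And>m. coef (cc m)"
    "\<And>k z. Wpoly (fst k) (snd k) z = (\<Sum>m | set m \<subseteq> idx_upto 4 2 \<and> length m \<le> 4. cc m k * (\<Prod>v\<leftarrow>m. Zk v k z))"
    using polyd_Wpoly unfolding R.polyd_def by blast
  let ?I = "{m :: ('q, 'p) idx list. set m \<subseteq> idx_upto 4 2 \<and> length m \<le> 4}"
  let ?c = "\<lambda>n t m. cc m (n, t)"
  have eq: "Wbar D n z - (\<Sum>m\<in>?I. ?c n t m * (\<Prod>v\<leftarrow>m. cvar D n (\<nu> n t) v z / sqrt (real n))) = Wbar D n z - Wpoly n t z" for n t z
    using cc(2)[of "(n, t)" z] by (simp add: Zstd_def)
  have "finite ?I \<and> (\<forall>m\<in>?I. set m \<subseteq> idx_upto 4 2 \<and> bigOp P (\<lambda>n y. ?c n (T n y) m) (\<lambda>n. 1))"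
    using cc(1) finite_short_lists[OF finite_idx_upto] unfolding coef_def by blast
  moreover note rp[unfolded remainder_preserved_def Let_def, THEN conjunct2, rule_format, of ?I ?c, unfolded eq]
  ultimately show ?thesis using Wbar_Wpoly by blast
qed

text \<open>
  \<open>CARD('q)\<close> is the number of all coordinates minus the number of nuisance coordinates.
\<close>
theorem expectation_Wbar:
  assumes rp: "remainder_preserved D T \<nu>"
  shows "tight P (\<lambda>F. (\<lambda>w. EN D (fst w) (mu w) (Wbar D (fst w)) - (real CARD('q) + (rootn w)\<^sup>2 *
      (Omega D (fst w) (mu w) UNIV - Omega D (fst w) (mu w) (range Inr)))) \<in> O[F](\<lambda>w. rootn w ^ 3))"
proof -
  have i: "tight P (\<lambda>F. \<forall>\<^sub>F w in F. integrable (dist_of D (fst w) (mu w) (theta0 D)) (Wbar D (fst w)))"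
    using rp unfolding remainder_preserved_def by (intro tight_AE[OF P_prob]) blast
  have "tight P (\<lambda>F. moment_orders F D mu c \<and> (\<forall>\<^sub>F w in F. integrable (dist_of D (fst w) (mu w) (theta0 D)) (Wbar D (fst w))) \<and>
    (\<lambda>w. \<integral>z. Wbar D (fst w) z - Wpoly (fst w) (T (fst w) (snd w)) z \<partial>dist_of D (fst w) (mu w) (theta0 D)) \<in> O[F](\<lambda>w. real (fst w) powr (-3/2)))"
    by (intro tight_conj[OF P_prob] tight_moment_orders i tight_bigOp[OF remainder_expectation[OF rp]])
  then show ?thesis
  proof (rule tight_mono, elim conjE)
    fix F :: "(nat \<times> sample) filter"
    assume mo: "moment_orders F D mu c" and int: "\<forall>\<^sub>F w in F. integrable (dist_of D (fst w) (mu w) (theta0 D)) (Wbar D (fst w))"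
      and rem: "(\<lambda>w. \<integral>z. Wbar D (fst w) z - Wpoly (fst w) (T (fst w) (snd w)) z \<partial>dist_of D (fst w) (mu w) (theta0 D)) \<in> O[F](\<lambda>w. real (fst w) powr (-3/2))"
    interpret M: moment_orders F D mu c by (rule mo)
    have p3: "O[F](\<lambda>w. real (fst w) powr (-3/2)) = O[F](\<lambda>w. rootn w ^ 3)" using M.O_powr[of 3] by simp
    let ?R = "\<lambda>w. \<integral>z. Wbar D (fst w) z - Wpoly (fst w) (T (fst w) (snd w)) z \<partial>dist_of D (fst w) (mu w) (theta0 D)"
    let ?X = "\<lambda>S w. EN D (fst w) (mu w) (lr_approx D (fst w) (mu w) S) - (real (card S) + (rootn w)\<^sup>2 * Omega D (fst w) (mu w) S)"
    have X: "?X S \<in> O[F](\<lambda>w. rootn w ^ 3)" for S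
      by (rule M.big_\<delta>_weaken[OF M.expectation_lr_approx(1)]) simp
    have "(\<lambda>w. ?R w + (?X UNIV w - ?X (range Inr) w)) \<in> O[F](\<lambda>w. rootn w ^ 3)"
      by (intro sum_in_bigo X rem[unfolded p3])
    moreover have "\<forall>\<^sub>F w in F. EN D (fst w) (mu w) (Wbar D (fst w)) - (real CARD('q) + (rootn w)\<^sup>2 *
      (Omega D (fst w) (mu w) UNIV - Omega D (fst w) (mu w) (range Inr))) = ?R w + (?X UNIV w - ?X (range Inr) w)"
      using int M.expectation_lr_approx(2)[of UNIV] M.expectation_lr_approx(2)[of "range Inr"]
    proof eventually_elim
      case (elim w)
      have "?R w = EN D (fst w) (mu w) (Wbar D (fst w)) - (EN D (fst w) (mu w) (lr_approx D (fst w) (mu w) UNIV) - EN D (fst w) (mu w) (lr_approx D (fst w) (mu w) (range Inr)))"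
        unfolding Wpoly_def EN_def using elim by simp
      moreover have "card (range (Inr :: 'p \<Rightarrow> 'q + 'p)) = CARD('p)" by (rule card_image) simp
      ultimately show ?case by (simp add: algebra_simps)
    qed
    ultimately show "(\<lambda>w. EN D (fst w) (mu w) (Wbar D (fst w)) - (real CARD('q) + (rootn w)\<^sup>2 *
      (Omega D (fst w) (mu w) UNIV - Omega D (fst w) (mu w) (range Inr)))) \<in> O[F](\<lambda>w. rootn w ^ 3)"
      by (subst landau_o.big.in_cong)
  qed
qed

end

section \<open>Agreement of the conditional and unconditional distributions\<close>

text \<open>
  The events have positive probability and are therefore not empty.
\<close>
lemma tight_imp_eventually:
  assumes "tight P (\<lambda>F. \<forall>\<^sub>F w in F. Q (fst w))"
  shows "\<forall>\<^sub>F n in sequentially. Q n"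
proof -
  obtain E where E: "\<forall>\<^sub>F n in sequentially. E n \<in> sets (P n) \<and> 1 - 1/2 \<le> measure (P n) (E n)"
    "\<forall>F\<le>on_events E. \<forall>\<^sub>F w in F. Q (fst w)"
    using assms[unfolded tight_def, rule_format, of "1/2"] by auto
  have "\<forall>\<^sub>F w in on_events E. Q (fst w)" using E(2) by blast
  then have "\<forall>\<^sub>F n in sequentially. \<forall>y\<in>E n. Q n" unfolding eventually_on_events by simp
  then show ?thesis using E(1)
  proof eventually_elim
    case (elim n)
    have "E n \<noteq> {}" using elim(2) by auto
    then show ?case using elim(1) by blast
  qed
qed

text \<open>
  Both properties are contained in the measurability of the kernel into the space of probability measures.
\<close>
lemma kernel_conditional:
  assumes m: "model D n" and a: "anc D n \<in> measurable (leb n) (anc_space D n)" and c: "cond_dist D n"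
  shows "AE y in truth D n. sets (cbase D n (anc D n y)) = sets (leb n) \<and> (\<forall>\<theta>\<in>Theta D. prob_space (dist_of D n (cbase D n (anc D n y)) \<theta>))"
proof (rule AE_I2)
  fix y assume "y \<in> space (truth D n)"
  then have y: "anc D n y \<in> space (anc_space D n)" using measurable_space[OF a] by (simp add: truth_def)
  have k: "dist_of D n (cbase D n (anc D n y)) \<theta> \<in> space (prob_algebra (leb n))" if "\<theta> \<in> Theta D" for \<theta>
  proof -
    have "(\<lambda>a. dist_of D n (cbase D n a) \<theta>) \<in> measurable (anc_space D n) (prob_algebra (leb n))"
      using c that unfolding cond_dist_def by blast
    from measurable_space[OF this y] show ?thesis .
  qed
  have "theta0 D \<in> Theta D" using m by (simp add: model_def)
  from k[OF this] have "sets (cbase D n (anc D n y)) = sets (leb n)" by (simp add: space_prob_algebra)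
  moreover have "prob_space (dist_of D n (cbase D n (anc D n y)) \<theta>)" if "\<theta> \<in> Theta D" for \<theta>
    using k[OF that] by (simp add: space_prob_algebra)
  ultimately show "sets (cbase D n (anc D n y)) = sets (leb n) \<and> (\<forall>\<theta>\<in>Theta D. prob_space (dist_of D n (cbase D n (anc D n y)) \<theta>))"
    by blast
qed

lemma (in sample_filter) O_powr_2: "O[F](\<lambda>w. real (fst w) powr (-2)) = O[F](\<lambda>w. rootn w ^ 4)"
  using O_powr[of 4] by simp

lemma (in sample_filter) O_powr_32: "O[F](\<lambda>w. real (fst w) powr (-3/2)) = O[F](\<lambda>w. rootn w ^ 3)"
  using O_powr[of 3] by simp

lemma (in sample_filter) O_powr_12: "O[F](\<lambda>w. real (fst w) powr (-1/2)) = O[F](rootn)"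
  using O_powr[of 1] by simp

lemma (in sample_filter) big_sqrt_div:
  assumes "X \<in> O[F](\<lambda>w. real (fst w) powr (1/2))"
  shows "(\<lambda>w. X w / real (fst w)) \<in> O[F](rootn)"
proof -
  have "\<forall>\<^sub>F w in F. real (fst w) \<noteq> 0" using ev_pos by eventually_elim simp
  from landau_o.big.divide_right[OF this assms]
  have "(\<lambda>w. X w / real (fst w)) \<in> O[F](\<lambda>w. real (fst w) powr (1/2) / real (fst w))" .
  also have "O[F](\<lambda>w. real (fst w) powr (1/2) / real (fst w)) = O[F](rootn)"
    by (rule landau_o.big.cong)
       (use ev_pos in \<open>eventually_elim, simp add: rootn_def powr_half_sqrt field_simps\<close>)
  finally show ?thesis .
qed

lemma tight_relations_L:
  fixes D :: "('q::finite, 'p::finite, 'c) problem"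
  assumes P: "\<forall>\<^sub>F n in sequentially. prob_space (truth D n)" and rel: "differentiable_relations D"
  shows "tight (truth D) (\<lambda>F. \<forall>p\<in>{p. 2 \<le> length (fst p) \<and> length (fst p) + length (snd p) \<le> 4}.
      (\<lambda>w. dlam D (fst w) (cbase D (fst w) (anc D (fst w) (snd w))) (snd p) (fst p) - dlam D (fst w) (leb (fst w)) (snd p) (fst p)) \<in> O[F](rootn))"
proof (rule tight_ball[OF P])
  have "finite ({l :: ('q + 'p) list. set l \<subseteq> UNIV \<and> length l \<le> 4} \<times> {l :: ('q + 'p) list. set l \<subseteq> UNIV \<and> length l \<le> 4})"
    by (intro finite_cartesian_product finite_lists_length_le finite)
  then show "finite {p :: ('q + 'p) list \<times> ('q + 'p) list. 2 \<le> length (fst p) \<and> length (fst p) + length (snd p) \<le> 4}"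
    by (rule finite_subset[rotated]) auto
  fix p :: "('q + 'p) list \<times> ('q + 'p) list" assume "p \<in> {p. 2 \<le> length (fst p) \<and> length (fst p) + length (snd p) \<le> 4}"
  then have "bigOp (truth D) (\<lambda>n y. pds (map par_axis (snd p)) (mean D n (cbase D n (anc D n y)) (Inl (fst p))) (theta0 D)
               - pds (map par_axis (snd p)) (mean D n (leb n) (Inl (fst p))) (theta0 D)) (\<lambda>n. real n powr (1/2))"
    using rel unfolding differentiable_relations_def by blast
  from tight_bigOp[OF this]
  show "tight (truth D) (\<lambda>F. (\<lambda>w. dlam D (fst w) (cbase D (fst w) (anc D (fst w) (snd w))) (snd p) (fst p) - dlam D (fst w) (leb (fst w)) (snd p) (fst p)) \<in> O[F](rootn))"
  proof (rule tight_mono)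
    fix F :: "(nat \<times> sample) filter"
    assume "F \<le> filtercomap fst sequentially"
    then interpret sample_filter F by unfold_locales
    assume "(\<lambda>w. pds (map par_axis (snd p)) (mean D (fst w) (cbase D (fst w) (anc D (fst w) (snd w))) (Inl (fst p))) (theta0 D)
               - pds (map par_axis (snd p)) (mean D (fst w) (leb (fst w)) (Inl (fst p))) (theta0 D)) \<in> O[F](\<lambda>w. real (fst w) powr (1/2))"
    from big_sqrt_div[OF this]
    show "(\<lambda>w. dlam D (fst w) (cbase D (fst w) (anc D (fst w) (snd w))) (snd p) (fst p) - dlam D (fst w) (leb (fst w)) (snd p) (fst p)) \<in> O[F](rootn)"
      by (simp add: dlam_def diff_divide_distrib)
  qed
qed

lemma tight_relations_B:
  fixes D :: "('q::finite, 'p::finite, 'c) problem"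
  assumes P: "\<forall>\<^sub>F n in sequentially. prob_space (truth D n)" and rel: "differentiable_relations D"
  shows "tight (truth D) (\<lambda>F. \<forall>p\<in>{p. 1 \<le> length (fst p) \<and> length (fst p) + length (snd p) \<le> 2}.
      (\<lambda>w. dbet D (fst w) (cbase D (fst w) (anc D (fst w) (snd w))) (snd p) (fst p) - dbet D (fst w) (leb (fst w)) (snd p) (fst p)) \<in> O[F](rootn))"
proof (rule tight_ball[OF P])
  have "finite ({l :: 'q list. set l \<subseteq> UNIV \<and> length l \<le> 2} \<times> {l :: ('q + 'p) list. set l \<subseteq> UNIV \<and> length l \<le> 2})"
    by (intro finite_cartesian_product finite_lists_length_le finite)
  then show "finite {p :: 'q list \<times> ('q + 'p) list. 1 \<le> length (fst p) \<and> length (fst p) + length (snd p) \<le> 2}"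
    by (rule finite_subset[rotated]) auto
  fix p :: "'q list \<times> ('q + 'p) list" assume "p \<in> {p. 1 \<le> length (fst p) \<and> length (fst p) + length (snd p) \<le> 2}"
  then have "bigOp (truth D) (\<lambda>n y. pds (map par_axis (snd p)) (mean D n (cbase D n (anc D n y)) (Inr (fst p))) (theta0 D)
               - pds (map par_axis (snd p)) (mean D n (leb n) (Inr (fst p))) (theta0 D)) (\<lambda>n. real n powr (-1/2))"
    using rel unfolding differentiable_relations_def by blast
  from tight_bigOp[OF this]
  show "tight (truth D) (\<lambda>F. (\<lambda>w. dbet D (fst w) (cbase D (fst w) (anc D (fst w) (snd w))) (snd p) (fst p) - dbet D (fst w) (leb (fst w)) (snd p) (fst p)) \<in> O[F](rootn))"
  proof (rule tight_mono)
    fix F :: "(nat \<times> sample) filter"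
    assume "F \<le> filtercomap fst sequentially"
    then interpret sample_filter F by unfold_locales
    assume "(\<lambda>w. pds (map par_axis (snd p)) (mean D (fst w) (cbase D (fst w) (anc D (fst w) (snd w))) (Inr (fst p))) (theta0 D)
               - pds (map par_axis (snd p)) (mean D (fst w) (leb (fst w)) (Inr (fst p))) (theta0 D)) \<in> O[F](\<lambda>w. real (fst w) powr (-1/2))"
    then show "(\<lambda>w. dbet D (fst w) (cbase D (fst w) (anc D (fst w) (snd w))) (snd p) (fst p) - dbet D (fst w) (leb (fst w)) (snd p) (fst p)) \<in> O[F](rootn)"
      unfolding O_powr_12 dbet_def .
  qed
qed

lemma (in sample_filter) chi_square_close:
  assumes w1: "bnd om" and w2: "bnd om'" and d: "(\<lambda>w. om' w / real (fst w) - om w / real (fst w)) \<in> O[F](\<lambda>w. rootn w ^ 3)" and k: "0 < k"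
  shows "(\<lambda>w. measure (chi_square k) {u. (1 + om' w / real (fst w)) * u \<le> x} - measure (chi_square k) {u. (1 + om w / real (fst w)) * u \<le> x})
     \<in> O[F](\<lambda>w. rootn w ^ 3)"
proof -
  obtain C where C: "\<And>a b. \<bar>a\<bar> \<le> 1/2 \<Longrightarrow> \<bar>b\<bar> \<le> 1/2 \<Longrightarrow>
    \<bar>measure (chi_square k) {u. (1 + a) * u \<le> x} - measure (chi_square k) {u. (1 + b) * u \<le> x}\<bar> \<le> C * \<bar>a - b\<bar>"
    using chi_square_Lipschitz[OF k, of x] by blast
  have half: "\<forall>\<^sub>F w in F. \<bar>X w / real (fst w)\<bar> \<le> 1/2" if X: "bnd X" for X
  proof -
    obtain B where B: "B > 0" "\<forall>\<^sub>F w in F. norm (X w) \<le> B * norm (1::real)" using X by (rule landau_o.bigE)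
    have "\<forall>\<^sub>F n in sequentially. 2 * B \<le> real n" by (rule eventually_sequentiallyI[of "nat \<lceil>2 * B\<rceil>"]) linarith
    from ev_n[OF this] B(2) ev_pos show ?thesis
    proof eventually_elim
      case (elim w)
      then have "\<bar>X w\<bar> * 2 \<le> real (fst w)" by simp
      then show ?case using elim(3) by (simp add: field_simps)
    qed
  qed
  have "(\<lambda>w. measure (chi_square k) {u. (1 + om' w / real (fst w)) * u \<le> x} - measure (chi_square k) {u. (1 + om w / real (fst w)) * u \<le> x})
     \<in> O[F](\<lambda>w. om' w / real (fst w) - om w / real (fst w))"
  proof (rule landau_o.bigI[of "\<bar>C\<bar> + 1"])
    show "\<forall>\<^sub>F w in F. norm (measure (chi_square k) {u. (1 + om' w / real (fst w)) * u \<le> x} - measure (chi_square k) {u. (1 + om w / real (fst w)) * u \<le> x})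
       \<le> (\<bar>C\<bar> + 1) * norm (om' w / real (fst w) - om w / real (fst w))"
      using half[OF w1] half[OF w2]
    proof eventually_elim
      case (elim w)
      have "\<bar>measure (chi_square k) {u. (1 + om' w / real (fst w)) * u \<le> x} - measure (chi_square k) {u. (1 + om w / real (fst w)) * u \<le> x}\<bar>
         \<le> C * \<bar>om' w / real (fst w) - om w / real (fst w)\<bar>" by (rule C[OF elim(2,1)])
      also have "\<dots> \<le> (\<bar>C\<bar> + 1) * \<bar>om' w / real (fst w) - om w / real (fst w)\<bar>" by (intro mult_right_mono) auto
      finally show ?case by simp
    qed
  qed simp
  then show ?thesis using d by (rule landau_o.big_trans)
qed

theorem theorem5:
  fixes D :: "('q::finite, 'p::finite, 'c) problem"
    and x :: real
  assumes model: "\<forall>\<^sub>F n in sequentially. model D n"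
    and adjustment: "\<forall>\<^sub>F n in sequentially. adjustment D n"
    and adj_order: "adj_order D"
    and estimators: "\<forall>\<^sub>F n in sequentially. estimators D n"
    and ancillary: "\<forall>\<^sub>F n in sequentially. ancillary D n (anc_space D n) (anc D n)"
    and sufficient: "\<forall>\<^sub>F n in sequentially.
          sufficient D n (borel \<Otimes>\<^sub>M anc_space D n) (\<lambda>y. (mle D n y, anc D n y))"
    and cond_dist: "\<forall>\<^sub>F n in sequentially. cond_dist D n"
    and inverse_order: "inverse_order D"
    and expansions: "expansions_valid D"
    and unconditional: "regular_given D (\<lambda>n y. ()) (\<lambda>n _. leb n)"
    and conditional: "regular_given D (anc D) (cbase D)"
    and relations: "differentiable_relations D"
  shows "bigOp (truth D)
           (\<lambda>n y. real_cond_exp (truth D n)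
                     (vimage_algebra (space (leb n)) (anc D n) (anc_space D n))
                     (indicator {z \<in> space (leb n). Wbar D n z \<le> x}) y
                - measure (truth D n) {z \<in> space (leb n). Wbar D n z \<le> x})
           (\<lambda>n. real n powr (-3/2))"
proof -
  note U = unconditional[unfolded regular_given_def] and C = conditional[unfolded regular_given_def]
  have P: "\<forall>\<^sub>F n in sequentially. prob_space (truth D n)"
    using model by eventually_elim (rule prob_space_truth)
  interpret RU: regular_problem D "\<lambda>n y. ()" "\<lambda>n _. leb n"
    by unfold_locales
      (use model adjustment estimators expansions U in \<open>auto elim!: eventually_mono simp: model_def\<close>)
  have ker: "\<forall>\<^sub>F n in sequentially. AE y in truth D n. sets (cbase D n (anc D n y)) = sets (leb n) \<and>
        (\<forall>\<theta>\<in>Theta D. prob_space (dist_of D n (cbase D n (anc D n y)) \<theta>))"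
    using model ancillary cond_dist by eventually_elim (rule kernel_conditional, auto simp: ancillary_def)
  interpret RC: regular_problem D "anc D" "cbase D"
    by unfold_locales (use model adjustment estimators expansions C ker in auto)
  have "\<forall>\<^sub>F n in sequentially. bartlett D n (leb n)"
    using RU.tight_bartlett by (rule tight_imp_eventually)
  from coercive_unconditional[OF inverse_order this] obtain c where c: "c > 0"
    "\<forall>\<^sub>F n in sequentially. \<forall>u. form2 (\<lambda>r s. lamh D n (leb n) [r, s]) u u \<le> - c * (\<Sum>r\<in>UNIV. (u r)\<^sup>2)"
    by (elim exE conjE) (rule that)
  have tc: "tight (truth D) (\<lambda>F. \<forall>\<^sub>F w in F. \<forall>u. form2 (\<lambda>r s. lamh D (fst w) (leb (fst w)) [r, s]) u u \<le> - c * (\<Sum>r\<in>UNIV. (u r)\<^sup>2))"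
    by (rule tight_AE[OF P]) (use c(2) in \<open>eventually_elim, simp\<close>)
  interpret CU: coercive_problem D "\<lambda>n y. ()" "\<lambda>n _. leb n" c
    by unfold_locales (rule c(1), rule tc)
  note relL = tight_relations_L[OF P relations] and relB = tight_relations_B[OF P relations]
  \<comment> \<open>The conditional information differs from the unconditional one by a term of smaller order.\<close>
  have tc': "tight (truth D) (\<lambda>F. \<forall>\<^sub>F w in F. \<forall>u. form2 (\<lambda>r s. lamh D (fst w) (cbase D (fst w) (anc D (fst w) (snd w))) [r, s]) u u
      \<le> - (c / 2) * (\<Sum>r\<in>UNIV. (u r)\<^sup>2))"
    using tight_conj[OF P tc relL]
  proof (rule tight_mono, elim conjE)
    fix F :: "(nat \<times> sample) filter"
    assume "F \<le> filtercomap fst sequentially"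
    then interpret sample_filter F by unfold_locales
    assume 1: "\<forall>\<^sub>F w in F. \<forall>u. form2 (\<lambda>r s. lamh D (fst w) (leb (fst w)) [r, s]) u u \<le> - c * (\<Sum>r\<in>UNIV. (u r)\<^sup>2)"
      and 2: "\<forall>p\<in>{p. 2 \<le> length (fst p) \<and> length (fst p) + length (snd p) \<le> 4}.
      (\<lambda>w. dlam D (fst w) (cbase D (fst w) (anc D (fst w) (snd w))) (snd p) (fst p) - dlam D (fst w) (leb (fst w)) (snd p) (fst p)) \<in> O[F](rootn)"
    show "\<forall>\<^sub>F w in F. \<forall>u. form2 (\<lambda>r s. lamh D (fst w) (cbase D (fst w) (anc D (fst w) (snd w))) [r, s]) u u
      \<le> - (c / 2) * (\<Sum>r\<in>UNIV. (u r)\<^sup>2)"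
    proof (rule coercive_perturb[OF c(1) 1])
      fix r s :: "'q + 'p"
      show "(\<lambda>w. lamh D (fst w) (cbase D (fst w) (anc D (fst w) (snd w))) [r, s] - lamh D (fst w) (leb (fst w)) [r, s]) \<in> O[F](rootn)"
        using bspec[OF 2, of "([r, s], [])"] by (simp add: dlam_def lamh_def)
    qed
  qed
  interpret CC: coercive_problem D "anc D" "cbase D" "c / 2"
    by unfold_locales (use c(1) tc' in auto)
  obtain om where om: "bigOp (truth D) (\<lambda>n y. om n ()) (\<lambda>n. 1)"
    "bigOp (truth D) (\<lambda>n y. (\<integral>z. Wbar D n z \<partial>dist_of D n (leb n) (theta0 D)) - real CARD('q) * (1 + om n () / real n)) (\<lambda>n. real n powr (-2))"
    "\<And>x. bigOp (truth D) (\<lambda>n y. measure (dist_of D n (leb n) (theta0 D)) {z \<in> space (leb n). Wbar D n z \<le> x}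
       - measure (chi_square CARD('q)) {u. (1 + om n () / real n) * u \<le> x}) (\<lambda>n. real n powr (-2))"
    using U unfolding bartlett_expansion_def by (elim exE conjE) (rule that, auto)
  obtain om' where om': "bigOp (truth D) (\<lambda>n y. om' n (anc D n y)) (\<lambda>n. 1)"
    "bigOp (truth D) (\<lambda>n y. (\<integral>z. Wbar D n z \<partial>dist_of D n (cbase D n (anc D n y)) (theta0 D)) - real CARD('q) * (1 + om' n (anc D n y) / real n)) (\<lambda>n. real n powr (-2))"
    "\<And>x. bigOp (truth D) (\<lambda>n y. measure (dist_of D n (cbase D n (anc D n y)) (theta0 D)) {z \<in> space (leb n). Wbar D n z \<le> x}
       - measure (chi_square CARD('q)) {u. (1 + om' n (anc D n y) / real n) * u \<le> x}) (\<lambda>n. real n powr (-2))"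
    using C unfolding bartlett_expansion_def by (elim exE conjE) (rule that, auto)
  let ?A = "\<lambda>n. {z \<in> space (leb n). Wbar D n z \<le> x}"
  have ce: "tight (truth D) (\<lambda>F. \<forall>\<^sub>F w in F. real_cond_exp (truth D (fst w))
       (vimage_algebra (space (leb (fst w))) (anc D (fst w)) (anc_space D (fst w))) (indicator (?A (fst w))) (snd w)
     = measure (dist_of D (fst w) (cbase D (fst w) (anc D (fst w) (snd w))) (theta0 D)) (?A (fst w)))"
  proof (rule tight_AE[OF P])
    show "\<forall>\<^sub>F n in sequentially. AE y in truth D n. real_cond_exp (truth D n)
       (vimage_algebra (space (leb n)) (anc D n) (anc_space D n)) (indicator (?A n)) y
     = measure (dist_of D n (cbase D n (anc D n y)) (theta0 D)) (?A n)"
      using model ancillary cond_dist estimators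
    proof eventually_elim
      case (elim n)
      have "Wbar D n \<in> borel_measurable (leb n)" using elim(4) by (simp add: estimators_def)
      then have "?A n \<in> sets (leb n)" by simp
      then show ?case using elim by (intro cond_exp_eq_kernel) (auto simp: ancillary_def)
    qed
  qed
  let ?mC = "\<lambda>w. cbase D (fst w) (anc D (fst w) (snd w))" and ?mU = "\<lambda>w. leb (fst w)"
  let ?dO = "\<lambda>m w. Omega D (fst w) (m w) UNIV - Omega D (fst w) (m w) (range Inr)"
  have all: "tight (truth D) (\<lambda>F. moment_orders F D ?mU c \<and> moment_orders F D ?mC (c / 2) \<and>
    (\<forall>p\<in>{p. 2 \<le> length (fst p) \<and> length (fst p) + length (snd p) \<le> 4}.
      (\<lambda>w. dlam D (fst w) (?mC w) (snd p) (fst p) - dlam D (fst w) (?mU w) (snd p) (fst p)) \<in> O[F](rootn)) \<and>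
    (\<forall>p\<in>{p. 1 \<le> length (fst p) \<and> length (fst p) + length (snd p) \<le> 2}.
      (\<lambda>w. dbet D (fst w) (?mC w) (snd p) (fst p) - dbet D (fst w) (?mU w) (snd p) (fst p)) \<in> O[F](rootn)) \<and>
    (\<lambda>w. EN D (fst w) (?mU w) (Wbar D (fst w)) - (real CARD('q) + (rootn w)\<^sup>2 * ?dO ?mU w)) \<in> O[F](\<lambda>w. rootn w ^ 3) \<and>
    (\<lambda>w. EN D (fst w) (?mC w) (Wbar D (fst w)) - (real CARD('q) + (rootn w)\<^sup>2 * ?dO ?mC w)) \<in> O[F](\<lambda>w. rootn w ^ 3) \<and>
    (\<lambda>w. om (fst w) ()) \<in> O[F](\<lambda>w. 1) \<and>
    (\<lambda>w. om' (fst w) (anc D (fst w) (snd w))) \<in> O[F](\<lambda>w. 1) \<and>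
    (\<lambda>w. (\<integral>z. Wbar D (fst w) z \<partial>dist_of D (fst w) (leb (fst w)) (theta0 D)) - real CARD('q) * (1 + om (fst w) () / real (fst w))) \<in> O[F](\<lambda>w. real (fst w) powr (-2)) \<and>
    (\<lambda>w. (\<integral>z. Wbar D (fst w) z \<partial>dist_of D (fst w) (?mC w) (theta0 D)) - real CARD('q) * (1 + om' (fst w) (anc D (fst w) (snd w)) / real (fst w)))
       \<in> O[F](\<lambda>w. real (fst w) powr (-2)) \<and>
    (\<lambda>w. measure (dist_of D (fst w) (leb (fst w)) (theta0 D)) (?A (fst w)) - measure (chi_square CARD('q)) {u. (1 + om (fst w) () / real (fst w)) * u \<le> x})
       \<in> O[F](\<lambda>w. real (fst w) powr (-2)) \<and>
    (\<lambda>w. measure (dist_of D (fst w) (?mC w) (theta0 D)) (?A (fst w)) - measure (chi_square CARD('q)) {u. (1 + om' (fst w) (anc D (fst w) (snd w)) / real (fst w)) * u \<le> x})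
       \<in> O[F](\<lambda>w. real (fst w) powr (-2)) \<and>
    (\<forall>\<^sub>F w in F. real_cond_exp (truth D (fst w))
       (vimage_algebra (space (leb (fst w))) (anc D (fst w)) (anc_space D (fst w))) (indicator (?A (fst w))) (snd w)
     = measure (dist_of D (fst w) (?mC w) (theta0 D)) (?A (fst w))))"
    by (intro tight_conj[OF P] CU.tight_moment_orders CC.tight_moment_orders relL relB
        CU.expectation_Wbar CC.expectation_Wbar tight_bigOp[OF om(1)] tight_bigOp[OF om'(1)] tight_bigOp[OF om(2)] tight_bigOp[OF om'(2)]
        tight_bigOp[OF om(3)] tight_bigOp[OF om'(3)] ce) (use U C in auto)
  show ?thesis
  proof (rule bigOp_tight, rule tight_mono[OF all], elim conjE)
    fix F :: "(nat \<times> sample) filter"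
    assume mU: "moment_orders F D ?mU c" and mC: "moment_orders F D ?mC (c / 2)"
      and rL: "\<forall>p\<in>{p. 2 \<le> length (fst p) \<and> length (fst p) + length (snd p) \<le> 4}.
        (\<lambda>w. dlam D (fst w) (?mC w) (snd p) (fst p) - dlam D (fst w) (?mU w) (snd p) (fst p)) \<in> O[F](rootn)"
      and rB: "\<forall>p\<in>{p. 1 \<le> length (fst p) \<and> length (fst p) + length (snd p) \<le> 2}.
        (\<lambda>w. dbet D (fst w) (?mC w) (snd p) (fst p) - dbet D (fst w) (?mU w) (snd p) (fst p)) \<in> O[F](rootn)"
      and EU: "(\<lambda>w. EN D (fst w) (?mU w) (Wbar D (fst w)) - (real CARD('q) + (rootn w)\<^sup>2 * ?dO ?mU w)) \<in> O[F](\<lambda>w. rootn w ^ 3)"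
      and EC: "(\<lambda>w. EN D (fst w) (?mC w) (Wbar D (fst w)) - (real CARD('q) + (rootn w)\<^sup>2 * ?dO ?mC w)) \<in> O[F](\<lambda>w. rootn w ^ 3)"
      and oU: "(\<lambda>w. om (fst w) ()) \<in> O[F](\<lambda>w. 1)" and oC: "(\<lambda>w. om' (fst w) (anc D (fst w) (snd w))) \<in> O[F](\<lambda>w. 1)"
      and bU: "(\<lambda>w. (\<integral>z. Wbar D (fst w) z \<partial>dist_of D (fst w) (leb (fst w)) (theta0 D)) - real CARD('q) * (1 + om (fst w) () / real (fst w))) \<in> O[F](\<lambda>w. real (fst w) powr (-2))"
      and bC: "(\<lambda>w. (\<integral>z. Wbar D (fst w) z \<partial>dist_of D (fst w) (?mC w) (theta0 D)) - real CARD('q) * (1 + om' (fst w) (anc D (fst w) (snd w)) / real (fst w)))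
         \<in> O[F](\<lambda>w. real (fst w) powr (-2))"
      and pU: "(\<lambda>w. measure (dist_of D (fst w) (leb (fst w)) (theta0 D)) (?A (fst w)) - measure (chi_square CARD('q)) {u. (1 + om (fst w) () / real (fst w)) * u \<le> x})
         \<in> O[F](\<lambda>w. real (fst w) powr (-2))"
      and pC: "(\<lambda>w. measure (dist_of D (fst w) (?mC w) (theta0 D)) (?A (fst w)) - measure (chi_square CARD('q)) {u. (1 + om' (fst w) (anc D (fst w) (snd w)) / real (fst w)) * u \<le> x})
         \<in> O[F](\<lambda>w. real (fst w) powr (-2))"
      and ce: "\<forall>\<^sub>F w in F. real_cond_exp (truth D (fst w))
         (vimage_algebra (space (leb (fst w))) (anc D (fst w)) (anc_space D (fst w))) (indicator (?A (fst w))) (snd w)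
       = measure (dist_of D (fst w) (?mC w) (theta0 D)) (?A (fst w))"
    interpret T: two_moment_orders F D ?mU c ?mC "c / 2"
    proof (intro two_moment_orders.intro two_moment_orders_axioms.intro mU mC)
      show "(\<lambda>w. dlam D (fst w) (?mC w) ts rs - dlam D (fst w) (?mU w) ts rs) \<in> O[F](rootn)"
        if "2 \<le> length rs" "length rs + length ts \<le> 4" for rs ts
        using bspec[OF rL, of "(rs, ts)"] that by simp
      show "(\<lambda>w. dbet D (fst w) (?mC w) ts as - dbet D (fst w) (?mU w) ts as) \<in> O[F](rootn)"
        if "1 \<le> length as" "length as + length ts \<le> 2" for as ts
        using bspec[OF rB, of "(as, ts)"] that by simp
    qed
    have w43: "X \<in> O[F](\<lambda>w. rootn w ^ 3)" if "X \<in> O[F](\<lambda>w. real (fst w) powr (-2))" for X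
      using that unfolding T.A.O_powr_2 by (rule T.A.big_\<delta>_weaken) simp
    let ?aU = "\<lambda>w. om (fst w) () / real (fst w)" and ?aC = "\<lambda>w. om' (fst w) (anc D (fst w) (snd w)) / real (fst w)"
    have dO: "(\<lambda>w. ?dO ?mC w - ?dO ?mU w) \<in> O[F](rootn)"
      using sum_in_bigo(2)[OF T.Omega_close[of UNIV] T.Omega_close[of "range Inr"]] by (simp add: algebra_simps)
    have dO3: "(\<lambda>w. (rootn w)\<^sup>2 * (?dO ?mC w - ?dO ?mU w)) \<in> O[F](\<lambda>w. rootn w ^ 3)"
      using big_prod2[OF _ dO, of "\<lambda>w. (rootn w)\<^sup>2" "\<lambda>w. (rootn w)\<^sup>2"]
      by (simp add: power2_eq_square power3_eq_cube mult.assoc)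
    \<comment> \<open>Each expectation of the statistic has two expressions, by the expansion above and by the Bartlett-correction factor;
    their comparison leaves the difference of the two factors.\<close>
    have "(\<lambda>w. ((((EN D (fst w) (?mC w) (Wbar D (fst w)) - (real CARD('q) + (rootn w)\<^sup>2 * ?dO ?mC w))
       - (EN D (fst w) (?mC w) (Wbar D (fst w)) - real CARD('q) * (1 + ?aC w)))
       - (EN D (fst w) (?mU w) (Wbar D (fst w)) - (real CARD('q) + (rootn w)\<^sup>2 * ?dO ?mU w)))
       + (EN D (fst w) (?mU w) (Wbar D (fst w)) - real CARD('q) * (1 + ?aU w)))
       + (rootn w)\<^sup>2 * (?dO ?mC w - ?dO ?mU w)) \<in> O[F](\<lambda>w. rootn w ^ 3)"
      by (intro sum_in_bigo EU EC dO3 w43[OF bU, folded EN_def] w43[OF bC, folded EN_def])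
    also have "(\<lambda>w. ((((EN D (fst w) (?mC w) (Wbar D (fst w)) - (real CARD('q) + (rootn w)\<^sup>2 * ?dO ?mC w))
       - (EN D (fst w) (?mC w) (Wbar D (fst w)) - real CARD('q) * (1 + ?aC w)))
       - (EN D (fst w) (?mU w) (Wbar D (fst w)) - (real CARD('q) + (rootn w)\<^sup>2 * ?dO ?mU w)))
       + (EN D (fst w) (?mU w) (Wbar D (fst w)) - real CARD('q) * (1 + ?aU w)))
       + (rootn w)\<^sup>2 * (?dO ?mC w - ?dO ?mU w)) = (\<lambda>w. real CARD('q) * (?aC w - ?aU w))"
      by (rule ext) (simp add: algebra_simps)
    finally have "(\<lambda>w. real CARD('q) * (?aC w - ?aU w)) \<in> O[F](\<lambda>w. rootn w ^ 3)" .
    then have a3: "(\<lambda>w. ?aC w - ?aU w) \<in> O[F](\<lambda>w. rootn w ^ 3)" by simp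
    have chi: "(\<lambda>w. measure (chi_square CARD('q)) {u. (1 + ?aC w) * u \<le> x} - measure (chi_square CARD('q)) {u. (1 + ?aU w) * u \<le> x})
       \<in> O[F](\<lambda>w. rootn w ^ 3)"
      by (rule T.A.chi_square_close[OF oU oC a3]) simp
    have "(\<lambda>w. (measure (dist_of D (fst w) (?mC w) (theta0 D)) (?A (fst w)) - measure (chi_square CARD('q)) {u. (1 + ?aC w) * u \<le> x})
        + (measure (chi_square CARD('q)) {u. (1 + ?aC w) * u \<le> x} - measure (chi_square CARD('q)) {u. (1 + ?aU w) * u \<le> x})
        - (measure (dist_of D (fst w) (leb (fst w)) (theta0 D)) (?A (fst w)) - measure (chi_square CARD('q)) {u. (1 + ?aU w) * u \<le> x}))
       \<in> O[F](\<lambda>w. rootn w ^ 3)"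
      by (intro sum_in_bigo chi w43 pC pU)
    then have "(\<lambda>w. measure (dist_of D (fst w) (?mC w) (theta0 D)) (?A (fst w)) - measure (truth D (fst w)) (?A (fst w))) \<in> O[F](\<lambda>w. real (fst w) powr (-3/2))"
      unfolding T.A.O_powr_32 truth_def by (simp add: algebra_simps)
    moreover have "\<forall>\<^sub>F w in F. real_cond_exp (truth D (fst w))
         (vimage_algebra (space (leb (fst w))) (anc D (fst w)) (anc_space D (fst w))) (indicator (?A (fst w))) (snd w) - measure (truth D (fst w)) (?A (fst w))
       = measure (dist_of D (fst w) (?mC w) (theta0 D)) (?A (fst w)) - measure (truth D (fst w)) (?A (fst w))"
      using ce by eventually_elim simp
    ultimately show "(\<lambda>w. real_cond_exp (truth D (fst w))
         (vimage_algebra (space (leb (fst w))) (anc D (fst w)) (anc_space D (fst w))) (indicator (?A (fst w))) (snd w) - measure (truth D (fst w)) (?A (fst w)))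
       \<in> O[F](\<lambda>w. real (fst w) powr (-3/2))"
      by (subst landau_o.big.in_cong)
  qed simp
qed

end
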